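(* Let $d\ge2$, $1\le k<d$, $D=\operatorname{diag}(1,\dots,1,0,\dots,0)\in\mathbb{R}^{d\times d}$ with $k$ ones, and $C\in\mathbb{R}^{d\times d}$ satisfy condition (A). Let $\psi$ be an admissible generating function and let $f$ be the solution of $\partial_tf=\operatorname{div}(D\nabla f+Cxf)$ with a $\psi$-compatible initial state $f_0$. Let $\mu:=\min\{\operatorname{Re}\lambda:\lambda\in\sigma(C)\}$ and $\lambda_1,\dots,\lambda_{m_0}$ the eigenvalues of $C$ with real part $\mu$. (i) If all $\lambda_m$ are non-defective and $P$ is symmetric positive definite with $QP+PQ^T\ge2\mu P$, then $e_\psi(f(t)|f_\infty)\le\frac{1}{2\lambda_P}S_\psi(f_0)e^{-2\mu t}$ for all $t\ge0$. (ii) If some $\lambda_m$ is defective, then for any $\varepsilon\in(0,\mu)$ and any symmetric positive definite $P=P(\varepsilon)$ with $QP+PQ^T\ge 2(\mu-\varepsilon)P$, $e_\psi(f(t)|f_\infty)\le\frac{1}{2\lambda_P}S_\psi(f_0,\varepsilon)e^{-2(\mu-\varepsilon)t}$ for all $t\ge0$, where $S_\psi(\cdot,\varepsilon)$ is built with $P(\varepsilon)$. Here $\lambda_P>0$ is the largest constant with $K^{-1}\ge\lambda_PP^{-1}$.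
   Context: Condition (A): (a) no non-trivial subspace of $\ker D$ is invariant under $C^T$; (b) all eigenvalues of $C$ have positive real part. $K$ is the symmetric positive definite solution of $2D=CK+KC^T$, $f_\infty(x)=(2\pi)^{-d/2}(\det K)^{-1/2}\exp(-x^TK^{-1}x/2)$, $Q:=KC^TK^{-1}$. Defective eigenvalue: geometric multiplicity < algebraic multiplicity. Admissible generating function: $\psi\not\equiv0$, $\psi\in C([0,\infty))\cap C^4((0,\infty))$, $\psi(1)=\psi'(1)=0$, $\psi''\ge0$, $(\psi''')^2\le\frac12\psi''\psi^{IV}$ on $(0,\infty)$ (for $\psi(s)=(s-1)^2$ on $\mathbb{R}$ with signed data). $e_\psi(g|f_\infty):=\int\psi(g/f_\infty)f_\infty dx$. For $g\in L^1$, $\int g=1$, $g\ge0$ (any sign if $\psi$ quadratic): $w_g:=\int_1^{g/f_\infty}\sqrt{\psi''(s)}ds$; $\psi$-compatible means $\nabla w_g\in L^2(\mathbb{R}^d,f_\infty)$; $S_\psi(g):=\int(\nabla w_g)^TP\nabla w_g f_\infty dx$. *)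

theory Defs
  imports "HOL-Analysis.Analysis" "HOL-Computational_Algebra.Polynomial"
begin

definition diag_first_ones :: "nat \<Rightarrow> real^('n::{finite,linorder})^('n::{finite,linorder})" where
  "diag_first_ones k = (\<chi> i j. if i = j \<and> card {l. l < i} < k then 1 else 0)"

definition sym_mat :: "real^'n^'n \<Rightarrow> bool" where
  "sym_mat A \<longleftrightarrow> transpose A = A"

definition pos_def :: "real^'n^'n \<Rightarrow> bool" where
  "pos_def A \<longleftrightarrow> (\<forall>x. x \<noteq> 0 \<longrightarrow> x \<bullet> (A *v x) > 0)"

definition loewner_le :: "real^'n^'n \<Rightarrow> real^'n^'n \<Rightarrow> bool" where
  "loewner_le A B \<longleftrightarrow> (\<forall>x. x \<bullet> ((B - A) *v x) \<ge> 0)"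

definition cmat :: "real^'n^'n \<Rightarrow> complex^'n^'n" where
  "cmat C = (\<chi> i j. complex_of_real (C $ i $ j))"

definition spec :: "real^'n^'n \<Rightarrow> complex set" where
  "spec C = {lam. \<exists>v. v \<noteq> 0 \<and> cmat C *v v = lam *s v}"

definition charpoly :: "real^'n^'n \<Rightarrow> complex poly" where
  "charpoly C = det (mat [:0, 1:] - (\<chi> i j. [: cmat C $ i $ j :]))"

definition alg_mult :: "real^'n^'n \<Rightarrow> complex \<Rightarrow> nat" where
  "alg_mult C lam = order lam (charpoly C)"

definition geom_mult :: "real^'n^'n \<Rightarrow> complex \<Rightarrow> nat" where
  "geom_mult C lam = vec.dim {v :: complex^'n. cmat C *v v = lam *s v}"

definition defective :: "real^'n^'n \<Rightarrow> complex \<Rightarrow> bool" where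
  "defective C lam \<longleftrightarrow> geom_mult C lam < alg_mult C lam"

definition condition_A :: "real^'n^'n \<Rightarrow> real^'n^'n \<Rightarrow> bool" where
  "condition_A D C \<longleftrightarrow>
     (\<forall>V. subspace V \<and> V \<subseteq> {x. D *v x = 0} \<and> (\<forall>x\<in>V. transpose C *v x \<in> V)
          \<longrightarrow> V = {0}) \<and>
     (\<forall>lam\<in>spec C. Re lam > 0)"

definition mu_min :: "real^'n^'n \<Rightarrow> real" where
  "mu_min C = Min (Re ` spec C)"

definition finf :: "real^'n^'n \<Rightarrow> real^'n \<Rightarrow> real" where
  "finf K x = (2 * pi) powr (- real CARD('n) / 2) * (det K) powr (-1/2)
              * exp (- (x \<bullet> (matrix_inv K *v x)) / 2)"

definition Qmat :: "real^'n^'n \<Rightarrow> real^'n^'n \<Rightarrow> real^'n^'n" where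
  "Qmat K C = K ** transpose C ** matrix_inv K"

definition lambdaP :: "real^'n^'n \<Rightarrow> real^'n^'n \<Rightarrow> real" where
  "lambdaP K P = Sup {c. loewner_le (c *\<^sub>R matrix_inv P) (matrix_inv K)}"

definition admissible :: "(real \<Rightarrow> real) \<Rightarrow> bool" where
  "admissible \<psi> \<longleftrightarrow>
     (\<exists>s\<ge>0. \<psi> s \<noteq> 0) \<and>
     continuous_on {0..} \<psi> \<and>
     (\<forall>k<4. \<forall>s>0. ((deriv ^^ k) \<psi>) differentiable (at s)) \<and>
     continuous_on {0<..} ((deriv ^^ 4) \<psi>) \<and>
     \<psi> 1 = 0 \<and> deriv \<psi> 1 = 0 \<and>
     (\<forall>s>0. (deriv ^^ 2) \<psi> s \<ge> 0) \<and>
     (\<forall>s>0. ((deriv ^^ 3) \<psi> s)\<^sup>2 \<le> 1/2 * (deriv ^^ 2) \<psi> s * (deriv ^^ 4) \<psi> s)"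

definition e_psi :: "(real \<Rightarrow> real) \<Rightarrow> real^'n^'n \<Rightarrow> (real^'n \<Rightarrow> real) \<Rightarrow> ennreal" where
  "e_psi \<psi> K g = (\<integral>\<^sup>+ x. ennreal (\<psi> (g x / finf K x) * finf K x) \<partial>lborel)"

definition w_fun :: "(real \<Rightarrow> real) \<Rightarrow> real^'n^'n \<Rightarrow> (real^'n \<Rightarrow> real) \<Rightarrow> real^'n \<Rightarrow> real" where
  "w_fun \<psi> K g x = (LBINT s=1..(g x / finf K x). sqrt ((deriv ^^ 2) \<psi> s))"

definition test_fun :: "(real^'n \<Rightarrow> real) \<Rightarrow> (real^'n \<Rightarrow> real^'n) \<Rightarrow> bool" where
  "test_fun \<phi> d\<phi> \<longleftrightarrow> (\<forall>x. (\<phi> has_derivative (\<lambda>h. d\<phi> x \<bullet> h)) (at x)) \<and>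
      continuous_on UNIV d\<phi> \<and> bounded {x. \<phi> x \<noteq> 0}"

definition weak_grad :: "(real^'n \<Rightarrow> real) \<Rightarrow> (real^'n \<Rightarrow> real^'n) \<Rightarrow> bool" where
  "weak_grad w G \<longleftrightarrow>
     w \<in> borel_measurable lborel \<and> G \<in> borel_measurable lborel \<and>
     (\<forall>S. compact S \<longrightarrow> set_integrable lborel S w \<and> set_integrable lborel S G) \<and>
     (\<forall>\<phi> d\<phi>. test_fun \<phi> d\<phi> \<longrightarrow>
        (\<forall>i. (\<integral>x. w x * d\<phi> x $ i \<partial>lborel) = - (\<integral>x. G x $ i * \<phi> x \<partial>lborel)))"

definition psi_compatible :: "(real \<Rightarrow> real) \<Rightarrow> real^'n^'n \<Rightarrow> (real^'n \<Rightarrow> real) \<Rightarrow> bool" where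
  "psi_compatible \<psi> K g \<longleftrightarrow>
     (\<exists>G. weak_grad (w_fun \<psi> K g) G \<and> integrable lborel (\<lambda>x. (norm (G x))\<^sup>2 * finf K x))"

definition S_psi :: "(real \<Rightarrow> real) \<Rightarrow> real^'n^'n \<Rightarrow> real^'n^'n \<Rightarrow> (real^'n \<Rightarrow> real) \<Rightarrow> real" where
  "S_psi \<psi> K P g =
     (let G = (SOME G. weak_grad (w_fun \<psi> K g) G)
      in \<integral>x. (G x \<bullet> (P *v G x)) * finf K x \<partial>lborel)"

definition L1dist :: "(real^'n \<Rightarrow> real) \<Rightarrow> (real^'n \<Rightarrow> real) \<Rightarrow> ennreal" where
  "L1dist g h = (\<integral>\<^sup>+ x. ennreal (\<bar>g x - h x\<bar>) \<partial>lborel)"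

text \<open>Classical solution on (0,oo) x R^d, continuous into L^1 on [0,oo), with f(0) = f0.
  ft = time derivative, gf = spatial gradient, J = flux D grad f + C x f, dJ its
  spatial derivative (Jacobian, as a linear map).\<close>
definition is_solution ::
  "real^'n^'n \<Rightarrow> real^'n^'n \<Rightarrow> (real^'n \<Rightarrow> real) \<Rightarrow> (real \<Rightarrow> real^'n \<Rightarrow> real) \<Rightarrow> bool" where
  "is_solution D C f0 f \<longleftrightarrow>
     f 0 = f0 \<and>
     (\<forall>t\<ge>0. integrable lborel (f t)) \<and>
     (\<forall>s\<ge>0. ((\<lambda>t. L1dist (f t) (f s)) \<longlongrightarrow> 0) (at s within {0..})) \<and>
     (\<exists>ft gf dJ.
        continuous_on ({0<..} \<times> UNIV) (\<lambda>(t,x). f t x) \<and>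
        continuous_on ({0<..} \<times> UNIV) (\<lambda>(t,x). ft t x) \<and>
        continuous_on ({0<..} \<times> UNIV) (\<lambda>(t,x). gf t x) \<and>
        continuous_on ({0<..} \<times> UNIV) (\<lambda>(t,x). dJ t x) \<and>
        (\<forall>t>0. \<forall>x.
           ((\<lambda>s. f s x) has_real_derivative ft t x) (at t) \<and>
           (f t has_derivative (\<lambda>h. gf t x \<bullet> h)) (at x) \<and>
           ((\<lambda>y. D *v gf t y + f t y *\<^sub>R (C *v y)) has_derivative (\<lambda>h. dJ t x *v h)) (at x) \<and>
           ft t x = (\<Sum>i\<in>UNIV. dJ t x $ i $ i)))"

end

theory Submission
  imports Defs "HOL-Probability.Probability"
begin

text \<open>
  Comparing Fourier transforms identifies the solution: \<open>f t / f\<^sub>\<infinity>\<close> is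
  \<open>T g x = \<integral> g (A x + N z) \<gamma>(dz)\<close>, where \<open>\<gamma>\<close> is the standard Gaussian, \<open>g = f\<^sub>0 / f\<^sub>\<infinity>\<close>,
  \<open>A = exp (- t Q)\<close> and \<open>N N\<^sup>T = K - A K A\<^sup>T\<close>. For smooth \<open>g\<close>, joint convexity of
  \<open>(s, v) \<mapsto> \<psi>''(s) |v|\<^sup>2\<close> and \<open>\<nabla>(T g) = A\<^sup>T T(\<nabla>g)\<close> bound the weighted
  Fisher information of \<open>T g\<close> by that of \<open>g\<close>, and \<open>|A\<^sup>T v|\<^sub>P \<le> e\<^sup>- \<^sup>\<nu> \<^sup>t |v|\<^sub>P\<close> follows from
  \<open>Q P + P Q\<^sup>T \<ge> 2 \<nu> P\<close>. The convex Sobolev inequality for the Gaussian and \<open>\<lambda>\<^sub>P K \<le> P\<close> turn this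
  into the bound on the entropy. A general compatible \<open>g\<close> is reached by truncating and
  mollifying \<open>w = \<integral>\<^sub>1\<^sup>g (\<psi>'')\<^sup>1\<^sup>/\<^sup>2\<close>, whose gradient carries the Fisher information, followed by
  Fatou's lemma.
\<close>

section \<open>Gaussian measures\<close>

text \<open>The obstacle is the degeneracy of \<open>D\<close>: the entropy dissipation sees only
  the first \<open>k\<close> components of the gradient and can vanish away from equilibrium, so it
  does not control the entropy. The functional weighted by the positive definite \<open>P\<close>
  sees all directions, and its decay is a statement about the linear map \<open>A\<close> alone. The
  explicit kernel and convexity take the place of differentiating the entropy in time, which would
  demand regularity and decay of the solution at infinity. Two linear flows occur. Fourier
  frequencies move by the transpose of \<open>exp (- t C)\<close>, whereas the density relative to
  the Gaussian is transported by \<open>A\<close>, conjugate to that transpose through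
  \<open>K\<close>; the joint law of a stationary Gaussian pair links them. Smoothing acts on
  \<open>w\<close> rather than \<open>g\<close> because the hypothesis controls only the gradient of
  \<open>w\<close>, while \<psi>'' may blow up at 0. The inequality in the definition of
  admissibility is concavity of 1/\<psi>'', on which the convexity rests. The factor 1/2 in the
  bound is the constant of the Gaussian convex Sobolev inequality.\<close>

lemma integral_lborel_prod:
  fixes f :: "'a::euclidean_space \<Rightarrow> real \<Rightarrow> 'c::{real_normed_field,banach,second_countable_topology}"
  assumes int: "\<And>b. b \<in> Basis \<Longrightarrow> integrable lborel (f b)"
  shows "integrable lborel (\<lambda>x. \<Prod>b\<in>Basis. f b (x \<bullet> b))"
    and "(\<integral>x. (\<Prod>b\<in>Basis. f b (x \<bullet> b)) \<partial>lborel) = (\<Prod>b\<in>Basis. \<integral>x. f b x \<partial>lborel)"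
proof -
  interpret product_sigma_finite "\<lambda>_::'a. lborel :: real measure"
    by standard
  have [measurable]: "\<And>b. b \<in> Basis \<Longrightarrow> f b \<in> borel_measurable borel"
    using borel_measurable_integrable[OF int] by simp
  have m[measurable]: "(\<lambda>f. \<Sum>b\<in>Basis. f b *\<^sub>R b) \<in> (\<Pi>\<^sub>M b\<in>Basis. lborel) \<rightarrow>\<^sub>M (borel :: 'a measure)"
    by measurable
  have [measurable]: "(\<lambda>x. \<Prod>b\<in>Basis. f b (x \<bullet> b)) \<in> borel_measurable (borel :: 'a measure)"
    by measurable
  have eq: "(\<Prod>b\<in>Basis. f b ((\<Sum>c\<in>Basis. x c *\<^sub>R c) \<bullet> b)) = (\<Prod>b\<in>Basis. f b (x b))" for x :: "'a \<Rightarrow> real"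
    by (intro prod.cong refl) simp
  show "integrable lborel (\<lambda>x. \<Prod>b\<in>Basis. f b (x \<bullet> b))"
    by (subst lborel_eq, subst integrable_distr_eq) (auto simp: eq intro!: product_integrable_prod int)
  show "(\<integral>x. (\<Prod>b\<in>Basis. f b (x \<bullet> b)) \<partial>lborel) = (\<Prod>b\<in>Basis. \<integral>x. f b x \<partial>lborel)"
    by (subst (1) lborel_eq, subst integral_distr) (auto simp: eq intro!: product_integral_prod int)
qed

text \<open>Posed on any Euclidean space because a pair of independent Gaussian vectors is treated
  as one Gaussian vector in a product space; \<open>gauss_pair\<close> identifies the two
  views.\<close>

definition gauss_density :: "'a::euclidean_space \<Rightarrow> real" where
  "gauss_density x = (2 * pi) powr (- real DIM('a) / 2) * exp (- (x \<bullet> x) / 2)"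

definition gauss :: "'a::euclidean_space measure" where
  "gauss = density lborel (\<lambda>x. ennreal (gauss_density x))"

lemma gauss_density_eq_prod:
  "gauss_density (x::'a::euclidean_space) = (\<Prod>b\<in>Basis. std_normal_density (x \<bullet> b))"
proof -
  have "x \<bullet> x = (\<Sum>b\<in>Basis. (x \<bullet> b)\<^sup>2)"
    by (simp add: euclidean_inner[of x x] power2_eq_square)
  then have "exp (- (x \<bullet> x) / 2) = (\<Prod>b\<in>Basis. exp (- (x \<bullet> b)\<^sup>2 / 2))"
    by (simp add: exp_sum[symmetric] sum_negf sum_divide_distrib)
  moreover have "(2 * pi) powr (- real DIM('a) / 2) = (1 / sqrt (2 * pi)) ^ DIM('a)"
  proof -
    have "(1 / sqrt (2 * pi)) = (2 * pi) powr (- (1/2))"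
      using powr_half_sqrt[of "2 * pi"] powr_minus_divide[of "2 * pi" "1/2"] by simp
    then show ?thesis
      by (simp add: powr_realpow[symmetric] powr_powr)
  qed
  ultimately show ?thesis
    by (simp add: gauss_density_def std_normal_density_def prod_dividef power_divide)
qed

lemma gauss_density_pos: "gauss_density x > 0"
  by (simp add: gauss_density_def)

lemma gauss_density_measurable[measurable]: "gauss_density \<in> borel_measurable borel"
  unfolding gauss_density_def[abs_def] by measurable

lemma sets_gauss[measurable_cong, simp]: "sets gauss = sets borel"
  by (simp add: gauss_def)

lemma space_gauss[simp]: "space gauss = UNIV"
  by (simp add: gauss_def)

lemma prob_space_gauss: "prob_space (gauss :: 'a::euclidean_space measure)"
proof
  have "emeasure (gauss::'a measure) (space gauss) = (\<integral>\<^sup>+x. ennreal (gauss_density (x::'a)) \<partial>lborel)"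
    by (simp add: gauss_def emeasure_density)
  also have "\<dots> = (\<integral>\<^sup>+x. (\<Prod>b\<in>Basis. ennreal (std_normal_density ((x::'a) \<bullet> b))) \<partial>lborel)"
    by (simp add: gauss_density_eq_prod prod_ennreal)
  also have "\<dots> = (\<Prod>b\<in>(Basis::'a set). \<integral>\<^sup>+x. ennreal (std_normal_density x) \<partial>lborel)"
    by (rule nn_integral_lborel_prod) auto
  also have "\<dots> = 1"
    using prob_space.emeasure_space_1[OF prob_space_normal_density[of 1 0]]
    by (simp add: emeasure_density)
  finally show "emeasure (gauss :: 'a measure) (space gauss) = 1" .
qed

interpretation gauss: prob_space "gauss :: 'a::euclidean_space measure"
  by (rule prob_space_gauss)

lemma gauss_prob_UNIV[simp]: "measure gauss UNIV = 1"
  using gauss.prob_space by simp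

lemma gauss_integral_prod:
  fixes f :: "'a::euclidean_space \<Rightarrow> real \<Rightarrow> 'c::{real_normed_field,banach,second_countable_topology}"
  assumes int: "\<And>b. b \<in> Basis \<Longrightarrow> integrable std_normal_distribution (f b)"
  shows "integrable gauss (\<lambda>x. \<Prod>b\<in>Basis. f b (x \<bullet> b))"
    and "(\<integral>x. (\<Prod>b\<in>Basis. f b (x \<bullet> b)) \<partial>gauss) = (\<Prod>b\<in>Basis. \<integral>x. f b x \<partial>std_normal_distribution)"
proof -
  have m[measurable]: "\<And>b. b \<in> Basis \<Longrightarrow> f b \<in> borel_measurable borel"
    using borel_measurable_integrable[OF int] by simp
  have i: "\<And>b. b \<in> Basis \<Longrightarrow> integrable lborel (\<lambda>x. std_normal_density x *\<^sub>R f b x)"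
  proof -
    fix b :: 'a assume b: "b \<in> Basis"
    show "integrable lborel (\<lambda>x. std_normal_density x *\<^sub>R f b x)"
      using int[OF b] m[OF b] by (subst (asm) integrable_density) auto
  qed
  have eq: "gauss_density x *\<^sub>R (\<Prod>b\<in>Basis. f b (x \<bullet> b)) = (\<Prod>b\<in>Basis. std_normal_density (x \<bullet> b) *\<^sub>R f b (x \<bullet> b))" for x :: 'a
    by (simp add: gauss_density_eq_prod prod.distrib scaleR_conv_of_real)
  have mm: "(\<lambda>x. \<Prod>b\<in>Basis. f b (x \<bullet> b)) \<in> borel_measurable (lborel :: 'a measure)"
    by measurable
  show "integrable gauss (\<lambda>x. \<Prod>b\<in>Basis. f b (x \<bullet> b))"
    unfolding gauss_def
    by (subst integrable_density)
       (use mm in \<open>auto simp: eq less_imp_le[OF gauss_density_pos] intro!: integral_lborel_prod(1)[of "\<lambda>b x. std_normal_density x *\<^sub>R f b x"] i\<close>)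
  show "(\<integral>x. (\<Prod>b\<in>Basis. f b (x \<bullet> b)) \<partial>gauss) = (\<Prod>b\<in>Basis. \<integral>x. f b x \<partial>std_normal_distribution)"
    unfolding gauss_def
    by (subst integral_density)
       (use mm in \<open>auto simp: eq less_imp_le[OF gauss_density_pos] integral_density
          integral_lborel_prod(2)[of "\<lambda>b x. std_normal_density x *\<^sub>R f b x", OF i]\<close>)
qed

text \<open>The phase \<open>p\<close> lets real cosines carry the whole Fourier transform, since
  \<open>p = - pi / 2\<close> gives the sine. The complex exponential factors over the coordinates,
  which reduces the integral to the one-dimensional characteristic function.\<close>

lemma gauss_cos:
  fixes \<xi> :: "'a::euclidean_space"
  shows "(\<integral>x. cos (\<xi> \<bullet> x + p) \<partial>gauss) = exp (- (norm \<xi>)\<^sup>2 / 2) * cos p"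
proof -
  let ?f = "\<lambda>b x. iexp ((\<xi> \<bullet> b) * x)"
  interpret N: real_distribution std_normal_distribution
    by (rule real_dist_normal_dist)
  have i: "integrable std_normal_distribution (?f b)" for b
    by (rule N.integrable_iexp) auto
  have p: "(\<Prod>b\<in>Basis. ?f b (x \<bullet> b)) = iexp (\<xi> \<bullet> x)" for x
    by (subst exp_sum[symmetric]) (auto simp: euclidean_inner[of \<xi> x] sum_distrib_left)
  have I: "integrable gauss (\<lambda>x::'a. iexp (\<xi> \<bullet> x))"
    using gauss_integral_prod(1)[of ?f, OF i] by (simp only: p)
  have "(\<integral>x. iexp (\<xi> \<bullet> x) \<partial>gauss) = (\<Prod>b\<in>Basis. \<integral>x. ?f b x \<partial>std_normal_distribution)"
    using gauss_integral_prod(2)[of ?f, OF i] by (simp only: p)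
  also have "\<dots> = (\<Prod>b\<in>Basis. complex_of_real (exp (- ((\<xi> \<bullet> b)\<^sup>2) / 2)))"
    using char_std_normal_distribution by (intro prod.cong refl) (auto simp: char_def fun_eq_iff)
  also have "\<dots> = complex_of_real (exp (- (norm \<xi>)\<^sup>2 / 2))"
    using euclidean_inner[of \<xi> \<xi>] dot_square_norm[of \<xi>]
    by (simp add: exp_sum[symmetric] sum_negf sum_divide_distrib[symmetric] power2_norm_eq_inner
        power2_eq_square flip: of_real_prod dot_square_norm)
  finally have E: "(\<integral>x. iexp (\<xi> \<bullet> x) \<partial>gauss) = complex_of_real (exp (- (norm \<xi>)\<^sup>2 / 2))" .
  have "(\<integral>x. iexp p * iexp (\<xi> \<bullet> x) \<partial>gauss) = iexp p * complex_of_real (exp (- (norm \<xi>)\<^sup>2 / 2))"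
    using E I by simp
  then have "Re (\<integral>x. iexp p * iexp (\<xi> \<bullet> x) \<partial>gauss) = exp (- (norm \<xi>)\<^sup>2 / 2) * cos p"
    by (simp add: Re_exp)
  moreover have "Re (\<integral>x. iexp p * iexp (\<xi> \<bullet> x) \<partial>gauss) = (\<integral>x. Re (iexp p * iexp (\<xi> \<bullet> x)) \<partial>gauss)"
    using I by (intro integral_Re[symmetric]) auto
  moreover have "Re (iexp p * iexp (\<xi> \<bullet> x)) = cos (\<xi> \<bullet> x + p)" for x
    by (simp add: exp_add[symmetric] Re_exp  distrib_left[symmetric] add.commute)
  ultimately show ?thesis by (simp only:)
qed

lemma gauss_second_moment_Basis:
  assumes b: "b \<in> Basis" "c \<in> Basis"
  shows "integrable gauss (\<lambda>x::'a::euclidean_space. (x \<bullet> b) * (x \<bullet> c))"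
    and "(\<integral>x. (x \<bullet> b) * (x \<bullet> c) \<partial>(gauss :: 'a measure)) = (if b = c then 1 else 0)"
proof -
  let ?f = "\<lambda>d x::real. (if d = b then x else 1) * (if d = c then x else 1)"
  interpret N: real_distribution std_normal_distribution
    by (rule real_dist_normal_dist)
  have m: "integrable std_normal_distribution (\<lambda>x::real. x ^ k)" for k
    by (subst integrable_density) (auto simp: integrable_std_normal_moment)
  have m1: "integrable std_normal_distribution (\<lambda>x::real. x)"
    using m[of 1] by simp
  have m2: "integrable std_normal_distribution (\<lambda>x::real. x * x)"
    using m[of 2] by (simp add: power2_eq_square)
  have e1: "(\<integral>x. x \<partial>std_normal_distribution) = 0"
    using integral_std_normal_moment_odd[of 0] by (subst integral_density) (auto)
  have e2: "(\<integral>x. x * x \<partial>std_normal_distribution) = 1"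
    using integral_std_normal_moment_even[of 1] by (subst integral_density) (auto simp: power2_eq_square fact_numeral numeral_2_eq_2)
  have i: "integrable std_normal_distribution (?f d)" for d
    using m1 m2 by (cases "d = b"; cases "d = c") auto
  have p: "(\<Prod>d\<in>Basis. ?f d (x \<bullet> d)) = (x \<bullet> b) * (x \<bullet> c)" for x :: 'a
    using b by (simp only: prod.distrib prod.delta finite_Basis if_True)
  show "integrable gauss (\<lambda>x::'a. (x \<bullet> b) * (x \<bullet> c))"
    using gauss_integral_prod(1)[of ?f, OF i] by (simp add: p)
  have "(\<integral>x. (x \<bullet> b) * (x \<bullet> c) \<partial>(gauss :: 'a measure)) = (\<Prod>d\<in>(Basis::'a set). \<integral>x. ?f d x \<partial>std_normal_distribution)"
    using gauss_integral_prod(2)[of ?f, OF i] by (simp add: p)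
  also have "\<dots> = (if b = c then 1 else 0)"
  proof (cases "b = c")
    case True
    have "(\<integral>x. ?f d x \<partial>std_normal_distribution) = 1" for d
      using True e2 N.prob_space by (cases "d = b") auto
    then show ?thesis using True by simp
  next
    case False
    have "(\<integral>x. ?f b x \<partial>std_normal_distribution) = 0"
      using False e1 by simp
    then show ?thesis using False b by (subst prod_zero[of Basis]) (auto intro!: bexI[of _ b])
  qed
  finally show "(\<integral>x. (x \<bullet> b) * (x \<bullet> c) \<partial>(gauss :: 'a measure)) = (if b = c then 1 else 0)" .
qed

lemma gauss_second_moment:
  fixes u v :: "'a::euclidean_space"
  shows "integrable gauss (\<lambda>x. (u \<bullet> x) * (v \<bullet> x))"
    and "(\<integral>x. (u \<bullet> x) * (v \<bullet> x) \<partial>gauss) = u \<bullet> v"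
proof -
  have eq: "(u \<bullet> x) * (v \<bullet> x) = (\<Sum>b\<in>Basis. \<Sum>c\<in>Basis. ((u \<bullet> b) * (v \<bullet> c)) * ((x \<bullet> b) * (x \<bullet> c)))" for x
    by (subst euclidean_inner[of u x], subst euclidean_inner[of v x], subst sum_product)
       (simp add: algebra_simps)
  show "integrable gauss (\<lambda>x. (u \<bullet> x) * (v \<bullet> x))"
    unfolding eq by (intro Bochner_Integration.integrable_sum integrable_mult_right gauss_second_moment_Basis)
  have "(\<integral>x. (u \<bullet> x) * (v \<bullet> x) \<partial>gauss) = (\<Sum>b\<in>Basis. \<Sum>c\<in>Basis. ((u \<bullet> b) * (v \<bullet> c)) * (if b = c then 1 else 0))"
    unfolding eq
    by (subst Bochner_Integration.integral_sum, intro Bochner_Integration.integrable_sum integrable_mult_right gauss_second_moment_Basis, assumption, assumption)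
       (auto intro!: sum.cong simp: gauss_second_moment_Basis Bochner_Integration.integral_sum)
  also have "\<dots> = u \<bullet> v"
    by (simp add: euclidean_inner[of u v] if_distrib cong: if_cong)
  finally show "(\<integral>x. (u \<bullet> x) * (v \<bullet> x) \<partial>gauss) = u \<bullet> v" .
qed

lemma gauss_norm_sq_integrable: "integrable gauss (\<lambda>x::'a::euclidean_space. (norm x)\<^sup>2)"
proof -
  have "(norm x)\<^sup>2 = (\<Sum>b\<in>Basis. (b \<bullet> x) * (b \<bullet> x))" for x :: 'a
    by (simp add: power2_norm_eq_inner euclidean_inner[of x x] inner_commute)
  then show ?thesis
    by (auto intro!: Bochner_Integration.integrable_sum gauss_second_moment)
qed

lemma gauss_norm_integrable: "integrable gauss (\<lambda>x::'a::euclidean_space. norm x)"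
proof (rule Bochner_Integration.integrable_bound[OF _ _ AE_I2])
  show "integrable gauss (\<lambda>x::'a. 1 + (norm x)\<^sup>2)"
    by (intro Bochner_Integration.integrable_add gauss_norm_sq_integrable) auto
  show "norm (norm x) \<le> norm (1 + (norm x)\<^sup>2)" for x :: 'a
    using sum_power2_ge_zero[of "norm x - 1" 0] by (simp add: power2_eq_square algebra_simps) (smt (verit) norm_ge_zero)
qed measurable

text \<open>The gradient bound \<open>B\<close> on the ball dominates the difference quotients at
  \<open>x0\<close>, by the mean value inequality, so dominated convergence along sequences gives
  the derivative. Integrability of \<open>F\<close> is assumed at \<open>x0\<close> and spreads to
  the ball by the same bound.\<close>

lemma has_derivative_integral_dominated:
  fixes F :: "'p::euclidean_space \<Rightarrow> 'z \<Rightarrow> real" and D :: "'p \<Rightarrow> 'z \<Rightarrow> 'p"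
  assumes r: "0 < r"
    and meas: "\<And>x. x \<in> ball x0 r \<Longrightarrow> F x \<in> borel_measurable M"
    and int: "integrable M (F x0)"
    and der: "\<And>x z. x \<in> ball x0 r \<Longrightarrow> z \<in> space M \<Longrightarrow> ((\<lambda>y. F y z) has_derivative (\<lambda>v. D x z \<bullet> v)) (at x)"
    and bd: "\<And>x z. x \<in> ball x0 r \<Longrightarrow> z \<in> space M \<Longrightarrow> norm (D x z) \<le> B z"
    and B: "integrable M B"
    and D[measurable]: "D x0 \<in> borel_measurable M"
  shows "((\<lambda>x. \<integral>z. F x z \<partial>M) has_derivative (\<lambda>v. (\<integral>z. D x0 z \<partial>M) \<bullet> v)) (at x0)"
    and "integrable M (D x0)"
proof -
  have Dint: "integrable M (D x0)"
    using B by (rule Bochner_Integration.integrable_bound) (use bd[of x0] r in \<open>auto intro!: AE_I2 intro: order_trans[OF _ abs_ge_self]\<close>)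
  then show "integrable M (D x0)" .
  have lip: "\<bar>F x z - F x0 z\<bar> \<le> B z * norm (x - x0)" if "x \<in> ball x0 r" "z \<in> space M" for x z
  proof -
    have "norm (F x z - F x0 z) \<le> B z * norm (x - x0)"
    proof (rule differentiable_bound[of "ball x0 r" "\<lambda>y. F y z" "\<lambda>x v. D x z \<bullet> v"])
      show "onorm (\<lambda>v. D y z \<bullet> v) \<le> B z" if "y \<in> ball x0 r" for y
        using bd[OF that \<open>z \<in> space M\<close>] Cauchy_Schwarz_ineq2[of "D y z"]
        by (intro onorm_le) (smt (verit) mult_right_mono norm_ge_zero real_norm_def)
    qed (use that r der in \<open>auto intro: has_derivative_at_withinI\<close>)
    then show ?thesis by simp
  qed
  have Fint: "integrable M (F x)" if x: "x \<in> ball x0 r" for x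
  proof -
    have [measurable]: "F x \<in> borel_measurable M" "F x0 \<in> borel_measurable M"
      using meas x int by auto
    have "integrable M (\<lambda>z. F x z - F x0 z)"
      by (rule Bochner_Integration.integrable_bound[of M "\<lambda>z. B z * norm (x - x0)"])
         (use B lip[OF x] in \<open>auto intro!: AE_I2 intro: order_trans[OF _ abs_ge_self]\<close>)
    then have "integrable M (\<lambda>z. (F x z - F x0 z) + F x0 z)"
      by (intro Bochner_Integration.integrable_add int)
    then show ?thesis by simp
  qed
  show "((\<lambda>x. \<integral>z. F x z \<partial>M) has_derivative (\<lambda>v. (\<integral>z. D x0 z \<partial>M) \<bullet> v)) (at x0)"
    unfolding has_derivative_at_within[of _ _ _ UNIV, simplified]
  proof (intro conjI bounded_linear_inner_right)
    let ?Q = "\<lambda>y. ((\<integral>z. F y z \<partial>M) - (\<integral>z. F x0 z \<partial>M) - (\<integral>z. D x0 z \<partial>M) \<bullet> (y - x0)) /\<^sub>R norm (y - x0)"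
    have "(?Q \<longlongrightarrow> 0) (at x0)"
      unfolding tendsto_at_iff_sequentially[of _ _ _ UNIV, simplified] comp_def
    proof (intro allI impI)
      fix X :: "nat \<Rightarrow> 'p" assume ne: "\<forall>i. X i \<noteq> x0" and lim: "X \<longlonglongrightarrow> x0"
      obtain N where N: "\<And>n. n \<ge> N \<Longrightarrow> X n \<in> ball x0 r"
        using lim r unfolding lim_sequentially by (metis dist_commute mem_ball)
      let ?Y = "\<lambda>n. X (n + N)"
      let ?u = "\<lambda>n z. (F (?Y n) z - F x0 z - D x0 z \<bullet> (?Y n - x0)) /\<^sub>R norm (?Y n - x0)"
      have Y: "?Y n \<in> ball x0 r" for n using N by simp
      have Ylim: "?Y \<longlonglongrightarrow> x0" using lim by (rule LIMSEQ_ignore_initial_segment)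
      have ui: "(\<integral>z. ?u n z \<partial>M) = ?Q (?Y n)" for n
        using Fint[OF Y[of n]] int Dint by simp
      have "(\<lambda>n. \<integral>z. ?u n z \<partial>M) \<longlonglongrightarrow> (\<integral>z. 0 \<partial>M)"
      proof (rule integral_dominated_convergence[where w="\<lambda>z. 2 * B z"])
        show "?u n \<in> borel_measurable M" for n
          using Fint[OF Y[of n]] int by measurable
        show "AE z in M. norm (?u n z) \<le> 2 * B z" for n
        proof (rule AE_I2)
          fix z assume z: "z \<in> space M"
          have "\<bar>D x0 z \<bullet> (?Y n - x0)\<bar> \<le> B z * norm (?Y n - x0)"
            using Cauchy_Schwarz_ineq2[of "D x0 z" "?Y n - x0"] bd[of x0 z] z r
            by (smt (verit) centre_in_ball mult_right_mono norm_ge_zero)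
          with lip[OF Y[of n] z] have "\<bar>F (?Y n) z - F x0 z - D x0 z \<bullet> (?Y n - x0)\<bar> \<le> 2 * B z * norm (?Y n - x0)"
            by linarith
          then show "norm (?u n z) \<le> 2 * B z"
            using ne by (simp add: divide_simps abs_mult)
        qed
        show "AE z in M. (\<lambda>n. ?u n z) \<longlonglongrightarrow> 0"
        proof (rule AE_I2)
          fix z assume z: "z \<in> space M"
          have "((\<lambda>y. F y z) has_derivative (\<lambda>v. D x0 z \<bullet> v)) (at x0)"
            using der z r by auto
          then have "((\<lambda>y. (F y z - F x0 z - D x0 z \<bullet> (y - x0)) /\<^sub>R norm (y - x0)) \<longlongrightarrow> 0) (at x0)"
            unfolding has_derivative_at_within[of _ _ _ UNIV, simplified] by auto
          then show "(\<lambda>n. ?u n z) \<longlonglongrightarrow> 0"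
            unfolding tendsto_at_iff_sequentially[of _ _ _ UNIV, simplified] comp_def
            using ne Ylim by auto
        qed
      qed (use B in auto)
      then have "(\<lambda>n. ?Q (?Y n)) \<longlonglongrightarrow> 0" unfolding ui by simp
      then show "(\<lambda>n. ?Q (X n)) \<longlonglongrightarrow> 0" by (rule LIMSEQ_offset)
    qed
    then show "((\<lambda>y. ((\<integral>z. F y z \<partial>M) - (\<integral>z. F x0 z \<partial>M) - (\<integral>z. D x0 z \<partial>M) \<bullet> (y - x0)) /\<^sub>R norm (y - x0)) \<longlongrightarrow> 0) (at x0)" .
  qed
qed

section \<open>Uniqueness of finite measures from their cosine transforms\<close>

lemma integral_gauss_density:
  fixes \<phi> :: "'a::euclidean_space \<Rightarrow> real"
  assumes [measurable]: "\<phi> \<in> borel_measurable borel"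
  shows "(\<integral>x. \<phi> x \<partial>gauss) = (\<integral>x. gauss_density x * \<phi> x \<partial>lborel)"
  unfolding gauss_def by (subst integral_density) (auto simp: less_imp_le[OF gauss_density_pos])

lemma gauss_shift_scale:
  fixes \<phi> :: "'a::euclidean_space \<Rightarrow> real"
  assumes [measurable]: "\<phi> \<in> borel_measurable borel" and s: "s > 0"
  shows "(\<integral>z. \<phi> (x + s *\<^sub>R z) \<partial>gauss) = (\<integral>a. \<phi> a * gauss_density ((a - x) /\<^sub>R s) \<partial>lborel) / s ^ DIM('a)"
proof -
  have "(\<integral>a. \<phi> a * gauss_density ((a - x) /\<^sub>R s) \<partial>lborel)
      = (\<integral>z. s ^ DIM('a) * (gauss_density z * \<phi> (x + s *\<^sub>R z)) \<partial>lborel)"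
    by (subst lborel_affine[of s x])
       (use s in \<open>auto simp: integral_density integral_distr mult_ac\<close>)
  then show ?thesis
    using s by (simp add: integral_gauss_density)
qed

text \<open>Gaussian smoothing inverts the transform. A Gaussian density is itself an average of
  cosines, so equal transforms give equal integrals of every test function convolved with a narrow
  Gaussian; letting the width tend to 0 removes the smoothing. Indicators of open boxes are limits
  of such test functions, and boxes form a generator stable under intersection.\<close>

theorem measure_eqI_cos:
  fixes M N :: "'a::euclidean_space measure"
  assumes M: "finite_measure M" and N: "finite_measure N"
    and sM: "sets M = sets borel" and sN: "sets N = sets borel"
    and eq: "\<And>\<xi> p. (\<integral>x. cos (\<xi> \<bullet> x + p) \<partial>M) = (\<integral>x. cos (\<xi> \<bullet> x + p) \<partial>N)"
  shows "M = N"
proof -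
  interpret M: finite_measure M by fact
  interpret N: finite_measure N by fact
  note [measurable_cong] = sM sN
  have spM: "space M = UNIV" and spN: "space N = UNIV"
    using sets_eq_imp_space_eq[OF sM] sets_eq_imp_space_eq[OF sN] by auto
  have kernel: "(\<integral>x. gauss_density ((a - x) /\<^sub>R s) \<partial>P)
        = (2 * pi) powr (- real DIM('a) / 2) * (\<integral>\<eta>. (\<integral>x. cos ((- inverse s *\<^sub>R \<eta>) \<bullet> x + (\<eta> \<bullet> a) / s) \<partial>P) \<partial>gauss)"
    if P: "finite_measure P" and sP[measurable_cong]: "sets P = sets borel" and s: "s > 0"
    for P :: "'a measure" and a s
  proof -
    interpret P: finite_measure P by fact
    interpret PG: pair_sigma_finite P "gauss :: 'a measure" ..
    have c: "exp (- (y \<bullet> y) / 2) = (\<integral>\<eta>. cos (\<eta> \<bullet> y) \<partial>gauss)" for y :: 'a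
      using gauss_cos[of y 0] by (simp add: power2_norm_eq_inner inner_commute)
    have i: "integrable (P \<Otimes>\<^sub>M gauss) (\<lambda>(x, \<eta>). cos (\<eta> \<bullet> ((a - x) /\<^sub>R s)))"
    proof -
      interpret Q: finite_measure "P \<Otimes>\<^sub>M (gauss :: 'a measure)"
        by (intro finite_measure_pair_measure) unfold_locales
      show ?thesis
        by (rule Q.integrable_const_bound[of _ 1]) (auto simp: split_beta)
    qed
    have "(\<integral>x. exp (- (((a - x) /\<^sub>R s) \<bullet> ((a - x) /\<^sub>R s)) / 2) \<partial>P)
       = (\<integral>x. (\<integral>\<eta>. cos (\<eta> \<bullet> ((a - x) /\<^sub>R s)) \<partial>gauss) \<partial>P)"
      by (subst c) simp
    also have "\<dots> = (\<integral>\<eta>. (\<integral>x. cos (\<eta> \<bullet> ((a - x) /\<^sub>R s)) \<partial>P) \<partial>gauss)"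
      using PG.Fubini_integral[OF i] by simp
    also have "\<dots> = (\<integral>\<eta>. (\<integral>x. cos ((- inverse s *\<^sub>R \<eta>) \<bullet> x + (\<eta> \<bullet> a) / s) \<partial>P) \<partial>gauss)"
      by (intro Bochner_Integration.integral_cong refl arg_cong[where f=cos])
         (simp add: inner_diff_right algebra_simps divide_inverse)
    finally show ?thesis by (simp add: gauss_density_def)
  qed
  have smooth: "(\<integral>x. (\<integral>z. \<phi> (x + s *\<^sub>R z) \<partial>gauss) \<partial>P)
        = (\<integral>a. \<phi> a * (\<integral>x. gauss_density ((a - x) /\<^sub>R s) \<partial>P) \<partial>lborel) / s ^ DIM('a)"
    if P: "finite_measure P" and sP[measurable_cong]: "sets P = sets borel" and s: "s > 0"
      and \<phi>: "integrable lborel \<phi>" for P :: "'a measure" and s and \<phi> :: "'a \<Rightarrow> real"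
  proof -
    interpret P: finite_measure P by fact
    interpret PG: pair_sigma_finite P "lborel :: 'a measure" ..
    have [measurable]: "\<phi> \<in> borel_measurable borel" using \<phi> by auto
    have dle: "gauss_density y \<le> (2 * pi) powr (- real DIM('a) / 2)" for y :: 'a
      by (simp add: gauss_density_def)
    have i: "integrable (P \<Otimes>\<^sub>M lborel) (\<lambda>(x, a). \<phi> a * gauss_density ((a - x) /\<^sub>R s))"
    proof (rule Bochner_Integration.integrable_bound[of _ "\<lambda>(x, a). (2 * pi) powr (- real DIM('a) / 2) * \<phi> a"])
      show "integrable (P \<Otimes>\<^sub>M lborel) (\<lambda>(x, a). (2 * pi) powr (- real DIM('a) / 2) * \<phi> a)"
        by (rule PG.Fubini_integrable) (use \<phi> in \<open>auto simp: split_beta\<close>)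
      show "AE z in P \<Otimes>\<^sub>M lborel. norm (case z of (x, a) \<Rightarrow> \<phi> a * gauss_density ((a - x) /\<^sub>R s))
          \<le> norm (case z of (x, a) \<Rightarrow> (2 * pi) powr (- real DIM('a) / 2) * \<phi> a)"
      proof (rule AE_I2)
        fix z :: "'a \<times> 'a"
        obtain x a where z: "z = (x, a)" by (cases z)
        have "\<bar>\<phi> a\<bar> * gauss_density ((a - x) /\<^sub>R s) \<le> \<bar>\<phi> a\<bar> * (2 * pi) powr (- real DIM('a) / 2)"
          by (intro mult_left_mono dle) auto
        then show "norm (case z of (x, a) \<Rightarrow> \<phi> a * gauss_density ((a - x) /\<^sub>R s))
          \<le> norm (case z of (x, a) \<Rightarrow> (2 * pi) powr (- real DIM('a) / 2) * \<phi> a)"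
          by (simp add: z abs_mult less_imp_le[OF gauss_density_pos] mult.commute)
      qed
    qed auto
    have "(\<integral>x. (\<integral>z. \<phi> (x + s *\<^sub>R z) \<partial>gauss) \<partial>P)
        = (\<integral>x. (\<integral>a. \<phi> a * gauss_density ((a - x) /\<^sub>R s) \<partial>lborel) / s ^ DIM('a) \<partial>P)"
      using s by (simp add: gauss_shift_scale)
    also have "\<dots> = (\<integral>x. (\<integral>a. \<phi> a * gauss_density ((a - x) /\<^sub>R s) \<partial>lborel) \<partial>P) / s ^ DIM('a)"
      by simp
    also have "(\<integral>x. (\<integral>a. \<phi> a * gauss_density ((a - x) /\<^sub>R s) \<partial>lborel) \<partial>P)
         = (\<integral>a. (\<integral>x. \<phi> a * gauss_density ((a - x) /\<^sub>R s) \<partial>P) \<partial>lborel)"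
      using PG.Fubini_integral[OF i] by simp
    finally show ?thesis by simp
  qed
  have lim: "(\<lambda>n. \<integral>x. (\<integral>z. \<phi> (x + inverse (real (Suc n)) *\<^sub>R z) \<partial>gauss) \<partial>P) \<longlonglongrightarrow> (\<integral>x. \<phi> x \<partial>P)"
    if P: "finite_measure P" and sP[measurable_cong]: "sets P = sets borel"
      and \<phi>: "continuous_on UNIV \<phi>" and b: "\<And>x. \<bar>\<phi> x\<bar> \<le> B" for P :: "'a measure" and \<phi> :: "'a \<Rightarrow> real" and B
  proof -
    interpret P: finite_measure P by fact
    have [measurable]: "\<phi> \<in> borel_measurable borel"
      using \<phi> by (rule borel_measurable_continuous_onI)
    show ?thesis
    proof (rule integral_dominated_convergence[where w="\<lambda>_. B"])
      show "AE x in P. (\<lambda>n. \<integral>z. \<phi> (x + inverse (real (Suc n)) *\<^sub>R z) \<partial>gauss) \<longlonglongrightarrow> \<phi> x"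
      proof (rule AE_I2)
        fix x
        have "(\<lambda>n. \<integral>z. \<phi> (x + inverse (real (Suc n)) *\<^sub>R z) \<partial>gauss) \<longlonglongrightarrow> (\<integral>z. \<phi> x \<partial>(gauss :: 'a measure))"
        proof (rule integral_dominated_convergence[where w="\<lambda>_. B"])
          show "AE z in gauss. (\<lambda>n. \<phi> (x + inverse (real (Suc n)) *\<^sub>R z)) \<longlonglongrightarrow> \<phi> x"
          proof (rule AE_I2)
            fix z :: 'a
            have "(\<lambda>n. x + inverse (real (Suc n)) *\<^sub>R z) \<longlonglongrightarrow> x + 0 *\<^sub>R z"
              by (intro tendsto_intros LIMSEQ_inverse_real_of_nat)
            then show "(\<lambda>n. \<phi> (x + inverse (real (Suc n)) *\<^sub>R z)) \<longlonglongrightarrow> \<phi> x"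
              using \<phi> by (intro isCont_tendsto_compose[of x \<phi>]) (auto simp: continuous_on_eq_continuous_at)
          qed
        qed (use b in auto)
        then show "(\<lambda>n. \<integral>z. \<phi> (x + inverse (real (Suc n)) *\<^sub>R z) \<partial>gauss) \<longlonglongrightarrow> \<phi> x"
          by (simp add: gauss.prob_space)
      qed
      show "AE x in P. norm (\<integral>z. \<phi> (x + inverse (real (Suc n)) *\<^sub>R z) \<partial>gauss) \<le> B" for n
      proof (rule AE_I2)
        fix x
        have "norm (\<integral>z. \<phi> (x + inverse (real (Suc n)) *\<^sub>R z) \<partial>gauss) \<le> (\<integral>z. norm (\<phi> (x + inverse (real (Suc n)) *\<^sub>R z)) \<partial>gauss)"
          by (rule integral_norm_bound)
        also have "\<dots> \<le> (\<integral>z. B \<partial>(gauss :: 'a measure))"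
          by (intro integral_mono gauss.integrable_const_bound[of _ B]) (auto simp: b order_trans[OF abs_ge_zero b])
        finally show "norm (\<integral>z. \<phi> (x + inverse (real (Suc n)) *\<^sub>R z) \<partial>gauss) \<le> B"
          by simp
      qed
    qed (auto)
  qed
  have keq: "(\<integral>x. gauss_density ((a - x) /\<^sub>R s) \<partial>M) = (\<integral>x. gauss_density ((a - x) /\<^sub>R s) \<partial>N)" if "s > 0" for a s
    by (simp only: kernel[OF M sM that] kernel[OF N sN that] eq)
  have test: "(\<integral>x. \<phi> x \<partial>M) = (\<integral>x. \<phi> x \<partial>N)"
    if \<phi>: "continuous_on UNIV \<phi>" and b: "\<And>x. \<bar>\<phi> x\<bar> \<le> B" and i: "integrable lborel \<phi>" for \<phi> :: "'a \<Rightarrow> real" and B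
  proof -
    have "(\<integral>x. (\<integral>z. \<phi> (x + inverse (real (Suc n)) *\<^sub>R z) \<partial>gauss) \<partial>M)
        = (\<integral>x. (\<integral>z. \<phi> (x + inverse (real (Suc n)) *\<^sub>R z) \<partial>gauss) \<partial>N)" for n
      by (subst smooth[OF M sM _ i], simp, subst smooth[OF N sN _ i], simp, subst keq, simp_all)
    with lim[OF M sM \<phi> b] lim[OF N sN \<phi> b] show ?thesis
      using LIMSEQ_unique by simp
  qed
  show ?thesis
  proof (rule measure_eqI_generator_eq)
    let ?E = "range (\<lambda>(a, b). box a b::'a set)"
    show "Int_stable ?E"
      by (auto simp: Int_stable_def box_Int_box)
    show "?E \<subseteq> Pow UNIV" "sets M = sigma_sets UNIV ?E" "sets N = sigma_sets UNIV ?E"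
      by (simp_all add: borel_eq_box sM sN)
    let ?A = "\<lambda>n::nat. box (- (real n *\<^sub>R One)) (real n *\<^sub>R One) :: 'a set"
    show "range ?A \<subseteq> ?E" "(\<Union>i. ?A i) = UNIV"
      unfolding UN_box_eq_UNIV by auto
    show "emeasure M (?A i) \<noteq> \<infinity>" for i by auto
    fix X assume "X \<in> ?E"
    then obtain a b where X: "X = box a b" by auto
    \<comment> \<open>Continuous functions supported in the box that increase to its indicator: a
      point of the open box has positive distance to the complement, so the value there is
      eventually 1.\<close>
    let ?\<phi> = "\<lambda>n x. min 1 (real n * infdist x (- X))"
    have ne: "- X \<noteq> {}"
      using bounded_box[of a b] X not_bounded_UNIV by (metis Compl_eq_Diff_UNIV Diff_eq_empty_iff top.extremum_uniqueI)
    have cl: "closed (- X)" using X by (simp add: open_box closed_Compl)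
    have c: "continuous_on UNIV (?\<phi> n)" for n
      by (intro continuous_intros)
    have [measurable]: "?\<phi> n \<in> borel_measurable borel" for n
      using c by (rule borel_measurable_continuous_onI)
    have bd: "\<bar>?\<phi> n x\<bar> \<le> 1" for n x by (auto simp: infdist_nonneg)
    have z: "?\<phi> n x = 0" if "x \<notin> X" for n x using that by simp
    have [measurable]: "X \<in> sets borel" using X by simp
    have i: "integrable lborel (?\<phi> n)" for n
    proof (rule Bochner_Integration.integrable_bound[of lborel "indicator X :: 'a \<Rightarrow> real"])
      show "integrable lborel (indicator X :: 'a \<Rightarrow> real)"
        using X emeasure_bounded_finite[OF bounded_box[of a b]] by (intro integrable_real_indicator) auto
      show "AE x in lborel. norm (?\<phi> n x) \<le> norm (indicator X x :: real)"
        using z bd by (intro AE_I2) (auto simp: indicator_def)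
    qed auto
    have l: "(\<lambda>n. \<integral>x. ?\<phi> n x \<partial>P) \<longlonglongrightarrow> measure P X"
      if P: "finite_measure P" and sP[measurable_cong]: "sets P = sets borel" for P :: "'a measure"
    proof -
      interpret P: finite_measure P by fact
      have "(\<lambda>n. \<integral>x. ?\<phi> n x \<partial>P) \<longlonglongrightarrow> (\<integral>x. indicator X x \<partial>P)"
      proof (rule integral_dominated_convergence[where w="\<lambda>_. 1"])
        show "AE x in P. (\<lambda>n. ?\<phi> n x) \<longlonglongrightarrow> indicator X x"
        proof (rule AE_I2)
          fix x show "(\<lambda>n. ?\<phi> n x) \<longlonglongrightarrow> indicator X x"
          proof (cases "x \<in> X")
            case True
            then have d: "infdist x (- X) > 0"
              using infdist_pos_not_in_closed[OF cl ne] by auto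
            obtain m where m: "real m * infdist x (- X) > 1"
              using reals_Archimedean3[OF d] by blast
            have "?\<phi> n x = 1" if "n \<ge> m" for n
            proof -
              have "real m * infdist x (- X) \<le> real n * infdist x (- X)"
                using that d by (intro mult_right_mono) auto
              then show ?thesis using m by simp
            qed
            then have "\<forall>\<^sub>F n in sequentially. ?\<phi> n x = 1"
              using eventually_sequentially by blast
            then show ?thesis using True by (simp add: tendsto_eventually)
          qed (use z in simp)
        qed
      qed (use bd sP in auto)
      moreover have "(\<integral>x. indicator X x \<partial>P) = measure P X"
        using sP sets_eq_imp_space_eq[OF sP] by simp
      ultimately show ?thesis by simp
    qed
    have "measure M X = measure N X"
      using l[OF M sM] l[OF N sN] LIMSEQ_unique test[OF c bd i] by simp
    then show "emeasure M X = emeasure N X"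
      by (simp add: M.emeasure_eq_measure N.emeasure_eq_measure)
  qed
qed

text \<open>By \<open>gauss_cos\<close> the transform of a linear image depends on the map only
  through the norm of its adjoint, that is, through the covariance. The two source spaces may
  differ, so a single noise vector can be replaced by an independent pair.\<close>

lemma gauss_linear_law:
  fixes S :: "'c::euclidean_space \<Rightarrow> 'a::euclidean_space" and T :: "'d::euclidean_space \<Rightarrow> 'a"
  assumes S: "linear S" and T: "linear T"
    and eq: "\<And>\<xi>. norm (adjoint S \<xi>) = norm (adjoint T \<xi>)"
  shows "distr gauss borel S = distr gauss borel T"
proof (rule measure_eqI_cos)
  have [measurable]: "S \<in> borel_measurable borel" "T \<in> borel_measurable borel"
    using S T by (auto intro!: borel_measurable_continuous_onI linear_continuous_on simp: linear_conv_bounded_linear)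
  show "finite_measure (distr gauss borel S)" "finite_measure (distr gauss borel T)"
    by (auto intro!: prob_space.finite_measure gauss.prob_space_distr)
  fix \<xi> p
  have "(\<integral>x. cos (\<xi> \<bullet> S x + p) \<partial>gauss) = (\<integral>x. cos (adjoint S \<xi> \<bullet> x + p) \<partial>gauss)"
    using adjoint_works[OF S] by (simp add: inner_commute)
  moreover have "(\<integral>x. cos (\<xi> \<bullet> T x + p) \<partial>gauss) = (\<integral>x. cos (adjoint T \<xi> \<bullet> x + p) \<partial>gauss)"
    using adjoint_works[OF T] by (simp add: inner_commute)
  ultimately show "(\<integral>x. cos (\<xi> \<bullet> x + p) \<partial>distr gauss borel S) = (\<integral>x. cos (\<xi> \<bullet> x + p) \<partial>distr gauss borel T)"
    by (simp add: integral_distr gauss_cos eq)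
qed auto

lemma gauss_pair: "(gauss \<Otimes>\<^sub>M gauss) = (gauss :: ('a::euclidean_space \<times> 'b::euclidean_space) measure)"
proof -
  have d: "gauss_density x * gauss_density y = gauss_density (x, y)" for x :: 'a and y :: 'b
  proof -
    have "(2 * pi) powr (- real DIM('a) / 2) * (2 * pi) powr (- real DIM('b) / 2) = (2 * pi) powr (- real DIM('a \<times> 'b) / 2)"
      by (subst powr_add[symmetric]) (simp add: field_simps)
    moreover have "exp (- (x \<bullet> x) / 2) * exp (- (y \<bullet> y) / 2) = exp (- ((x, y) \<bullet> (x, y)) / 2)"
      by (subst exp_add[symmetric]) (simp add: field_simps)
    ultimately show ?thesis
      unfolding gauss_density_def by (subst mult.assoc, subst mult.left_commute, subst mult.assoc[symmetric]) (simp only: mult.assoc[symmetric])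
  qed
  have sf: "sigma_finite_measure (density lborel (\<lambda>x. ennreal (gauss_density (x::'b))))"
    using prob_space_imp_sigma_finite[OF prob_space_gauss] unfolding gauss_def .
  have "density lborel (\<lambda>x. ennreal (gauss_density (x::'a))) \<Otimes>\<^sub>M density lborel (\<lambda>y. ennreal (gauss_density (y::'b)))
     = density (lborel \<Otimes>\<^sub>M lborel) (\<lambda>(x, y). ennreal (gauss_density x) * ennreal (gauss_density y))"
    by (rule pair_measure_density) (auto intro: sf lborel.sigma_finite_measure_axioms)
  also have "\<dots> = density lborel (\<lambda>z. ennreal (gauss_density z))"
  proof -
    have "(\<lambda>(x, y). ennreal (gauss_density x) * ennreal (gauss_density y)) = (\<lambda>z::'a \<times> 'b. ennreal (gauss_density z))"
      by (auto simp: fun_eq_iff ennreal_mult[symmetric] less_imp_le[OF gauss_density_pos] d)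
    then show ?thesis by (simp only: lborel_prod)
  qed
  finally show ?thesis by (simp add: gauss_def)
qed

lemma gauss_linear_law':
  fixes S :: "'c::euclidean_space \<Rightarrow> 'a::euclidean_space" and T :: "'d::euclidean_space \<Rightarrow> 'a"
  assumes "linear S" "linear T"
    and "\<And>x y. S x \<bullet> y = x \<bullet> S' y" "\<And>x y. T x \<bullet> y = x \<bullet> T' y"
    and "\<And>\<xi>. norm (S' \<xi>) = norm (T' \<xi>)"
  shows "distr gauss borel S = distr gauss borel T"
proof -
  have "adjoint S = S'" "adjoint T = T'"
    using assms by (auto intro!: adjoint_unique)
  then show ?thesis
    using assms by (intro gauss_linear_law) auto
qed

lemma gauss_pair_integral:
  fixes f :: "'a::euclidean_space \<times> 'b::euclidean_space \<Rightarrow> real"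
  assumes "integrable gauss f"
  shows "(\<integral>z. f z \<partial>gauss) = (\<integral>x. (\<integral>y. f (x, y) \<partial>gauss) \<partial>gauss)"
    and "integrable gauss (\<lambda>x. \<integral>y. f (x, y) \<partial>gauss)"
proof -
  interpret pair_sigma_finite "gauss :: 'a measure" "gauss :: 'b measure" ..
  show "(\<integral>z. f z \<partial>gauss) = (\<integral>x. (\<integral>y. f (x, y) \<partial>gauss) \<partial>gauss)"
    "integrable gauss (\<lambda>x. \<integral>y. f (x, y) \<partial>gauss)"
    using integral_fst'[of f] integrable_fst'[of f] assms unfolding gauss_pair by auto
qed

section \<open>The convex Sobolev inequality for the standard Gaussian\<close>

text \<open>With \<open>c = cos \<theta>\<close> and \<open>s = sin \<theta>\<close> this rotates
  two independent copies of the space into each other. The second component is then the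
  \<theta>-derivative of the first, which is what turns rotation invariance into integration by
  parts.\<close>

definition rot :: "real \<Rightarrow> real \<Rightarrow> 'a::euclidean_space \<times> 'a \<Rightarrow> 'a \<times> 'a" where
  "rot c s z = (c *\<^sub>R fst z + s *\<^sub>R snd z, c *\<^sub>R snd z - s *\<^sub>R fst z)"

lemma rot_measurable[measurable]: "rot c s \<in> borel_measurable borel"
  unfolding rot_def[abs_def] by (intro borel_measurable_continuous_onI continuous_intros)

lemma fst_borel_measurable[measurable]: "fst \<in> borel_measurable (borel :: ('a::euclidean_space \<times> 'b::euclidean_space) measure)"
  and snd_borel_measurable[measurable]: "snd \<in> borel_measurable (borel :: ('a::euclidean_space \<times> 'b::euclidean_space) measure)"
  by (auto intro!: borel_measurable_continuous_onI continuous_intros)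

lemma fst_rot_measurable[measurable]: "(\<lambda>z. fst (rot c s z)) \<in> borel_measurable borel"
  and snd_rot_measurable[measurable]: "(\<lambda>z. snd (rot c s z)) \<in> borel_measurable borel"
  unfolding rot_def by (auto intro!: borel_measurable_continuous_onI continuous_intros)

lemma gauss_rot:
  assumes cs: "c\<^sup>2 + s\<^sup>2 = 1"
  shows "distr gauss borel (rot c s) = (gauss :: ('a::euclidean_space \<times> 'a) measure)"
proof -
  have "distr gauss borel (rot c s) = distr (gauss :: ('a \<times> 'a) measure) borel (\<lambda>x. x)"
  proof (rule gauss_linear_law'[where T'="\<lambda>x. x" and S'="rot c (- s)"])
    show "linear (rot c s)"
      by (rule linearI) (auto simp: rot_def algebra_simps)
    show "rot c s x \<bullet> y = x \<bullet> rot c (- s) y" for x y :: "'a \<times> 'a"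
      by (cases x, cases y) (simp add: rot_def inner_add_left inner_add_right inner_diff_left algebra_simps)
    show "norm (rot c (- s) \<xi>) = norm \<xi>" for \<xi> :: "'a \<times> 'a"
    proof -
      obtain x y where xy: "\<xi> = (x, y)" by (cases \<xi>)
      have "(norm (rot c (- s) \<xi>))\<^sup>2 = (c\<^sup>2 + s\<^sup>2) * ((norm x)\<^sup>2 + (norm y)\<^sup>2)"
        unfolding power2_norm_eq_inner
        by (simp add: xy rot_def inner_add_left inner_add_right inner_diff_left inner_diff_right
            algebra_simps power2_eq_square inner_commute)
      also have "\<dots> = (norm \<xi>)\<^sup>2"
        by (simp add: cs xy norm_Pair)
      finally show ?thesis by simp
    qed
  qed (auto simp: linear_id[unfolded id_def])
  also have "\<dots> = gauss"
    by (rule distr_id2) simp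
  finally show ?thesis .
qed

lemma gauss_rot_integral:
  fixes f :: "'a::euclidean_space \<times> 'a \<Rightarrow> real"
  assumes cs: "c\<^sup>2 + s\<^sup>2 = 1" and [measurable]: "f \<in> borel_measurable borel"
  shows "(\<integral>z. f (rot c s z) \<partial>gauss) = (\<integral>z. f z \<partial>gauss)"
    and "integrable gauss (\<lambda>z. f (rot c s z)) \<longleftrightarrow> integrable gauss f"
proof -
  have "(\<integral>z. f (rot c s z) \<partial>gauss) = (\<integral>z. f z \<partial>distr gauss borel (rot c s))"
    by (subst integral_distr) auto
  then show "(\<integral>z. f (rot c s z) \<partial>gauss) = (\<integral>z. f z \<partial>gauss)"
    by (simp add: gauss_rot[OF cs])
  have "integrable gauss (\<lambda>z. f (rot c s z)) \<longleftrightarrow> integrable (distr gauss borel (rot c s)) f"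
    by (subst integrable_distr_eq) auto
  then show "integrable gauss (\<lambda>z. f (rot c s z)) \<longleftrightarrow> integrable gauss f"
    by (simp add: gauss_rot[OF cs])
qed

text \<open>A class stable under Gaussian averaging on which the integrals below converge: the
  gradient is bounded, and the values lie in one compact interval, so that \<psi> and its
  derivatives stay bounded along \<open>g\<close> once \<open>a\<close> and \<open>b\<close> belong
  to the domain \<open>I\<close>. \<open>dg\<close> is the gradient, carried as data.\<close>

definition nice :: "real \<Rightarrow> real \<Rightarrow> real \<Rightarrow> ('a::euclidean_space \<Rightarrow> real) \<Rightarrow> ('a \<Rightarrow> 'a) \<Rightarrow> bool" where
  "nice a b L g dg \<longleftrightarrow> (\<forall>x. (g has_derivative (\<lambda>v. dg x \<bullet> v)) (at x)) \<and> continuous_on UNIV dg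
     \<and> (\<forall>x. norm (dg x) \<le> L) \<and> (\<forall>x. g x \<in> {a..b})"

lemma niceD:
  assumes "nice a b L g dg"
  shows "(g has_derivative (\<lambda>v. dg x \<bullet> v)) (at x)" "continuous_on UNIV dg" "norm (dg x) \<le> L" "a \<le> g x" "g x \<le> b"
    "\<bar>g x\<bar> \<le> max \<bar>a\<bar> \<bar>b\<bar>" "continuous_on UNIV g" "g \<in> borel_measurable borel" "dg \<in> borel_measurable borel"
    "0 \<le> L"
proof -
  show 1: "(g has_derivative (\<lambda>v. dg x \<bullet> v)) (at x)" "continuous_on UNIV dg" "norm (dg x) \<le> L" "a \<le> g x" "g x \<le> b" for x
    using assms by (auto simp: nice_def)
  then show "\<bar>g x\<bar> \<le> max \<bar>a\<bar> \<bar>b\<bar>" for x by (smt (verit))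
  show "continuous_on UNIV g"
    using has_derivative_continuous[OF 1(1)] by (auto simp: continuous_on_eq_continuous_at)
  then show "g \<in> borel_measurable borel" by (rule borel_measurable_continuous_onI)
  show "dg \<in> borel_measurable borel" using 1(2) by (rule borel_measurable_continuous_onI)
  show "0 \<le> L" using 1(3)[of 0] norm_ge_zero order_trans by blast
qed

text \<open>Differentiation in \<open>x\<close> acts only through \<open>A\<close>, so the adjoint
  \<open>A'\<close> comes out of the average: the new gradient is \<open>A'\<close> applied to the
  averaged gradient. This commutation serves both the interpolation by rotations, where
  \<open>A\<close> is multiplication by a cosine, and the transport along the equation.\<close>

lemma nice_average:
  fixes g :: "'a::euclidean_space \<Rightarrow> real" and A :: "'b::euclidean_space \<Rightarrow> 'a" and N :: "'c::euclidean_space \<Rightarrow> 'a"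
  assumes g: "nice a b L g dg" and A: "linear A" and N: "linear N"
    and A': "\<And>x y. A x \<bullet> y = x \<bullet> A' y" and bA: "\<And>y. norm (A' y) \<le> C * norm y"
  shows "nice a b (C * L) (\<lambda>x. \<integral>z. g (A x + N z) \<partial>gauss) (\<lambda>x. A' (\<integral>z. dg (A x + N z) \<partial>gauss))"
    and "\<And>x. integrable gauss (\<lambda>z. g (A x + N z))" and "\<And>x. integrable gauss (\<lambda>z. dg (A x + N z))"
    and "\<And>x. norm (\<integral>z. dg (A x + N z) \<partial>gauss) \<le> L"
    and "continuous_on UNIV (\<lambda>x. \<integral>z. dg (A x + N z) \<partial>gauss)"
proof -
  note [measurable] = niceD(8,9)[OF g]
  have cA: "continuous_on UNIV A" "continuous_on UNIV N"
    using A N by (auto intro!: linear_continuous_on simp: linear_conv_bounded_linear)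
  have [measurable]: "A \<in> borel_measurable borel" "N \<in> borel_measurable borel"
    using cA by (auto intro: borel_measurable_continuous_onI)
  have adj: "adjoint A = A'" using A' by (intro adjoint_unique allI)
  have linA': "linear A'" using adjoint_linear[OF A] by (simp add: adj)
  then have blA': "bounded_linear A'" by (simp add: linear_conv_bounded_linear)
  have [measurable]: "A' \<in> borel_measurable borel"
    using blA' by (intro borel_measurable_continuous_onI linear_continuous_on)
  have C0: "0 \<le> C"
  proof -
    obtain y :: 'a where y: "norm y = 1" using vector_choose_size zero_le_one by blast
    with bA[of y] norm_ge_zero[of "A' y"] show ?thesis by (simp del: norm_ge_zero)
  qed
  show ig: "integrable gauss (\<lambda>z. g (A x + N z))" for x
    by (rule gauss.integrable_const_bound[of _ "max \<bar>a\<bar> \<bar>b\<bar>"]) (use niceD(6)[OF g] in auto)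
  show id: "integrable gauss (\<lambda>z. dg (A x + N z))" for x
    by (rule gauss.integrable_const_bound[of _ L]) (use niceD(3)[OF g] in auto)
  show nb: "norm (\<integral>z. dg (A x + N z) \<partial>gauss) \<le> L" for x
  proof -
    have "norm (\<integral>z. dg (A x + N z) \<partial>gauss) \<le> (\<integral>z. norm (dg (A x + N z)) \<partial>gauss)"
      by (rule integral_norm_bound)
    also have "\<dots> \<le> (\<integral>z. L \<partial>(gauss :: 'c measure))"
      using id[of x] niceD(3)[OF g] by (intro integral_mono integrable_norm) auto
    finally show ?thesis by simp
  qed
  show cd: "continuous_on UNIV (\<lambda>x. \<integral>z. dg (A x + N z) \<partial>gauss)"
    unfolding continuous_on_sequentially comp_def
  proof (intro allI ballI impI)
    fix X :: "nat \<Rightarrow> 'b" and x assume "(\<forall>n. X n \<in> UNIV) \<and> X \<longlonglongrightarrow> x"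
    then have X: "X \<longlonglongrightarrow> x" by simp
    show "(\<lambda>n. \<integral>z. dg (A (X n) + N z) \<partial>gauss) \<longlonglongrightarrow> (\<integral>z. dg (A x + N z) \<partial>gauss)"
    proof (rule integral_dominated_convergence[where w="\<lambda>_. L"])
      show "AE z in gauss. (\<lambda>n. dg (A (X n) + N z)) \<longlonglongrightarrow> dg (A x + N z)"
      proof (rule AE_I2)
        fix z
        have "(\<lambda>n. A (X n)) \<longlonglongrightarrow> A x"
          using cA(1) X by (intro isCont_tendsto_compose[of x A]) (auto simp: continuous_on_eq_continuous_at)
        then show "(\<lambda>n. dg (A (X n) + N z)) \<longlonglongrightarrow> dg (A x + N z)"
          using niceD(2)[OF g]
          by (intro isCont_tendsto_compose[of _ dg] tendsto_intros) (auto simp: continuous_on_eq_continuous_at)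
      qed
    qed (use niceD(3)[OF g] in auto)
  qed
  show "nice a b (C * L) (\<lambda>x. \<integral>z. g (A x + N z) \<partial>gauss) (\<lambda>x. A' (\<integral>z. dg (A x + N z) \<partial>gauss))"
    unfolding nice_def
  proof (intro conjI allI)
    fix x
    have "((\<lambda>x. \<integral>z. g (A x + N z) \<partial>gauss) has_derivative (\<lambda>v. (\<integral>z. A' (dg (A x + N z)) \<partial>gauss) \<bullet> v)) (at x)"
    proof (rule has_derivative_integral_dominated(1)[where r=1 and D="\<lambda>x z. A' (dg (A x + N z))" and B="\<lambda>_. C * L"])
      show "((\<lambda>y. g (A y + N z)) has_derivative (\<lambda>v. A' (dg (A y + N z)) \<bullet> v)) (at y)" for y z
      proof -
        have "((\<lambda>y. A y + N z) has_derivative (\<lambda>v. A v + 0)) (at y)"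
          using A by (intro has_derivative_add has_derivative_const has_derivative_linear)
            (simp add: linear_conv_bounded_linear bounded_linear_imp_has_derivative)
        from has_derivative_compose[OF this niceD(1)[OF g]]
        have "((\<lambda>y. g (A y + N z)) has_derivative (\<lambda>v. dg (A y + N z) \<bullet> A v)) (at y)" by simp
        then show ?thesis using A' by (simp add: inner_commute)
      qed
      show "norm (A' (dg (A y + N z))) \<le> C * L" for y z
        by (rule order_trans[OF bA]) (intro mult_left_mono niceD(3)[OF g] C0)
    qed (use ig in auto)
    then show "((\<lambda>x. \<integral>z. g (A x + N z) \<partial>gauss) has_derivative (\<lambda>v. A' (\<integral>z. dg (A x + N z) \<partial>gauss) \<bullet> v)) (at x)"
      by (simp add: integral_bounded_linear[OF blA' id])
    show "norm (A' (\<integral>z. dg (A x + N z) \<partial>gauss)) \<le> C * L"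
      by (rule order_trans[OF bA]) (intro mult_left_mono nb C0)
    have "(\<integral>z. a \<partial>(gauss :: 'c measure)) \<le> (\<integral>z. g (A x + N z) \<partial>gauss)"
      using niceD(4)[OF g] by (intro integral_mono ig) auto
    moreover have "(\<integral>z. g (A x + N z) \<partial>gauss) \<le> (\<integral>z. b \<partial>(gauss :: 'c measure))"
      using niceD(5)[OF g] by (intro integral_mono ig) auto
    ultimately show "(\<integral>z. g (A x + N z) \<partial>gauss) \<in> {a..b}"
      by simp
  next
    show "continuous_on UNIV (\<lambda>x. A' (\<integral>z. dg (A x + N z) \<partial>gauss))"
      using bounded_linear.continuous_on[OF blA' cd] .
  qed
qed

text \<open>Rotation invariance makes the integral of \<Phi> at the first component, times
  \<open>c\<close> paired with the second component, independent of the angle. Its derivative at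
  angle 0 therefore vanishes; the integrand of that derivative is \<open>(d\<Phi> u \<bullet> v) *
  (c \<bullet> v) - \<Phi> u * (c \<bullet> u)\<close>, and averaging over \<open>v\<close> gives
  the claim.\<close>

lemma gauss_integration_by_parts:
  fixes \<Phi> :: "'a::euclidean_space \<Rightarrow> real"
  assumes nice: "nice a b L \<Phi> d\<Phi>"
  shows "(\<integral>v. \<Phi> v * (c \<bullet> v) \<partial>gauss) = (\<integral>v. d\<Phi> v \<bullet> c \<partial>gauss)"
proof -
  note [measurable] = niceD(8,9)[OF nice]
  define K where "K = max \<bar>a\<bar> \<bar>b\<bar>"
  have K: "\<bar>\<Phi> x\<bar> \<le> K" for x using niceD(6)[OF nice] by (simp add: K_def)
  have K0: "0 \<le> K" by (simp add: K_def)
  note L = niceD(3,10)[OF nice]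
  define F where "F \<theta> z = \<Phi> (fst (rot (cos \<theta>) (sin \<theta>) z)) * (c \<bullet> snd (rot (cos \<theta>) (sin \<theta>) z))" for \<theta> and z :: "'a \<times> 'a"
  define D where "D \<theta> z = (d\<Phi> (fst (rot (cos \<theta>) (sin \<theta>) z)) \<bullet> snd (rot (cos \<theta>) (sin \<theta>) z)) * (c \<bullet> snd (rot (cos \<theta>) (sin \<theta>) z))
      - \<Phi> (fst (rot (cos \<theta>) (sin \<theta>) z)) * (c \<bullet> fst (rot (cos \<theta>) (sin \<theta>) z))" for \<theta> and z :: "'a \<times> 'a"
  have nr: "norm (fst (rot (cos \<theta>) (sin \<theta>) z)) \<le> 2 * norm z" "norm (snd (rot (cos \<theta>) (sin \<theta>) z)) \<le> 2 * norm z" for \<theta> and z :: "'a \<times> 'a"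
  proof -
    have b: "norm (cos \<theta> *\<^sub>R x) \<le> norm x" "norm (sin \<theta> *\<^sub>R x) \<le> norm x" for x :: 'a
      by (auto simp: mult_left_le_one_le)
    show "norm (fst (rot (cos \<theta>) (sin \<theta>) z)) \<le> 2 * norm z"
      using norm_triangle_ineq[of "cos \<theta> *\<^sub>R fst z" "sin \<theta> *\<^sub>R snd z"] b(1)[of "fst z"] b(2)[of "snd z"] norm_fst_le[of "fst z" "snd z"] norm_snd_le[of "snd z" "fst z"]
      by (simp add: rot_def)
    show "norm (snd (rot (cos \<theta>) (sin \<theta>) z)) \<le> 2 * norm z"
      using norm_triangle_ineq4[of "cos \<theta> *\<^sub>R snd z" "sin \<theta> *\<^sub>R fst z"] b(1)[of "snd z"] b(2)[of "fst z"] norm_fst_le[of "fst z" "snd z"] norm_snd_le[of "snd z" "fst z"]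
      by (simp add: rot_def)
  qed
  have Fm[measurable]: "F \<theta> \<in> borel_measurable borel" for \<theta>
    unfolding F_def[abs_def] by measurable
  have Dm[measurable]: "D \<theta> \<in> borel_measurable borel" for \<theta>
    unfolding D_def[abs_def] by measurable
  let ?G = "\<lambda>z. \<Phi> (fst z) * (c \<bullet> snd z)"
  have Gi: "integrable gauss ?G"
    by (rule Bochner_Integration.integrable_bound[OF integrable_mult_right[OF gauss_norm_integrable, of "K * norm c"]])
       (auto simp: abs_mult K0 mult.assoc intro!: mult_mono K order_trans[OF Cauchy_Schwarz_ineq2] mult_left_mono norm_snd_le)
  have const: "(\<integral>z. F \<theta> z \<partial>gauss) = (\<integral>z. ?G z \<partial>gauss)" for \<theta>
    using gauss_rot_integral(1)[of "cos \<theta>" "sin \<theta>" ?G] by (simp add: F_def)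
  have F0i: "integrable gauss (F 0)"
    using Gi by (simp add: F_def[abs_def] rot_def)
  let ?B = "\<lambda>z::'a \<times> 'a. 4 * L * norm c * (norm z)\<^sup>2 + 2 * K * norm c * norm z"
  have Dd: "((\<lambda>\<theta>. F \<theta> z) has_derivative (\<lambda>v. D \<theta> z \<bullet> v)) (at \<theta>)" for \<theta> z
  proof -
    have r: "((\<lambda>\<theta>. fst (rot (cos \<theta>) (sin \<theta>) z)) has_derivative (\<lambda>v. v *\<^sub>R snd (rot (cos \<theta>) (sin \<theta>) z))) (at \<theta>)"
      unfolding rot_def by (auto intro!: derivative_eq_intros simp: algebra_simps)
    have r2: "((\<lambda>\<theta>. snd (rot (cos \<theta>) (sin \<theta>) z)) has_derivative (\<lambda>v. - v *\<^sub>R fst (rot (cos \<theta>) (sin \<theta>) z))) (at \<theta>)"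
      unfolding rot_def by (auto intro!: derivative_eq_intros simp: algebra_simps)
    show ?thesis
      unfolding F_def D_def
      by (rule has_derivative_eq_rhs[OF has_derivative_mult[OF has_derivative_compose[OF r niceD(1)[OF nice]] has_derivative_inner_right[OF r2]]])
         (auto simp: algebra_simps)
  qed
  have Db: "norm (D \<theta> z) \<le> ?B z" for \<theta> z
  proof -
    have 1: "\<bar>(d\<Phi> (fst (rot (cos \<theta>) (sin \<theta>) z)) \<bullet> snd (rot (cos \<theta>) (sin \<theta>) z)) * (c \<bullet> snd (rot (cos \<theta>) (sin \<theta>) z))\<bar>
       \<le> (L * (2 * norm z)) * (norm c * (2 * norm z))"
      unfolding abs_mult
      by (intro mult_mono order_trans[OF Cauchy_Schwarz_ineq2] L nr mult_nonneg_nonneg) auto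
    have 2: "\<bar>\<Phi> (fst (rot (cos \<theta>) (sin \<theta>) z)) * (c \<bullet> fst (rot (cos \<theta>) (sin \<theta>) z))\<bar> \<le> K * (norm c * (2 * norm z))"
      unfolding abs_mult
      by (intro mult_mono order_trans[OF Cauchy_Schwarz_ineq2] K nr mult_nonneg_nonneg K0) auto
    show ?thesis
      unfolding D_def real_norm_def using 1 2 abs_triangle_ineq4 by (fastforce simp: power2_eq_square algebra_simps)
  qed
  have Bi: "integrable gauss ?B"
    by (intro Bochner_Integration.integrable_add integrable_mult_right gauss_norm_integrable gauss_norm_sq_integrable)
  have "((\<lambda>\<theta>. \<integral>z. F \<theta> z \<partial>gauss) has_derivative (\<lambda>v. (\<integral>z. D 0 z \<partial>gauss) \<bullet> v)) (at 0)"
    by (rule has_derivative_integral_dominated(1)[where r=1 and B="?B"]) (use F0i Dd Db Bi in auto)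
  moreover have "((\<lambda>\<theta>::real. \<integral>z. F \<theta> z \<partial>gauss) has_derivative (\<lambda>v. 0)) (at 0)"
    by (simp add: const)
  ultimately have "(\<lambda>v. (\<integral>z. D 0 z \<partial>gauss) \<bullet> v) = (\<lambda>v::real. 0)"
    by (rule has_derivative_unique)
  from fun_cong[OF this, of 1] have D0: "(\<integral>z. D 0 z \<partial>gauss) = 0" by simp
  have D0e: "D 0 (u, v) = (d\<Phi> u \<bullet> v) * (c \<bullet> v) - \<Phi> u * (c \<bullet> u)" for u v
    by (simp add: D_def rot_def)
  have D0i: "integrable gauss (D 0)"
  proof (rule Bochner_Integration.integrable_bound[OF Bi _ AE_I2])
    show "norm (D 0 z) \<le> norm (?B z)" for z
      using Db[of 0 z] by (simp del: split_paired_All)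
  qed simp
  have "0 = (\<integral>u. (\<integral>v. D 0 (u, v) \<partial>gauss) \<partial>gauss)"
    using gauss_pair_integral(1)[OF D0i] D0 by simp
  also have "\<dots> = (\<integral>u. d\<Phi> u \<bullet> c - \<Phi> u * (c \<bullet> u) \<partial>gauss)"
    by (simp add: D0e gauss_second_moment)
  also have "\<dots> = (\<integral>u. d\<Phi> u \<bullet> c \<partial>gauss) - (\<integral>u. \<Phi> u * (c \<bullet> u) \<partial>gauss)"
  proof (rule Bochner_Integration.integral_diff)
    show "integrable gauss (\<lambda>u. d\<Phi> u \<bullet> c)"
      by (rule gauss.integrable_const_bound[of _ "L * norm c"])
         (auto intro!: AE_I2 order_trans[OF Cauchy_Schwarz_ineq2] mult_right_mono L)
    show "integrable gauss (\<lambda>u. \<Phi> u * (c \<bullet> u))"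
      by (rule Bochner_Integration.integrable_bound[OF integrable_mult_right[OF gauss_norm_integrable, of "K * norm c"]])
         (auto simp: abs_mult K0 mult.assoc intro!: mult_mono K order_trans[OF Cauchy_Schwarz_ineq2])
  qed
  finally show ?thesis by simp
qed

lemma nice_compose:
  fixes f :: "real \<Rightarrow> real"
  assumes "nice a b L g dg" and f: "continuous_on {a..b} f"
  shows "(\<lambda>x. f (g x)) \<in> borel_measurable borel"
    and "\<exists>B\<ge>0. \<forall>x. \<bar>f (g x)\<bar> \<le> B"
proof -
  have ab: "a \<le> b" using niceD(4,5)[OF assms(1)] order_trans by blast
  have eq: "f (g x) = (f \<circ> g) x" for x by simp
  have "continuous_on UNIV (f \<circ> g)"
    by (rule continuous_on_compose[OF niceD(7)[OF assms(1)] continuous_on_subset[OF f]])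
       (use niceD(4,5)[OF assms(1)] in auto)
  then show "(\<lambda>x. f (g x)) \<in> borel_measurable borel"
    by (auto simp: comp_def intro: borel_measurable_continuous_onI)
  have "compact (f ` {a..b})" using f by (rule compact_continuous_image) simp
  then obtain B where B: "\<And>y. y \<in> f ` {a..b} \<Longrightarrow> norm y \<le> B"
    using compact_imp_bounded bounded_iff by metis
  have "\<bar>f (g x)\<bar> \<le> \<bar>B\<bar>" for x
    using B[of "f (g x)"] niceD(4,5)[OF assms(1)] by force
  then show "\<exists>B\<ge>0. \<forall>x. \<bar>f (g x)\<bar> \<le> B" by (intro exI[of _ "\<bar>B\<bar>"]) auto
qed

text \<open>\<open>h\<close> stands for \<psi>'' and \<open>h1\<close> for its derivative. Concavity
  of \<open>1 / h\<close> enters as the tangent line inequality \<open>tangent\<close>, which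
  mentions no further derivative. The two choices of \<open>I\<close> cover nonnegative densities
  and the quadratic generator with signed data; in the first case the value 0 is reached only
  through continuity on the closure.\<close>

locale phi_entropy =
  fixes I :: "real set" and \<psi> \<psi>1 h h1 :: "real \<Rightarrow> real"
  assumes I: "I = {0<..} \<or> I = UNIV"
    and d0: "\<And>s. s \<in> I \<Longrightarrow> (\<psi> has_real_derivative \<psi>1 s) (at s)"
    and d1: "\<And>s. s \<in> I \<Longrightarrow> (\<psi>1 has_real_derivative h s) (at s)"
    and d2: "\<And>s. s \<in> I \<Longrightarrow> (h has_real_derivative h1 s) (at s)"
    and hpos: "\<And>s. s \<in> I \<Longrightarrow> 0 < h s"
    and tangent: "\<And>s m. s \<in> I \<Longrightarrow> m \<in> I \<Longrightarrow> 1 / h s \<le> 1 / h m - h1 m / (h m)\<^sup>2 * (s - m)"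
    and psi_cont: "continuous_on (closure I) \<psi>"
    and psi_1: "\<psi> 1 = 0" and psi1_1: "\<psi>1 1 = 0"
begin

lemma Icc: "a \<in> I \<Longrightarrow> b \<in> I \<Longrightarrow> {a..b} \<subseteq> I"
  using I by auto

lemma Icc_cont:
  assumes "a \<in> I" "b \<in> I"
  shows "continuous_on {a..b} \<psi>" "continuous_on {a..b} \<psi>1" "continuous_on {a..b} h"
  using Icc[OF assms]
  by (intro continuous_at_imp_continuous_on ballI, metis DERIV_isCont d0 d1 d2 subsetD)+

text \<open>Completing the square bounds the right side below by an expression containing
  \<open>1 / h s\<close>, which \<open>tangent\<close> replaces by an affine function of
  \<open>s\<close>. The result is affine in \<open>(s, w)\<close> and is an equality at
  \<open>s = m\<close>, \<open>w = u\<close>: a supporting hyperplane of the convex function in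
  question.\<close>

lemma perspective_lower_bound:
  fixes w u :: "'v::real_inner"
  assumes "s \<in> I" "m \<in> I"
  shows "2 * h m * (w \<bullet> u) - (norm u)\<^sup>2 * (h m - h1 m * (s - m)) \<le> h s * (norm w)\<^sup>2"
proof -
  note hp = hpos[OF assms(1)] hpos[OF assms(2)]
  have "0 \<le> h s * (norm (w - (h m / h s) *\<^sub>R u))\<^sup>2"
    using hp by simp
  also have "\<dots> = h s * (norm w)\<^sup>2 - 2 * h m * (w \<bullet> u) + (h m)\<^sup>2 * (1 / h s) * (norm u)\<^sup>2"
    using hp unfolding power2_norm_eq_inner
    by (simp add: inner_diff_left inner_diff_right inner_commute power2_eq_square field_simps)
  also have "(h m)\<^sup>2 * (1 / h s) * (norm u)\<^sup>2 \<le> (h m)\<^sup>2 * (1 / h m - h1 m / (h m)\<^sup>2 * (s - m)) * (norm u)\<^sup>2"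
    by (intro mult_right_mono mult_left_mono tangent assms) auto
  also have "(h m)\<^sup>2 * (1 / h m - h1 m / (h m)\<^sup>2 * (s - m)) = h m - h1 m * (s - m)"
    using hp by (simp add: field_simps power2_eq_square)
  finally show ?thesis by (simp add: algebra_simps)
qed

text \<open>Joint convexity of \<open>(s, v) \<mapsto> \<psi>''(s) |v|\<^sup>2\<close>, equivalent to concavity of \<open>1 / \<psi>''\<close>.\<close>

lemma perspective_jensen:
  fixes v :: "'z \<Rightarrow> 'v::euclidean_space"
  assumes M: "prob_space M" and ab: "a \<in> I" "b \<in> I"
    and g: "integrable M g" "\<And>x. x \<in> space M \<Longrightarrow> g x \<in> {a..b}"
    and v: "integrable M v" and hv: "integrable M (\<lambda>x. h (g x) * (norm (v x))\<^sup>2)"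
  shows "h (\<integral>x. g x \<partial>M) * (norm (\<integral>x. v x \<partial>M))\<^sup>2 \<le> (\<integral>x. h (g x) * (norm (v x))\<^sup>2 \<partial>M)"
proof -
  interpret prob_space M by fact
  define m where "m = (\<integral>x. g x \<partial>M)"
  define u where "u = (\<integral>x. v x \<partial>M)"
  have "a \<le> m" unfolding m_def using g by (intro integral_ge_const) (auto intro!: AE_I2)
  moreover have "m \<le> b" unfolding m_def using g by (intro integral_le_const) (auto intro!: AE_I2)
  ultimately have m: "m \<in> I" using Icc[OF ab] by auto
  \<comment> \<open>The supporting affine function at the means integrates to its value there,
    because \<open>g x - m\<close> and \<open>v x - u\<close> have mean zero.\<close>
  have "h m * (norm u)\<^sup>2 = (\<integral>x. 2 * h m * (v x \<bullet> u) - (norm u)\<^sup>2 * (h m - h1 m * (g x - m)) \<partial>M)"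
  proof -
    have "(\<integral>x. v x \<bullet> u \<partial>M) = (norm u)\<^sup>2"
      using v by (simp add: u_def power2_norm_eq_inner)
    moreover have "(\<integral>x. h m - h1 m * (g x - m) \<partial>M) = h m"
      using g by (simp add: prob_space m_def)
    ultimately show ?thesis using v g by (simp add: prob_space)
  qed
  also have "\<dots> \<le> (\<integral>x. h (g x) * (norm (v x))\<^sup>2 \<partial>M)"
    using v g hv m Icc[OF ab] by (intro integral_mono perspective_lower_bound) auto
  finally show ?thesis by (simp add: m_def u_def)
qed

text \<open>Interpolating along \<open>g\<^sub>\<theta>(x) = \<int> g(x cos \<theta> + y sin \<theta>) \<gamma>(dy)\<close> between \<open>g\<close> and its mean,
  Gaussian integration by parts turns the derivative of the entropy into a Fisher information,
  which joint convexity compares with the one at \<open>\<theta> = 0\<close>.\<close>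

theorem gauss_convex_sobolev:
  fixes g :: "'a::euclidean_space \<Rightarrow> real"
  assumes nice: "nice a b L g dg" and ab: "a \<in> I" "b \<in> I"
  shows "(\<integral>x. \<psi> (g x) \<partial>gauss) - \<psi> (\<integral>x. g x \<partial>gauss) \<le> (\<integral>x. h (g x) * (norm (dg x))\<^sup>2 \<partial>gauss) / 2"
proof -
  note gm[measurable] = niceD(8,9)[OF nice]
  note L0 = niceD(10)[OF nice] and dgL = niceD(3)[OF nice]
  have le: "a \<le> b" using niceD(4,5)[OF nice] order_trans by blast
  note cont = Icc_cont[OF ab]
  \<comment> \<open>\<open>gt \<theta>\<close> is the interpolant,
    \<open>cos \<theta> *\<^sub>R vt \<theta> x\<close> its gradient and
    \<open>pt \<theta> x\<close> its derivative in the angle. At angle 0 it is \<open>g\<close>, at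
    \<open>pi / 2\<close> the constant mean.\<close>
  define gt where "gt \<theta> x = (\<integral>y. g (cos \<theta> *\<^sub>R x + sin \<theta> *\<^sub>R y) \<partial>gauss)" for \<theta> and x :: 'a
  define vt where "vt \<theta> x = (\<integral>y. dg (cos \<theta> *\<^sub>R x + sin \<theta> *\<^sub>R y) \<partial>gauss)" for \<theta> and x :: 'a
  define pt where "pt \<theta> x = (\<integral>y. dg (cos \<theta> *\<^sub>R x + sin \<theta> *\<^sub>R y) \<bullet> (cos \<theta> *\<^sub>R y - sin \<theta> *\<^sub>R x) \<partial>gauss)" for \<theta> and x :: 'a
  have avg: "nice a b (\<bar>cos \<theta>\<bar> * L) (gt \<theta>) (\<lambda>x. cos \<theta> *\<^sub>R vt \<theta> x)"
    "integrable gauss (\<lambda>y. g (cos \<theta> *\<^sub>R x + sin \<theta> *\<^sub>R y))" "integrable gauss (\<lambda>y. dg (cos \<theta> *\<^sub>R x + sin \<theta> *\<^sub>R y))"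
    "norm (vt \<theta> x) \<le> L" "continuous_on UNIV (vt \<theta>)" for \<theta> x
    unfolding gt_def vt_def
    using nice_average[OF nice, of "\<lambda>x. cos \<theta> *\<^sub>R x" "\<lambda>y. sin \<theta> *\<^sub>R y" "\<lambda>x. cos \<theta> *\<^sub>R x" "\<bar>cos \<theta>\<bar>"]
    by (auto intro: linear_scaleR)
  note gtm[measurable] = niceD(8)[OF avg(1)]
  have vtm[measurable]: "vt \<theta> \<in> borel_measurable borel" for \<theta>
    using avg(5) by (rule borel_measurable_continuous_onI)
  have ptm[measurable]: "pt \<theta> \<in> borel_measurable borel" for \<theta>
    unfolding pt_def by measurable
  let ?m1 = "\<integral>y. norm y \<partial>(gauss :: 'a measure)"
  have nle: "norm (cos \<theta> *\<^sub>R y - sin \<theta> *\<^sub>R x) \<le> norm x + norm y" for \<theta> and x y :: 'a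
  proof -
    have "norm (cos \<theta> *\<^sub>R y) \<le> norm y" "norm (sin \<theta> *\<^sub>R x) \<le> norm x"
      by (auto simp: mult_left_le_one_le)
    then show ?thesis using norm_triangle_ineq4[of "cos \<theta> *\<^sub>R y" "sin \<theta> *\<^sub>R x"] by simp
  qed
  have pb: "\<bar>dg (cos \<theta> *\<^sub>R x + sin \<theta> *\<^sub>R y) \<bullet> (cos \<theta> *\<^sub>R y - sin \<theta> *\<^sub>R x)\<bar> \<le> L * (norm x + norm y)" for \<theta> and x y :: 'a
    by (rule order_trans[OF Cauchy_Schwarz_ineq2]) (intro mult_mono dgL nle L0 norm_ge_zero)
  have Bi: "integrable gauss (\<lambda>y::'a. L * (norm x + norm y))" for x :: 'a
    by (intro integrable_mult_right Bochner_Integration.integrable_add gauss_norm_integrable) auto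
  have pti: "integrable gauss (\<lambda>y. dg (cos \<theta> *\<^sub>R x + sin \<theta> *\<^sub>R y) \<bullet> (cos \<theta> *\<^sub>R y - sin \<theta> *\<^sub>R x))" for \<theta> x
    by (rule Bochner_Integration.integrable_bound[OF Bi[of x] _ AE_I2]) (use order_trans[OF pb abs_ge_self] in auto)
  have ptb: "\<bar>pt \<theta> x\<bar> \<le> L * (norm x + ?m1)" for \<theta> x
  proof -
    have "\<bar>pt \<theta> x\<bar> \<le> (\<integral>y. norm (dg (cos \<theta> *\<^sub>R x + sin \<theta> *\<^sub>R y) \<bullet> (cos \<theta> *\<^sub>R y - sin \<theta> *\<^sub>R x)) \<partial>gauss)"
      unfolding pt_def real_norm_def[symmetric] by (rule integral_norm_bound)
    also have "\<dots> \<le> (\<integral>y. L * (norm x + norm y) \<partial>(gauss :: 'a measure))"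
      using integral_mono[OF integrable_norm[OF pti[of \<theta> x]] Bi[of x]] pb by simp
    also have "\<dots> = L * (norm x + ?m1)"
      by (simp add: gauss_norm_integrable)
    finally show ?thesis .
  qed
  have gtd: "((\<lambda>\<theta>. gt \<theta> x) has_derivative (\<lambda>v. pt \<theta> x \<bullet> v)) (at \<theta>)" for \<theta> x
    unfolding gt_def pt_def
  proof (rule has_derivative_integral_dominated(1)[where r=1 and B="\<lambda>y. L * (norm x + norm y)"])
    show "((\<lambda>\<theta>. g (cos \<theta> *\<^sub>R x + sin \<theta> *\<^sub>R y)) has_derivative (\<lambda>v. (dg (cos t *\<^sub>R x + sin t *\<^sub>R y) \<bullet> (cos t *\<^sub>R y - sin t *\<^sub>R x)) \<bullet> v)) (at t)" for t y
    proof -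
      have r: "((\<lambda>\<theta>. cos \<theta> *\<^sub>R x + sin \<theta> *\<^sub>R y) has_derivative (\<lambda>v. v *\<^sub>R (cos t *\<^sub>R y - sin t *\<^sub>R x))) (at t)"
        by (auto intro!: derivative_eq_intros simp: algebra_simps)
      show ?thesis
        by (rule has_derivative_eq_rhs[OF has_derivative_compose[OF r niceD(1)[OF nice]]]) (auto simp: mult.commute)
    qed
  qed (use avg(2) pb Bi in auto)
  obtain C0 where C0: "0 \<le> C0" "\<bar>\<psi> (gt \<theta> x)\<bar> \<le> C0" for \<theta> x
  proof -
    have "compact (\<psi> ` {a..b})" using cont(1) by (rule compact_continuous_image) simp
    then obtain B where B: "\<And>y. y \<in> \<psi> ` {a..b} \<Longrightarrow> norm y \<le> B"
      using compact_imp_bounded bounded_iff by metis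
    have "\<bar>\<psi> (gt \<theta> x)\<bar> \<le> \<bar>B\<bar>" for \<theta> x
      using B[of "\<psi> (gt \<theta> x)"] niceD(4,5)[OF avg(1)] by force
    then show ?thesis using that[of "\<bar>B\<bar>"] by auto
  qed
  obtain C1 where C1: "0 \<le> C1" "\<bar>\<psi>1 (gt \<theta> x)\<bar> \<le> C1" for \<theta> x
  proof -
    have "compact (\<psi>1 ` {a..b})" using cont(2) by (rule compact_continuous_image) simp
    then obtain B where B: "\<And>y. y \<in> \<psi>1 ` {a..b} \<Longrightarrow> norm y \<le> B"
      using compact_imp_bounded bounded_iff by metis
    have "\<bar>\<psi>1 (gt \<theta> x)\<bar> \<le> \<bar>B\<bar>" for \<theta> x
      using B[of "\<psi>1 (gt \<theta> x)"] niceD(4,5)[OF avg(1)] by force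
    then show ?thesis using that[of "\<bar>B\<bar>"] by auto
  qed
  obtain C2 where C2: "0 \<le> C2" "\<bar>h (gt \<theta> x)\<bar> \<le> C2" "\<bar>h (g x)\<bar> \<le> C2" for \<theta> x
  proof -
    have "compact (h ` {a..b})" using cont(3) by (rule compact_continuous_image) simp
    then obtain B where B: "\<And>y. y \<in> h ` {a..b} \<Longrightarrow> norm y \<le> B"
      using compact_imp_bounded bounded_iff by metis
    have "\<bar>h (gt \<theta> x)\<bar> \<le> \<bar>B\<bar>" "\<bar>h (g x)\<bar> \<le> \<bar>B\<bar>" for \<theta> x
      using B[of "h (gt \<theta> x)"] niceD(4,5)[OF avg(1)] B[of "h (g x)"] niceD(4,5)[OF nice] by force+
    then show ?thesis using that[of "\<bar>B\<bar>"] by auto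
  qed
  have pm[measurable]: "(\<lambda>x. \<psi> (gt \<theta> x)) \<in> borel_measurable borel" for \<theta>
    by (rule nice_compose(1)[OF avg(1) cont(1)])
  have p1m[measurable]: "(\<lambda>x. \<psi>1 (gt \<theta> x)) \<in> borel_measurable borel" for \<theta>
    by (rule nice_compose(1)[OF avg(1) cont(2)])
  have hm[measurable]: "(\<lambda>x. h (gt \<theta> x)) \<in> borel_measurable borel" for \<theta>
    by (rule nice_compose(1)[OF avg(1) cont(3)])
  have hgm[measurable]: "(\<lambda>x. h (g x)) \<in> borel_measurable borel"
    by (rule nice_compose(1)[OF nice cont(3)])
  have gtI: "gt \<theta> x \<in> I" for \<theta> x
    using Icc[OF ab] niceD(4,5)[OF avg(1)] by auto
  define F where "F \<theta> = (\<integral>x. \<psi> (gt \<theta> x) \<partial>gauss)" for \<theta>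
  define B where "B = (\<integral>x. h (g x) * (norm (dg x))\<^sup>2 \<partial>gauss)"
  have Fd: "(F has_real_derivative (\<integral>x. \<psi>1 (gt \<theta> x) * pt \<theta> x \<partial>gauss)) (at \<theta>)" for \<theta>
  proof -
    have "(F has_derivative (\<lambda>v. (\<integral>x. \<psi>1 (gt \<theta> x) * pt \<theta> x \<partial>gauss) \<bullet> v)) (at \<theta>)"
      unfolding F_def
    proof (rule has_derivative_integral_dominated(1)[where r=1 and B="\<lambda>x. C1 * (L * (norm x + ?m1))"])
      show "integrable gauss (\<lambda>x. \<psi> (gt \<theta> x))"
        by (rule gauss.integrable_const_bound[of _ C0]) (auto simp: C0)
      show "((\<lambda>\<theta>. \<psi> (gt \<theta> x)) has_derivative (\<lambda>v. (\<psi>1 (gt t x) * pt t x) \<bullet> v)) (at t)" for t x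
        by (rule has_derivative_eq_rhs[OF has_derivative_compose[OF gtd d0[OF gtI, unfolded has_field_derivative_def]]]) (auto simp: fun_eq_iff)
      show "norm (\<psi>1 (gt t x) * pt t x) \<le> C1 * (L * (norm x + ?m1))" for t x
        unfolding real_norm_def abs_mult by (intro mult_mono C1 ptb abs_ge_zero)
      show "integrable gauss (\<lambda>x::'a. C1 * (L * (norm x + ?m1)))"
        by (intro integrable_mult_right Bochner_Integration.integrable_add gauss_norm_integrable) auto
    qed auto
    then show ?thesis
      unfolding has_field_derivative_def by (rule has_derivative_eq_rhs) (auto simp: fun_eq_iff)
  qed
  \<comment> \<open>In the rotated coordinates \<open>u\<close>, \<open>v\<close> the angular
    derivative becomes \<open>dg u \<bullet> v\<close>, linear in \<open>v\<close>, while
    \<open>gt \<theta>\<close> is evaluated at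
    \<open>cos \<theta> *\<^sub>R u - sin \<theta> *\<^sub>R v\<close>. Integration by parts in
    \<open>v\<close> at fixed \<open>u\<close> produces the factor \<open>- sin \<theta>\<close>
    from the inner map and \<open>cos \<theta>\<close> from the gradient of
    \<open>gt \<theta>\<close>; after rotating back, \<open>dg\<close> averages to
    \<open>vt \<theta>\<close>.\<close>
  have F': "(\<integral>x. \<psi>1 (gt \<theta> x) * pt \<theta> x \<partial>gauss) = - (sin \<theta> * cos \<theta>) * (\<integral>x. h (gt \<theta> x) * (norm (vt \<theta> x))\<^sup>2 \<partial>gauss)" for \<theta>
  proof -
    let ?c = "cos \<theta>" and ?s = "sin \<theta>"
    have cs: "?c\<^sup>2 + ?s\<^sup>2 = 1" by simp
    define G where "G z = \<psi>1 (gt \<theta> (?c *\<^sub>R fst z - ?s *\<^sub>R snd z)) * (dg (fst z) \<bullet> snd z)" for z :: "'a \<times> 'a"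
    define H where "H z = h (gt \<theta> (?c *\<^sub>R fst z - ?s *\<^sub>R snd z)) * (vt \<theta> (?c *\<^sub>R fst z - ?s *\<^sub>R snd z) \<bullet> dg (fst z))" for z :: "'a \<times> 'a"
    have rev: "?c *\<^sub>R fst (rot ?c ?s z) - ?s *\<^sub>R snd (rot ?c ?s z) = fst z" for z :: "'a \<times> 'a"
    proof -
      have "?c *\<^sub>R fst (rot ?c ?s z) - ?s *\<^sub>R snd (rot ?c ?s z) = (?c\<^sup>2 + ?s\<^sup>2) *\<^sub>R fst z"
        by (simp add: rot_def algebra_simps power2_eq_square del: sin_cos_squared_add2 sin_cos_squared_add sin_cos_squared_add3)
      then show ?thesis by simp
    qed
    have mm[measurable]: "(\<lambda>z::'a\<times>'a. ?c *\<^sub>R fst z - ?s *\<^sub>R snd z) \<in> borel_measurable borel"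
      by (intro borel_measurable_continuous_onI continuous_intros)
    have [measurable]: "(\<lambda>z. \<psi>1 (gt \<theta> (?c *\<^sub>R fst z - ?s *\<^sub>R snd z))) \<in> borel_measurable borel"
      "(\<lambda>z. h (gt \<theta> (?c *\<^sub>R fst z - ?s *\<^sub>R snd z))) \<in> borel_measurable borel"
      using measurable_compose[OF mm p1m] measurable_compose[OF mm hm] by auto
    have Gm[measurable]: "G \<in> borel_measurable borel" unfolding G_def[abs_def] by measurable
    have Hm[measurable]: "H \<in> borel_measurable borel" unfolding H_def[abs_def] by measurable
    have Gi: "integrable gauss G"
    proof (rule Bochner_Integration.integrable_bound[OF integrable_mult_right[OF gauss_norm_integrable, of "C1 * L"] _ AE_I2])
      fix z :: "'a \<times> 'a"
      have "\<bar>G z\<bar> \<le> C1 * (L * norm (snd z))"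
        unfolding G_def abs_mult by (intro mult_mono C1 order_trans[OF Cauchy_Schwarz_ineq2] mult_right_mono dgL) auto
      also have "\<dots> \<le> C1 * (L * norm z)"
        using norm_snd_le[of "snd z" "fst z"] by (intro mult_left_mono C1 L0) auto
      finally show "norm (G z) \<le> norm (C1 * L * norm z)" by simp
    qed simp
    have Hi: "integrable gauss H"
    proof (rule gauss.integrable_const_bound[of _ "C2 * (L * L)", OF AE_I2])
      show "norm (H z) \<le> C2 * (L * L)" for z
        unfolding H_def real_norm_def abs_mult by (intro mult_mono C2 order_trans[OF Cauchy_Schwarz_ineq2] dgL avg(4) L0) auto
    qed simp
    have Gr: "G (rot ?c ?s (x, y)) = \<psi>1 (gt \<theta> x) * (dg (?c *\<^sub>R x + ?s *\<^sub>R y) \<bullet> (?c *\<^sub>R y - ?s *\<^sub>R x))" for x y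
      unfolding G_def rev by (simp add: rot_def)
    have Hr: "H (rot ?c ?s (x, y)) = h (gt \<theta> x) * (vt \<theta> x \<bullet> dg (?c *\<^sub>R x + ?s *\<^sub>R y))" for x y
      unfolding H_def rev by (simp add: rot_def)
    have "(\<integral>x. \<psi>1 (gt \<theta> x) * pt \<theta> x \<partial>gauss) = (\<integral>x. (\<integral>y. G (rot ?c ?s (x, y)) \<partial>gauss) \<partial>gauss)"
      by (simp add: Gr pt_def)
    also have "\<dots> = (\<integral>z. G (rot ?c ?s z) \<partial>gauss)"
      using Gi gauss_rot_integral(2)[OF cs Gm] by (intro gauss_pair_integral(1)[symmetric]) simp
    also have "\<dots> = (\<integral>z. G z \<partial>gauss)"
      by (rule gauss_rot_integral(1)[OF cs Gm])
    also have "\<dots> = (\<integral>u. (\<integral>v. G (u, v) \<partial>gauss) \<partial>gauss)"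
      by (rule gauss_pair_integral(1)[OF Gi])
    also have "\<dots> = (\<integral>u. (\<integral>v. - (?s * ?c) * H (u, v) \<partial>gauss) \<partial>gauss)"
    proof (rule Bochner_Integration.integral_cong[OF refl])
      fix u :: 'a
      let ?x = "\<lambda>v. ?c *\<^sub>R u - ?s *\<^sub>R v"
      have n: "nice (- C1) C1 (C2 * L) (\<lambda>v. \<psi>1 (gt \<theta> (?x v))) (\<lambda>v. (h (gt \<theta> (?x v)) * (- ?s) * ?c) *\<^sub>R vt \<theta> (?x v))"
        unfolding nice_def
      proof (intro conjI allI)
        fix v
        have r: "(?x has_derivative (\<lambda>w. - ?s *\<^sub>R w)) (at v)"
          by (auto intro!: derivative_eq_intros)
        show "((\<lambda>v. \<psi>1 (gt \<theta> (?x v))) has_derivative (\<lambda>w. ((h (gt \<theta> (?x v)) * (- ?s) * ?c) *\<^sub>R vt \<theta> (?x v)) \<bullet> w)) (at v)"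
          by (rule has_derivative_eq_rhs[OF has_derivative_compose[OF has_derivative_compose[OF r niceD(1)[OF avg(1)]] d1[OF gtI, unfolded has_field_derivative_def]]])
             (auto simp: fun_eq_iff)
        have "norm ((h (gt \<theta> (?x v)) * (- ?s) * ?c) *\<^sub>R vt \<theta> (?x v)) = \<bar>h (gt \<theta> (?x v))\<bar> * ((\<bar>?s\<bar> * \<bar>?c\<bar>) * norm (vt \<theta> (?x v)))"
          by (simp add: abs_mult)
        also have "\<dots> \<le> C2 * ((1 * 1) * L)"
          by (intro mult_mono C2 avg(4)) auto
        finally show "norm ((h (gt \<theta> (?x v)) * (- ?s) * ?c) *\<^sub>R vt \<theta> (?x v)) \<le> C2 * L" by simp
        show "\<psi>1 (gt \<theta> (?x v)) \<in> {- C1..C1}" using C1(2)[of \<theta> "?x v"] by auto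
      next
        have "continuous_on UNIV (\<lambda>v. h (gt \<theta> (?x v)))"
          by (rule continuous_on_compose2[OF cont(3)], rule continuous_on_compose2[OF niceD(7)[OF avg(1)]])
             (use niceD(4,5)[OF avg(1)] in \<open>auto intro!: continuous_intros\<close>)
        moreover have "continuous_on UNIV (\<lambda>v. vt \<theta> (?x v))"
          by (rule continuous_on_compose2[OF avg(5)]) (auto intro!: continuous_intros)
        ultimately show "continuous_on UNIV (\<lambda>v. (h (gt \<theta> (?x v)) * (- ?s) * ?c) *\<^sub>R vt \<theta> (?x v))"
          by (intro continuous_intros)
      qed
      show "(\<integral>v. G (u, v) \<partial>gauss) = (\<integral>v. - (?s * ?c) * H (u, v) \<partial>gauss)"
        using gauss_integration_by_parts[OF n, of "dg u"] by (simp add: G_def H_def mult_ac)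
    qed
    also have "\<dots> = - (?s * ?c) * (\<integral>u. (\<integral>v. H (u, v) \<partial>gauss) \<partial>gauss)"
      by simp
    also have "(\<integral>u. (\<integral>v. H (u, v) \<partial>gauss) \<partial>gauss) = (\<integral>z. H z \<partial>gauss)"
      by (rule gauss_pair_integral(1)[OF Hi, symmetric])
    also have "\<dots> = (\<integral>z. H (rot ?c ?s z) \<partial>gauss)"
      by (rule gauss_rot_integral(1)[OF cs Hm, symmetric])
    also have "\<dots> = (\<integral>x. (\<integral>y. H (rot ?c ?s (x, y)) \<partial>gauss) \<partial>gauss)"
      using Hi gauss_rot_integral(2)[OF cs Hm] by (intro gauss_pair_integral(1)) simp
    also have "\<dots> = (\<integral>x. h (gt \<theta> x) * (norm (vt \<theta> x))\<^sup>2 \<partial>gauss)"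
    proof (rule Bochner_Integration.integral_cong[OF refl])
      fix x
      have "(\<integral>y. vt \<theta> x \<bullet> dg (?c *\<^sub>R x + ?s *\<^sub>R y) \<partial>gauss) = (norm (vt \<theta> x))\<^sup>2"
        using avg(3)[of \<theta> x] by (simp add: power2_norm_eq_inner) (simp add: vt_def)
      then show "(\<integral>y. H (rot ?c ?s (x, y)) \<partial>gauss) = h (gt \<theta> x) * (norm (vt \<theta> x))\<^sup>2"
        by (simp add: Hr)
    qed
    finally show ?thesis .
  qed
  \<comment> \<open>Jensen is applied to \<open>vt \<theta>\<close> and not to the gradient of
    \<open>gt \<theta>\<close>, whose factor \<open>cos \<theta>\<close> is already accounted for in
    \<open>F'\<close>. Rotation invariance then removes the angle.\<close>
  have fisher: "(\<integral>x. h (gt \<theta> x) * (norm (vt \<theta> x))\<^sup>2 \<partial>gauss) \<le> B" for \<theta>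
  proof -
    let ?c = "cos \<theta>" and ?s = "sin \<theta>"
    have cs: "?c\<^sup>2 + ?s\<^sup>2 = 1" by simp
    define H where "H z = h (g (fst z)) * (norm (dg (fst z)))\<^sup>2" for z :: "'a \<times> 'a"
    have Hm[measurable]: "H \<in> borel_measurable borel" unfolding H_def[abs_def] by measurable
    have sqL: "(norm (dg x))\<^sup>2 \<le> L\<^sup>2" for x using dgL by (simp add: power_mono)
    have Hb: "norm (h (g x) * (norm (dg x))\<^sup>2) \<le> C2 * L\<^sup>2" for x
      unfolding real_norm_def abs_mult by (intro mult_mono C2) (auto simp: sqL)
    have Hi: "integrable gauss H"
      by (rule gauss.integrable_const_bound[of _ "C2 * L\<^sup>2", OF AE_I2]) (use Hb in \<open>auto simp: H_def\<close>)
    have Hri: "integrable gauss (\<lambda>z. H (rot ?c ?s z))"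
      using Hi gauss_rot_integral(2)[OF cs Hm] by simp
    have Hr: "H (rot ?c ?s (x, y)) = h (g (?c *\<^sub>R x + ?s *\<^sub>R y)) * (norm (dg (?c *\<^sub>R x + ?s *\<^sub>R y)))\<^sup>2" for x y
      by (simp add: H_def rot_def)
    have J: "h (gt \<theta> x) * (norm (vt \<theta> x))\<^sup>2 \<le> (\<integral>y. H (rot ?c ?s (x, y)) \<partial>gauss)" for x
      unfolding Hr gt_def vt_def
    proof (rule perspective_jensen[OF prob_space_gauss ab avg(2) _ avg(3)])
      show "integrable gauss (\<lambda>y. h (g (?c *\<^sub>R x + ?s *\<^sub>R y)) * (norm (dg (?c *\<^sub>R x + ?s *\<^sub>R y)))\<^sup>2)"
      proof (rule gauss.integrable_const_bound[of _ "C2 * L\<^sup>2", OF AE_I2])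
        have "(\<lambda>y. (\<lambda>x. h (g x)) (?c *\<^sub>R x + ?s *\<^sub>R y)) \<in> borel_measurable borel"
          by measurable
        then have [measurable]: "(\<lambda>y. h (g (?c *\<^sub>R x + ?s *\<^sub>R y))) \<in> borel_measurable borel" .
        show "(\<lambda>y. h (g (?c *\<^sub>R x + ?s *\<^sub>R y)) * (norm (dg (?c *\<^sub>R x + ?s *\<^sub>R y)))\<^sup>2) \<in> borel_measurable gauss"
          by measurable
      qed (rule Hb)
    qed (use niceD(4,5)[OF nice] in auto)
    have vb: "norm (h (gt \<theta> x) * (norm (vt \<theta> x))\<^sup>2) \<le> C2 * L\<^sup>2" for x
      unfolding real_norm_def abs_mult by (intro mult_mono C2) (auto intro!: power_mono avg(4))
    have "(\<integral>x. h (gt \<theta> x) * (norm (vt \<theta> x))\<^sup>2 \<partial>gauss) \<le> (\<integral>x. (\<integral>y. H (rot ?c ?s (x, y)) \<partial>gauss) \<partial>gauss)"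
    proof (rule integral_mono[OF _ _ J])
      show "integrable gauss (\<lambda>x. h (gt \<theta> x) * (norm (vt \<theta> x))\<^sup>2)"
        by (rule gauss.integrable_const_bound[of _ "C2 * L\<^sup>2", OF AE_I2]) (use vb in auto)
      show "integrable gauss (\<lambda>x. \<integral>y. H (rot ?c ?s (x, y)) \<partial>gauss)"
        by (rule gauss_pair_integral(2)[OF Hri])
    qed
    also have "\<dots> = (\<integral>z. H (rot ?c ?s z) \<partial>gauss)"
      by (rule gauss_pair_integral(1)[OF Hri, symmetric])
    also have "\<dots> = (\<integral>z. H z \<partial>gauss)"
      by (rule gauss_rot_integral(1)[OF cs Hm])
    also have "\<dots> = B"
      unfolding B_def by (subst gauss_pair_integral(1)[OF Hi]) (simp add: H_def)
    finally show ?thesis .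
  qed
  \<comment> \<open>The derivative of \<open>F\<close> is at least
    \<open>- (sin \<theta> * cos \<theta>) * B\<close>, so adding
    \<open>B / 2 * (sin \<theta>)\<^sup>2\<close> makes it nondecreasing on the quarter circle. The
    integral of \<open>sin \<theta> * cos \<theta>\<close> there is the factor 1/2 of the
    inequality.\<close>
  have "F 0 + B / 2 * (sin 0)\<^sup>2 \<le> F (pi / 2) + B / 2 * (sin (pi / 2))\<^sup>2"
  proof (rule DERIV_nonneg_imp_nondecreasing[where f="\<lambda>\<theta>. F \<theta> + B / 2 * (sin \<theta>)\<^sup>2"])
    fix \<theta> :: real assume t: "0 \<le> \<theta>" "\<theta> \<le> pi / 2"
    have sc: "0 \<le> sin \<theta> * cos \<theta>"
      using t by (intro mult_nonneg_nonneg sin_ge_zero cos_ge_zero) auto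
    have "((\<lambda>\<theta>. F \<theta> + B / 2 * (sin \<theta>)\<^sup>2) has_real_derivative
        (\<integral>x. \<psi>1 (gt \<theta> x) * pt \<theta> x \<partial>gauss) + B * (sin \<theta> * cos \<theta>)) (at \<theta>)"
      by (rule derivative_eq_intros Fd refl)+ (simp add: power2_eq_square)
    moreover have "0 \<le> (\<integral>x. \<psi>1 (gt \<theta> x) * pt \<theta> x \<partial>gauss) + B * (sin \<theta> * cos \<theta>)"
      unfolding F' using mult_left_mono[OF fisher[of \<theta>] sc] by (simp add: mult.commute)
    ultimately show "\<exists>y. ((\<lambda>\<theta>. F \<theta> + B / 2 * (sin \<theta>)\<^sup>2) has_real_derivative y) (at \<theta>) \<and> 0 \<le> y" by blast
  qed simp
  then show ?thesis
    by (simp add: F_def gt_def B_def)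
qed

end

section \<open>Linear changes of variables and quadratic forms\<close>

text \<open>The shear translates along \<open>b\<close> by an amount that depends on another
  coordinate. Splitting off the coordinate \<open>b\<close> by Fubini leaves, for fixed other
  coordinates, a translation of the real line.\<close>

lemma nn_integral_lborel_shear:
  fixes F :: "'a::euclidean_space \<Rightarrow> ennreal"
  assumes F[measurable]: "F \<in> borel_measurable borel" and b: "b \<in> Basis" "c \<in> Basis" "b \<noteq> c"
  shows "(\<integral>\<^sup>+x. F (x + (k * (x \<bullet> c)) *\<^sub>R b) \<partial>lborel) = (\<integral>\<^sup>+x. F x \<partial>lborel)"
proof -
  interpret product_sigma_finite "\<lambda>_::'a. lborel :: real measure"
    by standard
  let ?B = "Basis - {b}"
  let ?s = "\<lambda>f. \<Sum>a\<in>Basis. f a *\<^sub>R (a::'a)"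
  have ins: "Basis = insert b ?B" using b by auto
  have m[measurable]: "?s \<in> (\<Pi>\<^sub>M b\<in>Basis. lborel) \<rightarrow>\<^sub>M borel"
    by measurable
  have G[measurable]: "(\<lambda>x. F (x + (k * (x \<bullet> c)) *\<^sub>R b)) \<in> borel_measurable borel"
    by measurable
  have lb: "(\<integral>\<^sup>+x. G x \<partial>lborel) = (\<integral>\<^sup>+x. (\<integral>\<^sup>+y. G (?s (x(b := y))) \<partial>lborel) \<partial>Pi\<^sub>M ?B (\<lambda>_. lborel))"
    if [measurable]: "G \<in> borel_measurable borel" for G :: "'a \<Rightarrow> ennreal"
  proof -
    have "(\<integral>\<^sup>+x. G x \<partial>lborel) = (\<integral>\<^sup>+x. G (?s x) \<partial>Pi\<^sub>M Basis (\<lambda>_. lborel))"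
      by (subst lborel_eq, subst nn_integral_distr) auto
    also have "\<dots> = (\<integral>\<^sup>+x. G (?s x) \<partial>Pi\<^sub>M (insert b ?B) (\<lambda>_. lborel))"
      using ins by simp
    also have "\<dots> = (\<integral>\<^sup>+x. (\<integral>\<^sup>+y. G (?s (x(b := y))) \<partial>lborel) \<partial>Pi\<^sub>M ?B (\<lambda>_. lborel))"
    proof (rule product_nn_integral_insert)
      show "(\<lambda>x. G (?s x)) \<in> borel_measurable (Pi\<^sub>M (insert b ?B) (\<lambda>_. lborel))"
        using measurable_compose[OF m that] ins by simp
    qed auto
    finally show ?thesis .
  qed
  have split: "?s (x(b := y)) = y *\<^sub>R b + (\<Sum>a\<in>?B. x a *\<^sub>R a)" for x y
    using b by (subst sum.remove[of Basis b]) auto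
  have e: "?s (x(b := y)) + (k * (?s (x(b := y)) \<bullet> c)) *\<^sub>R b = ?s (x(b := k * x c + y))" for x y
  proof -
    have "?s (x(b := y)) \<bullet> c = x c" using b by simp
    then show ?thesis unfolding split by (simp add: algebra_simps)
  qed
  have sh: "(\<integral>\<^sup>+y. G (t + y) \<partial>lborel) = (\<integral>\<^sup>+y. G y \<partial>lborel)" if [measurable]: "G \<in> borel_measurable borel" for G :: "real \<Rightarrow> ennreal" and t
    by (subst (2) lborel_distr_plus[symmetric, of t], subst nn_integral_distr) auto
  have "(\<lambda>y. F (?s (x(b := y)))) \<in> borel_measurable borel" for x
    unfolding split by measurable
  note inner = sh[OF this]
  show ?thesis
    unfolding lb[OF G] lb[OF F] e inner ..
qed

text \<open>The formula is multiplicative in \<open>A\<close>, so elementary matrices suffice: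
  diagonal ones rescale the axes, transpositions permute the sides of boxes, and the remaining ones
  are shears. A zero row is excluded by \<open>det A \<noteq> 0\<close>.\<close>

lemma nn_integral_lborel_matrix:
  fixes A :: "real^'n^'n"
  assumes "det A \<noteq> 0" "F \<in> borel_measurable borel"
  shows "(\<integral>\<^sup>+x. F x \<partial>lborel) = ennreal \<bar>det A\<bar> * (\<integral>\<^sup>+x. F (A *v x) \<partial>lborel)"
proof -
  define P where "P A \<longleftrightarrow> (det A \<noteq> 0 \<longrightarrow> (\<forall>F\<in>borel_measurable borel. (\<integral>\<^sup>+x. F x \<partial>lborel) = ennreal \<bar>det A\<bar> * (\<integral>\<^sup>+x. F (A *v x) \<partial>lborel)))" for A :: "real^'n^'n"
  have mv[measurable]: "(*v) A \<in> borel_measurable borel" for A :: "real^'n^'n"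
    by (intro borel_measurable_continuous_onI linear_continuous_on) simp
  have "P A"
  proof (rule induct_matrix_elementary)
    fix A B :: "real^'n^'n" assume AB: "P A" "P B"
    show "P (A ** B)"
      unfolding P_def
    proof (intro impI ballI)
      fix F :: "real^'n \<Rightarrow> ennreal" assume nz: "det (A ** B) \<noteq> 0" and F[measurable]: "F \<in> borel_measurable borel"
      have nz': "det A \<noteq> 0" "det B \<noteq> 0" using nz by (auto simp: det_mul)
      have m: "(\<lambda>x. F (A *v x)) \<in> borel_measurable borel" by measurable
      have "(\<integral>\<^sup>+x. F x \<partial>lborel) = ennreal \<bar>det A\<bar> * (\<integral>\<^sup>+x. F (A *v x) \<partial>lborel)"
        using AB(1)[unfolded P_def] nz'(1) F by blast
      also have "(\<integral>\<^sup>+x. F (A *v x) \<partial>lborel) = ennreal \<bar>det B\<bar> * (\<integral>\<^sup>+x. F (A *v (B *v x)) \<partial>lborel)"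
        using AB(2)[unfolded P_def] nz'(2) m by blast
      finally show "(\<integral>\<^sup>+x. F x \<partial>lborel) = ennreal \<bar>det (A ** B)\<bar> * (\<integral>\<^sup>+x. F ((A ** B) *v x) \<partial>lborel)"
        by (simp add: matrix_vector_mul_assoc det_mul abs_mult ennreal_mult mult.assoc)
    qed
  next
    fix A :: "real^'n^'n" and i assume "row i A = 0"
    then show "P A" by (simp add: P_def det_zero_row)
  next
    fix A :: "real^'n^'n" assume d: "\<And>i j. i \<noteq> j \<Longrightarrow> A$i$j = 0"
    show "P A"
      unfolding P_def
    proof (intro impI ballI)
      fix F :: "real^'n \<Rightarrow> ennreal" assume nz: "det A \<noteq> 0" and F[measurable]: "F \<in> borel_measurable borel"
      define c where "c b = b \<bullet> (A *v b)" for b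
      have Ai: "(A *v x) $ i = A$i$i * x$i" for x i
      proof -
        have "(A *v x) $ i = (\<Sum>j\<in>UNIV. if j = i then A$i$i * x$i else 0)"
          unfolding matrix_vector_mult_def vec_lambda_beta by (rule sum.cong) (use d[of i] in auto)
        then show ?thesis by simp
      qed
      have ca: "c (axis i 1) = A$i$i" for i
        by (simp add: c_def inner_axis' Ai)
      have det: "det A = (\<Prod>i\<in>UNIV. A$i$i)" using d by (rule det_diagonal)
      have Ax: "(\<Sum>j\<in>Basis. (c j * (x \<bullet> j)) *\<^sub>R j) = A *v x" for x
      proof (rule vec_eq_iff[THEN iffD2], rule allI)
        fix i :: 'n
        have "axis i (1::real) \<in> Basis" by (auto simp: Basis_vec_def)
        then have "(\<Sum>j\<in>Basis. (c j * (x \<bullet> j)) *\<^sub>R j) \<bullet> axis i 1 = c (axis i 1) * (x \<bullet> axis i 1)"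
          by simp
        then show "(\<Sum>j\<in>Basis. (c j * (x \<bullet> j)) *\<^sub>R j) $ i = (A *v x) $ i"
          unfolding cart_eq_inner_axis[symmetric] ca Ai .
      qed
      have Bi: "(Basis :: (real^'n) set) = range (\<lambda>i. axis i 1)" by (auto simp: Basis_vec_def)
      have inj: "inj (\<lambda>i::'n. axis i (1::real))" by (auto simp: inj_on_def axis_eq_axis)
      have prodc: "(\<Prod>j\<in>Basis. \<bar>c j\<bar>) = \<bar>det A\<bar>"
        unfolding Bi by (subst prod.reindex[OF inj]) (simp add: ca det abs_prod)
      have cnz: "c j \<noteq> 0" if "j \<in> Basis" for j
        using nz that unfolding Bi det by (auto simp: ca)
      have lb: "lborel = density (distr lborel borel ((*v) A)) (\<lambda>_. ennreal \<bar>det A\<bar>)"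
        using lborel_affine_euclidean[of c 0, OF cnz] by (simp add: Ax prodc)
      show "(\<integral>\<^sup>+x. F x \<partial>lborel) = ennreal \<bar>det A\<bar> * (\<integral>\<^sup>+x. F (A *v x) \<partial>lborel)"
        by (subst lb) (simp add: nn_integral_density nn_integral_distr nn_integral_cmult)
    qed
  next
    fix m n :: 'n assume mn: "m \<noteq> n"
    let ?\<sigma> = "Transposition.transpose m n"
    let ?A = "(\<chi> i j. mat 1 $ i $ ?\<sigma> j) :: real^'n^'n"
    have Ax: "?A *v x = (\<chi> i. x $ ?\<sigma> i)" for x
    proof (rule vec_eq_iff[THEN iffD2], rule allI)
      fix i :: 'n
      have iff: "i = ?\<sigma> j \<longleftrightarrow> j = ?\<sigma> i" for j by (metis transpose_involutory)
      have "(?A *v x) $ i = (\<Sum>j\<in>UNIV. if j = ?\<sigma> i then x $ j else 0)"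
        unfolding matrix_vector_mult_def vec_lambda_beta
        by (rule sum.cong) (simp_all add: mat_def iff)
      then show "(?A *v x) $ i = (\<chi> i. x $ ?\<sigma> i) $ i" by simp
    qed
    have dA: "\<bar>det ?A\<bar> = 1"
    proof -
      have "?A ** ?A = mat 1"
      proof -
        have "(?A ** ?A) *v x = mat 1 *v x" for x
          by (simp add: matrix_vector_mul_assoc[symmetric] Ax vec_eq_iff)
        then show ?thesis by (simp add: matrix_eq)
      qed
      then have "det ?A * det ?A = 1" using det_mul[of ?A ?A] by (simp add: det_I)
      then have "(det ?A)\<^sup>2 = 1" unfolding power2_eq_square .
      then show ?thesis unfolding abs_square_eq_1 .
    qed
    have lb: "lborel = distr lborel borel (\<lambda>x. (\<chi> i. x $ ?\<sigma> i) :: real^'n)"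
    proof (rule lborel_eqI)
      fix l u :: "real^'n" assume le: "\<And>b. b \<in> Basis \<Longrightarrow> l \<bullet> b \<le> u \<bullet> b"
      have [measurable]: "(\<lambda>x. (\<chi> i. x $ ?\<sigma> i) :: real^'n) \<in> borel_measurable borel"
        using mv[of ?A] unfolding Ax .
      have v: "(\<lambda>x. (\<chi> i. x $ ?\<sigma> i) :: real^'n) -` box l u = box (\<chi> i. l $ ?\<sigma> i) (\<chi> i. u $ ?\<sigma> i)"
        by (auto simp: mem_box_cart) (metis transpose_involutory)+
      have Bi: "(Basis :: (real^'n) set) = range (\<lambda>i. axis i 1)" by (auto simp: Basis_vec_def)
      have inj: "inj (\<lambda>i::'n. axis i (1::real))" by (auto simp: inj_on_def axis_eq_axis)
      have pr: "(\<Prod>b\<in>Basis. x \<bullet> b) = (\<Prod>i\<in>UNIV. x $ i)" for x :: "real^'n"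
        unfolding Bi by (subst prod.reindex[OF inj]) (simp add: cart_eq_inner_axis)
      have le': "l $ i \<le> u $ i" for i
        using le[of "axis i 1"] by (simp add: Bi cart_eq_inner_axis)
      have "emeasure (distr lborel borel (\<lambda>x. (\<chi> i. x $ ?\<sigma> i) :: real^'n)) (box l u)
          = emeasure lborel (box (\<chi> i. l $ ?\<sigma> i) (\<chi> i. u $ ?\<sigma> i))"
        by (subst emeasure_distr) (auto simp: v)
      also have "\<dots> = ennreal (\<Prod>i\<in>UNIV. ((\<chi> i. u $ ?\<sigma> i) - (\<chi> i. l $ ?\<sigma> i)) $ i)"
        by (subst emeasure_lborel_box) (auto simp: Bi cart_eq_inner_axis[symmetric] le' pr[unfolded Bi])
      also have "(\<Prod>i\<in>UNIV. ((\<chi> i. u $ ?\<sigma> i) - (\<chi> i. l $ ?\<sigma> i)) $ i) = (\<Prod>i\<in>UNIV. (u - l) $ ?\<sigma> i)"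
        by simp
      also have "\<dots> = (\<Prod>i\<in>UNIV. (u - l) $ i)"
        by (rule prod.reindex_bij_betw) (auto simp: bij_betw_def intro!: inj_on_inverseI[where g="?\<sigma>"])
      finally show "emeasure (distr lborel borel (\<lambda>x. (\<chi> i. x $ ?\<sigma> i) :: real^'n)) (box l u) = ennreal (\<Prod>b\<in>Basis. (u - l) \<bullet> b)"
        by (simp add: pr)
    qed simp
    show "P ?A"
      unfolding P_def dA
    proof (intro impI ballI)
      fix F :: "real^'n \<Rightarrow> ennreal" assume F[measurable]: "F \<in> borel_measurable borel"
      have [measurable]: "(\<lambda>x. (\<chi> i. x $ ?\<sigma> i) :: real^'n) \<in> borel_measurable borel"
        using mv[of ?A] unfolding Ax .
      show "(\<integral>\<^sup>+x. F x \<partial>lborel) = ennreal 1 * (\<integral>\<^sup>+x. F (?A *v x) \<partial>lborel)"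
        unfolding Ax by (subst lb, subst nn_integral_distr) auto
    qed
  next
    fix m n :: 'n and c :: real assume mn: "m \<noteq> n"
    let ?A = "(\<chi> i j. if i = m \<and> j = n then c else of_bool (i = j)) :: real^'n^'n"
    have Ax: "?A *v x = x + (c * (x \<bullet> axis n 1)) *\<^sub>R axis m 1" for x
    proof (rule vec_eq_iff[THEN iffD2], rule allI)
      fix i :: 'n
      have "(?A *v x) $ i = (\<Sum>j\<in>UNIV. (if j = i then x $ j else 0) + (if j = n then (if i = m then c * x $ n else 0) else 0))"
        unfolding matrix_vector_mult_def using mn by (auto intro!: sum.cong)
      also have "\<dots> = x $ i + (if i = m then c * x $ n else 0)"
        by (simp add: sum.distrib)
      finally have "(?A *v x) $ i = x $ i + (if i = m then c * x $ n else 0)" .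
      moreover have "x \<bullet> axis n 1 = x $ n" by (simp add: cart_eq_inner_axis)
      ultimately show "(?A *v x) $ i = (x + (c * (x \<bullet> axis n 1)) *\<^sub>R axis m 1) $ i"
        by (simp add: axis_def)
    qed
    have dA: "det ?A = 1"
    proof -
      have "(\<chi> k. if k = m then row m (mat 1) + c *s row n (mat 1) else row k (mat 1)) = ?A"
        using mn by (auto simp: vec_eq_iff row_def mat_def)
      then show ?thesis
        using det_row_operation[of m n "mat 1 :: real^'n^'n" c] mn by (simp add: det_I)
    qed
    show "P ?A"
      unfolding P_def dA Ax using mn
      by (auto simp: nn_integral_lborel_shear Basis_vec_def axis_eq_axis)
  qed
  then show ?thesis using assms unfolding P_def by blast
qed

text \<open>\<open>E t\<close> is the exponential of \<open>t A\<close>, summed entry by entry so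
  that scalar power series can be differentiated termwise. The powers of \<open>A\<close> commute
  with \<open>A\<close>, so the derivative is both \<open>A ** E t\<close> and
  \<open>E t ** A\<close>; the second form yields the equation for the transpose, which moves
  Fourier frequencies.\<close>

lemma matrix_exponential:
  fixes A :: "real^'n^'n"
  obtains E :: "real \<Rightarrow> real^'n^'n" where "E 0 = mat 1"
    "\<And>t v. ((\<lambda>t. E t *v v) has_vector_derivative A *v (E t *v v)) (at t)"
    "\<And>t v. ((\<lambda>t. transpose (E t) *v v) has_vector_derivative transpose A *v (transpose (E t) *v v)) (at t)"
proof -
  define p :: "nat \<Rightarrow> real^'n^'n" where "p n = ((**) A ^^ n) (mat 1)" for n
  have pS: "p (Suc n) = A ** p n" for n by (simp add: p_def)
  have p0: "p 0 = mat 1" by (simp add: p_def)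
  have pS': "p (Suc n) = p n ** A" for n
  proof (induction n)
    case (Suc n)
    have "p (Suc (Suc n)) = A ** (p n ** A)" using Suc pS[of "Suc n"] by simp
    then show ?case by (simp add: matrix_mul_assoc pS)
  qed (simp add: pS p0)
  obtain B where B: "0 < B" "\<And>i j. \<bar>A$i$j\<bar> \<le> B"
  proof
    show "0 < 1 + (\<Sum>i\<in>UNIV. \<Sum>j\<in>UNIV. \<bar>A$i$j\<bar>)" by (intro add_pos_nonneg sum_nonneg) auto
    fix i j
    have "\<bar>A$i$j\<bar> \<le> (\<Sum>j\<in>UNIV. \<bar>A$i$j\<bar>)" by (rule member_le_sum) auto
    also have "\<dots> \<le> (\<Sum>i\<in>UNIV. \<Sum>j\<in>UNIV. \<bar>A$i$j\<bar>)" by (rule member_le_sum) (auto intro: sum_nonneg)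
    finally show "\<bar>A$i$j\<bar> \<le> 1 + (\<Sum>i\<in>UNIV. \<Sum>j\<in>UNIV. \<bar>A$i$j\<bar>)" by simp
  qed
  \<comment> \<open>An entry of a product of two matrices is a sum of \<open>CARD('n)\<close> terms,
    hence this geometric growth rate for the entries of the powers.\<close>
  define K where "K = B * CARD('n)"
  have pb: "\<bar>p n $ i $ j\<bar> \<le> K ^ n" for n i j
  proof (induction n arbitrary: i j)
    case 0 then show ?case by (simp add: p0 mat_def)
  next
    case (Suc n)
    have "\<bar>p (Suc n) $ i $ j\<bar> \<le> (\<Sum>k\<in>UNIV. \<bar>A$i$k * p n $ k $ j\<bar>)"
      unfolding pS matrix_matrix_mult_def by simp
    also have "\<dots> \<le> (\<Sum>k\<in>(UNIV::'n set). B * K ^ n)"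
      unfolding abs_mult using B(1) by (intro sum_mono mult_mono B Suc) auto
    finally show ?case by (simp add: K_def mult_ac)
  qed
  define c where "c i j n = p n $ i $ j / fact n" for i j n
  have summ: "summable (\<lambda>n. c i j n * y ^ n)" for i j y
  proof (rule summable_comparison_test')
    show "summable (\<lambda>n. (K * \<bar>y\<bar>) ^ n / fact n)"
      using summable_exp[of "K * \<bar>y\<bar>"] by (simp add: divide_inverse mult.commute)
    show "norm (c i j n * y ^ n) \<le> (K * \<bar>y\<bar>) ^ n / fact n" for n
      using mult_right_mono[OF pb[of n i j], of "\<bar>y\<bar> ^ n"]
      by (simp add: c_def abs_mult power_mult_distrib power_abs divide_right_mono)
  qed
  define E :: "real \<Rightarrow> real^'n^'n" where "E t = (\<chi> i j. \<Sum>n. c i j n * t ^ n)" for t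
  have E0: "E 0 = mat 1"
  proof -
    have "(\<Sum>n. c i j n * 0 ^ n) = c i j 0" for i j using powser_zero[of "c i j"] by simp
    then show ?thesis by (simp add: E_def vec_eq_iff c_def p0)
  qed
  have diffs: "diffs (c i j) n = p (Suc n) $ i $ j / fact n" for i j n
    by (simp add: diffs_def c_def fact_Suc del: of_nat_Suc)
  have d: "((\<lambda>t. E t $ i $ j) has_real_derivative (A ** E t) $ i $ j) (at t)"
    and d': "((\<lambda>t. E t $ i $ j) has_real_derivative (E t ** A) $ i $ j) (at t)" for i j t
  proof -
    have D: "((\<lambda>t. E t $ i $ j) has_real_derivative (\<Sum>n. diffs (c i j) n * t ^ n)) (at t)"
      unfolding E_def by (simp, rule termdiffs_strong_converges_everywhere[OF summ])
    have "(\<Sum>n. diffs (c i j) n * t ^ n) = (\<Sum>n. \<Sum>k\<in>UNIV. A$i$k * (c k j n * t ^ n))"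
      unfolding diffs pS c_def by (simp add: matrix_matrix_mult_def sum_divide_distrib sum_distrib_right mult.assoc)
    also have "\<dots> = (\<Sum>k\<in>UNIV. \<Sum>n. A$i$k * (c k j n * t ^ n))"
      by (rule suminf_sum) (intro summable_mult summ)
    also have "\<dots> = (A ** E t) $ i $ j"
      by (simp add: matrix_matrix_mult_def E_def suminf_mult summ)
    finally show "((\<lambda>t. E t $ i $ j) has_real_derivative (A ** E t) $ i $ j) (at t)" using D by simp
    have "(\<Sum>n. diffs (c i j) n * t ^ n) = (\<Sum>n. \<Sum>k\<in>UNIV. A$k$j * (c i k n * t ^ n))"
      unfolding diffs pS' c_def by (simp add: matrix_matrix_mult_def sum_divide_distrib sum_distrib_left mult_ac)
    also have "\<dots> = (\<Sum>k\<in>UNIV. \<Sum>n. A$k$j * (c i k n * t ^ n))"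
      by (rule suminf_sum) (intro summable_mult summ)
    also have "\<dots> = (E t ** A) $ i $ j"
      by (simp only: matrix_matrix_mult_def E_def vec_lambda_beta suminf_mult[OF summ]) (simp only: mult.commute)
    finally show "((\<lambda>t. E t $ i $ j) has_real_derivative (E t ** A) $ i $ j) (at t)" using D by simp
  qed
  have vec: "(f has_vector_derivative f') (at t)" if "\<And>i. ((\<lambda>t. f t $ i) has_real_derivative f' $ i) (at t)"
    for f :: "real \<Rightarrow> real^'n" and f' t
    unfolding has_vector_derivative_def
  proof (subst has_derivative_componentwise_within, intro ballI)
    fix b :: "real^'n" assume "b \<in> Basis"
    then obtain i where b: "b = axis i 1" by (auto simp: Basis_vec_def)
    show "((\<lambda>x. f x \<bullet> b) has_derivative (\<lambda>x. (x *\<^sub>R f') \<bullet> b)) (at t)"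
      unfolding b cart_eq_inner_axis[symmetric] vector_scaleR_component
      using that[of i, unfolded has_field_derivative_def]
      by (rule has_derivative_eq_rhs) (auto simp: fun_eq_iff)
  qed
  have 1: "((\<lambda>t. E t *v v) has_vector_derivative A *v (E t *v v)) (at t)" for t v
  proof (rule vec)
    fix i
    have "((\<lambda>t. \<Sum>j\<in>UNIV. E t $ i $ j * v $ j) has_real_derivative (\<Sum>j\<in>UNIV. (A ** E t) $ i $ j * v $ j)) (at t)"
      by (intro DERIV_sum DERIV_cmult_right d)
    then show "((\<lambda>t. (E t *v v) $ i) has_real_derivative (A *v (E t *v v)) $ i) (at t)"
      by (simp add: matrix_vector_mul_assoc) (simp add: matrix_vector_mult_def)
  qed
  have 2: "((\<lambda>t. transpose (E t) *v v) has_vector_derivative transpose A *v (transpose (E t) *v v)) (at t)" for t v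
  proof (rule vec)
    fix i
    have "((\<lambda>t. \<Sum>j\<in>UNIV. E t $ j $ i * v $ j) has_real_derivative (\<Sum>j\<in>UNIV. (E t ** A) $ j $ i * v $ j)) (at t)"
      by (intro DERIV_sum DERIV_cmult_right d')
    moreover have "transpose A *v (transpose (E t) *v v) = transpose (E t ** A) *v v"
      by (simp only: matrix_vector_mul_assoc matrix_transpose_mul)
    ultimately show "((\<lambda>t. (transpose (E t) *v v) $ i) has_real_derivative (transpose A *v (transpose (E t) *v v)) $ i) (at t)"
      by (simp add: matrix_vector_mult_def transpose_def)
  qed
  show thesis by (rule that[OF E0 1 2])
qed

section \<open>Positive semidefinite quadratic forms and their comparison\<close>

definition psd :: "real^'n^'n \<Rightarrow> bool" where
  "psd A \<longleftrightarrow> sym_mat A \<and> (\<forall>x. 0 \<le> x \<bullet> (A *v x))"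

lemma sym_mat_inner: "sym_mat A \<Longrightarrow> x \<bullet> (A *v y) = (A *v x) \<bullet> y"
  unfolding sym_mat_def by (metis dot_lmul_matrix transpose_matrix_vector)

lemma inner_matrix_transpose: "((A::real^'n^'m) *v x) \<bullet> y = x \<bullet> (transpose A *v y)"
  by (metis dot_lmul_matrix inner_commute transpose_matrix_vector)

lemma psd_cauchy_schwarz:
  assumes "psd A"
  shows "(x \<bullet> (A *v y))\<^sup>2 \<le> (x \<bullet> (A *v x)) * (y \<bullet> (A *v y))"
proof -
  have sym: "y \<bullet> (A *v x) = x \<bullet> (A *v y)"
    using assms sym_mat_inner[of A x y] by (simp add: psd_def inner_commute)
  have q: "0 \<le> x \<bullet> (A *v x) + 2 * t * (x \<bullet> (A *v y)) + t\<^sup>2 * (y \<bullet> (A *v y))" for t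
  proof -
    have "0 \<le> (x + t *\<^sub>R y) \<bullet> (A *v (x + t *\<^sub>R y))"
      using assms by (simp add: psd_def)
    also have "\<dots> = x \<bullet> (A *v x) + 2 * t * (x \<bullet> (A *v y)) + t\<^sup>2 * (y \<bullet> (A *v y))"
      by (simp add: matrix_vector_right_distrib matrix_vector_mult_scaleR inner_add_left inner_add_right sym power2_eq_square algebra_simps)
    finally show ?thesis .
  qed
  show ?thesis
  proof (cases "y \<bullet> (A *v y) = 0")
    case True
    have "x \<bullet> (A *v y) = 0"
    proof (rule ccontr)
      assume nz: "x \<bullet> (A *v y) \<noteq> 0"
      \<comment> \<open>With the quadratic term absent, this value of \<open>t\<close> makes the
        remaining affine expression equal to -1.\<close>
      from q[of "- (x \<bullet> (A *v x) + 1) / (2 * (x \<bullet> (A *v y)))"] show False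
        using nz True by (simp add: field_simps)
    qed
    then show ?thesis using True by simp
  next
    case False
    then have p: "y \<bullet> (A *v y) > 0" using assms by (simp add: psd_def order_less_le)
    from q[of "- (x \<bullet> (A *v y)) / (y \<bullet> (A *v y))"] show ?thesis
      using p by (simp add: field_simps power2_eq_square)
  qed
qed

text \<open>Symmetric Gaussian elimination: subtracting the rank-one part of a nonzero diagonal entry
  clears a row and keeps the matrix positive semidefinite.\<close>

lemma psd_factor:
  fixes A :: "real^'n^'n"
  assumes "psd A"
  obtains N :: "real^'n^'n" where "A = N ** transpose N"
proof -
  \<comment> \<open>The second clause, that the vector of an index vanishes together with the
    diagonal entry, leaves slot \<open>m\<close> free after the elimination; the rank-one vector
    \<open>w\<close> goes there, so one vector per index is enough.\<close>
  have "\<exists>v :: 'n \<Rightarrow> real^'n. (\<forall>i j. A $ i $ j = (\<Sum>l\<in>UNIV. v l $ i * v l $ j)) \<and> (\<forall>l. A $ l $ l = 0 \<longrightarrow> v l = 0)"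
    using assms
  proof (induction "card {i. A $ i $ i \<noteq> 0}" arbitrary: A rule: less_induct)
    case less
    have Ax: "axis i 1 \<bullet> (A *v axis j 1) = A $ i $ j" for A :: "real^'n^'n" and i j
    proof -
      have "(A *v axis j 1) $ i = A $ i $ j"
        by (simp add: matrix_vector_mult_basis column_def)
      then show ?thesis by (simp add: inner_axis')
    qed
    have cs: "(A $ i $ j)\<^sup>2 \<le> A $ i $ i * A $ j $ j" for i j
      using psd_cauchy_schwarz[OF less.prems, of "axis i 1" "axis j 1"] by (simp add: Ax)
    have sym: "A $ i $ j = A $ j $ i" for i j
      using less.prems by (simp add: psd_def sym_mat_def transpose_def vec_eq_iff)
    show ?case
    proof (cases "\<forall>i. A $ i $ i = 0")
      case True
      then have "A $ i $ j = 0" for i j using cs[of i j] by simp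
      then show ?thesis by (intro exI[of _ "\<lambda>_. 0"]) auto
    next
      case False
      then obtain m where m: "A $ m $ m \<noteq> 0" by auto
      have mp: "A $ m $ m > 0"
        using m less.prems Ax[of m A m] unfolding psd_def by (metis order_less_le)
      define w :: "real^'n" where "w = (\<chi> i. A $ i $ m / sqrt (A $ m $ m))"
      define A' :: "real^'n^'n" where "A' = (\<chi> i j. A $ i $ j - w $ i * w $ j)"
      have ww: "w $ i * w $ j = A $ i $ m * A $ j $ m / A $ m $ m" for i j
        using mp by (simp add: w_def)
      have A'x: "x \<bullet> (A' *v x) = x \<bullet> (A *v x) - (w \<bullet> x)\<^sup>2" for x
      proof -
        have "A' *v x = A *v x - (w \<bullet> x) *\<^sub>R w"
          by (simp add: A'_def vec_eq_iff matrix_vector_mult_def left_diff_distrib right_diff_distrib sum_subtractf inner_vec_def sum_distrib_left mult_ac)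
        then show ?thesis by (simp add: inner_diff_right power2_eq_square inner_commute)
      qed
      have psd': "psd A'"
        unfolding psd_def
      proof (intro conjI allI)
        show "sym_mat A'" by (simp add: sym_mat_def transpose_def A'_def vec_eq_iff sym mult.commute)
        fix x
        have wx: "w \<bullet> x = (axis m 1 \<bullet> (A *v x)) / sqrt (A $ m $ m)"
        proof -
          have "(A *v x) $ m = (\<Sum>i\<in>UNIV. A $ i $ m * x $ i)"
            unfolding matrix_vector_mult_def vec_lambda_beta by (rule sum.cong) (simp_all add: sym[of m])
          moreover have "axis m 1 \<bullet> (A *v x) = (A *v x) $ m" by (simp add: inner_axis')
          moreover have "w \<bullet> x = (\<Sum>i\<in>UNIV. A $ i $ m * x $ i) / sqrt (A $ m $ m)"
            by (simp add: inner_vec_def w_def sum_divide_distrib)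
          ultimately show ?thesis by simp
        qed
        have "(w \<bullet> x)\<^sup>2 = (axis m 1 \<bullet> (A *v x))\<^sup>2 / A $ m $ m"
          using mp by (simp add: wx power_divide)
        also have "\<dots> \<le> x \<bullet> (A *v x)"
          using psd_cauchy_schwarz[OF less.prems, of "axis m 1" x] mp by (simp add: Ax field_simps)
        finally show "0 \<le> x \<bullet> (A' *v x)" by (simp add: A'x)
      qed
      have z: "A' $ m $ m = 0" using mp by (simp add: A'_def ww)
      have sub: "A $ i $ i = 0 \<Longrightarrow> A' $ i $ i = 0" for i
        using cs[of i m] by (simp add: A'_def ww)
      have "{i. A' $ i $ i \<noteq> 0} \<subset> {i. A $ i $ i \<noteq> 0}"
        using z m sub by auto
      then have "card {i. A' $ i $ i \<noteq> 0} < card {i. A $ i $ i \<noteq> 0}"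
        by (intro psubset_card_mono) auto
      from less.hyps[OF this psd'] obtain v where v: "\<And>i j. A' $ i $ j = (\<Sum>l\<in>UNIV. v l $ i * v l $ j)" "\<And>l. A' $ l $ l = 0 \<Longrightarrow> v l = 0"
        by blast
      have vm: "v m = 0" using v(2)[OF z] .
      show ?thesis
      proof (intro exI[of _ "v(m := w)"] conjI allI impI)
        fix i j
        have "(\<Sum>l\<in>UNIV. (v(m := w)) l $ i * (v(m := w)) l $ j) = (\<Sum>l\<in>UNIV. v l $ i * v l $ j + (if l = m then w $ i * w $ j else 0))"
          using vm by (intro sum.cong) auto
        also have "\<dots> = A $ i $ j" by (simp add: sum.distrib v(1)[symmetric] A'_def)
        finally show "A $ i $ j = (\<Sum>l\<in>UNIV. (v(m := w)) l $ i * (v(m := w)) l $ j)" ..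
      next
        fix l assume "A $ l $ l = 0"
        then show "(v(m := w)) l = 0" using m v(2) sub by auto
      qed
    qed
  qed
  then obtain v :: "'n \<Rightarrow> real^'n" where v: "\<And>i j. A $ i $ j = (\<Sum>l\<in>UNIV. v l $ i * v l $ j)" by blast
  show thesis
    by (rule that[of "\<chi> i l. v l $ i"]) (simp add: vec_eq_iff matrix_matrix_mult_def transpose_def v)
qed

lemma pos_def_psd: "sym_mat A \<Longrightarrow> pos_def A \<Longrightarrow> psd A"
  unfolding psd_def pos_def_def by (metis inner_zero_left less_eq_real_def)

lemma pos_def_invertible:
  assumes "pos_def A"
  shows "invertible A"
proof -
  have "A *v x \<noteq> 0" if "x \<noteq> 0" for x
    using assms that unfolding pos_def_def by fastforce
  then show ?thesis
    unfolding invertible_left_inverse matrix_left_invertible_ker by blast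
qed

lemma matrix_inv_mult:
  assumes "invertible (A::real^'n^'n)"
  shows "matrix_inv A ** A = mat 1" "A ** matrix_inv A = mat 1" "matrix_inv A *v (A *v x) = x" "A *v (matrix_inv A *v x) = x"
proof -
  show *: "matrix_inv A ** A = mat 1" "A ** matrix_inv A = mat 1"
    using someI_ex[OF assms[unfolded invertible_def]] unfolding matrix_inv_def by auto
  show "matrix_inv A *v (A *v x) = x" "A *v (matrix_inv A *v x) = x"
    by (simp_all add: matrix_vector_mul_assoc *)
qed

lemma matrix_inv_pos_def:
  fixes A :: "real^'n^'n"
  assumes "sym_mat A" "pos_def A"
  shows "sym_mat (matrix_inv A)" "pos_def (matrix_inv A)"
proof -
  note inv = matrix_inv_mult[OF pos_def_invertible[OF assms(2)]]
  have "transpose (matrix_inv A) ** A = mat 1"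
    using inv(2) assms(1) unfolding sym_mat_def by (metis matrix_transpose_mul transpose_mat)
  then show "sym_mat (matrix_inv A)"
    unfolding sym_mat_def by (metis inv(2) matrix_mul_assoc matrix_mul_lid matrix_mul_rid)
  show "pos_def (matrix_inv A)"
    unfolding pos_def_def
  proof (intro allI impI)
    fix x :: "real^'n" assume "x \<noteq> 0"
    then have "matrix_inv A *v x \<noteq> 0" using inv(4)[of x] by auto
    then have "0 < (matrix_inv A *v x) \<bullet> (A *v (matrix_inv A *v x))"
      using assms(2) by (simp add: pos_def_def)
    then show "0 < x \<bullet> (matrix_inv A *v x)" by (simp add: inv inner_commute)
  qed
qed

lemma pos_def_bounds:
  assumes "pos_def (A::real^'n^'n)"
  obtains m M where "0 < m" "0 < M" "\<And>x. m * (norm x)\<^sup>2 \<le> x \<bullet> (A *v x)" "\<And>x. x \<bullet> (A *v x) \<le> M * (norm x)\<^sup>2"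
proof -
  obtain M where M: "0 < M" "\<And>x. norm (A *v x) \<le> norm x * M"
    using bounded_linear.pos_bounded[OF matrix_vector_mul_bounded_linear[of A]] by blast
  have up: "x \<bullet> (A *v x) \<le> M * (norm x)\<^sup>2" for x
  proof -
    have "x \<bullet> (A *v x) \<le> norm x * norm (A *v x)" by (rule norm_cauchy_schwarz)
    also have "\<dots> \<le> norm x * (norm x * M)" by (intro mult_left_mono M) auto
    finally show ?thesis by (simp add: power2_eq_square mult_ac)
  qed
  let ?S = "sphere (0::real^'n) 1"
  have cont: "continuous_on ?S (\<lambda>x. x \<bullet> (A *v x))"
    by (intro continuous_intros)
  have ne: "?S \<noteq> {}" by simp
  obtain x0 where x0: "x0 \<in> ?S" "\<And>x. x \<in> ?S \<Longrightarrow> x0 \<bullet> (A *v x0) \<le> x \<bullet> (A *v x)"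
    using continuous_attains_inf[OF compact_sphere ne cont] by blast
  have p: "0 < x0 \<bullet> (A *v x0)"
  proof -
    have "x0 \<noteq> 0" using x0(1) by auto
    then show ?thesis using assms by (simp add: pos_def_def)
  qed
  have "x0 \<bullet> (A *v x0) * (norm x)\<^sup>2 \<le> x \<bullet> (A *v x)" for x
  proof (cases "x = 0")
    case False
    have "x0 \<bullet> (A *v x0) \<le> (x /\<^sub>R norm x) \<bullet> (A *v (x /\<^sub>R norm x))"
      using False by (intro x0) auto
    also have "\<dots> = (x \<bullet> (A *v x)) / (norm x)\<^sup>2"
      by (simp add: matrix_vector_mult_scaleR power2_eq_square divide_inverse mult_ac)
    finally show ?thesis using False by (simp add: field_simps)
  qed simp
  then show thesis using that p M(1) up by blast
qed

text \<open>The definition compares the inverses, whereas the entropy estimate needs the reversed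
  comparison of \<open>K\<close> and \<open>P\<close>. Cauchy-Schwarz for the form of
  \<open>P\<close>, between \<open>v\<close> and \<open>matrix_inv P *v (K *v v)\<close>, reverses
  it. The supremum satisfies the defining comparison itself, because each quotient of the two forms
  bounds all constants in the set.\<close>

lemma lambdaP_props:
  assumes K: "sym_mat K" "pos_def K" and P: "sym_mat P" "pos_def P"
  shows "0 < lambdaP K P" and "lambdaP K P * (v \<bullet> (K *v v)) \<le> v \<bullet> (P *v v)"
proof -
  note iK = matrix_inv_pos_def[OF K] and iP = matrix_inv_pos_def[OF P]
  note mK = matrix_inv_mult[OF pos_def_invertible[OF K(2)]] and mP = matrix_inv_mult[OF pos_def_invertible[OF P(2)]]
  let ?S = "{c. loewner_le (c *\<^sub>R matrix_inv P) (matrix_inv K)}"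
  have Siff: "c \<in> ?S \<longleftrightarrow> (\<forall>x. c * (x \<bullet> (matrix_inv P *v x)) \<le> x \<bullet> (matrix_inv K *v x))" for c
    unfolding loewner_le_def
    by (simp add: matrix_vector_mult_diff_rdistrib inner_diff_right scaleR_matrix_vector_assoc[symmetric])
  obtain mK' MK where bK: "0 < mK'" "\<And>x. mK' * (norm x)\<^sup>2 \<le> x \<bullet> (matrix_inv K *v x)"
    using pos_def_bounds[OF iK(2)] by metis
  obtain MP where bP: "0 < MP" "\<And>x. x \<bullet> (matrix_inv P *v x) \<le> MP * (norm x)\<^sup>2"
    using pos_def_bounds[OF iP(2)] by metis
  have c0: "mK' / MP \<in> ?S"
    unfolding Siff
  proof
    fix x
    have "mK' / MP * (x \<bullet> (matrix_inv P *v x)) \<le> mK' / MP * (MP * (norm x)\<^sup>2)"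
      using bK(1) bP by (intro mult_left_mono) auto
    also have "\<dots> = mK' * (norm x)\<^sup>2" using bP(1) by simp
    finally show "mK' / MP * (x \<bullet> (matrix_inv P *v x)) \<le> x \<bullet> (matrix_inv K *v x)"
      using bK(2)[of x] by linarith
  qed
  have bd: "c \<le> (x \<bullet> (matrix_inv K *v x)) / (x \<bullet> (matrix_inv P *v x))" if "c \<in> ?S" "x \<noteq> 0" for c x
    using that iP(2) unfolding Siff pos_def_def by (simp add: pos_le_divide_eq)
  have bdd: "bdd_above ?S"
  proof (rule bdd_aboveI)
    \<comment> \<open>Any nonzero vector yields an upper bound; a unit vector at an arbitrary index
      is taken.\<close>
    show "c \<le> (axis undefined 1 \<bullet> (matrix_inv K *v axis undefined 1)) / (axis undefined 1 \<bullet> (matrix_inv P *v axis undefined 1))" if "c \<in> ?S" for c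
      by (rule bd[OF that]) (simp add: axis_eq_0_iff)
  qed
  have "mK' / MP \<le> lambdaP K P"
    unfolding lambdaP_def by (rule cSup_upper[OF c0 bdd])
  moreover have "0 < mK' / MP" using bK(1) bP(1) by simp
  ultimately show pos: "0 < lambdaP K P" by linarith
  have inv_le: "lambdaP K P * (x \<bullet> (matrix_inv P *v x)) \<le> x \<bullet> (matrix_inv K *v x)" for x
  proof (cases "x = 0")
    case False
    have "lambdaP K P \<le> (x \<bullet> (matrix_inv K *v x)) / (x \<bullet> (matrix_inv P *v x))"
      unfolding lambdaP_def by (rule cSup_least) (use c0 bd[OF _ False] in auto)
    then show ?thesis using False iP(2) unfolding pos_def_def by (simp add: pos_le_divide_eq)
  qed simp
  show "lambdaP K P * (v \<bullet> (K *v v)) \<le> v \<bullet> (P *v v)"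
  proof (cases "v = 0")
    case False
    let ?w = "K *v v"
    have k: "0 < v \<bullet> ?w" using False K(2) by (simp add: pos_def_def)
    have 1: "lambdaP K P * (?w \<bullet> (matrix_inv P *v ?w)) \<le> v \<bullet> ?w"
      using inv_le[of ?w] by (simp add: mK inner_commute)
    have "(v \<bullet> ?w)\<^sup>2 = (v \<bullet> (P *v (matrix_inv P *v ?w)))\<^sup>2"
      by (simp add: mP)
    also have "\<dots> \<le> (v \<bullet> (P *v v)) * (?w \<bullet> (matrix_inv P *v ?w))"
      using psd_cauchy_schwarz[OF pos_def_psd[OF P], of v "matrix_inv P *v ?w"] by (simp add: mP inner_commute)
    finally have 2: "(v \<bullet> ?w)\<^sup>2 \<le> (v \<bullet> (P *v v)) * (?w \<bullet> (matrix_inv P *v ?w))" .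
    have vP: "0 \<le> v \<bullet> (P *v v)" using pos_def_psd[OF P] by (simp add: psd_def)
    have "lambdaP K P * (v \<bullet> ?w) * (v \<bullet> ?w) \<le> (v \<bullet> (P *v v)) * (lambdaP K P * (?w \<bullet> (matrix_inv P *v ?w)))"
      using mult_left_mono[OF 2, of "lambdaP K P"] pos by (simp add: power2_eq_square mult_ac)
    also have "\<dots> \<le> (v \<bullet> (P *v v)) * (v \<bullet> ?w)"
      using 1 vP by (rule mult_left_mono)
    finally show ?thesis using k by simp
  qed simp
qed

text \<open>Gronwall for a quadratic form along a linear flow: \<open>exp (2 * \<nu> * t)\<close>
  times the form has nonpositive derivative. It is applied to \<open>P\<close> at the decay rate and
  to \<open>K\<close> at rate 0.\<close>

lemma quadratic_form_decay:
  fixes y :: "real \<Rightarrow> real^'n"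
  assumes P: "sym_mat P" and y: "\<And>t. (y has_vector_derivative A *v y t) (at t)"
    and le: "\<And>x. x \<bullet> (P *v (A *v x)) \<le> - \<nu> * (x \<bullet> (P *v x))" and t: "0 \<le> t"
  shows "y t \<bullet> (P *v y t) \<le> exp (- 2 * \<nu> * t) * (y 0 \<bullet> (P *v y 0))"
proof -
  let ?q = "\<lambda>t. y t \<bullet> (P *v y t)"
  have q: "(?q has_real_derivative 2 * (y t \<bullet> (P *v (A *v y t)))) (at t)" for t
  proof -
    have yd: "(y has_derivative (\<lambda>h. h *\<^sub>R (A *v y t))) (at t)"
      using y[of t] by (simp add: has_vector_derivative_def)
    have "((\<lambda>t. P *v y t) has_derivative (\<lambda>h. P *v (h *\<^sub>R (A *v y t)))) (at t)"
      using yd by (rule bounded_linear.has_derivative[OF matrix_vector_mul_bounded_linear])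
    from has_derivative_inner[OF yd this] show ?thesis
      unfolding has_field_derivative_def
    proof (rule has_derivative_eq_rhs)
      have "(A *v y t) \<bullet> (P *v y t) = y t \<bullet> (P *v (A *v y t))"
        using sym_mat_inner[OF P, of "y t" "A *v y t"] by (simp add: inner_commute)
      then show "(\<lambda>h. y t \<bullet> (P *v (h *\<^sub>R (A *v y t))) + (h *\<^sub>R (A *v y t)) \<bullet> (P *v y t)) = (*) (2 * (y t \<bullet> (P *v (A *v y t))))"
        by (simp add: fun_eq_iff matrix_vector_mult_scaleR)
    qed
  qed
  have "exp (2 * \<nu> * t) * ?q t \<le> exp (2 * \<nu> * 0) * ?q 0"
  proof (rule DERIV_nonpos_imp_nonincreasing[where f="\<lambda>t. exp (2 * \<nu> * t) * ?q t"])
    fix s :: real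
    have "((\<lambda>t. exp (2 * \<nu> * t) * ?q t) has_real_derivative
        exp (2 * \<nu> * s) * (2 * (y s \<bullet> (P *v (A *v y s))) + 2 * \<nu> * ?q s)) (at s)"
      by (rule derivative_eq_intros q refl)+ (simp add: algebra_simps)
    moreover have "exp (2 * \<nu> * s) * (2 * (y s \<bullet> (P *v (A *v y s))) + 2 * \<nu> * ?q s) \<le> 0"
      using le[of "y s"] by (intro mult_nonneg_nonpos) auto
    ultimately show "\<exists>d. ((\<lambda>t. exp (2 * \<nu> * t) * ?q t) has_real_derivative d) (at s) \<and> d \<le> 0" by blast
  qed (use t in auto)
  then have "exp (- 2 * \<nu> * t) * (exp (2 * \<nu> * t) * ?q t) \<le> exp (- 2 * \<nu> * t) * ?q 0"
    by (intro mult_left_mono) auto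
  then show ?thesis by (simp add: exp_minus mult.assoc[symmetric])
qed

text \<open>Any square factor \<open>M\<close> of \<open>K\<close> serves, symmetric or not: the
  change of variables \<open>x = M *v z\<close> turns the form of the inverse of \<open>K\<close>
  into \<open>z \<bullet> z\<close>, and \<open>det K powr (-1/2)\<close> cancels the Jacobian.
  Integrals against the steady state thus become integrals against the standard Gaussian.\<close>

lemma gauss_image_density:
  fixes K M :: "real^'n^'n"
  assumes K: "sym_mat K" "pos_def K" and M: "K = M ** transpose M"
  shows "density lborel (\<lambda>x. ennreal (finf K x)) = distr gauss borel ((*v) M)"
    and "finf K (M *v z) > 0" and "invertible M"
proof -
  have detK: "det K = (det M)\<^sup>2"
    by (simp add: M det_mul power2_eq_square)
  have "det K \<noteq> 0" using pos_def_invertible[OF K(2)] by (simp add: invertible_det_nz)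
  then have dM: "det M \<noteq> 0" by (simp add: detK)
  then show iM: "invertible M" by (simp add: invertible_det_nz)
  note mM = matrix_inv_mult[OF iM] and mK = matrix_inv_mult[OF pos_def_invertible[OF K(2)]]
  have pw: "det K powr (-1/2) = 1 / \<bar>det M\<bar>"
  proof -
    have "det K = \<bar>det M\<bar> powr 2" using dM by (simp add: detK powr_numeral)
    then have "det K powr (-1/2) = \<bar>det M\<bar> powr (2 * (-1/2))" by (simp only: powr_powr)
    then show ?thesis using dM by (simp add: powr_minus_divide)
  qed
  have qf: "(M *v z) \<bullet> (matrix_inv K *v (M *v z)) = z \<bullet> z" for z
  proof -
    have "transpose M *v (matrix_inv K *v (M *v z)) = z"
    proof -
      have "M *v (transpose M *v (matrix_inv K *v (M *v z))) = M *v z"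
        using mK(4)[of "M *v z"] by (simp add: M matrix_vector_mul_assoc matrix_mul_assoc)
      then show ?thesis by (metis mM(3))
    qed
    then show ?thesis by (simp add: inner_matrix_transpose)
  qed
  have fM: "finf K (M *v z) = gauss_density z / \<bar>det M\<bar>" for z
    unfolding finf_def gauss_density_def pw qf by simp
  then show "finf K (M *v z) > 0" using dM gauss_density_pos[of z] by simp
  have fm[measurable]: "finf K \<in> borel_measurable borel"
    unfolding finf_def[abs_def]
    by (intro borel_measurable_continuous_onI continuous_intros) auto
  have mv[measurable]: "(*v) M \<in> borel_measurable borel"
    by (intro borel_measurable_continuous_onI linear_continuous_on) simp
  show "density lborel (\<lambda>x. ennreal (finf K x)) = distr gauss borel ((*v) M)"
  proof (rule measure_eqI)
    fix B assume "B \<in> sets (density lborel (\<lambda>x. ennreal (finf K x)))"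
    then have B[measurable]: "B \<in> sets borel" by simp
    have "emeasure (density lborel (\<lambda>x. ennreal (finf K x))) B = (\<integral>\<^sup>+x. ennreal (finf K x) * indicator B x \<partial>lborel)"
      by (simp add: emeasure_density)
    also have "\<dots> = ennreal \<bar>det M\<bar> * (\<integral>\<^sup>+x. ennreal (finf K (M *v x)) * indicator B (M *v x) \<partial>lborel)"
      by (rule nn_integral_lborel_matrix[OF dM]) measurable
    also have "\<dots> = (\<integral>\<^sup>+x. ennreal (gauss_density x) * indicator B (M *v x) \<partial>lborel)"
      using dM by (subst nn_integral_cmult[symmetric])
        (auto simp: fM mult.assoc[symmetric] ennreal_mult[symmetric] less_imp_le[OF gauss_density_pos])
    also have "\<dots> = (\<integral>\<^sup>+x. indicator B (M *v x) \<partial>gauss)"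
      unfolding gauss_def by (subst nn_integral_density) auto
    also have "\<dots> = (\<integral>\<^sup>+x. indicator B x \<partial>distr gauss borel ((*v) M))"
      by (subst nn_integral_distr) auto
    also have "\<dots> = emeasure (distr gauss borel ((*v) M)) B"
      by simp
    finally show "emeasure (density lborel (\<lambda>x. ennreal (finf K x))) B = emeasure (distr gauss borel ((*v) M)) B" .
  qed simp
qed

section \<open>The Fourier transform of a solution\<close>

lemma integral_lborel_translate:
  fixes u :: "'a::euclidean_space \<Rightarrow> real"
  assumes [measurable]: "u \<in> borel_measurable borel"
  shows "(\<integral>x. u (c + x) \<partial>lborel) = (\<integral>x. u x \<partial>lborel)"
  by (subst (2) lborel_distr_plus[of c, symmetric], subst integral_distr) auto

lemma integrable_indicator_cball: "integrable lborel (indicator (cball a r) :: 'a::euclidean_space \<Rightarrow> real)"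
  using emeasure_bounded_finite[OF bounded_cball] by (intro integrable_real_indicator) auto

lemma integrable_continuous_compact_support:
  fixes u :: "'a::euclidean_space \<Rightarrow> real"
  assumes c: "continuous_on UNIV u" and s: "\<And>x. R < norm x \<Longrightarrow> u x = 0"
  shows "integrable lborel u"
proof -
  have "compact (u ` cball 0 R)"
    using continuous_on_subset[OF c] by (intro compact_continuous_image) auto
  then obtain B where B: "\<And>y. y \<in> u ` cball 0 R \<Longrightarrow> norm y \<le> B"
    using compact_imp_bounded bounded_iff by metis
  have [measurable]: "u \<in> borel_measurable borel" using c by (rule borel_measurable_continuous_onI)
  show ?thesis
  proof (rule Bochner_Integration.integrable_bound[of lborel "\<lambda>x::'a. B * indicator (cball 0 R) x"])
    show "integrable lborel (\<lambda>x::'a. B * indicator (cball 0 R) x)"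
      by (intro integrable_mult_right integrable_indicator_cball)
    show "AE x in lborel. norm (u x) \<le> norm (B * indicator (cball 0 R) x)"
    proof (rule AE_I2)
      fix x show "norm (u x) \<le> norm (B * indicator (cball 0 R) x)"
        using s[of x] B[of "u x"] by (cases "norm x \<le> R") (auto simp: indicator_def)
    qed
  qed simp
qed

text \<open>The integral of the translate \<open>u (h *\<^sub>R e + x)\<close> does not depend on
  \<open>h\<close>; differentiating under the integral at \<open>h = 0\<close> gives the claim.
  Compact support supplies the dominating function.\<close>

lemma integral_derivative_compact_support:
  fixes u :: "'a::euclidean_space \<Rightarrow> real"
  assumes d: "\<And>x. (u has_derivative (\<lambda>h. gu x \<bullet> h)) (at x)" and c: "continuous_on UNIV gu"
    and s: "\<And>x. R < norm x \<Longrightarrow> u x = 0 \<and> gu x = 0"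
  shows "(\<integral>x. gu x \<bullet> e \<partial>lborel) = 0"
proof -
  have cu: "continuous_on UNIV u"
    using has_derivative_continuous[OF d] by (auto simp: continuous_on_eq_continuous_at)
  have [measurable]: "u \<in> borel_measurable borel" "gu \<in> borel_measurable borel"
    using cu c by (auto intro: borel_measurable_continuous_onI)
  have "compact (gu ` cball 0 R)"
    using continuous_on_subset[OF c] by (intro compact_continuous_image) auto
  then obtain B0 where B0: "\<And>y. y \<in> gu ` cball 0 R \<Longrightarrow> norm y \<le> B0"
    using compact_imp_bounded bounded_iff by metis
  define B where "B = max 0 B0"
  have B: "norm (gu x) \<le> B" for x
    using s[of x] B0[of "gu x"] by (cases "norm x \<le> R") (auto simp: B_def)
  let ?w = "\<lambda>x::'a. B * norm e * indicator (cball 0 (R + norm e)) x"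
  have b: "norm (gu (h *\<^sub>R e + x) \<bullet> e) \<le> ?w x" if "\<bar>h\<bar> < 1" for h x
  proof (cases "norm x \<le> R + norm e")
    case True
    have "norm (gu (h *\<^sub>R e + x) \<bullet> e) \<le> norm (gu (h *\<^sub>R e + x)) * norm e"
      using Cauchy_Schwarz_ineq2 by auto
    also have "\<dots> \<le> B * norm e" by (intro mult_right_mono B) auto
    finally show ?thesis using True by simp
  next
    case False
    have "norm x \<le> norm (h *\<^sub>R e + x) + norm (h *\<^sub>R e)"
      using norm_triangle_ineq4[of "h *\<^sub>R e + x" "h *\<^sub>R e"] by simp
    moreover have "norm (h *\<^sub>R e) \<le> norm e" using that by (simp add: mult_left_le_one_le)
    ultimately have "R < norm (h *\<^sub>R e + x)" using False by simp
    then show ?thesis using s False by simp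
  qed
  have "((\<lambda>h::real. \<integral>x. u (h *\<^sub>R e + x) \<partial>lborel) has_derivative (\<lambda>v. (\<integral>x. gu (0 *\<^sub>R e + x) \<bullet> e \<partial>lborel) \<bullet> v)) (at 0)"
  proof (rule has_derivative_integral_dominated(1)[where r=1 and D="\<lambda>h x. gu (h *\<^sub>R e + x) \<bullet> e" and B="?w"])
    show "integrable lborel (\<lambda>x. u (0 *\<^sub>R e + x))"
      using integrable_continuous_compact_support[OF cu, of R] s by simp
    show "integrable lborel ?w"
      by (intro integrable_mult_right integrable_indicator_cball)
    show "((\<lambda>y. u (y *\<^sub>R e + z)) has_derivative (\<lambda>v. (gu (x *\<^sub>R e + z) \<bullet> e) \<bullet> v)) (at x)" for x z
    proof -
      have "((\<lambda>y. y *\<^sub>R e + z) has_derivative (\<lambda>v. v *\<^sub>R e)) (at x)"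
        by (auto intro!: derivative_eq_intros)
      from has_derivative_compose[OF this d] show ?thesis
        by (rule has_derivative_eq_rhs) (auto simp: mult.commute)
    qed
  qed (use b in \<open>auto simp: dist_real_def\<close>)
  moreover have "(\<lambda>h::real. \<integral>x. u (h *\<^sub>R e + x) \<partial>lborel) = (\<lambda>h. \<integral>x. u x \<partial>lborel)"
    by (simp add: integral_lborel_translate)
  ultimately have "((\<lambda>h::real. \<integral>x. u x \<partial>lborel) has_derivative (\<lambda>v. (\<integral>x. gu x \<bullet> e \<partial>lborel) \<bullet> v)) (at 0)"
    by simp
  from has_derivative_unique[OF this has_derivative_const] show ?thesis
    by (auto simp: fun_eq_iff dest: spec[of _ 1])
qed

lemma integral_by_parts_lborel:
  fixes a \<phi> :: "'a::euclidean_space \<Rightarrow> real"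
  assumes a: "\<And>x. (a has_derivative (\<lambda>h. ga x \<bullet> h)) (at x)" and ca: "continuous_on UNIV ga"
    and p: "\<And>x. (\<phi> has_derivative (\<lambda>h. gp x \<bullet> h)) (at x)" and cp: "continuous_on UNIV gp"
    and s: "\<And>x. R < norm x \<Longrightarrow> \<phi> x = 0 \<and> gp x = 0"
  shows "(\<integral>x. (ga x \<bullet> e) * \<phi> x \<partial>lborel) = - (\<integral>x. a x * (gp x \<bullet> e) \<partial>lborel)"
    and "integrable lborel (\<lambda>x. (ga x \<bullet> e) * \<phi> x)" and "integrable lborel (\<lambda>x. a x * (gp x \<bullet> e))"
proof -
  have c: "continuous_on UNIV a" "continuous_on UNIV \<phi>"
    using has_derivative_continuous[OF a] has_derivative_continuous[OF p] by (auto simp: continuous_on_eq_continuous_at)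
  show i: "integrable lborel (\<lambda>x. (ga x \<bullet> e) * \<phi> x)" "integrable lborel (\<lambda>x. a x * (gp x \<bullet> e))"
    using s by (auto intro!: integrable_continuous_compact_support[where R=R] continuous_intros c ca cp)
  have "(\<integral>x. (\<phi> x *\<^sub>R ga x + a x *\<^sub>R gp x) \<bullet> e \<partial>lborel) = 0"
  proof (rule integral_derivative_compact_support[where u="\<lambda>x. a x * \<phi> x" and R=R])
    show "((\<lambda>x. a x * \<phi> x) has_derivative (\<lambda>h. (\<phi> x *\<^sub>R ga x + a x *\<^sub>R gp x) \<bullet> h)) (at x)" for x
      by (rule has_derivative_eq_rhs[OF has_derivative_mult[OF a p]]) (auto simp: inner_add_left mult.commute)
    show "continuous_on UNIV (\<lambda>x. \<phi> x *\<^sub>R ga x + a x *\<^sub>R gp x)"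
      by (intro continuous_intros c ca cp)
  qed (use s in auto)
  then show "(\<integral>x. (ga x \<bullet> e) * \<phi> x \<partial>lborel) = - (\<integral>x. a x * (gp x \<bullet> e) \<partial>lborel)"
    using i by (simp add: inner_add_left mult.commute)
qed

text \<open>A truncated paraboloid, for \<open>r > 0\<close> with support of radius
  \<open>1 / sqrt r\<close>. Its square is once and its cube twice continuously differentiable, with
  explicit derivatives: the cube suits the second-order equation, the square the mollifier and the
  cut-off of densities.\<close>

definition bump :: "real \<Rightarrow> 'a::euclidean_space \<Rightarrow> real" where
  "bump r x = max 0 (1 - r * (x \<bullet> x))"

lemma bump_bounds: "0 \<le> bump r x" "0 \<le> r \<Longrightarrow> bump r x \<le> 1"
  by (auto simp: bump_def)

lemma bump_support: "0 < r \<Longrightarrow> bump r x \<noteq> 0 \<Longrightarrow> r * (norm x)\<^sup>2 < 1"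
  by (auto simp: bump_def power2_norm_eq_inner max_def split: if_splits)

lemma bump_continuous: "continuous_on S (bump r)"
  unfolding bump_def[abs_def] by (intro continuous_intros)

lemma bump_tendsto_1:
  assumes "r \<longlonglongrightarrow> 0"
  shows "(\<lambda>n. bump (r n) x) \<longlonglongrightarrow> 1"
proof -
  have "(\<lambda>n. max 0 (1 - r n * (x \<bullet> x))) \<longlonglongrightarrow> max 0 (1 - 0 * (x \<bullet> x))"
    by (intro tendsto_intros assms)
  then show ?thesis by (simp add: bump_def)
qed

lemma max_power_deriv:
  fixes a :: real
  assumes "2 \<le> k"
  shows "((\<lambda>y. max 0 y ^ k) has_real_derivative real k * max 0 a ^ (k - 1)) (at a)"
proof -
  consider "a > 0" | "a < 0" | "a = 0" by linarith
  then show ?thesis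
  proof cases
    case 1
    have "((\<lambda>y. y ^ k) has_real_derivative real k * a ^ (k - 1)) (at a)"
      by (auto intro!: derivative_eq_intros)
    then show ?thesis
    proof (rule DERIV_cong_ev[THEN iffD1, rotated -1, OF _ refl _ ])
      show "\<forall>\<^sub>F x in nhds a. x ^ k = max 0 x ^ k"
        using eventually_nhds_in_open[of "{0<..}" a] 1 by (auto elim!: eventually_mono)
      show "real k * a ^ (k - 1) = real k * max 0 a ^ (k - 1)" using 1 by simp
    qed
  next
    case 2
    have "((\<lambda>y. 0) has_real_derivative 0) (at a)" by simp
    then show ?thesis
    proof (rule DERIV_cong_ev[THEN iffD1, rotated -1, OF _ refl _ ])
      show "\<forall>\<^sub>F x in nhds a. 0 = max 0 x ^ k"
        using eventually_nhds_in_open[of "{..<0}" a] 2 assms by (auto elim!: eventually_mono)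
      show "0 = real k * max 0 a ^ (k - 1)" using 2 assms by simp
    qed
  next
    case 3
    have q: "((\<lambda>h::real. max 0 h ^ k / h) \<longlongrightarrow> 0) (at 0)"
    proof (rule Lim_null_comparison[where g="\<lambda>h. \<bar>h\<bar> ^ (k - 1)"])
      show "\<forall>\<^sub>F h in at 0. norm (max 0 h ^ k / h) \<le> \<bar>h\<bar> ^ (k - 1)"
      proof (rule eventuallyI)
        fix h :: real
        have "max 0 h ^ k = max 0 h ^ (k - 1) * max 0 h" using assms by (cases k) auto
        then have "norm (max 0 h ^ k / h) = max 0 h ^ (k - 1) * (max 0 h / \<bar>h\<bar>)" by (simp add: abs_mult)
        also have "max 0 h / \<bar>h\<bar> \<le> 1" by (cases "h = 0") (auto simp: divide_le_eq_1)
        then have "max 0 h ^ (k - 1) * (max 0 h / \<bar>h\<bar>) \<le> \<bar>h\<bar> ^ (k - 1) * 1"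
          by (intro mult_mono power_mono) auto
        finally show "norm (max 0 h ^ k / h) \<le> \<bar>h\<bar> ^ (k - 1)" by simp
      qed
      have "((\<lambda>h::real. \<bar>h\<bar> ^ (k - 1)) \<longlongrightarrow> \<bar>0\<bar> ^ (k - 1)) (at 0)"
        by (intro tendsto_intros)
      moreover have "\<bar>0::real\<bar> ^ (k - 1) = 0" using assms by simp
      ultimately show "((\<lambda>h::real. \<bar>h\<bar> ^ (k - 1)) \<longlongrightarrow> 0) (at 0)" by (simp only:)
    qed
    have z: "(0::real) ^ k = 0" "(0::real) ^ (k - 1) = 0" using assms by auto
    show ?thesis
      unfolding 3 DERIV_def add_0 max.idem z diff_0_right mult_zero_right by (rule q)
  qed
qed

lemma bump_power_deriv:
  assumes "2 \<le> k"
  shows "((\<lambda>x. bump r x ^ k) has_derivative (\<lambda>h. ((- 2 * real k * r * bump r x ^ (k - 1)) *\<^sub>R x) \<bullet> h)) (at x)"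
proof -
  have "((\<lambda>x. 1 - r * (x \<bullet> x)) has_derivative (\<lambda>h. - 2 * r * (x \<bullet> h))) (at x)"
    by (auto intro!: derivative_eq_intros simp: inner_commute)
  from has_derivative_compose[OF this max_power_deriv[OF assms, unfolded has_field_derivative_def]]
  show ?thesis
    unfolding bump_def by (rule has_derivative_eq_rhs) (auto simp: fun_eq_iff)
qed

lemma L1dist_integral:
  fixes g h :: "real^'n \<Rightarrow> real"
  assumes "integrable lborel g" "integrable lborel h"
  shows "L1dist g h = ennreal (\<integral>x. \<bar>g x - h x\<bar> \<partial>lborel)"
  unfolding L1dist_def using assms by (intro nn_integral_eq_integral) auto

lemma L1dist_tendsto:
  fixes f :: "real \<Rightarrow> real^'n \<Rightarrow> real"
  assumes int: "\<forall>t\<ge>0. integrable lborel (f t)"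
    and L: "((\<lambda>t. L1dist (f t) (f s)) \<longlongrightarrow> 0) (at s within {0..})" and s: "0 \<le> s"
  shows "((\<lambda>t. \<integral>x. \<bar>f t x - f s x\<bar> \<partial>lborel) \<longlongrightarrow> 0) (at s within {0..})"
proof -
  have "\<forall>\<^sub>F t in at s within {0..}. L1dist (f t) (f s) = ennreal (\<integral>x. \<bar>f t x - f s x\<bar> \<partial>lborel)"
    using int s by (auto simp: eventually_at_filter intro!: always_eventually L1dist_integral)
  from tendsto_cong[OF this] L
  have "((\<lambda>t. ennreal (\<integral>x. \<bar>f t x - f s x\<bar> \<partial>lborel)) \<longlongrightarrow> ennreal 0) (at s within {0..})"
    by simp
  then show ?thesis by (subst (asm) tendsto_ennreal_iff) auto
qed

text \<open>On the support \<open>r * (norm x)\<^sup>2 < 1\<close>, so one factor \<open>r\<close>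
  pays for two powers of \<open>norm x\<close>. The bounds are uniform in \<open>r\<close> and serve
  to dominate the cut-off errors against a density that is merely integrable; smallness comes only
  pointwise, as \<open>r\<close> tends to 0.\<close>

lemma bump_err_bounds:
  fixes x :: "'a::euclidean_space"
  assumes r: "0 < r" "r \<le> 1"
  shows "r * bump r x ^ 2 * norm x \<le> 1" "r * bump r x ^ 2 * (norm x)\<^sup>2 \<le> 1" "r\<^sup>2 * bump r x * (norm x)\<^sup>2 \<le> 1" "r * bump r x ^ 2 \<le> 1"
proof -
  have b: "0 \<le> bump r x" "bump r x \<le> 1" using bump_bounds(1)[of r x] bump_bounds(2)[of r x] r by auto
  then have b2: "bump r x ^ 2 \<le> 1" by (simp add: power_le_one)
  show "r * bump r x ^ 2 \<le> 1" using r b2 by (simp add: mult_le_one)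
  show q: "r * bump r x ^ 2 * (norm x)\<^sup>2 \<le> 1"
  proof (cases "bump r x = 0")
    case False
    then have "r * (norm x)\<^sup>2 \<le> 1" using bump_support[OF r(1), of x] by simp
    then have "bump r x ^ 2 * (r * (norm x)\<^sup>2) \<le> 1 * 1" using b2 r by (intro mult_mono) auto
    then show ?thesis by (simp add: mult_ac)
  qed simp
  show "r\<^sup>2 * bump r x * (norm x)\<^sup>2 \<le> 1"
  proof (cases "bump r x = 0")
    case False
    then have "r * (norm x)\<^sup>2 \<le> 1" using bump_support[OF r(1), of x] by simp
    moreover have "r * bump r x \<le> 1" using b r by (intro mult_le_one) auto
    ultimately have "(r * bump r x) * (r * (norm x)\<^sup>2) \<le> 1 * 1" using r by (intro mult_mono) auto
    then show ?thesis by (simp add: mult_ac power2_eq_square)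
  qed simp
  show "r * bump r x ^ 2 * norm x \<le> 1"
  proof (cases "norm x \<le> 1")
    case True
    then show ?thesis using r b2 by (intro mult_le_one) auto
  next
    case False
    then have "norm x \<le> (norm x)\<^sup>2"
      using mult_right_mono[of 1 "norm x" "norm x"] by (simp add: power2_eq_square)
    then have "r * bump r x ^ 2 * norm x \<le> r * bump r x ^ 2 * (norm x)\<^sup>2" using r b by (intro mult_left_mono) auto
    then show ?thesis using q by linarith
  qed
qed

text \<open>Tested with a plane wave, the drift becomes transport of the frequency and the diffusion
  becomes multiplication by \<open>- (\<eta> \<bullet> (D *v \<eta>))\<close>. Along the
  characteristic \<eta> the transform times an integrating factor is therefore constant in time.
  Plane waves lack compact support, so they are cut off by a bump whose contribution vanishes in the
  limit; time 0 is reached through continuity in L1.\<close>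

lemma solution_fourier:
  fixes D C K :: "real^'n^'n" and E :: "real \<Rightarrow> real^'n^'n"
  assumes sol: "is_solution D C f0 f" and Dsym: "sym_mat D" and Ksym: "sym_mat K"
    and lyap: "2 *\<^sub>R D = C ** K + K ** transpose C"
    and E0: "E 0 = mat 1"
    and E': "\<And>t v. ((\<lambda>t. transpose (E t) *v v) has_vector_derivative transpose (- C) *v (transpose (E t) *v v)) (at t)"
    and t: "0 < t"
  shows "(\<integral>x. f t x * cos (\<xi> \<bullet> x + p) \<partial>lborel)
      = exp (((transpose (E t) *v \<xi>) \<bullet> (K *v (transpose (E t) *v \<xi>)) - \<xi> \<bullet> (K *v \<xi>)) / 2)
        * (\<integral>x. f0 x * cos ((transpose (E t) *v \<xi>) \<bullet> x + p) \<partial>lborel)"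
proof -
  have f0: "f 0 = f0" and fint: "\<forall>t\<ge>0. integrable lborel (f t)"
    and L1: "\<And>s. s \<ge> 0 \<Longrightarrow> ((\<lambda>t. L1dist (f t) (f s)) \<longlongrightarrow> 0) (at s within {0..})"
    using sol unfolding is_solution_def by auto
  obtain ft gf dJ where
    cf0: "continuous_on ({0<..} \<times> UNIV) (\<lambda>(t,x). f t x)" and
    cft0: "continuous_on ({0<..} \<times> UNIV) (\<lambda>(t,x). ft t x)" and
    cgf0: "continuous_on ({0<..} \<times> UNIV) (\<lambda>(t,x). gf t x)" and
    cdJ0: "continuous_on ({0<..} \<times> UNIV) (\<lambda>(t,x). dJ t x)" and
    der: "\<forall>t>0. \<forall>x.
           ((\<lambda>s. f s x) has_real_derivative ft t x) (at t) \<and>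
           (f t has_derivative (\<lambda>h. gf t x \<bullet> h)) (at x) \<and>
           ((\<lambda>y. D *v gf t y + f t y *\<^sub>R (C *v y)) has_derivative (\<lambda>h. dJ t x *v h)) (at x) \<and>
           ft t x = (\<Sum>i\<in>UNIV. dJ t x $ i $ i)"
    using sol unfolding is_solution_def by blast
  have cf: "continuous_on ({0<..} \<times> UNIV) (\<lambda>z. f (fst z) (snd z))"
    and cft: "continuous_on ({0<..} \<times> UNIV) (\<lambda>z. ft (fst z) (snd z))"
    and cgf: "continuous_on ({0<..} \<times> UNIV) (\<lambda>z. gf (fst z) (snd z))"
    and cdJ: "continuous_on ({0<..} \<times> UNIV) (\<lambda>z. dJ (fst z) (snd z))"
    using cf0 cft0 cgf0 cdJ0 by (simp_all add: case_prod_unfold)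
  have slice: "continuous_on UNIV (\<lambda>x. q s x)"
    if "continuous_on ({0<..} \<times> UNIV) (\<lambda>z. q (fst z) (snd z))" "s > 0" for q :: "real \<Rightarrow> real^'n \<Rightarrow> 'b::topological_space" and s
  proof -
    have "continuous_on UNIV (\<lambda>x::real^'n. (s, x))" by (intro continuous_intros)
    from continuous_on_compose2[OF that(1) this] that(2) show ?thesis by auto
  qed
  have fm: "f s \<in> borel_measurable borel" if "s \<ge> 0" for s
    using fint that borel_measurable_integrable by fastforce
  \<comment> \<open>The characteristic that arrives at \<xi> at time \<open>t\<close>; letting the
    test frequency move along it cancels the drift term.\<close>
  define \<eta> where "\<eta> s = transpose (E (t - s)) *v \<xi>" for s
  have \<eta>d: "(\<eta> has_vector_derivative transpose C *v \<eta> s) (at s)" for s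
  proof -
    have "((\<lambda>s. transpose (E (t - s)) *v \<xi>) has_derivative (\<lambda>h. (- h) *\<^sub>R (transpose (- C) *v \<eta> s))) (at s)"
      unfolding \<eta>_def
      by (rule has_derivative_compose[OF _ E'[unfolded has_vector_derivative_def]]) (auto intro!: derivative_eq_intros)
    moreover have "transpose (- C) *v w = - (transpose C *v w)" for w
      by (simp add: transpose_def matrix_vector_mult_def vec_eq_iff sum_negf)
    ultimately show ?thesis by (simp add: has_vector_derivative_def \<eta>_def[abs_def])
  qed
  have \<eta>t: "\<eta> t = \<xi>" by (simp add: \<eta>_def E0 transpose_mat)
  have c\<eta>: "continuous_on S \<eta>" for S
    using \<eta>d by (intro continuous_at_imp_continuous_on ballI has_vector_derivative_continuous) auto
  \<comment> \<open>The Lyapunov equation makes half the \<open>K\<close>-form of \<eta> a primitive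
    of \<open>\<eta> s \<bullet> (D *v \<eta> s)\<close>, so \<open>exp (k s)\<close> is the
    integrating factor.\<close>
  define k where "k s = (\<eta> s \<bullet> (K *v \<eta> s)) / 2" for s
  have kd: "(k has_real_derivative \<eta> s \<bullet> (D *v \<eta> s)) (at s)" for s
  proof -
    have yd: "(\<eta> has_derivative (\<lambda>h. h *\<^sub>R (transpose C *v \<eta> s))) (at s)"
      using \<eta>d[of s] by (simp add: has_vector_derivative_def)
    have Ky: "((\<lambda>s. K *v \<eta> s) has_derivative (\<lambda>h. K *v (h *\<^sub>R (transpose C *v \<eta> s)))) (at s)"
      using yd by (rule bounded_linear.has_derivative[OF matrix_vector_mul_bounded_linear])
    have e: "2 * (\<eta> s \<bullet> (D *v \<eta> s)) = \<eta> s \<bullet> (K *v (transpose C *v \<eta> s)) + (transpose C *v \<eta> s) \<bullet> (K *v \<eta> s)"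
    proof -
      have "2 * (\<eta> s \<bullet> (D *v \<eta> s)) = \<eta> s \<bullet> ((2 *\<^sub>R D) *v \<eta> s)"
        by (simp add: scaleR_matrix_vector_assoc[symmetric])
      also have "\<dots> = \<eta> s \<bullet> (C *v (K *v \<eta> s)) + \<eta> s \<bullet> (K *v (transpose C *v \<eta> s))"
        by (simp only: lyap matrix_vector_mult_add_rdistrib inner_add_right matrix_vector_mul_assoc)
      also have "\<eta> s \<bullet> (C *v (K *v \<eta> s)) = (transpose C *v \<eta> s) \<bullet> (K *v \<eta> s)"
        using inner_matrix_transpose[of C "K *v \<eta> s" "\<eta> s"] by (simp only: inner_commute)
      finally show ?thesis by simp
    qed
    have "((\<lambda>s. \<eta> s \<bullet> (K *v \<eta> s)) has_real_derivative 2 * (\<eta> s \<bullet> (D *v \<eta> s))) (at s)"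
      unfolding has_field_derivative_def
      by (rule has_derivative_eq_rhs[OF has_derivative_inner[OF yd Ky]])
         (simp add: fun_eq_iff matrix_vector_mult_scaleR e algebra_simps)
    from DERIV_cdivide[OF this, of 2] show ?thesis by (simp add: k_def[abs_def])
  qed
  obtain nD where nD: "0 < nD" "\<And>x. norm (D *v x) \<le> norm x * nD"
    using bounded_linear.pos_bounded[OF matrix_vector_mul_bounded_linear[of D]] by blast
  obtain nC where nC: "0 < nC" "\<And>x. norm (C *v x) \<le> norm x * nC"
    using bounded_linear.pos_bounded[OF matrix_vector_mul_bounded_linear[of C]] by blast
  define trD where "trD = (\<Sum>i\<in>UNIV. D $ i $ i)"
  define \<Phi> where "\<Phi> r s x = bump r x ^ 3 * cos (\<eta> s \<bullet> x + p)" for r s and x :: "real^'n"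
  define g\<Phi> where "g\<Phi> r s x = (- 6 * r * bump r x ^ 2 * cos (\<eta> s \<bullet> x + p)) *\<^sub>R x - (bump r x ^ 3 * sin (\<eta> s \<bullet> x + p)) *\<^sub>R \<eta> s" for r s and x :: "real^'n"
  \<comment> \<open>All terms of the adjoint operator on the cut-off wave in which a derivative
    falls on the bump: the mixed and the second-order diffusion terms, then the drift. Each carries
    a factor \<open>r\<close>.\<close>
  define err where "err r s x = 12 * (r * bump r x ^ 2) * sin (\<eta> s \<bullet> x + p) * (x \<bullet> (D *v \<eta> s))
      + 24 * (r\<^sup>2 * bump r x) * cos (\<eta> s \<bullet> x + p) * (x \<bullet> (D *v x))
      - 6 * (r * bump r x ^ 2) * cos (\<eta> s \<bullet> x + p) * trD
      + 6 * (r * bump r x ^ 2) * cos (\<eta> s \<bullet> x + p) * (x \<bullet> (C *v x))" for r s and x :: "real^'n"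
  define m where "m r s = (\<integral>x. f s x * \<Phi> r s x \<partial>lborel)" for r s
  have cb: "continuous_on S (bump r)" for S r by (rule bump_continuous)
  have supp: "bump r x = 0" if "0 < r" "1 / sqrt r < norm x" for r and x :: "real^'n"
  proof (rule ccontr)
    assume "bump r x \<noteq> 0"
    from bump_support[OF that(1) this] have "(norm x)\<^sup>2 < (1 / sqrt r)\<^sup>2"
      using that(1) by (simp add: power_divide field_simps)
    moreover have "0 \<le> 1 / sqrt r" using that(1) by simp
    ultimately have "norm x < 1 / sqrt r" by (rule power2_less_imp_less)
    then show False using that(2) by simp
  qed
  have g\<Phi>: "((\<Phi> r s) has_derivative (\<lambda>h. g\<Phi> r s x \<bullet> h)) (at x)" for r s x
  proof -
    have "((\<lambda>x. cos (\<eta> s \<bullet> x + p)) has_derivative (\<lambda>h. - sin (\<eta> s \<bullet> x + p) * (\<eta> s \<bullet> h))) (at x)"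
      by (auto intro!: derivative_eq_intros)
    from has_derivative_mult[OF bump_power_deriv[of 3 r x] this] show ?thesis
      unfolding \<Phi>_def g\<Phi>_def
      by (rule has_derivative_eq_rhs) (auto simp: fun_eq_iff inner_diff_left algebra_simps)
  qed
  have cg\<Phi>: "continuous_on UNIV (g\<Phi> r s)" for r s
    unfolding g\<Phi>_def[abs_def] by (intro continuous_intros cb)
  have g\<Phi>0: "\<Phi> r s x = 0" "g\<Phi> r s x = 0" if "0 < r" "1 / sqrt r < norm x" for r s x
    using supp[OF that] by (auto simp: \<Phi>_def g\<Phi>_def)
  have intf: "integrable lborel (\<lambda>x. f s x * q x)"
    if "s > 0" "continuous_on UNIV q" "0 < r" "\<And>x. 1 / sqrt r < norm x \<Longrightarrow> q x = 0" for q :: "real^'n \<Rightarrow> real" and r s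
    using that slice[OF cf that(1)] by (intro integrable_continuous_compact_support[where R="1 / sqrt r"] continuous_intros) auto
  have cerr: "continuous_on UNIV (err r s)" for r s
    unfolding err_def[abs_def] by (intro continuous_intros cb)
  \<comment> \<open>The flux is integrated by parts once, its gradient part a second time. The last
    integrand grows linearly in \<open>x\<close> without a factor \<open>r\<close>; it is kept apart
    because it cancels in the time derivative.\<close>
  have spatial: "(\<integral>x. ft s x * \<Phi> r s x \<partial>lborel) = (\<integral>x. f s x * err r s x \<partial>lborel) - (\<eta> s \<bullet> (D *v \<eta> s)) * m r s
       + (\<integral>x. f s x * (bump r x ^ 3 * sin (\<eta> s \<bullet> x + p) * (\<eta> s \<bullet> (C *v x))) \<partial>lborel)"
    if s: "s > 0" and r: "0 < r" for r s
  proof -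
    let ?J = "\<lambda>y. D *v gf s y + f s y *\<^sub>R (C *v y)"
    let ?R = "1 / sqrt r"
    have df: "(f s has_derivative (\<lambda>h. gf s x \<bullet> h)) (at x)" for x using der s by auto
    have 1: "(\<integral>x. dJ s x $ i $ i * \<Phi> r s x \<partial>lborel) = - (\<integral>x. ?J x $ i * (g\<Phi> r s x \<bullet> axis i 1) \<partial>lborel)"
      "integrable lborel (\<lambda>x. dJ s x $ i $ i * \<Phi> r s x)" "integrable lborel (\<lambda>x. ?J x $ i * (g\<Phi> r s x \<bullet> axis i 1))" for i
    proof -
      have dd: "((\<lambda>y. ?J y $ i) has_derivative (\<lambda>h. (dJ s x $ i) \<bullet> h)) (at x)" for x
      proof -
        have "(?J has_derivative (\<lambda>h. dJ s x *v h)) (at x)" using der s by auto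
        from bounded_linear.has_derivative[OF bounded_linear_vec_nth this, of i] show ?thesis
          by (rule has_derivative_eq_rhs) (simp add: fun_eq_iff matrix_vector_mult_def inner_vec_def)
      qed
      have cc: "continuous_on UNIV (\<lambda>x. dJ s x $ i)"
        using slice[OF cdJ s] by (intro continuous_intros)
      show "(\<integral>x. dJ s x $ i $ i * \<Phi> r s x \<partial>lborel) = - (\<integral>x. ?J x $ i * (g\<Phi> r s x \<bullet> axis i 1) \<partial>lborel)"
        "integrable lborel (\<lambda>x. dJ s x $ i $ i * \<Phi> r s x)" "integrable lborel (\<lambda>x. ?J x $ i * (g\<Phi> r s x \<bullet> axis i 1))"
        using integral_by_parts_lborel[OF dd cc g\<Phi> cg\<Phi>, of ?R r s "axis i 1"] g\<Phi>0[OF r]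
        by (auto simp: cart_eq_inner_axis)
    qed
    \<comment> \<open>\<open>W w x\<close> is the Hessian of the cut-off wave at \<open>x\<close>
      applied to \<open>w\<close>.\<close>
    define W where "W w x = (6 * r * bump r x ^ 2 * (x \<bullet> w) * sin (\<eta> s \<bullet> x + p)) *\<^sub>R \<eta> s
        + (24 * r\<^sup>2 * bump r x * (x \<bullet> w) * cos (\<eta> s \<bullet> x + p)) *\<^sub>R x
        - (6 * r * bump r x ^ 2 * cos (\<eta> s \<bullet> x + p)) *\<^sub>R w
        + (6 * r * bump r x ^ 2 * sin (\<eta> s \<bullet> x + p) * (\<eta> s \<bullet> w)) *\<^sub>R x
        - (bump r x ^ 3 * cos (\<eta> s \<bullet> x + p) * (\<eta> s \<bullet> w)) *\<^sub>R \<eta> s" for w x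
    have 2: "(\<integral>x. (gf s x \<bullet> e) * (g\<Phi> r s x \<bullet> w) \<partial>lborel) = - (\<integral>x. f s x * (W w x \<bullet> e) \<partial>lborel)"
      "integrable lborel (\<lambda>x. (gf s x \<bullet> e) * (g\<Phi> r s x \<bullet> w))" "integrable lborel (\<lambda>x. f s x * (W w x \<bullet> e))" for e w
    proof -
      have dW: "((\<lambda>x. g\<Phi> r s x \<bullet> w) has_derivative (\<lambda>h. W w x \<bullet> h)) (at x)" for x
      proof -
        have c: "((\<lambda>x. cos (\<eta> s \<bullet> x + p)) has_derivative (\<lambda>h. - sin (\<eta> s \<bullet> x + p) * (\<eta> s \<bullet> h))) (at x)"
          "((\<lambda>x. sin (\<eta> s \<bullet> x + p)) has_derivative (\<lambda>h. cos (\<eta> s \<bullet> x + p) * (\<eta> s \<bullet> h))) (at x)"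
          by (auto intro!: derivative_eq_intros)
        have xw: "((\<lambda>x. x \<bullet> w) has_derivative (\<lambda>h. h \<bullet> w)) (at x)" by (auto intro!: derivative_eq_intros)
        have b2: "((\<lambda>x. bump r x ^ 2) has_derivative (\<lambda>h. ((- 4 * r * bump r x) *\<^sub>R x) \<bullet> h)) (at x)"
          using bump_power_deriv[of 2 r x] by simp
        have b3: "((\<lambda>x. bump r x ^ 3) has_derivative (\<lambda>h. ((- 6 * r * bump r x ^ 2) *\<^sub>R x) \<bullet> h)) (at x)"
          using bump_power_deriv[of 3 r x] by simp
        have "((\<lambda>x. - 6 * r * (bump r x ^ 2 * (cos (\<eta> s \<bullet> x + p) * (x \<bullet> w))) - (bump r x ^ 3 * sin (\<eta> s \<bullet> x + p)) * (\<eta> s \<bullet> w))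
           has_derivative (\<lambda>h. W w x \<bullet> h)) (at x)"
          by (rule has_derivative_eq_rhs[OF has_derivative_diff[OF has_derivative_mult_right[OF has_derivative_mult[OF b2 has_derivative_mult[OF c(1) xw]]]
                has_derivative_mult_left[OF has_derivative_mult[OF b3 c(2)]]]])
             (auto simp: W_def fun_eq_iff inner_add_left inner_diff_left inner_commute[of _ w] algebra_simps power2_eq_square)
        then show ?thesis by (simp add: g\<Phi>_def inner_diff_left mult.assoc)
      qed
      have cW: "continuous_on UNIV (W w)"
        unfolding W_def[abs_def] by (intro continuous_intros cb)
      show "(\<integral>x. (gf s x \<bullet> e) * (g\<Phi> r s x \<bullet> w) \<partial>lborel) = - (\<integral>x. f s x * (W w x \<bullet> e) \<partial>lborel)"
        "integrable lborel (\<lambda>x. (gf s x \<bullet> e) * (g\<Phi> r s x \<bullet> w))" "integrable lborel (\<lambda>x. f s x * (W w x \<bullet> e))"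
        using integral_by_parts_lborel[OF df slice[OF cgf s] dW cW, of ?R e] g\<Phi>0[OF r] supp[OF r]
        by (auto simp: W_def)
    qed
    let ?e = "\<lambda>i::'n. axis i (1::real)"
    have exp_inner: "x \<bullet> y = (\<Sum>i\<in>UNIV. (x \<bullet> ?e i) * (y \<bullet> ?e i))" for x y :: "real^'n"
      unfolding cart_eq_inner_axis[symmetric] by (simp add: inner_vec_def)
    have Dj: "x \<bullet> (D *v y) = (D *v x) \<bullet> y" for x y by (rule sym_mat_inner[OF Dsym])
    have intC: "integrable lborel (\<lambda>x. f s x * ((C *v x) \<bullet> g\<Phi> r s x))"
      using g\<Phi>0[OF r] by (intro intf[OF s _ r] continuous_intros cg\<Phi>) auto
    have "(\<integral>x. ft s x * \<Phi> r s x \<partial>lborel) = (\<integral>x. (\<Sum>i\<in>UNIV. dJ s x $ i $ i * \<Phi> r s x) \<partial>lborel)"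
      using der s by (simp add: sum_distrib_right)
    also have "\<dots> = (\<Sum>i\<in>UNIV. - (\<integral>x. ?J x $ i * (g\<Phi> r s x \<bullet> ?e i) \<partial>lborel))"
      by (subst Bochner_Integration.integral_sum) (auto simp: 1)
    also have "\<dots> = - (\<integral>x. (\<Sum>i\<in>UNIV. ?J x $ i * (g\<Phi> r s x \<bullet> ?e i)) \<partial>lborel)"
      by (subst Bochner_Integration.integral_sum, rule 1(3)) (simp only: sum_negf)
    also have "(\<lambda>x. \<Sum>i\<in>UNIV. ?J x $ i * (g\<Phi> r s x \<bullet> ?e i)) = (\<lambda>x. (\<Sum>i\<in>UNIV. (gf s x \<bullet> ?e i) * (g\<Phi> r s x \<bullet> (D *v ?e i))) + f s x * ((C *v x) \<bullet> g\<Phi> r s x))"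
    proof
      fix x
      have "(\<Sum>i\<in>UNIV. ?J x $ i * (g\<Phi> r s x \<bullet> ?e i)) = ?J x \<bullet> g\<Phi> r s x"
        by (subst exp_inner) (simp add: cart_eq_inner_axis)
      also have "\<dots> = gf s x \<bullet> (D *v g\<Phi> r s x) + f s x * ((C *v x) \<bullet> g\<Phi> r s x)"
        by (simp add: inner_add_left Dj)
      also have "gf s x \<bullet> (D *v g\<Phi> r s x) = (\<Sum>i\<in>UNIV. (gf s x \<bullet> ?e i) * (g\<Phi> r s x \<bullet> (D *v ?e i)))"
        unfolding Dj[of "g\<Phi> r s x"] by (rule exp_inner)
      finally show "(\<Sum>i\<in>UNIV. ?J x $ i * (g\<Phi> r s x \<bullet> ?e i)) = (\<Sum>i\<in>UNIV. (gf s x \<bullet> ?e i) * (g\<Phi> r s x \<bullet> (D *v ?e i))) + f s x * ((C *v x) \<bullet> g\<Phi> r s x)" .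
    qed
    also have "- (\<integral>x. (\<Sum>i\<in>UNIV. (gf s x \<bullet> ?e i) * (g\<Phi> r s x \<bullet> (D *v ?e i))) + f s x * ((C *v x) \<bullet> g\<Phi> r s x) \<partial>lborel)
       = (\<Sum>i\<in>UNIV. (\<integral>x. f s x * (W (D *v ?e i) x \<bullet> ?e i) \<partial>lborel)) - (\<integral>x. f s x * ((C *v x) \<bullet> g\<Phi> r s x) \<partial>lborel)"
      by (subst Bochner_Integration.integral_add, use 2(2) intC in force, rule intC,
          subst Bochner_Integration.integral_sum) (auto simp: 2 sum_negf)
    also have "\<dots> = (\<integral>x. (\<Sum>i\<in>UNIV. f s x * (W (D *v ?e i) x \<bullet> ?e i)) - f s x * ((C *v x) \<bullet> g\<Phi> r s x) \<partial>lborel)"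
      by (subst Bochner_Integration.integral_diff, use 2(3) in force, rule intC,
          subst Bochner_Integration.integral_sum) (auto simp: 2(3))
    also have "\<dots> = (\<integral>x. (f s x * err r s x - (\<eta> s \<bullet> (D *v \<eta> s)) * (f s x * \<Phi> r s x))
         + f s x * (bump r x ^ 3 * sin (\<eta> s \<bullet> x + p) * (\<eta> s \<bullet> (C *v x))) \<partial>lborel)"
    proof (rule Bochner_Integration.integral_cong[OF refl])
      fix x
      have sW: "(\<Sum>i\<in>UNIV. W (D *v ?e i) x \<bullet> ?e i) = 6 * r * bump r x ^ 2 * sin (\<eta> s \<bullet> x + p) * (x \<bullet> (D *v \<eta> s))
         + 24 * r\<^sup>2 * bump r x * cos (\<eta> s \<bullet> x + p) * (x \<bullet> (D *v x))
         - 6 * r * bump r x ^ 2 * cos (\<eta> s \<bullet> x + p) * trD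
         + 6 * r * bump r x ^ 2 * sin (\<eta> s \<bullet> x + p) * (x \<bullet> (D *v \<eta> s))
         - bump r x ^ 3 * cos (\<eta> s \<bullet> x + p) * (\<eta> s \<bullet> (D *v \<eta> s))"
      proof -
        have a: "(\<Sum>i\<in>UNIV. (y \<bullet> (D *v ?e i)) * (z \<bullet> ?e i)) = y \<bullet> (D *v z)" for y z
          unfolding Dj by (rule exp_inner[symmetric])
        have b: "(\<Sum>i\<in>UNIV. (D *v ?e i) \<bullet> ?e i) = trD"
          unfolding trD_def by (simp add: cart_eq_inner_axis[symmetric] matrix_vector_mult_basis column_def)
        have "(\<Sum>i\<in>UNIV. W (D *v ?e i) x \<bullet> ?e i) =
           6 * r * bump r x ^ 2 * sin (\<eta> s \<bullet> x + p) * (\<Sum>i\<in>UNIV. (x \<bullet> (D *v ?e i)) * (\<eta> s \<bullet> ?e i))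
         + 24 * r\<^sup>2 * bump r x * cos (\<eta> s \<bullet> x + p) * (\<Sum>i\<in>UNIV. (x \<bullet> (D *v ?e i)) * (x \<bullet> ?e i))
         - 6 * r * bump r x ^ 2 * cos (\<eta> s \<bullet> x + p) * (\<Sum>i\<in>UNIV. (D *v ?e i) \<bullet> ?e i)
         + 6 * r * bump r x ^ 2 * sin (\<eta> s \<bullet> x + p) * (\<Sum>i\<in>UNIV. (\<eta> s \<bullet> (D *v ?e i)) * (x \<bullet> ?e i))
         - bump r x ^ 3 * cos (\<eta> s \<bullet> x + p) * (\<Sum>i\<in>UNIV. (\<eta> s \<bullet> (D *v ?e i)) * (\<eta> s \<bullet> ?e i))"
          by (simp add: W_def inner_add_left inner_diff_left sum.distrib sum_subtractf sum_distrib_left mult_ac)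
        also have "\<eta> s \<bullet> (D *v x) = x \<bullet> (D *v \<eta> s)" using Dj[of "\<eta> s" x] by (simp add: inner_commute)
        ultimately show ?thesis unfolding a b by simp
      qed
      have "(\<Sum>i\<in>UNIV. f s x * (W (D *v ?e i) x \<bullet> ?e i)) = f s x * (\<Sum>i\<in>UNIV. W (D *v ?e i) x \<bullet> ?e i)"
        by (simp add: sum_distrib_left)
      then show "(\<Sum>i\<in>UNIV. f s x * (W (D *v ?e i) x \<bullet> ?e i)) - f s x * ((C *v x) \<bullet> g\<Phi> r s x)
        = (f s x * err r s x - (\<eta> s \<bullet> (D *v \<eta> s)) * (f s x * \<Phi> r s x))
         + f s x * (bump r x ^ 3 * sin (\<eta> s \<bullet> x + p) * (\<eta> s \<bullet> (C *v x)))"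
        unfolding sW err_def g\<Phi>_def \<Phi>_def inner_diff_right inner_scaleR_right
          inner_commute[of "C *v x" x] inner_commute[of "C *v x" "\<eta> s"] by algebra
    qed
    also have "\<dots> = (\<integral>x. f s x * err r s x \<partial>lborel) - (\<eta> s \<bullet> (D *v \<eta> s)) * m r s
       + (\<integral>x. f s x * (bump r x ^ 3 * sin (\<eta> s \<bullet> x + p) * (\<eta> s \<bullet> (C *v x))) \<partial>lborel)"
    proof -
      have i1: "integrable lborel (\<lambda>x. f s x * err r s x)"
        using supp[OF r] by (intro intf[OF s cerr r]) (auto simp: err_def)
      have i2: "integrable lborel (\<lambda>x. f s x * \<Phi> r s x)"
        using supp[OF r] unfolding \<Phi>_def by (intro intf[OF s _ r] continuous_intros cb) auto
      have i3: "integrable lborel (\<lambda>x. f s x * (bump r x ^ 3 * sin (\<eta> s \<bullet> x + p) * (\<eta> s \<bullet> (C *v x))))"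
        using supp[OF r] by (intro intf[OF s _ r] continuous_intros cb) auto
      show ?thesis using i1 i2 i3 by (simp add: m_def)
    qed
    finally show ?thesis .
  qed
  \<comment> \<open>The motion of \<eta> contributes exactly the linearly growing term of
    \<open>spatial\<close> with the opposite sign, since \<open>transpose C *v \<eta> s\<close>
    paired with \<open>x\<close> equals \<open>\<eta> s\<close> paired with \<open>C *v x\<close>.
    What remains is the error and the multiplier.\<close>
  have md: "(m r has_real_derivative (\<integral>x. f s x * err r s x \<partial>lborel) - (\<eta> s \<bullet> (D *v \<eta> s)) * m r s) (at s)"
    if s: "s > 0" and r: "0 < r" for r s
  proof -
    define W where "W u x = ft u x * \<Phi> r u x - f u x * (bump r x ^ 3 * sin (\<eta> u \<bullet> x + p) * ((transpose C *v \<eta> u) \<bullet> x))" for u x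
    let ?R = "1 / sqrt r"
    let ?S = "{s / 2..3 * s / 2} \<times> cball (0::real^'n) ?R"
    have cC\<eta>: "continuous_on UNIV (\<lambda>u. transpose C *v \<eta> u)"
      by (rule bounded_linear.continuous_on[OF matrix_vector_mul_bounded_linear c\<eta>])
    have "continuous_on ?S (\<lambda>z. transpose C *v \<eta> (fst z))"
      by (rule continuous_on_compose2[OF cC\<eta>]) (auto intro: continuous_intros)
    then have "continuous_on ?S (\<lambda>z. W (fst z) (snd z))"
      unfolding W_def \<Phi>_def
      by (intro continuous_intros continuous_on_compose2[OF c\<eta>[of UNIV]] continuous_on_compose2[OF cb[of UNIV]]
          continuous_on_subset[OF cf] continuous_on_subset[OF cft]) (use s in auto)
    then have "compact ((\<lambda>z. W (fst z) (snd z)) ` ?S)"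
      by (intro compact_continuous_image compact_Times) auto
    from compact_imp_bounded[OF this] obtain B0 where B0': "\<forall>y\<in>(\<lambda>z. W (fst z) (snd z)) ` ?S. norm y \<le> B0"
      unfolding bounded_iff by blast
    have B0: "\<bar>W u x\<bar> \<le> B0" if "u \<in> {s / 2..3 * s / 2}" "norm x \<le> ?R" for u x
      using bspec[OF B0' imageI[of "(u, x)"]] that by simp
    have W0: "W u x = 0" if "?R < norm x" for u x
      using supp[OF r that] by (simp add: W_def \<Phi>_def)
    have Bb: "norm (W u x) \<le> \<bar>B0\<bar> * indicator (cball 0 ?R) x" if "u \<in> ball s (s / 2)" for u x
    proof (cases "norm x \<le> ?R")
      case True
      have "u \<in> {s / 2..3 * s / 2}" using that by (auto simp: dist_real_def abs_if split: if_splits)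
      from B0[OF this True] True show ?thesis by simp
    qed (use W0 in auto)
    have d: "((\<lambda>u. f u x * \<Phi> r u x) has_derivative (\<lambda>v. W u x \<bullet> v)) (at u)" if "u > 0" for u x
    proof -
      have 1: "((\<lambda>u. f u x) has_derivative (*) (ft u x)) (at u)"
      proof -
        have "((\<lambda>s. f s x) has_real_derivative ft u x) (at u)" using der that by blast
        then show ?thesis unfolding has_field_derivative_def .
      qed
      have 2: "((\<lambda>u. \<eta> u \<bullet> x + p) has_derivative (\<lambda>v. v * ((transpose C *v \<eta> u) \<bullet> x))) (at u)"
        using has_derivative_add[OF has_derivative_inner_left[OF \<eta>d[of u, unfolded has_vector_derivative_def], of x] has_derivative_const[of p]]
        by (rule has_derivative_eq_rhs) (simp add: fun_eq_iff)
      have 3: "((\<lambda>u. \<Phi> r u x) has_derivative (\<lambda>v. bump r x ^ 3 * (v * ((transpose C *v \<eta> u) \<bullet> x) * - sin (\<eta> u \<bullet> x + p)))) (at u)"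
        unfolding \<Phi>_def by (rule has_derivative_mult_right[OF has_derivative_cos[OF 2]])
      show ?thesis
        by (rule has_derivative_eq_rhs[OF has_derivative_mult[OF 1 3]])
           (simp add: fun_eq_iff W_def algebra_simps)
    qed
    have mm: "(\<lambda>x. f u x * \<Phi> r u x) \<in> borel_measurable lborel" if "u > 0" for u
    proof -
      have "continuous_on UNIV (\<lambda>x. f u x * \<Phi> r u x)"
        unfolding \<Phi>_def by (intro continuous_intros slice[OF cf that] cb)
      then show ?thesis using borel_measurable_continuous_onI by simp
    qed
    have Wc: "continuous_on UNIV (W s)"
      unfolding W_def[abs_def] \<Phi>_def
      by (intro continuous_intros slice[OF cf s] slice[OF cft s] cb)
    have "((\<lambda>u. \<integral>x. f u x * \<Phi> r u x \<partial>lborel) has_derivative (\<lambda>v. (\<integral>x. W s x \<partial>lborel) \<bullet> v)) (at s)"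
    proof (rule has_derivative_integral_dominated(1)[where r="s / 2" and D=W and B="\<lambda>x. \<bar>B0\<bar> * indicator (cball 0 ?R) x"])
      have pos: "u > 0" if "u \<in> ball s (s / 2)" for u
        using that s by (auto simp: dist_real_def abs_if split: if_splits)
      show "(\<lambda>x. f u x * \<Phi> r u x) \<in> borel_measurable lborel" if "u \<in> ball s (s / 2)" for u
        using mm pos that by auto
      show "((\<lambda>u. f u x * \<Phi> r u x) has_derivative (\<lambda>v. W u x \<bullet> v)) (at u)" if "u \<in> ball s (s / 2)" for u x
        using d pos that by auto
      show "integrable lborel (\<lambda>x. f s x * \<Phi> r s x)"
        using supp[OF r] unfolding \<Phi>_def by (intro intf[OF s _ r] continuous_intros cb) auto
      show "W s \<in> borel_measurable lborel"
        using borel_measurable_continuous_onI[OF Wc] by simp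
      show "integrable lborel (\<lambda>x. \<bar>B0\<bar> * indicator (cball 0 ?R) x)"
        by (intro integrable_mult_right integrable_indicator_cball)
    qed (use s Bb in auto)
    moreover have "(\<integral>x. W s x \<partial>lborel) = (\<integral>x. f s x * err r s x \<partial>lborel) - (\<eta> s \<bullet> (D *v \<eta> s)) * m r s"
    proof -
      have i1: "integrable lborel (\<lambda>x. ft s x * \<Phi> r s x)"
        using supp[OF r] slice[OF cft s] unfolding \<Phi>_def
        by (intro integrable_continuous_compact_support[where R="?R"] continuous_intros cb) auto
      have i2: "integrable lborel (\<lambda>x. f s x * (bump r x ^ 3 * sin (\<eta> s \<bullet> x + p) * (\<eta> s \<bullet> (C *v x))))"
        using supp[OF r] by (intro intf[OF s _ r] continuous_intros cb) auto
      have "(transpose C *v \<eta> s) \<bullet> x = \<eta> s \<bullet> (C *v x)" for x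
        using inner_matrix_transpose[of C x "\<eta> s"] by (simp only: inner_commute)
      then have "W s x = ft s x * \<Phi> r s x - f s x * (bump r x ^ 3 * sin (\<eta> s \<bullet> x + p) * (\<eta> s \<bullet> (C *v x)))" for x
        unfolding W_def by simp
      then show ?thesis using i1 i2 spatial[OF s r] by simp
    qed
    ultimately show ?thesis
      unfolding has_field_derivative_def m_def
      by (auto elim!: has_derivative_eq_rhs simp: fun_eq_iff)
  qed
  define F where "F r s = exp (k s) * m r s" for r s
  have Fd: "(F r has_real_derivative exp (k s) * (\<integral>x. f s x * err r s x \<partial>lborel)) (at s)" if "s > 0" "0 < r" for r s
    unfolding F_def
    by (rule derivative_eq_intros DERIV_exp kd md[OF that] refl)+ (simp add: algebra_simps)
  define M where "M s = (\<integral>x. f s x * cos (\<eta> s \<bullet> x + p) \<partial>lborel)" for s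
  let ?r = "\<lambda>n. inverse (real (Suc n))"
  have r: "0 < ?r n" "?r n \<le> 1" for n by (auto simp: inverse_le_1_iff)
  have r0: "?r \<longlonglongrightarrow> 0" by (rule LIMSEQ_inverse_real_of_nat)
  have Flim: "(\<lambda>n. F (?r n) s) \<longlonglongrightarrow> exp (k s) * M s" if s: "s \<ge> 0" for s
    unfolding F_def m_def M_def
  proof (intro tendsto_mult_left integral_dominated_convergence[where w="\<lambda>x. \<bar>f s x\<bar>"])
    have [measurable]: "f s \<in> borel_measurable borel" by (rule fm[OF s])
    have [measurable]: "bump r \<in> borel_measurable borel" for r :: real
      using cb by (rule borel_measurable_continuous_onI)
    show "(\<lambda>x. f s x * cos (\<eta> s \<bullet> x + p)) \<in> borel_measurable lborel" by measurable
    show "(\<lambda>x. f s x * \<Phi> (?r n) s x) \<in> borel_measurable lborel" for n unfolding \<Phi>_def by measurable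
    show "integrable lborel (\<lambda>x. \<bar>f s x\<bar>)" using fint s by auto
    show "AE x in lborel. (\<lambda>n. f s x * \<Phi> (?r n) s x) \<longlonglongrightarrow> f s x * cos (\<eta> s \<bullet> x + p)"
    proof (rule AE_I2)
      fix x
      have "(\<lambda>n. f s x * (bump (?r n) x ^ 3 * cos (\<eta> s \<bullet> x + p))) \<longlonglongrightarrow> f s x * (1 ^ 3 * cos (\<eta> s \<bullet> x + p))"
        by (intro tendsto_intros bump_tendsto_1 r0)
      then show "(\<lambda>n. f s x * \<Phi> (?r n) s x) \<longlonglongrightarrow> f s x * cos (\<eta> s \<bullet> x + p)" by (simp add: \<Phi>_def)
    qed
    show "AE x in lborel. norm (f s x * \<Phi> (?r n) s x) \<le> \<bar>f s x\<bar>" for n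
    proof (rule AE_I2)
      fix x
      have "bump (?r n) x ^ 3 * \<bar>cos (\<eta> s \<bullet> x + p)\<bar> \<le> 1"
        using bump_bounds(1)[of "?r n" x] bump_bounds(2)[of "?r n" x] r[of n] by (intro mult_le_one power_le_one) auto
      from mult_left_mono[OF this, of "\<bar>f s x\<bar>"] show "norm (f s x * \<Phi> (?r n) s x) \<le> \<bar>f s x\<bar>"
        using bump_bounds(1)[of "?r n" x] by (simp add: \<Phi>_def abs_mult)
    qed
  qed
  have nrm: "continuous_on {0..} (\<lambda>s. \<integral>x. \<bar>f s x\<bar> \<partial>lborel)"
    unfolding continuous_on_def
  proof
    fix s :: real assume s: "s \<in> {0..}"
    have "((\<lambda>u. (\<integral>x. \<bar>f u x\<bar> \<partial>lborel) - (\<integral>x. \<bar>f s x\<bar> \<partial>lborel)) \<longlongrightarrow> 0) (at s within {0..})"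
    proof (rule Lim_null_comparison[OF _ L1dist_tendsto[OF fint L1]])
      show "\<forall>\<^sub>F u in at s within {0..}. norm ((\<integral>x. \<bar>f u x\<bar> \<partial>lborel) - (\<integral>x. \<bar>f s x\<bar> \<partial>lborel)) \<le> (\<integral>x. \<bar>f u x - f s x\<bar> \<partial>lborel)"
        unfolding eventually_at_filter
      proof (intro always_eventually allI impI)
        fix u :: real assume "u \<in> {0..}"
        then have i: "integrable lborel (f u)" "integrable lborel (f s)" using fint s by auto
        have "norm (\<integral>x. \<bar>f u x\<bar> - \<bar>f s x\<bar> \<partial>lborel) \<le> (\<integral>x. norm (\<bar>f u x\<bar> - \<bar>f s x\<bar>) \<partial>lborel)"
          by (rule integral_norm_bound)
        also have "\<dots> \<le> (\<integral>x. \<bar>f u x - f s x\<bar> \<partial>lborel)"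
          using i by (intro integral_mono) auto
        finally show "norm ((\<integral>x. \<bar>f u x\<bar> \<partial>lborel) - (\<integral>x. \<bar>f s x\<bar> \<partial>lborel)) \<le> (\<integral>x. \<bar>f u x - f s x\<bar> \<partial>lborel)"
          using i by simp
      qed
    qed (use s in auto)
    then show "((\<lambda>s. \<integral>x. \<bar>f s x\<bar> \<partial>lborel) \<longlongrightarrow> (\<integral>x. \<bar>f s x\<bar> \<partial>lborel)) (at s within {0..})"
      by (rule LIM_zero_cancel)
  qed
  \<comment> \<open>The derivatives are available for positive times, so the identity is integrated
    from some \<open>s > 0\<close> to \<open>t\<close>; the error integral vanishes as the cut-off
    is removed, by dominated convergence in space and then in time.\<close>
  have const: "exp (k t) * M t = exp (k s) * M s" if s: "0 < s" "s \<le> t" for s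
  proof -
    let ?I = "{s..t}"
    have "\<exists>B. \<forall>u\<in>?I. \<bar>\<integral>x. \<bar>f u x\<bar> \<partial>lborel\<bar> \<le> B"
      using compact_imp_bounded[OF compact_continuous_image[OF continuous_on_subset[OF nrm, of ?I]]] s
      by (auto simp: bounded_iff)
    then obtain B1 where B1: "\<And>u. u \<in> ?I \<Longrightarrow> (\<integral>x. \<bar>f u x\<bar> \<partial>lborel) \<le> B1" by (metis abs_le_D1)
    have "\<exists>B. \<forall>u\<in>?I. norm (\<eta> u) \<le> B"
      using compact_imp_bounded[OF compact_continuous_image[OF c\<eta>[of ?I]]] by (auto simp: bounded_iff)
    then obtain H0 where H0: "\<And>u. u \<in> ?I \<Longrightarrow> norm (\<eta> u) \<le> H0" by blast
    have "norm (\<eta> s) \<le> H0" using s by (intro H0) auto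
    then have H00: "0 \<le> H0" using norm_ge_zero[of "\<eta> s"] by linarith
    have ck: "continuous_on ?I k"
      using DERIV_isCont[OF kd] by (intro continuous_at_imp_continuous_on) auto
    have "\<exists>B. \<forall>u\<in>?I. norm (exp (k u)) \<le> B"
      using compact_imp_bounded[OF compact_continuous_image[OF continuous_on_exp[OF ck]]] by (auto simp: bounded_iff)
    then obtain X where "\<forall>u\<in>?I. norm (exp (k u)) \<le> X" by blast
    then have X: "\<And>u. u \<in> ?I \<Longrightarrow> exp (k u) \<le> X" by simp
    have "exp (k s) \<le> X" using s by (intro X) auto
    then have X0: "0 \<le> X" using exp_gt_zero[of "k s"] by linarith
    define Z where "Z = 12 * (nD * H0) + 24 * nD + 6 * \<bar>trD\<bar> + 6 * nC"
    have Z: "\<bar>err (?r n) u x\<bar> \<le> Z" if u: "u \<in> ?I" for n u x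
    proof -
      note b = bump_err_bounds[OF r(1)[of n] r(2)[of n], of x]
      have b0: "0 \<le> bump (?r n) x" by (rule bump_bounds)
      have cs: "\<bar>sin y\<bar> \<le> 1" "\<bar>cos y\<bar> \<le> 1" for y :: real by auto
      have t1: "\<bar>12 * (?r n * bump (?r n) x ^ 2) * sin (\<eta> u \<bullet> x + p) * (x \<bullet> (D *v \<eta> u))\<bar> \<le> 12 * (nD * H0)"
      proof -
        have "\<bar>x \<bullet> (D *v \<eta> u)\<bar> \<le> norm x * (nD * H0)"
          by (rule order_trans[OF Cauchy_Schwarz_ineq2], intro mult_left_mono order_trans[OF nD(2)])
             (use H0[OF u] nD(1) in \<open>auto simp: mult.commute intro!: mult_left_mono\<close>)
        then have "(?r n * bump (?r n) x ^ 2) * (\<bar>sin (\<eta> u \<bullet> x + p)\<bar> * \<bar>x \<bullet> (D *v \<eta> u)\<bar>) \<le> (?r n * bump (?r n) x ^ 2) * (1 * (norm x * (nD * H0)))"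
          using r[of n] b0 cs by (intro mult_left_mono mult_mono) auto
        also have "\<dots> = (?r n * bump (?r n) x ^ 2 * norm x) * (nD * H0)" by simp
        also have "\<dots> \<le> 1 * (nD * H0)" using nD(1) H00 b(1) by (intro mult_right_mono) auto
        finally show ?thesis using r[of n] b0 by (simp add: abs_mult mult.assoc)
      qed
      have t2: "\<bar>24 * ((?r n)\<^sup>2 * bump (?r n) x) * cos (\<eta> u \<bullet> x + p) * (x \<bullet> (D *v x))\<bar> \<le> 24 * nD"
      proof -
        have "\<bar>x \<bullet> (D *v x)\<bar> \<le> norm x * (norm x * nD)"
          by (rule order_trans[OF Cauchy_Schwarz_ineq2], intro mult_left_mono nD(2)) auto
        then have "((?r n)\<^sup>2 * bump (?r n) x) * (\<bar>cos (\<eta> u \<bullet> x + p)\<bar> * \<bar>x \<bullet> (D *v x)\<bar>) \<le> ((?r n)\<^sup>2 * bump (?r n) x) * (1 * (norm x * (norm x * nD)))"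
          using b0 cs by (intro mult_left_mono mult_mono) auto
        also have "\<dots> = ((?r n)\<^sup>2 * bump (?r n) x * (norm x)\<^sup>2) * nD" by (simp add: power2_eq_square)
        also have "\<dots> \<le> 1 * nD" using nD(1) b(3) by (intro mult_right_mono) auto
        finally show ?thesis using b0 by (simp add: abs_mult mult.assoc)
      qed
      have t3: "\<bar>6 * (?r n * bump (?r n) x ^ 2) * cos (\<eta> u \<bullet> x + p) * trD\<bar> \<le> 6 * \<bar>trD\<bar>"
      proof -
        have "(?r n * bump (?r n) x ^ 2) * (\<bar>cos (\<eta> u \<bullet> x + p)\<bar> * \<bar>trD\<bar>) \<le> 1 * (1 * \<bar>trD\<bar>)"
          using b(4) r[of n] b0 cs by (intro mult_mono) auto
        then show ?thesis using r[of n] b0 by (simp add: abs_mult mult.assoc)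
      qed
      have t4: "\<bar>6 * (?r n * bump (?r n) x ^ 2) * cos (\<eta> u \<bullet> x + p) * (x \<bullet> (C *v x))\<bar> \<le> 6 * nC"
      proof -
        have "\<bar>x \<bullet> (C *v x)\<bar> \<le> norm x * (norm x * nC)"
          by (rule order_trans[OF Cauchy_Schwarz_ineq2], intro mult_left_mono nC(2)) auto
        then have "(?r n * bump (?r n) x ^ 2) * (\<bar>cos (\<eta> u \<bullet> x + p)\<bar> * \<bar>x \<bullet> (C *v x)\<bar>) \<le> (?r n * bump (?r n) x ^ 2) * (1 * (norm x * (norm x * nC)))"
          using b0 r[of n] cs by (intro mult_left_mono mult_mono) auto
        also have "\<dots> = (?r n * bump (?r n) x ^ 2 * (norm x)\<^sup>2) * nC" by (simp add: power2_eq_square)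
        also have "\<dots> \<le> 1 * nC" using nC(1) b(2) by (intro mult_right_mono) auto
        finally show ?thesis using r[of n] b0 by (simp add: abs_mult mult.assoc)
      qed
      show ?thesis unfolding err_def Z_def using t1 t2 t3 t4 by linarith
    qed
    have Z0: "0 \<le> Z" unfolding Z_def using nD(1) nC(1) H00 by simp
    let ?g = "\<lambda>n u. exp (k u) * (\<integral>x. f u x * err (?r n) u x \<partial>lborel)"
    have HI: "(?g n has_integral F (?r n) t - F (?r n) s) ?I" for n
    proof (rule fundamental_theorem_of_calculus)
      fix u assume "u \<in> ?I"
      then have "u > 0" using s by auto
      from Fd[OF this r(1)[of n]] show "(F (?r n) has_vector_derivative ?g n u) (at u within ?I)"
        by (auto simp: has_real_derivative_iff_has_vector_derivative intro: has_vector_derivative_at_within)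
    qed (use s in auto)
    have fe: "(\<lambda>x. f u x * err (?r n) u x) \<in> borel_measurable lborel" if "u \<in> ?I" for u n
      using fm[of u] that s borel_measurable_continuous_onI[OF cerr[of "?r n" u]] by simp
    have fb: "\<bar>f u x * err (?r n) u x\<bar> \<le> Z * \<bar>f u x\<bar>" if "u \<in> ?I" for u n x
      using mult_left_mono[OF Z[OF that, of n x], of "\<bar>f u x\<bar>"] by (simp add: abs_mult mult.commute)
    have fi: "integrable lborel (\<lambda>x. Z * \<bar>f u x\<bar>)" if "u \<in> ?I" for u
      using fint that s by auto
    have dc: "(\<lambda>n. integral ?I (?g n)) \<longlonglongrightarrow> integral ?I (\<lambda>u. 0)"
    proof (rule dominated_convergence(2)[where h="\<lambda>u. X * (Z * B1)"])
      show "?g n integrable_on ?I" for n using HI by blast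
      show "norm (?g n u) \<le> X * (Z * B1)" if u: "u \<in> ?I" for n u
      proof -
        have "\<bar>\<integral>x. f u x * err (?r n) u x \<partial>lborel\<bar> \<le> (\<integral>x. norm (f u x * err (?r n) u x) \<partial>lborel)"
          unfolding real_norm_def[symmetric] by (rule integral_norm_bound)
        also have "\<dots> \<le> (\<integral>x. Z * \<bar>f u x\<bar> \<partial>lborel)"
          using fb[OF u] fe[OF u, of n] fi[OF u]
          by (intro integral_mono integrable_norm Bochner_Integration.integrable_bound[OF fi[OF u]]) (auto intro: order_trans[OF _ abs_ge_self])
        also have "\<dots> \<le> Z * B1" using B1[OF u] Z0 by (simp add: mult_left_mono)
        finally show ?thesis using X[OF u] X0 by (simp add: abs_mult mult_mono)
      qed
      show "(\<lambda>n. ?g n u) \<longlonglongrightarrow> 0" if u: "u \<in> ?I" for u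
      proof -
        have "(\<lambda>n. \<integral>x. f u x * err (?r n) u x \<partial>lborel) \<longlonglongrightarrow> (\<integral>x. 0 \<partial>(lborel :: (real^'n) measure))"
        proof (rule integral_dominated_convergence[where w="\<lambda>x. Z * \<bar>f u x\<bar>"])
          show "AE x in lborel. (\<lambda>n. f u x * err (?r n) u x) \<longlonglongrightarrow> 0"
          proof (rule AE_I2)
            fix x
            have "(\<lambda>n. f u x * err (?r n) u x) \<longlonglongrightarrow> f u x * (12 * (0 * 1 ^ 2) * sin (\<eta> u \<bullet> x + p) * (x \<bullet> (D *v \<eta> u))
              + 24 * (0\<^sup>2 * 1) * cos (\<eta> u \<bullet> x + p) * (x \<bullet> (D *v x))
              - 6 * (0 * 1 ^ 2) * cos (\<eta> u \<bullet> x + p) * trD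
              + 6 * (0 * 1 ^ 2) * cos (\<eta> u \<bullet> x + p) * (x \<bullet> (C *v x)))"
              unfolding err_def by (intro tendsto_intros bump_tendsto_1 r0)
            then show "(\<lambda>n. f u x * err (?r n) u x) \<longlonglongrightarrow> 0" by simp
          qed
        qed (use fe[OF u] fi[OF u] fb[OF u] in auto)
        then have "(\<lambda>n. ?g n u) \<longlonglongrightarrow> exp (k u) * 0" by (intro tendsto_mult_left) simp
        then show ?thesis by simp
      qed
    qed auto
    have "(\<lambda>n. F (?r n) t - F (?r n) s) \<longlonglongrightarrow> 0"
      using dc unfolding integral_unique[OF HI] by (simp del: of_nat_Suc)
    moreover have "(\<lambda>n. F (?r n) t - F (?r n) s) \<longlonglongrightarrow> exp (k t) * M t - exp (k s) * M s"
      using s by (intro tendsto_diff Flim) auto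
    ultimately show ?thesis using LIMSEQ_unique by fastforce
  qed
  let ?s = "\<lambda>n. t * ?r n"
  have s0: "?s \<longlonglongrightarrow> 0" using tendsto_mult_left[OF r0, of t] by simp
  have sp: "0 < ?s n" "?s n \<le> t" for n using t r[of n] by (auto simp: mult_left_le)
  have Mlim: "(\<lambda>n. M (?s n)) \<longlonglongrightarrow> M 0"
  proof -
    have c0: "isCont \<eta> 0" using \<eta>d by (rule has_vector_derivative_continuous)
    have i0: "integrable lborel (f 0)" using fint by auto
    have a: "(\<lambda>n. \<integral>x. \<bar>f (?s n) x - f 0 x\<bar> \<partial>lborel) \<longlonglongrightarrow> 0"
    proof -
      have "filterlim ?s (at 0 within {0..}) sequentially"
        using s0 sp(1) by (auto simp: filterlim_at less_imp_le intro!: always_eventually)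
      from filterlim_compose[OF L1dist_tendsto[OF fint L1[of 0]] this] show ?thesis by simp
    qed
    have b: "(\<lambda>n. \<integral>x. f 0 x * (cos (\<eta> (?s n) \<bullet> x + p) - cos (\<eta> 0 \<bullet> x + p)) \<partial>lborel) \<longlonglongrightarrow> (\<integral>x. 0 \<partial>(lborel :: (real^'n) measure))"
    proof (rule integral_dominated_convergence[where w="\<lambda>x. \<bar>f 0 x\<bar> * 2"])
      have [measurable]: "f 0 \<in> borel_measurable borel" by (rule fm) simp
      show "(\<lambda>x. f 0 x * (cos (\<eta> (?s n) \<bullet> x + p) - cos (\<eta> 0 \<bullet> x + p))) \<in> borel_measurable lborel" for n by measurable
      show "integrable lborel (\<lambda>x. \<bar>f 0 x\<bar> * 2)" using i0 by auto
      show "AE x in lborel. norm (f 0 x * (cos (\<eta> (?s n) \<bullet> x + p) - cos (\<eta> 0 \<bullet> x + p))) \<le> \<bar>f 0 x\<bar> * 2" for n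
      proof (rule AE_I2)
        fix x
        have "\<bar>cos (\<eta> (?s n) \<bullet> x + p) - cos (\<eta> 0 \<bullet> x + p)\<bar> \<le> 2"
          using cos_le_one[of "\<eta> (?s n) \<bullet> x + p"] cos_ge_minus_one[of "\<eta> (?s n) \<bullet> x + p"] cos_le_one[of "\<eta> 0 \<bullet> x + p"] cos_ge_minus_one[of "\<eta> 0 \<bullet> x + p"]
          by linarith
        then show "norm (f 0 x * (cos (\<eta> (?s n) \<bullet> x + p) - cos (\<eta> 0 \<bullet> x + p))) \<le> \<bar>f 0 x\<bar> * 2"
          unfolding real_norm_def abs_mult by (rule mult_left_mono) simp
      qed
      show "AE x in lborel. (\<lambda>n. f 0 x * (cos (\<eta> (?s n) \<bullet> x + p) - cos (\<eta> 0 \<bullet> x + p))) \<longlonglongrightarrow> 0"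
      proof (rule AE_I2)
        fix x
        have "(\<lambda>n. f 0 x * (cos (\<eta> (?s n) \<bullet> x + p) - cos (\<eta> 0 \<bullet> x + p))) \<longlonglongrightarrow> f 0 x * (cos (\<eta> 0 \<bullet> x + p) - cos (\<eta> 0 \<bullet> x + p))"
          by (intro tendsto_intros isCont_tendsto_compose[OF c0] s0)
        then show "(\<lambda>n. f 0 x * (cos (\<eta> (?s n) \<bullet> x + p) - cos (\<eta> 0 \<bullet> x + p))) \<longlonglongrightarrow> 0" by simp
      qed
    qed simp
    \<comment> \<open>Splitting off the moving frequency: the first integral is bounded by the L1
      distance to \<open>f 0\<close>, the second vanishes by dominated convergence.\<close>
    have e: "M (?s n) - M 0 = (\<integral>x. (f (?s n) x - f 0 x) * cos (\<eta> (?s n) \<bullet> x + p) \<partial>lborel)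
        + (\<integral>x. f 0 x * (cos (\<eta> (?s n) \<bullet> x + p) - cos (\<eta> 0 \<bullet> x + p)) \<partial>lborel)" for n
    proof -
      have i: "integrable lborel (\<lambda>x. f u x * cos (\<eta> v \<bullet> x + p))" if "u \<ge> 0" for u v
      proof (rule Bochner_Integration.integrable_bound[of lborel "f u"])
        have [measurable]: "f u \<in> borel_measurable borel" using fm that by auto
        show "(\<lambda>x. f u x * cos (\<eta> v \<bullet> x + p)) \<in> borel_measurable lborel" by measurable
        show "AE x in lborel. norm (f u x * cos (\<eta> v \<bullet> x + p)) \<le> norm (f u x)"
          by (rule AE_I2) (simp add: abs_mult mult_left_le)
      qed (use fint that in auto)
      have sn: "?s n \<ge> 0" using sp(1)[of n] by simp
      show ?thesis
        using i[OF sn, of "?s n"] i[of 0 "?s n"] i[of 0 0] unfolding M_def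
        by (simp add: left_diff_distrib right_diff_distrib)
    qed
    have "(\<lambda>n. \<integral>x. (f (?s n) x - f 0 x) * cos (\<eta> (?s n) \<bullet> x + p) \<partial>lborel) \<longlonglongrightarrow> 0"
    proof (rule Lim_null_comparison[OF _ a], rule always_eventually, rule allI)
      fix n
      have i: "integrable lborel (\<lambda>x. \<bar>f (?s n) x - f 0 x\<bar>)"
        using fint sp(1)[of n] by (intro integrable_abs Bochner_Integration.integrable_diff) (auto simp: less_imp_le)
      have [measurable]: "f (?s n) \<in> borel_measurable borel" "f 0 \<in> borel_measurable borel"
        using fm sp(1)[of n] by (auto simp: less_imp_le)
      have "norm (\<integral>x. (f (?s n) x - f 0 x) * cos (\<eta> (?s n) \<bullet> x + p) \<partial>lborel) \<le> (\<integral>x. norm ((f (?s n) x - f 0 x) * cos (\<eta> (?s n) \<bullet> x + p)) \<partial>lborel)"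
        by (rule integral_norm_bound)
      also have "\<dots> \<le> (\<integral>x. \<bar>f (?s n) x - f 0 x\<bar> \<partial>lborel)"
      proof (rule integral_mono[OF integrable_norm[OF Bochner_Integration.integrable_bound[OF i]] i])
        show "(\<lambda>x. (f (?s n) x - f 0 x) * cos (\<eta> (?s n) \<bullet> x + p)) \<in> borel_measurable lborel" by measurable
      qed (auto simp: abs_mult mult_left_le)
      finally show "norm (\<integral>x. (f (?s n) x - f 0 x) * cos (\<eta> (?s n) \<bullet> x + p) \<partial>lborel) \<le> (\<integral>x. \<bar>f (?s n) x - f 0 x\<bar> \<partial>lborel)" .
    qed
    then have "(\<lambda>n. M (?s n) - M 0) \<longlonglongrightarrow> 0 + (\<integral>x. 0 \<partial>(lborel :: (real^'n) measure))"
      unfolding e by (rule tendsto_add[OF _ b])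
    then have "(\<lambda>n. M (?s n) - M 0) \<longlonglongrightarrow> 0" by simp
    then show ?thesis by (rule LIM_zero_cancel)
  qed
  have kc: "(\<lambda>n. k (?s n)) \<longlonglongrightarrow> k 0"
    using DERIV_isCont[OF kd] s0 by (rule isCont_tendsto_compose)
  have "(\<lambda>n. exp (k (?s n)) * M (?s n)) \<longlonglongrightarrow> exp (k 0) * M 0"
    by (intro tendsto_intros kc Mlim)
  moreover have "(\<lambda>n. exp (k (?s n)) * M (?s n)) = (\<lambda>n. exp (k t) * M t)"
    by (rule ext, rule const[OF sp, symmetric])
  ultimately have "exp (k 0) * M 0 = exp (k t) * M t"
    using LIMSEQ_unique tendsto_const by metis
  then have "M t = exp (k 0 - k t) * M 0"
    by (simp add: exp_diff field_simps)
  moreover have "\<eta> 0 = transpose (E t) *v \<xi>" by (simp add: \<eta>_def)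
  ultimately show ?thesis
    by (simp add: M_def \<eta>t k_def f0 diff_divide_distrib)
qed

section \<open>Admissible generating functions\<close>

lemma concave_tangent:
  fixes \<phi> \<phi>' \<phi>'' :: "real \<Rightarrow> real"
  assumes d: "\<And>x. x \<in> closed_segment s m \<Longrightarrow> (\<phi> has_real_derivative \<phi>' x) (at x)"
    "\<And>x. x \<in> closed_segment s m \<Longrightarrow> (\<phi>' has_real_derivative \<phi>'' x) (at x)"
    and neg: "\<And>x. x \<in> closed_segment s m \<Longrightarrow> \<phi>'' x \<le> 0"
  shows "\<phi> s \<le> \<phi> m + \<phi>' m * (s - m)"
proof -
  have mono: "\<phi>' y \<le> \<phi>' x" if "x \<le> y" "x \<in> closed_segment s m" "y \<in> closed_segment s m" for x y
  proof (rule DERIV_nonpos_imp_nonincreasing[OF that(1)])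
    fix z assume "x \<le> z" "z \<le> y"
    then have "z \<in> closed_segment s m"
      using that by (auto simp: closed_segment_eq_real_ivl split: if_splits)
    then show "\<exists>d. (\<phi>' has_real_derivative d) (at z) \<and> d \<le> 0" using d neg by blast
  qed
  have dd: "((\<lambda>x. \<phi> x - \<phi>' m * x) has_real_derivative \<phi>' x - \<phi>' m) (at x)" if "x \<in> closed_segment s m" for x
    using d(1)[OF that] by (auto intro!: derivative_eq_intros)
  have "\<phi> s - \<phi>' m * s \<le> \<phi> m - \<phi>' m * m"
  proof (cases "m \<le> s")
    case True
    show ?thesis
    proof (rule DERIV_nonpos_imp_nonincreasing[OF True, of "\<lambda>x. \<phi> x - \<phi>' m * x"])
      fix x assume x: "m \<le> x" "x \<le> s"
      then have xs: "x \<in> closed_segment s m" using True by (auto simp: closed_segment_eq_real_ivl)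
      have "\<phi>' x - \<phi>' m \<le> 0" using mono[OF x(1) _ xs] by simp
      with dd[OF xs] show "\<exists>d. ((\<lambda>x. \<phi> x - \<phi>' m * x) has_real_derivative d) (at x) \<and> d \<le> 0" by blast
    qed
  next
    case False
    then have sm: "s \<le> m" by simp
    show ?thesis
    proof (rule DERIV_nonneg_imp_nondecreasing[OF sm, of "\<lambda>x. \<phi> x - \<phi>' m * x"])
      fix x assume x: "s \<le> x" "x \<le> m"
      then have xs: "x \<in> closed_segment s m" using sm by (auto simp: closed_segment_eq_real_ivl)
      have "0 \<le> \<phi>' x - \<phi>' m" using mono[OF x(2) xs] by simp
      with dd[OF xs] show "\<exists>d. ((\<lambda>x. \<phi> x - \<phi>' m * x) has_real_derivative d) (at x) \<and> 0 \<le> d" by blast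
    qed
  qed
  then show ?thesis by (simp add: algebra_simps)
qed

text \<open>The second derivative of \<open>1 / h\<close> is
  \<open>(2 * (h1 x)\<^sup>2 - h x * h2 x) / (h x) ^ 3\<close>, and the admissibility inequality
  says precisely that its numerator is nonpositive.\<close>

lemma reciprocal_concave_tangent:
  fixes h h1 h2 :: "real \<Rightarrow> real"
  assumes d: "\<And>x. x \<in> closed_segment s m \<Longrightarrow> (h has_real_derivative h1 x) (at x)"
    "\<And>x. x \<in> closed_segment s m \<Longrightarrow> (h1 has_real_derivative h2 x) (at x)"
    and pos: "\<And>x. x \<in> closed_segment s m \<Longrightarrow> 0 < h x"
    and le: "\<And>x. x \<in> closed_segment s m \<Longrightarrow> (h1 x)\<^sup>2 \<le> 1/2 * h x * h2 x"
  shows "1 / h s \<le> 1 / h m - h1 m / (h m)\<^sup>2 * (s - m)"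
proof -
  have "1 / h s \<le> 1 / h m + (- h1 m / (h m)\<^sup>2) * (s - m)"
  proof (rule concave_tangent[where \<phi>''="\<lambda>x. (2 * (h1 x)\<^sup>2 - h x * h2 x) / (h x) ^ 3"])
    fix x assume x: "x \<in> closed_segment s m"
    show "((\<lambda>x. 1 / h x) has_real_derivative - h1 x / (h x)\<^sup>2) (at x)"
      by (rule derivative_eq_intros d[OF x] refl)+ (use pos[OF x] in \<open>auto simp: power2_eq_square\<close>)
    show "((\<lambda>x. - h1 x / (h x)\<^sup>2) has_real_derivative (2 * (h1 x)\<^sup>2 - h x * h2 x) / (h x) ^ 3) (at x)"
      by (rule derivative_eq_intros d[OF x] refl)+
         (use pos[OF x] in \<open>auto simp: power2_eq_square power3_eq_cube field_simps\<close>)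
    show "(2 * (h1 x)\<^sup>2 - h x * h2 x) / (h x) ^ 3 \<le> 0"
      using le[OF x] pos[OF x] by (intro divide_nonpos_pos) auto
  qed
  then show ?thesis by simp
qed

text \<open>A positive concave function on a bounded interval is bounded, so \<open>h\<close> cannot vanish at
  an end point of an interval on which it is positive.\<close>

lemma reciprocal_concave_lower_bound:
  fixes h h1 h2 :: "real \<Rightarrow> real"
  assumes "a < b"
    and d: "\<And>x. x \<in> {a<..<b} \<Longrightarrow> (h has_real_derivative h1 x) (at x)"
    "\<And>x. x \<in> {a<..<b} \<Longrightarrow> (h1 has_real_derivative h2 x) (at x)"
    and pos: "\<And>x. x \<in> {a<..<b} \<Longrightarrow> 0 < h x"
    and le: "\<And>x. x \<in> {a<..<b} \<Longrightarrow> (h1 x)\<^sup>2 \<le> 1/2 * h x * h2 x"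
  obtains e where "0 < e" "\<And>x. x \<in> {a<..<b} \<Longrightarrow> e \<le> h x"
proof -
  let ?m = "(a + b) / 2"
  have m: "?m \<in> {a<..<b}" using assms(1) by auto
  define B where "B = 1 / h ?m + \<bar>h1 ?m / (h ?m)\<^sup>2\<bar> * (b - a)"
  have B: "0 < B" unfolding B_def using pos[OF m] assms(1) by (intro add_pos_nonneg) auto
  have "1 / B \<le> h x" if x: "x \<in> {a<..<b}" for x
  proof -
    have sub: "closed_segment x ?m \<subseteq> {a<..<b}"
      using x m by (auto simp: closed_segment_eq_real_ivl split: if_splits)
    have "1 / h x \<le> 1 / h ?m - h1 ?m / (h ?m)\<^sup>2 * (x - ?m)"
      using sub by (intro reciprocal_concave_tangent[of x ?m h h1 h2] d pos le) auto
    also have "\<dots> \<le> 1 / h ?m + \<bar>h1 ?m / (h ?m)\<^sup>2\<bar> * \<bar>x - ?m\<bar>"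
      using abs_ge_minus_self[of "h1 ?m / (h ?m)\<^sup>2 * (x - ?m)"] unfolding abs_mult by linarith
    also have "\<dots> \<le> B"
      unfolding B_def using x by (intro add_left_mono mult_left_mono) (auto simp: abs_le_iff field_simps)
    finally show ?thesis using pos[OF x] B by (simp add: field_simps)
  qed
  then show thesis using that[of "1 / B"] B by simp
qed

section \<open>Positivity and growth of \<psi>''\<close>

locale admissible_derivs =
  fixes \<psi> \<psi>1 h h1 h2 :: "real \<Rightarrow> real"
  assumes d0: "\<And>s. s > 0 \<Longrightarrow> (\<psi> has_real_derivative \<psi>1 s) (at s)"
    and d1: "\<And>s. s > 0 \<Longrightarrow> (\<psi>1 has_real_derivative h s) (at s)"
    and d2: "\<And>s. s > 0 \<Longrightarrow> (h has_real_derivative h1 s) (at s)"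
    and d3: "\<And>s. s > 0 \<Longrightarrow> (h1 has_real_derivative h2 s) (at s)"
    and h0: "\<And>s. s > 0 \<Longrightarrow> 0 \<le> h s"
    and le: "\<And>s. s > 0 \<Longrightarrow> (h1 s)\<^sup>2 \<le> 1/2 * h s * h2 s"
    and cont: "continuous_on {0..} \<psi>" and psi_1: "\<psi> 1 = 0" and psi1_1: "\<psi>1 1 = 0"
    and nontriv: "\<exists>s\<ge>0. \<psi> s \<noteq> 0"
begin

lemma h_isCont: "s > 0 \<Longrightarrow> isCont h s"
  using d2 DERIV_isCont by blast

text \<open>Let \<open>c\<close> be the zero of \<open>h\<close> nearest to a point \<open>b\<close>
  with \<open>h b > 0\<close>. Strictly between them \<open>h\<close> is positive, hence bounded
  below by a positive constant through reciprocal concavity, which contradicts continuity at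
  \<open>c\<close>.\<close>

lemma h_zero_propagates:
  assumes "0 < a" "0 < b" "h a = 0"
  shows "h b = 0"
proof (rule ccontr)
  assume "h b \<noteq> 0"
  then have hb: "0 < h b" using h0[OF assms(2)] by simp
  let ?S = "closed_segment a b"
  have S: "x > 0" if "x \<in> ?S" for x
    using that assms by (auto simp: closed_segment_eq_real_ivl split: if_splits)
  have ch: "continuous_on ?S h"
    using h_isCont S by (intro continuous_at_imp_continuous_on) auto
  let ?Z = "{x \<in> ?S. h x = 0}"
  have "closed ?Z" by (rule continuous_closed_preimage_constant[OF ch closed_segment])
  moreover have "bounded ?Z" by (rule bounded_subset[OF bounded_closed_segment]) auto
  ultimately have Z: "compact ?Z" "?Z \<noteq> {}"
    using assms(3) by (auto simp: compact_eq_bounded_closed)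
  have cdist: "continuous_on ?Z (\<lambda>x. \<bar>x - b\<bar>)" by (intro continuous_intros)
  obtain c where c: "c \<in> ?S" "h c = 0" and cmin: "\<And>x. x \<in> ?S \<Longrightarrow> h x = 0 \<Longrightarrow> \<bar>c - b\<bar> \<le> \<bar>x - b\<bar>"
    using continuous_attains_inf[OF Z cdist] by auto
  have cb: "c \<noteq> b" using c hb by auto
  let ?l = "min c b" and ?u = "max c b"
  have lu: "?l < ?u" using cb by auto
  have sub: "{?l<..<?u} \<subseteq> ?S" using c(1) by (auto simp: closed_segment_eq_real_ivl split: if_splits)
  have pos: "0 < h x" if "x \<in> {?l<..<?u}" for x
  proof (rule ccontr)
    assume "\<not> 0 < h x"
    then have "h x = 0" using h0[of x] S sub that by fastforce
    then show False using cmin[of x] sub that by (auto simp: abs_if min_def max_def split: if_splits)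
  qed
  have S': "x > 0" if "x \<in> {?l<..<?u}" for x using S sub that by blast
  obtain e where e: "0 < e" "\<And>x. x \<in> {?l<..<?u} \<Longrightarrow> e \<le> h x"
    by (rule reciprocal_concave_lower_bound[OF lu d2[OF S'] d3[OF S'] pos le[OF S']], assumption, assumption, assumption, assumption, rule that)
  \<comment> \<open>Points approaching \<open>c\<close> from the side of \<open>b\<close>; starting
    the denominators at 2 keeps the first point different from \<open>b\<close>, inside the open
    interval.\<close>
  define X where "X n = c + (b - c) * inverse (real (Suc (Suc n)))" for n
  have X: "X n \<in> {?l<..<?u}" for n
  proof -
    define q where "q = inverse (real (Suc (Suc n)))"
    have q: "0 < q" "q < 1" unfolding q_def by (auto simp: inverse_less_1_iff)
    have Xn: "X n = c + (b - c) * q" by (simp add: X_def q_def)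
    show ?thesis
    proof (cases "c < b")
      case True
      have "0 < b - c" using True by simp
      from mult_strict_left_mono[OF q(2) this] have "(b - c) * q < b - c" unfolding mult_1_right .
      moreover have "0 < (b - c) * q" using True q by (intro mult_pos_pos) auto
      ultimately have "c < X n" "X n < b" unfolding Xn by linarith+
      then show ?thesis using True by simp
    next
      case False
      then have bc: "b < c" using cb by simp
      have "0 < c - b" using bc by simp
      from mult_strict_left_mono[OF q(2) this] have "(c - b) * q < c - b" unfolding mult_1_right .
      moreover have "0 < (c - b) * q" using bc q by (intro mult_pos_pos) auto
      moreover have "(b - c) * q = - ((c - b) * q)" by (simp add: algebra_simps)
      ultimately have "X n < c" "b < X n" unfolding Xn by linarith+
      then show ?thesis using bc by simp
    qed
  qed
  have "X \<longlonglongrightarrow> c + (b - c) * 0"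
    unfolding X_def by (intro tendsto_intros LIMSEQ_Suc[OF LIMSEQ_inverse_real_of_nat])
  then have "X \<longlonglongrightarrow> c" by simp
  then have "(\<lambda>n. h (X n)) \<longlonglongrightarrow> h c"
    using h_isCont[OF S[OF c(1)]] by (intro isCont_tendsto_compose[of c h])
  then have "e \<le> h c" using e(2)[OF X] by (intro LIMSEQ_le_const) auto
  then show False using e c by simp
qed

text \<open>One zero of \<psi>'' would spread to the half line; then \<psi>' and \<psi>, which
  vanish at 1, would be zero, against nontriviality. Strict positivity is what permits dividing by
  \<open>h\<close>.\<close>

lemma h_pos:
  assumes "s > 0" shows "0 < h s"
proof (rule ccontr)
  assume "\<not> 0 < h s"
  then have "h s = 0" using h0[OF assms] by simp
  then have z: "h x = 0" if "x > 0" for x using h_zero_propagates[OF assms that] by simp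
  have "\<exists>c. \<forall>x\<in>{0<..}. \<psi>1 x = c"
  proof (rule has_field_derivative_zero_constant)
    show "(\<psi>1 has_real_derivative 0) (at x within {0<..})" if "x \<in> {0<..}" for x
      using d1[of x] z[of x] that by (auto intro: has_field_derivative_at_within)
  qed simp
  then have p1: "\<psi>1 x = 0" if "x > 0" for x
    using that psi1_1 by (metis greaterThan_iff zero_less_one)
  have "\<exists>c. \<forall>x\<in>{0<..}. \<psi> x = c"
  proof (rule has_field_derivative_zero_constant)
    show "(\<psi> has_real_derivative 0) (at x within {0<..})" if "x \<in> {0<..}" for x
      using d0[of x] p1[of x] that by (auto intro: has_field_derivative_at_within)
  qed simp
  then have p0: "\<psi> x = 0" if "x > 0" for x
    using that psi_1 by (metis greaterThan_iff zero_less_one)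
  have "\<psi> 0 = 0"
  proof -
    have "(\<lambda>n. \<psi> (inverse (real (Suc n)))) \<longlonglongrightarrow> \<psi> 0"
      using cont LIMSEQ_inverse_real_of_nat unfolding continuous_on_sequentially comp_def by auto
    moreover have "(\<lambda>n. \<psi> (inverse (real (Suc n)))) = (\<lambda>n. 0)" by (rule ext, rule p0) simp
    ultimately show ?thesis using LIMSEQ_unique tendsto_const by metis
  qed
  then show False using p0 nontriv by (metis less_eq_real_def)
qed

lemma h_tangent:
  assumes "s > 0" "m > 0"
  shows "1 / h s \<le> 1 / h m - h1 m / (h m)\<^sup>2 * (s - m)"
proof -
  have "x > 0" if "x \<in> closed_segment s m" for x
    using that assms by (auto simp: closed_segment_eq_real_ivl split: if_splits)
  then show ?thesis using d2 d3 le h_pos by (intro reciprocal_concave_tangent[of s m h h1 h2]) auto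
qed

sublocale phi_entropy "{0<..}" \<psi> \<psi>1 h h1
  using d0 d1 d2 h_pos h_tangent cont psi_1 psi1_1 by unfold_locales auto

text \<open>A positive concave function on the half line lies below its tangents, so no tangent can
  turn negative before 0; for \<open>1 / h\<close> this says that \<open>s * h s\<close> is
  nondecreasing. Hence \<open>sqrt (h s)\<close> is at most a multiple of \<open>1 / sqrt s\<close>
  below 1 and at least the same multiple above 1, so its primitive stays finite at 0 and is
  unbounded above.\<close>

lemma h_ratio_bounds:
  assumes "s > 0"
  shows "s \<le> 1 \<Longrightarrow> h s \<le> h 1 / s" "1 \<le> s \<Longrightarrow> h 1 / s \<le> h s"
proof -
  let ?q = "\<lambda>s. s * h s"
  have "?q x \<le> ?q y" if "0 < x" "x \<le> y" for x y
  proof (rule DERIV_nonneg_imp_nondecreasing[OF that(2)])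
    fix z assume "x \<le> z" "z \<le> y"
    then have z: "0 < z" using that by simp
    have dz: "(h has_real_derivative h1 z) (at z)" using d2[of z] z by simp
    have "((\<lambda>s. s * h s) has_real_derivative h z + z * h1 z) (at z)"
      by (rule derivative_eq_intros dz refl)+ simp
    moreover have "0 \<le> h z + z * h1 z"
    proof (rule ccontr)
      assume "\<not> 0 \<le> h z + z * h1 z"
      then have neg: "h z + z * h1 z < 0" by simp
      define e where "e = - (h z + z * h1 z)"
      have e: "e > 0" using neg by (simp add: e_def)
      have hz: "h z > 0" using h_pos[OF z] .
      have k: "h1 z < 0" using neg hz z by (metis add_less_same_cancel1 add_pos_pos less_add_same_cancel1 linorder_neqE_linordered_idom mult_pos_pos mult_zero_right not_less_iff_gr_or_eq add_0_right)
      \<comment> \<open>A point so close to 0 that the tangent of \<open>1 / h\<close> at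
        \<open>z\<close> is already negative there, although \<open>1 / h r\<close> is
        positive.\<close>
      define r where "r = min z (e / (- 2 * h1 z))"
      have r: "r > 0" "r \<le> z" "- h1 z * r \<le> e / 2"
      proof -
        show "r > 0" using z e k by (auto simp: r_def divide_simps)
        show "r \<le> z" by (simp add: r_def)
        have "- h1 z * r \<le> - h1 z * (e / (- 2 * h1 z))" using k by (intro mult_left_mono) (auto simp: r_def)
        also have "\<dots> = e / 2" using k by simp
        finally show "- h1 z * r \<le> e / 2" .
      qed
      have "0 < 1 / h r" using h_pos[OF r(1)] by simp
      also have "\<dots> \<le> 1 / h z - h1 z / (h z)\<^sup>2 * (r - z)" using h_tangent[OF r(1) z] .
      also have "\<dots> = (h z + z * h1 z - h1 z * r) / (h z)\<^sup>2"
        using hz by (simp add: field_simps power2_eq_square)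
      finally have "0 < h z + z * h1 z - h1 z * r" using hz by (simp add: zero_less_divide_iff)
      then show False using r(3) e by (simp add: e_def)
    qed
    ultimately show "\<exists>d. ((\<lambda>s. s * h s) has_real_derivative d) (at z) \<and> 0 \<le> d" by blast
  qed note mono = this
  show "s \<le> 1 \<Longrightarrow> h s \<le> h 1 / s" using mono[of s 1] assms by (simp add: field_simps)
  show "1 \<le> s \<Longrightarrow> h 1 / s \<le> h s" using mono[of 1 s] assms by (simp add: field_simps)
qed

end

text \<open>\<open>V\<close> inverts \<open>W = \<int>\<^sub>1 (\<psi>'')\<^sup>1\<^sup>/\<^sup>2\<close>, so that \<open>\<psi>''(V u) |\<nabla>(V u)|\<^sup>2 = |\<nabla>u|\<^sup>2\<close> for smooth \<open>u\<close>.\<close>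

locale entropy_root = phi_entropy +
  fixes J :: "real set" and W V :: "real \<Rightarrow> real"
  assumes J: "(\<exists>\<alpha><0. J = {\<alpha><..}) \<or> J = UNIV"
    and V_in: "\<And>u. u \<in> J \<Longrightarrow> V u \<in> I"
    and V_deriv: "\<And>u. u \<in> J \<Longrightarrow> (V has_real_derivative 1 / sqrt (h (V u))) (at u)"
    and V_W: "\<And>s. s \<in> I \<Longrightarrow> V (W s) = s"
    and W_in: "\<And>s. s \<in> I \<Longrightarrow> W s \<in> J"
    and W_1: "W 1 = 0"
    and W_closure: "\<And>s. s \<in> closure I \<Longrightarrow> W s \<in> closure J"
    and V_boundary: "\<And>s X. s \<in> closure I \<Longrightarrow> range X \<subseteq> J \<Longrightarrow> X \<longlonglongrightarrow> W s \<Longrightarrow> (\<lambda>n. V (X n)) \<longlonglongrightarrow> s"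

text \<open>\<open>J\<close> is the range of the primitive on positive arguments: by
  \<open>h_ratio_bounds\<close> it is unbounded above and has a finite lower end
  \<open>\<alpha> = W 0\<close>. The value 0 of a density corresponds to this end point, which lies
  outside \<open>J\<close>; there \<open>V\<close> is controlled along sequences, and monotonicity
  of the primitive forces the limit 0.\<close>

lemma (in admissible_derivs) root:
  fixes W :: "real \<Rightarrow> real"
  assumes W_def: "\<And>s. W s = (LBINT x=1..s. sqrt (h x))"
  obtains J V where "entropy_root {0<..} \<psi> \<psi>1 h h1 J W V"
proof -
  have sc: "isCont (\<lambda>x. sqrt (h x)) x" if "x > 0" for x
    using h_isCont[OF that] by (intro continuous_intros)
  have "\<exists>F. \<forall>x. (0::ereal) < x \<longrightarrow> x < (\<infinity>::ereal) \<longrightarrow> (F has_vector_derivative sqrt (h x)) (at x)"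
    by (rule einterval_antiderivative) (use sc in auto)
  then obtain F0 where F0: "\<And>x. 0 < x \<Longrightarrow> (F0 has_vector_derivative sqrt (h x)) (at x)" by auto
  define F where "F x = F0 x - F0 1" for x
  have Fd: "(F has_real_derivative sqrt (h x)) (at x)" if "x > 0" for x
    using F0[OF that] unfolding F_def
    by (auto intro!: derivative_eq_intros simp: has_real_derivative_iff_has_vector_derivative[symmetric])
  have F1: "F 1 = 0" by (simp add: F_def)
  have WF: "W s = F s" if "s > 0" for s
  proof -
    have "(LBINT x=ereal 1..ereal s. sqrt (h x)) = F s - F 1"
    proof (rule interval_integral_FTC_finite)
      show "continuous_on {min 1 s..max 1 s} (\<lambda>x. sqrt (h x))"
        using that sc by (intro continuous_at_imp_continuous_on) (auto simp: min_def split: if_splits)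
      show "(F has_vector_derivative sqrt (h x)) (at x within {min 1 s..max 1 s})" if "min 1 s \<le> x" "x \<le> max 1 s" for x
        using Fd[of x] that \<open>s > 0\<close>
        by (auto simp: has_real_derivative_iff_has_vector_derivative[symmetric] min_def intro: has_field_derivative_at_within split: if_splits)
    qed
    then show ?thesis by (simp add: W_def F1 one_ereal_def)
  qed
  have Fmono: "F x < F y" if "0 < x" "x < y" for x y
  proof (rule DERIV_pos_imp_increasing[OF that(2)])
    fix z assume "x \<le> z" "z \<le> y"
    then have "z > 0" using that by simp
    then show "\<exists>d. (F has_real_derivative d) (at z) \<and> 0 < d" using Fd h_pos by (intro exI[of _ "sqrt (h z)"]) auto
  qed
  have h1p: "0 < h 1" by (rule h_pos) simp
  \<comment> \<open>\<open>c * sqrt x\<close> is a primitive of \<open>sqrt (h 1 / x)\<close>, the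
    comparison function from \<open>h_ratio_bounds\<close>.\<close>
  define c where "c = 2 * sqrt (h 1)"
  have c: "0 < c" using h1p by (simp add: c_def)
  have csd: "((\<lambda>x. c * sqrt x) has_real_derivative sqrt (h 1 / x)) (at x)" if "x > 0" for x
  proof -
    have "((\<lambda>x. c * sqrt x) has_real_derivative c * (inverse (sqrt x) / 2)) (at x)"
      by (intro DERIV_cmult DERIV_real_sqrt that)
    also have "c * (inverse (sqrt x) / 2) = sqrt (h 1 / x)"
      unfolding c_def real_sqrt_divide by (simp add: inverse_eq_divide)
    finally show ?thesis .
  qed
  have Flow: "- c \<le> F s" if "0 < s" "s \<le> 1" for s
  proof -
    have "F s - c * sqrt s \<ge> F 1 - c * sqrt 1"
    proof (rule DERIV_nonpos_imp_nonincreasing[OF that(2), of "\<lambda>s. F s - c * sqrt s"])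
      fix x assume "s \<le> x" "x \<le> 1"
      then have x: "0 < x" "x \<le> 1" using that by auto
      have "((\<lambda>s. F s - c * sqrt s) has_real_derivative sqrt (h x) - sqrt (h 1 / x)) (at x)"
        by (intro DERIV_diff Fd csd x)
      moreover have "sqrt (h x) - sqrt (h 1 / x) \<le> 0" using h_ratio_bounds(1)[OF x] by simp
      ultimately show "\<exists>d. ((\<lambda>s. F s - c * sqrt s) has_real_derivative d) (at x) \<and> d \<le> 0" by blast
    qed
    moreover have "0 \<le> c * sqrt s" using c that by simp
    ultimately show ?thesis using F1 by simp
  qed
  have Fhigh: "c * sqrt s - c \<le> F s" if "1 \<le> s" for s
  proof -
    have "F 1 - c * sqrt 1 \<le> F s - c * sqrt s"
    proof (rule DERIV_nonneg_imp_nondecreasing[OF that, of "\<lambda>s. F s - c * sqrt s"])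
      fix x assume "1 \<le> x" "x \<le> s"
      then have x: "0 < x" "1 \<le> x" by auto
      have "((\<lambda>s. F s - c * sqrt s) has_real_derivative sqrt (h x) - sqrt (h 1 / x)) (at x)"
        by (intro DERIV_diff Fd csd x)
      moreover have "0 \<le> sqrt (h x) - sqrt (h 1 / x)" using h_ratio_bounds(2)[OF x] by simp
      ultimately show "\<exists>d. ((\<lambda>s. F s - c * sqrt s) has_real_derivative d) (at x) \<and> 0 \<le> d" by blast
    qed
    then show ?thesis using F1 by simp
  qed
  define \<alpha> where "\<alpha> = Inf (F ` {0<..1})"
  have bdd: "bdd_below (F ` {0<..1})" using Flow by (intro bdd_belowI[of _ "- c"]) auto
  have \<alpha>le: "\<alpha> < F s" if "s > 0" for s
  proof -
    have "\<alpha> \<le> F (min (s / 2) 1)" unfolding \<alpha>_def using bdd that by (intro cInf_lower) auto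
    also have "\<dots> < F s" using that by (intro Fmono) (auto simp: min_def)
    finally show ?thesis .
  qed
  have \<alpha>app: "\<exists>s>0. F s < y" if "\<alpha> < y" for y
    using cInf_lessD[of "F ` {0<..1}" y] that unfolding \<alpha>_def by auto
  have F0lim: "(F \<longlongrightarrow> \<alpha>) (at_right 0)"
  proof (rule order_tendstoI)
    fix a assume "a < \<alpha>"
    then show "\<forall>\<^sub>F x in at_right 0. a < F x"
      unfolding eventually_at_right_field using \<alpha>le by (intro exI[of _ 1]) (auto intro: less_trans)
  next
    fix a assume "\<alpha> < a"
    then obtain s where s: "s > 0" "F s < a" using \<alpha>app by blast
    then show "\<forall>\<^sub>F x in at_right 0. F x < a"
      unfolding eventually_at_right_field using Fmono by (intro exI[of _ s]) (auto intro: less_trans)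
  qed
  have W0: "W 0 = \<alpha>"
  proof -
    have "(LBINT x=ereal 0..ereal 1. sqrt (h x)) = F 1 - \<alpha>"
    proof (rule interval_integral_FTC_nonneg(2))
      show "((F \<circ> real_of_ereal) \<longlongrightarrow> \<alpha>) (at_right (ereal 0))"
        unfolding ereal_tendsto_simps by (rule F0lim)
      show "((F \<circ> real_of_ereal) \<longlongrightarrow> F 1) (at_left (ereal 1))"
        unfolding ereal_tendsto_simps
        using DERIV_isCont[OF Fd[of 1]] by (simp add: isCont_def filterlim_at_split)
    qed (use Fd sc h_pos in \<open>auto intro!: AE_I2 simp: less_imp_le\<close>)
    then have "(LBINT x=0..1. sqrt (h x)) = - \<alpha>"
      by (simp add: F1 zero_ereal_def one_ereal_def)
    then show ?thesis
      by (subst W_def, subst interval_integral_endpoints_reverse) (simp add: zero_ereal_def[symmetric] one_ereal_def[symmetric])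
  qed
  have \<alpha>neg: "\<alpha> < 0" using \<alpha>le[of 1] F1 by simp
  have surj: "\<exists>s>0. F s = u" if u: "u > \<alpha>" for u
  proof -
    obtain s1 where s1: "s1 > 0" "F s1 < u" using \<alpha>app[OF u] by blast
    \<comment> \<open>Large enough that \<open>c * sqrt s2 - c\<close> is at least the absolute
      value of \<open>u\<close>; together with \<open>s1\<close> this brackets \<open>u\<close> for
      the intermediate value theorem.\<close>
    define s2 where "s2 = max (max 1 s1) (((\<bar>u\<bar> + c) / c)\<^sup>2)"
    have "(\<bar>u\<bar> + c) / c \<le> sqrt s2"
      by (rule real_le_rsqrt) (simp add: s2_def)
    then have "\<bar>u\<bar> + c \<le> c * sqrt s2" using c by (simp add: field_simps)
    moreover have "c * sqrt s2 - c \<le> F s2" by (rule Fhigh) (simp add: s2_def)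
    ultimately have "u \<le> F s2" by linarith
    moreover have "s1 \<le> s2" by (simp add: s2_def)
    ultimately obtain s where "s1 \<le> s" "s \<le> s2" "F s = u"
      using IVT'[of F s1 u s2] s1 DERIV_isCont[OF Fd] by (metis continuous_at_imp_continuous_on atLeastAtMost_iff less_le_trans less_imp_le)
    then show ?thesis using s1 by (intro exI[of _ s]) auto
  qed
  define V where "V u = (THE s. s > 0 \<and> F s = u)" for u
  have Finj: "x = y" if "0 < x" "0 < y" "F x = F y" for x y
    using Fmono[of x y] Fmono[of y x] that by (metis less_irrefl linorder_neqE_linordered_idom)
  have V: "V u > 0" "F (V u) = u" if "u > \<alpha>" for u
  proof -
    have "\<exists>!s. s > 0 \<and> F s = u" using surj[OF that] Finj by metis
    from theI'[OF this] show "V u > 0" "F (V u) = u" unfolding V_def by auto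
  qed
  have VF: "V (F s) = s" if "s > 0" for s
    unfolding V_def using that Finj by (intro the_equality) auto
  have Vc: "isCont V u" if "u > \<alpha>" for u
  proof -
    have "isCont V (F (V u))"
    proof (rule isCont_inverse_function[where d="V u / 2" and f=F and g=V and x="V u"])
      show "V (F z) = z" "isCont F z" if "\<bar>z - V u\<bar> \<le> V u / 2" for z
      proof -
        have "z > 0" using that V(1)[OF \<open>u > \<alpha>\<close>] by linarith
        then show "V (F z) = z" "isCont F z" using VF DERIV_isCont[OF Fd] by auto
      qed
    qed (use V[OF that] in auto)
    then show ?thesis using V[OF that] by simp
  qed
  have Vd: "(V has_real_derivative 1 / sqrt (h (V u))) (at u)" if u: "u > \<alpha>" for u
  proof -
    have "(V has_real_derivative inverse (sqrt (h (V u)))) (at u)"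
      by (rule DERIV_inverse_function[where f=F and a=\<alpha> and b="u + 1"])
         (use Fd[OF V(1)[OF u]] h_pos[OF V(1)[OF u]] u V Vc[OF u] in auto)
    then show ?thesis by (simp add: inverse_eq_divide)
  qed
  have "entropy_root {0<..} \<psi> \<psi>1 h h1 {\<alpha><..} W V"
  proof (unfold_locales)
    show "(\<exists>\<alpha>'<0. {\<alpha><..} = {\<alpha>'<..}) \<or> {\<alpha><..} = UNIV" using \<alpha>neg by blast
    show "V u \<in> {0<..}" if "u \<in> {\<alpha><..}" for u using V that by auto
    show "(V has_real_derivative 1 / sqrt (h (V u))) (at u)" if "u \<in> {\<alpha><..}" for u using Vd that by auto
    show "V (W s) = s" "W s \<in> {\<alpha><..}" if "s \<in> {0<..}" for s using that VF WF \<alpha>le by auto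
    show "W 1 = 0" using WF[of 1] F1 by simp
    show "W s \<in> closure {\<alpha><..}" if "s \<in> closure {0<..}" for s
      using that W0 WF[of s] \<alpha>le[of s] by (cases "s = 0") auto
    fix s :: real and X :: "nat \<Rightarrow> real"
    assume s: "s \<in> closure {0<..}" and X: "range X \<subseteq> {\<alpha><..}" and lim: "X \<longlonglongrightarrow> W s"
    show "(\<lambda>n. V (X n)) \<longlonglongrightarrow> s"
    proof (cases "s = 0")
      case False
      then have s: "s > 0" using s by auto
      have "(\<lambda>n. V (X n)) \<longlonglongrightarrow> V (W s)"
        using Vc[of "W s"] \<alpha>le[OF s] WF[OF s] lim by (intro isCont_tendsto_compose[of _ V]) auto
      then show ?thesis using VF[OF s] WF[OF s] by simp
    next
      case True
      have Xp: "V (X n) > 0" "F (V (X n)) = X n" for n using V[of "X n"] X by auto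
      show ?thesis
        unfolding True
      proof (rule order_tendstoI)
        fix a :: real assume "a < 0"
        then show "\<forall>\<^sub>F n in sequentially. a < V (X n)"
          using Xp(1) by (intro always_eventually allI) (metis less_trans)
      next
        fix a :: real assume a: "0 < a"
        have "\<forall>\<^sub>F n in sequentially. X n < F a"
          using lim True W0 \<alpha>le[OF a] by (intro order_tendstoD(2)) auto
        then show "\<forall>\<^sub>F n in sequentially. V (X n) < a"
        proof (rule eventually_mono)
          fix n assume "X n < F a"
          then show "V (X n) < a" using Xp[of n] Fmono[of a "V (X n)"] a by (metis less_irrefl linorder_neqE_linordered_idom less_trans)
        qed
      qed
    qed
  qed
  then show thesis by (rule that)
qed

text \<open>With constant second derivative the primitive is affine and maps the line onto itself,
  so there is no boundary value to treat.\<close>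

lemma quadratic_root:
  fixes W :: "real \<Rightarrow> real"
  assumes W_def: "\<And>s. W s = (LBINT x=1..s. sqrt 2)"
  shows "entropy_root UNIV (\<lambda>s. (s - 1)\<^sup>2) (\<lambda>s. 2 * (s - 1)) (\<lambda>_. 2) (\<lambda>_. 0) UNIV W (\<lambda>u. 1 + u / sqrt 2)"
proof -
  have W: "W s = sqrt 2 * (s - 1)" for s
  proof -
    have "(LBINT x=ereal 1..ereal s. sqrt 2) = sqrt 2 * s - sqrt 2 * 1"
      by (rule interval_integral_FTC_finite)
         (auto intro!: derivative_eq_intros simp: has_real_derivative_iff_has_vector_derivative[symmetric])
    then show ?thesis by (simp add: W_def algebra_simps one_ereal_def)
  qed
  show ?thesis
  proof unfold_locales
    fix s and X :: "nat \<Rightarrow> real" assume "X \<longlonglongrightarrow> W s"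
    then have "(\<lambda>n. 1 + X n / sqrt 2) \<longlonglongrightarrow> 1 + W s / sqrt 2" by (intro tendsto_intros) auto
    then show "(\<lambda>n. 1 + X n / sqrt 2) \<longlonglongrightarrow> s" by (simp add: W)
  qed (auto intro!: derivative_eq_intros continuous_intros simp: W real_div_sqrt)
qed

section \<open>Entropy decay along Mehler operators\<close>

declare transpose_matrix_vector [simp del]

lemma continuous_on_matrix_mult [continuous_intros]:
  "continuous_on S f \<Longrightarrow> continuous_on S (\<lambda>x. (A :: real^'n^'m) *v f x)"
  by (rule bounded_linear.continuous_on[OF matrix_vector_mul_bounded_linear])

lemma norm_Pair_sq: "(norm (a, b))\<^sup>2 = (norm a)\<^sup>2 + (norm b)\<^sup>2"
  by (simp add: norm_Pair)

text \<open>The positive and negative parts of the difference are densities of finite measures with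
  equal cosine transforms, so \<open>measure_eqI_cos\<close> applies although \<open>f\<close> and
  \<open>g\<close> may change sign.\<close>

lemma cos_transform_unique:
  fixes f g :: "'a::euclidean_space \<Rightarrow> real"
  assumes f: "integrable lborel f" and g: "integrable lborel g"
    and eq: "\<And>\<xi> p. (\<integral>x. f x * cos (\<xi> \<bullet> x + p) \<partial>lborel) = (\<integral>x. g x * cos (\<xi> \<bullet> x + p) \<partial>lborel)"
  shows "AE x in lborel. f x = g x"
proof -
  define d where "d x = f x - g x" for x
  have [measurable]: "f \<in> borel_measurable borel" "g \<in> borel_measurable borel" using f g by auto
  have dm[measurable]: "d \<in> borel_measurable borel" unfolding d_def by measurable
  have d: "integrable lborel d" unfolding d_def using f g by auto
  let ?p = "\<lambda>x. max 0 (d x)" and ?n = "\<lambda>x. max 0 (- d x)"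
  have pn: "integrable lborel ?p" "integrable lborel ?n" using d by (auto intro!: integrable_max)
  have fin: "finite_measure (density lborel (\<lambda>x. ennreal (q x)))" if "integrable lborel q" "\<And>x. 0 \<le> q x" for q :: "'a \<Rightarrow> real"
  proof
    have "(\<integral>\<^sup>+x. ennreal (q x) \<partial>lborel) = ennreal (\<integral>x. q x \<partial>lborel)"
      using that by (intro nn_integral_eq_integral) auto
    then show "emeasure (density lborel (\<lambda>x. ennreal (q x))) (space (density lborel (\<lambda>x. ennreal (q x)))) \<noteq> \<infinity>"
      using that by (subst emeasure_density) auto
  qed
  have int: "integrable lborel (\<lambda>x. q x * cos (\<xi> \<bullet> x + p))" if q: "integrable lborel q" for q :: "'a \<Rightarrow> real" and \<xi> p
  proof (rule Bochner_Integration.integrable_bound[OF q])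
    have [measurable]: "q \<in> borel_measurable borel" using q by auto
    show "(\<lambda>x. q x * cos (\<xi> \<bullet> x + p)) \<in> borel_measurable lborel" by measurable
  qed (auto simp: abs_mult mult_left_le)
  have "density lborel (\<lambda>x. ennreal (?p x)) = density lborel (\<lambda>x. ennreal (?n x))"
  proof (rule measure_eqI_cos)
    show "finite_measure (density lborel (\<lambda>x. ennreal (?p x)))" "finite_measure (density lborel (\<lambda>x. ennreal (?n x)))"
      by (rule fin[OF pn(1)], simp, rule fin[OF pn(2)], simp)
    fix \<xi> p
    have "(\<integral>x. ?p x * cos (\<xi> \<bullet> x + p) \<partial>lborel) - (\<integral>x. ?n x * cos (\<xi> \<bullet> x + p) \<partial>lborel)
        = (\<integral>x. ?p x * cos (\<xi> \<bullet> x + p) - ?n x * cos (\<xi> \<bullet> x + p) \<partial>lborel)"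
      using int pn by (intro Bochner_Integration.integral_diff[symmetric]) auto
    also have "\<dots> = (\<integral>x. f x * cos (\<xi> \<bullet> x + p) - g x * cos (\<xi> \<bullet> x + p) \<partial>lborel)"
      by (rule Bochner_Integration.integral_cong[OF refl]) (auto simp: d_def max_def algebra_simps)
    also have "\<dots> = 0" using int[OF f] int[OF g] eq by simp
    finally have e: "(\<integral>x. ?p x * cos (\<xi> \<bullet> x + p) \<partial>lborel) = (\<integral>x. ?n x * cos (\<xi> \<bullet> x + p) \<partial>lborel)" by simp
    have id: "(\<integral>x. cos (\<xi> \<bullet> x + p) \<partial>density lborel (\<lambda>x. ennreal (q x))) = (\<integral>x. q x * cos (\<xi> \<bullet> x + p) \<partial>lborel)"
      if "q \<in> borel_measurable borel" "\<And>x. 0 \<le> q x" for q :: "'a \<Rightarrow> real"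
      using that by (subst integral_density) auto
    show "(\<integral>x. cos (\<xi> \<bullet> x + p) \<partial>density lborel (\<lambda>x. ennreal (?p x))) = (\<integral>x. cos (\<xi> \<bullet> x + p) \<partial>density lborel (\<lambda>x. ennreal (?n x)))"
      by (rule trans[OF id trans[OF e id[symmetric]]]) auto
  qed auto
  then have "AE x in lborel. ennreal (?p x) = ennreal (?n x)"
    by (rule sigma_finite_measure.density_unique[OF sigma_finite_lborel, rotated 2]) auto
  then show ?thesis
    by (rule AE_mp) (auto intro!: AE_I2 simp: d_def max_def split: if_splits)
qed

section \<open>Integrals against the invariant Gaussian and the Mehler operator\<close>

lemma matrix_borel_measurable[measurable]: "(*v) (A :: real^'n^'m) \<in> borel_measurable borel"
  by (intro borel_measurable_continuous_onI linear_continuous_on) simp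

lemma finf_integral:
  fixes K M :: "real^'n^'n" and q :: "real^'n \<Rightarrow> real"
  assumes K: "sym_mat K" "pos_def K" and M: "K = M ** transpose M" and q[measurable]: "q \<in> borel_measurable borel"
  shows "(\<integral>x. finf K x * q x \<partial>lborel) = (\<integral>u. q (M *v u) \<partial>gauss)"
    and "integrable lborel (\<lambda>x. finf K x * q x) \<longleftrightarrow> integrable gauss (\<lambda>u. q (M *v u))"
    and "(\<integral>\<^sup>+x. ennreal (finf K x) * ennreal (q x) \<partial>lborel) = (\<integral>\<^sup>+u. ennreal (q (M *v u)) \<partial>gauss)"
    and "finf K x > 0" and "finf K \<in> borel_measurable borel" and "continuous_on UNIV (finf K)"
proof -
  note g = gauss_image_density[OF K M]
  show cont: "continuous_on UNIV (finf K)"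
    unfolding finf_def[abs_def] by (intro continuous_intros) auto
  then show fm[measurable]: "finf K \<in> borel_measurable borel" by (rule borel_measurable_continuous_onI)
  show pos: "finf K x > 0" for x
    using g(2)[of "matrix_inv M *v x"] matrix_inv_mult(4)[OF g(3)] by simp
  have "(\<integral>x. finf K x * q x \<partial>lborel) = (\<integral>x. q x \<partial>density lborel (\<lambda>x. ennreal (finf K x)))"
    by (subst integral_density) (auto simp: less_imp_le[OF pos])
  also have "\<dots> = (\<integral>u. q (M *v u) \<partial>gauss)" unfolding g(1) by (subst integral_distr) auto
  finally show "(\<integral>x. finf K x * q x \<partial>lborel) = (\<integral>u. q (M *v u) \<partial>gauss)" .
  have "integrable lborel (\<lambda>x. finf K x * q x) \<longleftrightarrow> integrable (density lborel (\<lambda>x. ennreal (finf K x))) q"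
    by (subst integrable_density) (auto simp: less_imp_le[OF pos])
  also have "\<dots> \<longleftrightarrow> integrable gauss (\<lambda>u. q (M *v u))" unfolding g(1) by (subst integrable_distr_eq) auto
  finally show "integrable lborel (\<lambda>x. finf K x * q x) \<longleftrightarrow> integrable gauss (\<lambda>u. q (M *v u))" .
  have "(\<integral>\<^sup>+x. ennreal (finf K x) * ennreal (q x) \<partial>lborel) = (\<integral>\<^sup>+x. ennreal (q x) \<partial>density lborel (\<lambda>x. ennreal (finf K x)))"
    by (subst nn_integral_density) auto
  also have "\<dots> = (\<integral>\<^sup>+u. ennreal (q (M *v u)) \<partial>gauss)" unfolding g(1) by (subst nn_integral_distr) auto
  finally show "(\<integral>\<^sup>+x. ennreal (finf K x) * ennreal (q x) \<partial>lborel) = (\<integral>\<^sup>+u. ennreal (q (M *v u)) \<partial>gauss)" .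
qed

text \<open>\<open>T\<close> is the Ornstein-Uhlenbeck type operator acting on densities relative to the invariant
  Gaussian with covariance \<open>K\<close>, in Mehler form.\<close>

locale gauss_transport =
  fixes K M A N :: "real^'n^'n"
  assumes KM: "K = M ** transpose M" and KN: "K = A ** K ** transpose A + N ** transpose N"
begin

definition T :: "(real^'n \<Rightarrow> real) \<Rightarrow> real^'n \<Rightarrow> real" where
  "T g x = (\<integral>z. g (A *v x + N *v z) \<partial>gauss)"

text \<open>For independent standard Gaussian \<open>u\<close> and \<open>z\<close>,
  \<open>M *v u\<close> and \<open>Y (u, z)\<close> are the values of a stationary Gaussian process
  at two times, and \<open>T q (M *v u)\<close> is the conditional expectation of
  \<open>q (Y (u, z))\<close> given \<open>u\<close>.\<close>

definition Y :: "(real^'n) \<times> (real^'n) \<Rightarrow> real^'n" where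
  "Y z = A *v (M *v fst z) + N *v snd z"

lemma Y_measurable[measurable]: "Y \<in> borel_measurable borel"
  unfolding Y_def[abs_def] by (intro borel_measurable_continuous_onI continuous_intros)

lemma K_inner: "\<xi> \<bullet> (K *v \<eta>) = (transpose M *v \<xi>) \<bullet> (transpose M *v \<eta>)"
proof -
  have "\<xi> \<bullet> (K *v \<eta>) = \<xi> \<bullet> (M *v (transpose M *v \<eta>))"
    by (simp only: KM matrix_vector_mul_assoc)
  also have "\<dots> = (M *v (transpose M *v \<eta>)) \<bullet> \<xi>" by (rule inner_commute)
  also have "\<dots> = (transpose M *v \<eta>) \<bullet> (transpose M *v \<xi>)" by (rule inner_matrix_transpose)
  finally show ?thesis by (simp only: inner_commute)
qed

lemma K_split: "\<xi> \<bullet> (K *v \<xi>) = (norm (transpose M *v (transpose A *v \<xi>)))\<^sup>2 + (norm (transpose N *v \<xi>))\<^sup>2"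
proof -
  have "\<xi> \<bullet> (K *v \<xi>) = \<xi> \<bullet> ((A ** K ** transpose A) *v \<xi>) + \<xi> \<bullet> ((N ** transpose N) *v \<xi>)"
    by (subst KN) (simp only: matrix_vector_mult_add_rdistrib inner_add_right)
  also have "\<xi> \<bullet> ((A ** K ** transpose A) *v \<xi>) = (transpose A *v \<xi>) \<bullet> (K *v (transpose A *v \<xi>))"
  proof -
    have "\<xi> \<bullet> ((A ** K ** transpose A) *v \<xi>) = (A *v (K *v (transpose A *v \<xi>))) \<bullet> \<xi>"
      by (simp only: matrix_vector_mul_assoc matrix_mul_assoc inner_commute)
    also have "\<dots> = (K *v (transpose A *v \<xi>)) \<bullet> (transpose A *v \<xi>)" by (rule inner_matrix_transpose)
    finally show ?thesis by (simp only: inner_commute)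
  qed
  also have "\<dots> = (norm (transpose M *v (transpose A *v \<xi>)))\<^sup>2"
    unfolding K_inner power2_norm_eq_inner ..
  also have "\<xi> \<bullet> ((N ** transpose N) *v \<xi>) = (norm (transpose N *v \<xi>))\<^sup>2"
  proof -
    have "\<xi> \<bullet> ((N ** transpose N) *v \<xi>) = (N *v (transpose N *v \<xi>)) \<bullet> \<xi>"
      by (simp only: matrix_vector_mul_assoc inner_commute)
    also have "\<dots> = (norm (transpose N *v \<xi>))\<^sup>2" unfolding power2_norm_eq_inner by (rule inner_matrix_transpose)
    finally show ?thesis .
  qed
  finally show ?thesis .
qed

lemma Y_law: "distr gauss borel Y = distr gauss borel ((*v) M)"
proof (rule gauss_linear_law'[where S'="\<lambda>\<xi>. (transpose M *v (transpose A *v \<xi>), transpose N *v \<xi>)" and T'="\<lambda>\<xi>. transpose M *v \<xi>"])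
  show "linear Y"
    by (rule linearI) (auto simp: Y_def matrix_vector_right_distrib matrix_vector_mult_scaleR scaleR_add_right)
  show "linear ((*v) M)" by simp
  show "Y x \<bullet> y = x \<bullet> (transpose M *v (transpose A *v y), transpose N *v y)" for x y
    by (cases x) (simp only: Y_def fst_conv snd_conv inner_add_left inner_matrix_transpose inner_Pair)
  show "(M *v x) \<bullet> y = x \<bullet> (transpose M *v y)" for x y by (rule inner_matrix_transpose)
  fix \<xi>
  have "(norm (transpose M *v (transpose A *v \<xi>), transpose N *v \<xi>))\<^sup>2 = (norm (transpose M *v \<xi>))\<^sup>2"
  proof -
    have "(norm (transpose M *v (transpose A *v \<xi>), transpose N *v \<xi>))\<^sup>2 = \<xi> \<bullet> (K *v \<xi>)"
      by (simp only: norm_Pair_sq K_split)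
    also have "\<dots> = (norm (transpose M *v \<xi>))\<^sup>2" by (simp only: K_inner power2_norm_eq_inner)
    finally show ?thesis .
  qed
  then show "norm (transpose M *v (transpose A *v \<xi>), transpose N *v \<xi>) = norm (transpose M *v \<xi>)" by simp
qed

lemma Y_integral:
  fixes q :: "real^'n \<Rightarrow> real"
  assumes q[measurable]: "q \<in> borel_measurable borel"
  shows "(\<integral>z. q (Y z) \<partial>gauss) = (\<integral>u. q (M *v u) \<partial>gauss)"
    and "integrable gauss (\<lambda>z. q (Y z)) \<longleftrightarrow> integrable gauss (\<lambda>u. q (M *v u))"
proof -
  have "(\<integral>z. q (Y z) \<partial>gauss) = (\<integral>x. q x \<partial>distr gauss borel Y)" by (subst integral_distr) auto
  also have "\<dots> = (\<integral>u. q (M *v u) \<partial>gauss)" unfolding Y_law by (subst integral_distr) auto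
  finally show "(\<integral>z. q (Y z) \<partial>gauss) = (\<integral>u. q (M *v u) \<partial>gauss)" .
  have "integrable gauss (\<lambda>z. q (Y z)) \<longleftrightarrow> integrable (distr gauss borel Y) q" by (subst integrable_distr_eq) auto
  also have "\<dots> \<longleftrightarrow> integrable gauss (\<lambda>u. q (M *v u))" unfolding Y_law by (subst integrable_distr_eq) auto
  finally show "integrable gauss (\<lambda>z. q (Y z)) \<longleftrightarrow> integrable gauss (\<lambda>u. q (M *v u))" .
qed

lemma T_Y: "T q (M *v u) = (\<integral>z. q (Y (u, z)) \<partial>gauss)"
  by (simp add: T_def Y_def)

lemma T_integral:
  assumes q[measurable]: "q \<in> borel_measurable borel" and i: "integrable gauss (\<lambda>u. q (M *v u))"
  shows "integrable gauss (\<lambda>u. T q (M *v u))" and "(\<integral>u. T q (M *v u) \<partial>gauss) = (\<integral>u. q (M *v u) \<partial>gauss)"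
    and "AE u in gauss. integrable gauss (\<lambda>z. q (Y (u, z)))"
proof -
  have iY: "integrable gauss (\<lambda>z. q (Y z))" using i by (simp add: Y_integral)
  show "integrable gauss (\<lambda>u. T q (M *v u))" "(\<integral>u. T q (M *v u) \<partial>gauss) = (\<integral>u. q (M *v u) \<partial>gauss)"
    using gauss_pair_integral[OF iY] by (simp_all add: T_Y Y_integral)
  interpret pair_sigma_finite "gauss :: (real^'n) measure" "gauss :: (real^'n) measure" ..
  show "AE u in gauss. integrable gauss (\<lambda>z. q (Y (u, z)))"
    using AE_integrable_fst'[of "\<lambda>z. q (Y z)"] iY unfolding gauss_pair by simp
qed

text \<open>\<open>T\<close> is an average, so the absolute value moves inside, and invariance of
  the Gaussian gives the averaged difference the same integral as the difference itself.\<close>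

lemma T_contraction:
  assumes q[measurable]: "q \<in> borel_measurable borel" "q' \<in> borel_measurable borel"
    and i: "integrable gauss (\<lambda>u. q (M *v u))" "integrable gauss (\<lambda>u. q' (M *v u))"
  shows "(\<integral>u. \<bar>T q (M *v u) - T q' (M *v u)\<bar> \<partial>gauss) \<le> (\<integral>u. \<bar>q (M *v u) - q' (M *v u)\<bar> \<partial>gauss)"
proof -
  let ?d = "\<lambda>x. \<bar>q x - q' x\<bar>"
  have di: "integrable gauss (\<lambda>u. ?d (M *v u))" using i by auto
  have dm: "?d \<in> borel_measurable borel" by measurable
  have "(\<integral>u. \<bar>T q (M *v u) - T q' (M *v u)\<bar> \<partial>gauss) \<le> (\<integral>u. T ?d (M *v u) \<partial>gauss)"
  proof (rule integral_mono_AE)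
    show "integrable gauss (\<lambda>u. \<bar>T q (M *v u) - T q' (M *v u)\<bar>)" using i by (intro integrable_abs Bochner_Integration.integrable_diff T_integral q)
    show "integrable gauss (\<lambda>u. T ?d (M *v u))" by (rule T_integral[OF dm di])
    show "AE u in gauss. \<bar>T q (M *v u) - T q' (M *v u)\<bar> \<le> T ?d (M *v u)"
      using T_integral(3)[OF q(1) i(1)] T_integral(3)[OF q(2) i(2)]
    proof eventually_elim
      case (elim u)
      have "\<bar>T q (M *v u) - T q' (M *v u)\<bar> = norm (\<integral>z. q (Y (u, z)) - q' (Y (u, z)) \<partial>gauss)"
        using elim by (simp add: T_Y)
      also have "\<dots> \<le> (\<integral>z. norm (q (Y (u, z)) - q' (Y (u, z))) \<partial>gauss)" by (rule integral_norm_bound)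
      finally show ?case by (simp add: T_Y)
    qed
  qed
  then show ?thesis using T_integral(2)[OF dm di] by simp
qed

text \<open>Time reversal: the pair of \<open>M *v u\<close> and \<open>Y (u, z)\<close> built from
  \<open>A\<close>, \<open>N\<close> has the same law as the swapped pair built from
  \<open>E\<close>, \<open>N'\<close>, because all marginal covariances are \<open>K\<close> and
  \<open>rev\<close> equates the cross covariances. In the swapped picture \<open>q\<close> depends
  on \<open>u\<close> alone, and the noise is integrated out by \<open>gauss_cos\<close>.\<close>

lemma T_cos_transform:
  fixes E N' :: "real^'n^'n"
  assumes KN': "K = E ** K ** transpose E + N' ** transpose N'" and rev: "K ** transpose A = E ** K"
    and q[measurable]: "q \<in> borel_measurable borel" and i: "integrable gauss (\<lambda>u. q (M *v u))"
  shows "(\<integral>u. T q (M *v u) * cos (\<xi> \<bullet> (M *v u) + p) \<partial>gauss)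
    = exp (- (norm (transpose N' *v \<xi>))\<^sup>2 / 2) * (\<integral>u. q (M *v u) * cos ((transpose E *v \<xi>) \<bullet> (M *v u) + p) \<partial>gauss)"
proof -
  interpret rv: gauss_transport K M E N' by standard (fact KM KN')+
  let ?S = "\<lambda>z. (M *v fst z, Y z)" and ?T = "\<lambda>z. (rv.Y z, M *v fst z)"
  have Sm[measurable]: "?S \<in> borel_measurable borel" "?T \<in> borel_measurable borel"
    unfolding Y_def rv.Y_def by (auto intro!: borel_measurable_continuous_onI continuous_intros)
  have law: "distr gauss borel ?S = distr gauss borel ?T"
  proof (rule gauss_linear_law'[where S'="\<lambda>\<xi>. (transpose M *v fst \<xi> + transpose M *v (transpose A *v snd \<xi>), transpose N *v snd \<xi>)"
        and T'="\<lambda>\<xi>. (transpose M *v (transpose E *v fst \<xi>) + transpose M *v snd \<xi>, transpose N' *v fst \<xi>)"])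
    show "linear ?S" "linear ?T"
      by (rule linearI; auto simp: Y_def rv.Y_def matrix_vector_right_distrib matrix_vector_mult_scaleR scaleR_add_right)+
    show "?S x \<bullet> y = x \<bullet> (transpose M *v fst y + transpose M *v (transpose A *v snd y), transpose N *v snd y)" for x y
      by (cases x, cases y) (simp only: Y_def fst_conv snd_conv inner_add_left inner_add_right inner_matrix_transpose inner_Pair add.assoc)
    show "?T x \<bullet> y = x \<bullet> (transpose M *v (transpose E *v fst y) + transpose M *v snd y, transpose N' *v fst y)" for x y
      by (cases x, cases y) (simp only: rv.Y_def fst_conv snd_conv inner_add_left inner_add_right inner_matrix_transpose inner_Pair add_ac)
    fix \<zeta> :: "(real^'n) \<times> (real^'n)"
    obtain x y where z: "\<zeta> = (x, y)" by (cases \<zeta>)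
    have sq: "(norm (a + b))\<^sup>2 = (norm a)\<^sup>2 + 2 * (a \<bullet> b) + (norm b)\<^sup>2" for a b :: "real^'n"
      by (simp add: power2_norm_eq_inner inner_add_left inner_add_right inner_commute)
    have cross: "(transpose M *v x) \<bullet> (transpose M *v (transpose A *v y)) = (transpose M *v (transpose E *v x)) \<bullet> (transpose M *v y)"
    proof -
      have "(transpose M *v x) \<bullet> (transpose M *v (transpose A *v y)) = x \<bullet> (K *v (transpose A *v y))"
        by (rule K_inner[symmetric])
      also have "\<dots> = x \<bullet> (E *v (K *v y))" by (simp only: matrix_vector_mul_assoc rev)
      also have "\<dots> = (E *v (K *v y)) \<bullet> x" by (rule inner_commute)
      also have "\<dots> = (K *v y) \<bullet> (transpose E *v x)" by (rule inner_matrix_transpose)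
      also have "\<dots> = (transpose E *v x) \<bullet> (K *v y)" by (rule inner_commute)
      also have "\<dots> = (transpose M *v (transpose E *v x)) \<bullet> (transpose M *v y)" by (rule K_inner)
      finally show ?thesis .
    qed
    have "(norm (transpose M *v x + transpose M *v (transpose A *v y), transpose N *v y))\<^sup>2
        = x \<bullet> (K *v x) + 2 * ((transpose M *v x) \<bullet> (transpose M *v (transpose A *v y))) + y \<bullet> (K *v y)"
      unfolding K_split[of y] K_inner[of x x] norm_Pair_sq sq by (simp add: power2_norm_eq_inner)
    also have "\<dots> = (norm (transpose M *v (transpose E *v x) + transpose M *v y, transpose N' *v x))\<^sup>2"
      unfolding rv.K_split[of x] K_inner[of y y] norm_Pair_sq cross sq by (simp add: power2_norm_eq_inner)
    finally show "norm (transpose M *v fst \<zeta> + transpose M *v (transpose A *v snd \<zeta>), transpose N *v snd \<zeta>)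
       = norm (transpose M *v (transpose E *v fst \<zeta>) + transpose M *v snd \<zeta>, transpose N' *v fst \<zeta>)"
      unfolding z fst_conv snd_conv by (simp only: power2_eq_iff_nonneg norm_ge_zero)
  qed
  let ?F = "\<lambda>z. q (snd z) * cos (\<xi> \<bullet> fst z + p)"
  have Fm[measurable]: "?F \<in> borel_measurable (borel :: ((real^'n) \<times> (real^'n)) measure)"
    by measurable
  have qY: "integrable gauss (\<lambda>z. q (Y z))" using i by (simp add: Y_integral)
  have FS: "integrable gauss (\<lambda>z. ?F (?S z))"
    by (rule Bochner_Integration.integrable_bound[OF qY]) (auto simp: abs_mult mult_left_le)
  have FT: "integrable gauss (\<lambda>z. ?F (?T z))"
  proof -
    have "integrable gauss (\<lambda>z. ?F (?S z)) \<longleftrightarrow> integrable (distr gauss borel ?S) ?F"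
      by (rule integrable_distr_eq[symmetric]) auto
    also have "\<dots> \<longleftrightarrow> integrable gauss (\<lambda>z. ?F (?T z))"
      unfolding law by (rule integrable_distr_eq) auto
    finally show ?thesis using FS by simp
  qed
  have "(\<integral>u. T q (M *v u) * cos (\<xi> \<bullet> (M *v u) + p) \<partial>gauss) = (\<integral>u. (\<integral>z. ?F (?S (u, z)) \<partial>gauss) \<partial>gauss)"
    by (simp add: T_Y)
  also have "\<dots> = (\<integral>z. ?F (?S z) \<partial>gauss)" by (rule gauss_pair_integral(1)[OF FS, symmetric])
  also have "\<dots> = (\<integral>z. ?F z \<partial>distr gauss borel ?S)" by (rule integral_distr[symmetric]) auto
  also have "\<dots> = (\<integral>z. ?F (?T z) \<partial>gauss)" unfolding law by (rule integral_distr) auto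
  also have "\<dots> = (\<integral>u. (\<integral>z. ?F (?T (u, z)) \<partial>gauss) \<partial>gauss)" by (rule gauss_pair_integral(1)[OF FT])
  also have "\<dots> = (\<integral>u. exp (- (norm (transpose N' *v \<xi>))\<^sup>2 / 2) * (q (M *v u) * cos ((transpose E *v \<xi>) \<bullet> (M *v u) + p)) \<partial>gauss)"
  proof (rule Bochner_Integration.integral_cong[OF refl])
    fix u :: "real^'n"
    have e: "\<xi> \<bullet> rv.Y (u, z) + p = (transpose N' *v \<xi>) \<bullet> z + ((transpose E *v \<xi>) \<bullet> (M *v u) + p)" for z
    proof -
      have "\<xi> \<bullet> rv.Y (u, z) = (E *v (M *v u)) \<bullet> \<xi> + (N' *v z) \<bullet> \<xi>"
        by (simp only: rv.Y_def fst_conv snd_conv inner_add_right inner_commute)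
      also have "\<dots> = (M *v u) \<bullet> (transpose E *v \<xi>) + z \<bullet> (transpose N' *v \<xi>)"
        by (simp only: inner_matrix_transpose)
      finally show ?thesis by (simp only: inner_commute add_ac)
    qed
    have "(\<integral>z. ?F (?T (u, z)) \<partial>gauss) = q (M *v u) * (\<integral>z. cos ((transpose N' *v \<xi>) \<bullet> z + ((transpose E *v \<xi>) \<bullet> (M *v u) + p)) \<partial>gauss)"
      by (simp only: fst_conv snd_conv e) (rule integral_mult_right_zero)
    then show "(\<integral>z. ?F (?T (u, z)) \<partial>gauss) = exp (- (norm (transpose N' *v \<xi>))\<^sup>2 / 2) * (q (M *v u) * cos ((transpose E *v \<xi>) \<bullet> (M *v u) + p))"
      by (simp only: gauss_cos) (simp only: mult_ac)
  qed
  finally show ?thesis by simp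
qed

end

section \<open>Entropy of transported densities\<close>

context phi_entropy
begin

text \<open>The tangent of the convex \<psi> at 1 is zero; the closure follows by
  continuity.\<close>

lemma psi_nonneg:
  assumes "s \<in> closure I" shows "0 \<le> \<psi> s"
proof -
  have one: "1 \<in> I" using I by auto
  have pos: "0 \<le> \<psi> s" if s: "s \<in> I" for s
  proof -
    have sub: "closed_segment s 1 \<subseteq> I"
      using I s by (auto simp: closed_segment_eq_real_ivl split: if_splits)
    have "- \<psi> s \<le> - \<psi> 1 + (- \<psi>1 1) * (s - 1)"
      by (rule concave_tangent[where \<phi>="\<lambda>s. - \<psi> s" and \<phi>'="\<lambda>s. - \<psi>1 s" and \<phi>''="\<lambda>s. - h s"])
         (use sub d0 d1 hpos in \<open>auto intro!: derivative_eq_intros simp: less_imp_le subset_iff\<close>)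
    then show ?thesis by (simp add: psi_1 psi1_1)
  qed
  have "closed {x \<in> closure I. \<psi> x \<in> {0..}}"
    using continuous_closed_preimage[OF psi_cont closed_closure, of "{0..}"] by (simp add: vimage_def Int_def)
  moreover have "I \<subseteq> {x \<in> closure I. \<psi> x \<in> {0..}}" using pos closure_subset by auto
  ultimately have "closure I \<subseteq> {x \<in> closure I. \<psi> x \<in> {0..}}" by (rule closure_minimal[rotated])
  then show ?thesis using assms by auto
qed

text \<open>The convex Sobolev inequality is applied to the transported density in the coordinate
  \<open>u\<close>, where the gradient is \<open>transpose M\<close> and \<open>transpose A\<close>
  applied to an averaged gradient. \<open>contr\<close> trades these for \<open>transpose R\<close>,
  Jensen moves the average outside, and stationarity returns to the initial density. In the
  application \<open>R ** transpose R\<close> is \<open>P\<close>, so the last integral is the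
  weighted Fisher information.\<close>

lemma transported_entropy_nice:
  fixes R :: "real^'n^'n"
  assumes tr: "gauss_transport K M A N" and c: "0 \<le> c"
    and contr: "\<And>v. (norm (transpose M *v (transpose A *v v)))\<^sup>2 \<le> c * (norm (transpose R *v v))\<^sup>2"
    and nice: "nice a b L g dg" and ab: "a \<in> I" "b \<in> I"
  shows "(\<integral>u. \<psi> (gauss_transport.T A N g (M *v u)) \<partial>gauss)
    \<le> \<psi> (\<integral>u. g (M *v u) \<partial>gauss) + c / 2 * (\<integral>u. h (g (M *v u)) * (norm (transpose R *v dg (M *v u)))\<^sup>2 \<partial>gauss)"
proof -
  interpret gauss_transport K M A N by (fact tr)
  note [measurable] = niceD(8,9)[OF nice]
  note cont = Icc_cont[OF ab]
  let ?A = "\<lambda>u. A *v (M *v u)" and ?A' = "\<lambda>y. transpose M *v (transpose A *v y)" and ?N = "(*v) N"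
  have linA: "linear ?A" by (rule linearI) (auto simp: matrix_vector_right_distrib matrix_vector_mult_scaleR)
  obtain C where C: "\<And>y. norm (?A' y) \<le> C * norm y"
  proof -
    have "bounded_linear ?A'"
      by (rule bounded_linear_compose) (rule matrix_vector_mul_bounded_linear)+
    from bounded_linear.bounded[OF this] show ?thesis using that by (metis mult.commute)
  qed
  have adj: "?A x \<bullet> y = x \<bullet> ?A' y" for x y by (simp only: inner_matrix_transpose)
  define vb where "vb u = (\<integral>z. dg (?A u + ?N z) \<partial>gauss)" for u
  have Tg: "T g (M *v u) = (\<integral>z. g (?A u + ?N z) \<partial>gauss)" for u by (simp add: T_def)
  note avg = nice_average[OF nice linA matrix_vector_mul_linear[of N] adj C]
  have n: "nice a b (C * L) (\<lambda>u. T g (M *v u)) (\<lambda>u. ?A' (vb u))"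
    unfolding Tg vb_def by (rule avg(1))
  have [measurable]: "(\<lambda>x. h (g x)) \<in> borel_measurable borel" "(\<lambda>u. h (T g (M *v u))) \<in> borel_measurable borel"
    using nice_compose(1)[OF nice cont(3)] nice_compose(1)[OF n cont(3)] by auto
  obtain H where H: "0 \<le> H" "\<And>x. \<bar>h (g x)\<bar> \<le> H" using nice_compose(2)[OF nice cont(3)] by auto
  obtain H' where H': "0 \<le> H'" "\<And>u. \<bar>h (T g (M *v u))\<bar> \<le> H'" using nice_compose(2)[OF n cont(3)] by auto
  obtain CR where CR: "0 < CR" "\<And>x. norm (transpose R *v x) \<le> norm x * CR"
    using bounded_linear.pos_bounded[OF matrix_vector_mul_bounded_linear[of "transpose R"]] by blast
  let ?q = "\<lambda>x. h (g x) * (norm (transpose R *v dg x))\<^sup>2"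
  have qm[measurable]: "?q \<in> borel_measurable borel"
    using measurable_compose[OF niceD(9)[OF nice] matrix_borel_measurable[of "transpose R"]] by measurable
  have nR: "(norm (transpose R *v x))\<^sup>2 \<le> (L * CR)\<^sup>2" if "norm x \<le> L" for x
  proof (rule power_mono)
    have "norm x * CR \<le> L * CR" using that CR(1) by (intro mult_right_mono) auto
    then show "norm (transpose R *v x) \<le> L * CR" using CR(2)[of x] by linarith
  qed simp
  have qb: "\<bar>?q x\<bar> \<le> H * (L * CR)\<^sup>2" for x
    unfolding abs_mult using H nR[OF niceD(3)[OF nice]] by (intro mult_mono) auto
  have qi: "integrable gauss (\<lambda>u. ?q (M *v u))"
    by (rule gauss.integrable_const_bound[of _ "H * (L * CR)\<^sup>2"]) (use qb in auto)
  have qYi: "integrable gauss (\<lambda>z. ?q (Y z))" using Y_integral(2)[OF qm] qi by blast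
  have gi: "integrable gauss (\<lambda>u. g (M *v u))"
    by (rule gauss.integrable_const_bound[of _ "max \<bar>a\<bar> \<bar>b\<bar>"]) (use niceD(6)[OF nice] in auto)
  have hvi: "integrable gauss (\<lambda>u. h (T g (M *v u)) * (norm (transpose R *v vb u))\<^sup>2)"
  proof (rule gauss.integrable_const_bound[of _ "H' * (L * CR)\<^sup>2"])
    have [measurable]: "vb \<in> borel_measurable borel"
      unfolding vb_def using avg(5) by (rule borel_measurable_continuous_onI)
    have "(\<lambda>u. transpose R *v vb u) \<in> borel_measurable borel" by measurable
    then show "(\<lambda>u. h (T g (M *v u)) * (norm (transpose R *v vb u))\<^sup>2) \<in> borel_measurable gauss" by measurable
    have "norm (vb u) \<le> L" for u unfolding vb_def by (rule avg(4))
    from nR[OF this] show "AE u in gauss. norm (h (T g (M *v u)) * (norm (transpose R *v vb u))\<^sup>2) \<le> H' * (L * CR)\<^sup>2"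
      unfolding real_norm_def abs_mult using H' by (intro AE_I2 mult_mono) auto
  qed
  have "(\<integral>u. \<psi> (T g (M *v u)) \<partial>gauss) \<le> \<psi> (\<integral>u. T g (M *v u) \<partial>gauss) + (\<integral>u. h (T g (M *v u)) * (norm (?A' (vb u)))\<^sup>2 \<partial>gauss) / 2"
    using gauss_convex_sobolev[OF n ab] by simp
  also have "(\<integral>u. T g (M *v u) \<partial>gauss) = (\<integral>u. g (M *v u) \<partial>gauss)" by (rule T_integral[OF _ gi]) simp
  also have "(\<integral>u. h (T g (M *v u)) * (norm (?A' (vb u)))\<^sup>2 \<partial>gauss) \<le> (\<integral>u. c * (h (T g (M *v u)) * (norm (transpose R *v vb u))\<^sup>2) \<partial>gauss)"
  proof (rule integral_mono')
    fix u
    have hp: "0 \<le> h (T g (M *v u))"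
      using hpos Icc[OF ab] niceD(4,5)[OF n, of u] by (metis atLeastAtMost_iff less_imp_le subsetD)
    show "h (T g (M *v u)) * (norm (?A' (vb u)))\<^sup>2 \<le> c * (h (T g (M *v u)) * (norm (transpose R *v vb u))\<^sup>2)"
      using mult_left_mono[OF contr hp, of "vb u"] by (simp only: mult_ac)
    show "0 \<le> c * (h (T g (M *v u)) * (norm (transpose R *v vb u))\<^sup>2)" using hp c by simp
  qed (use hvi in auto)
  also have "\<dots> = c * (\<integral>u. h (T g (M *v u)) * (norm (transpose R *v vb u))\<^sup>2 \<partial>gauss)" by simp
  also have "(\<integral>u. h (T g (M *v u)) * (norm (transpose R *v vb u))\<^sup>2 \<partial>gauss) \<le> (\<integral>u. (\<integral>z. ?q (Y (u, z)) \<partial>gauss) \<partial>gauss)"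
  proof (rule integral_mono[OF hvi])
    show "integrable gauss (\<lambda>u. \<integral>z. ?q (Y (u, z)) \<partial>gauss)" by (rule gauss_pair_integral(2)[OF qYi])
    fix u
    have Yu: "Y (u, z) = ?A u + ?N z" for z by (simp add: Y_def)
    have bl: "bounded_linear ((*v) (transpose R))" by (rule matrix_vector_mul_bounded_linear)
    have "transpose R *v vb u = (\<integral>z. transpose R *v dg (?A u + ?N z) \<partial>gauss)"
      unfolding vb_def by (rule integral_bounded_linear[OF bl avg(3), symmetric])
    moreover have "h (\<integral>z. g (?A u + ?N z) \<partial>gauss) * (norm (\<integral>z. transpose R *v dg (?A u + ?N z) \<partial>gauss))\<^sup>2
       \<le> (\<integral>z. ?q (?A u + ?N z) \<partial>gauss)"
    proof (rule perspective_jensen[OF prob_space_gauss ab avg(2)])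
      show "integrable gauss (\<lambda>z. transpose R *v dg (?A u + ?N z))"
        by (rule integrable_bounded_linear[OF bl avg(3)])
      show "integrable gauss (\<lambda>z. ?q (?A u + ?N z))"
        by (rule gauss.integrable_const_bound[of _ "H * (L * CR)\<^sup>2"]) (use qb measurable_compose[OF _ qm] in auto)
    qed (use niceD(4,5)[OF nice] in auto)
    ultimately show "h (T g (M *v u)) * (norm (transpose R *v vb u))\<^sup>2 \<le> (\<integral>z. ?q (Y (u, z)) \<partial>gauss)"
      by (simp only: Yu Tg)
  qed
  also have "(\<integral>u. (\<integral>z. ?q (Y (u, z)) \<partial>gauss) \<partial>gauss) = (\<integral>u. ?q (M *v u) \<partial>gauss)"
    using gauss_pair_integral(1)[OF qYi] Y_integral(1)[OF qm] by simp
  finally show ?thesis using c by (simp add: mult_left_mono divide_right_mono)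
qed

text \<open>Lower semicontinuity: transport contracts the L1 distance, a subsequence converges
  almost everywhere, and Fatou applies since \<psi> is nonnegative. An upper bound on the
  approximating Fisher informations is all that is asked; \<open>a\<close>, \<open>b\<close> and
  \<open>L\<close> may degenerate along the sequence. The means converge to 1, where \<psi>
  vanishes.\<close>

lemma transported_entropy:
  fixes R :: "real^'n^'n"
  assumes tr: "gauss_transport K M A N" and c: "0 \<le> c"
    and contr: "\<And>v. (norm (transpose M *v (transpose A *v v)))\<^sup>2 \<le> c * (norm (transpose R *v v))\<^sup>2"
    and g[measurable]: "g \<in> borel_measurable borel" and gI: "\<And>x. g x \<in> closure I"
    and gi: "integrable gauss (\<lambda>u. g (M *v u))" and g1: "(\<integral>u. g (M *v u) \<partial>gauss) = 1"
    and approx: "\<And>e. 0 < e \<Longrightarrow> \<exists>a b L g' dg'. nice a b L g' dg' \<and> a \<in> I \<and> b \<in> I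
        \<and> (\<integral>u. \<bar>g' (M *v u) - g (M *v u)\<bar> \<partial>gauss) \<le> e
        \<and> (\<integral>u. h (g' (M *v u)) * (norm (transpose R *v dg' (M *v u)))\<^sup>2 \<partial>gauss) \<le> S + e"
  shows "(\<integral>\<^sup>+u. ennreal (\<psi> (gauss_transport.T A N g (M *v u))) \<partial>gauss) \<le> ennreal (c / 2 * S)"
proof -
  interpret gauss_transport K M A N by (fact tr)
  let ?e = "\<lambda>n. inverse (real (Suc n))"
  have e0: "?e \<longlonglongrightarrow> 0" by (rule LIMSEQ_inverse_real_of_nat)
  define P where "P n a b L g' dg' \<longleftrightarrow> nice a b L g' dg' \<and> a \<in> I \<and> b \<in> I
        \<and> (\<integral>u. \<bar>g' (M *v u) - g (M *v u)\<bar> \<partial>gauss) \<le> ?e n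
        \<and> (\<integral>u. h (g' (M *v u)) * (norm (transpose R *v dg' (M *v u)))\<^sup>2 \<partial>gauss) \<le> S + ?e n" for n a b L g' dg'
  have "\<forall>n. \<exists>a b L g' dg'. P n a b L g' dg'"
    unfolding P_def using approx[of "?e n" for n] by simp
  from choice[OF this] obtain a where "\<forall>n. \<exists>b L g' dg'. P n (a n) b L g' dg'" ..
  from choice[OF this] obtain b where "\<forall>n. \<exists>L g' dg'. P n (a n) (b n) L g' dg'" ..
  from choice[OF this] obtain L where "\<forall>n. \<exists>g' dg'. P n (a n) (b n) (L n) g' dg'" ..
  from choice[OF this] obtain G where "\<forall>n. \<exists>dg'. P n (a n) (b n) (L n) (G n) dg'" ..
  from choice[OF this] obtain dG where "\<forall>n. P n (a n) (b n) (L n) (G n) (dG n)" ..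
  then have G: "\<And>n. nice (a n) (b n) (L n) (G n) (dG n)" "\<And>n. a n \<in> I" "\<And>n. b n \<in> I"
    "\<And>n. (\<integral>u. \<bar>G n (M *v u) - g (M *v u)\<bar> \<partial>gauss) \<le> ?e n"
    "\<And>n. (\<integral>u. h (G n (M *v u)) * (norm (transpose R *v dG n (M *v u)))\<^sup>2 \<partial>gauss) \<le> S + ?e n"
    unfolding P_def by blast+
  have [measurable]: "G n \<in> borel_measurable borel" for n by (rule niceD(8)[OF G(1)])
  have Gi: "integrable gauss (\<lambda>u. G n (M *v u))" for n
    by (rule gauss.integrable_const_bound[of _ "max \<bar>a n\<bar> \<bar>b n\<bar>"]) (use niceD(6)[OF G(1)] in auto)
  have TI: "T (G n) (M *v u) \<in> I" and Tmem: "T (G n) (M *v u) \<in> {a n..b n}" for n u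
  proof -
    have gz: "integrable gauss (\<lambda>z. G n (A *v (M *v u) + N *v z))"
      by (rule gauss.integrable_const_bound[of _ "max \<bar>a n\<bar> \<bar>b n\<bar>"]) (use niceD(6)[OF G(1)] in auto)
    show "T (G n) (M *v u) \<in> {a n..b n}"
      unfolding T_def using gz niceD(4,5)[OF G(1)] by (auto intro!: gauss.integral_ge_const gauss.integral_le_const)
    then show "T (G n) (M *v u) \<in> I" using Icc[OF G(2)[of n] G(3)[of n]] by auto
  qed
  have TgI: "T g (M *v u) \<in> closure I" for u
  proof (cases "I = UNIV")
    case False
    then have "I = {0<..}" using I by auto
    then have "0 \<le> g x" for x using gI[of x] by simp
    then show ?thesis using \<open>I = {0<..}\<close> by (simp add: T_def)
  qed simp
  have "(\<lambda>n. \<integral>u. norm (T (G n) (M *v u) - T g (M *v u)) \<partial>gauss) \<longlonglongrightarrow> 0"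
  proof (rule tendsto_sandwich[OF _ _ tendsto_const e0])
    show "\<forall>\<^sub>F n in sequentially. (\<integral>u. norm (T (G n) (M *v u) - T g (M *v u)) \<partial>gauss) \<le> ?e n"
      using order_trans[OF T_contraction[OF _ _ Gi gi] G(4)] by (intro always_eventually allI) simp
  qed auto
  then obtain r where r: "strict_mono r" "AE u in gauss. (\<lambda>n. T (G (r n)) (M *v u) - T g (M *v u)) \<longlonglongrightarrow> 0"
    using tendsto_L1_AE_subseq[of gauss "\<lambda>n u. T (G n) (M *v u) - T g (M *v u)"] T_integral(1)[OF _ Gi] T_integral(1)[OF g gi]
    by auto
  let ?f = "\<lambda>n u. ennreal (\<psi> (T (G (r n)) (M *v u)))"
  have pm: "(\<lambda>u. \<psi> (T (G n) (M *v u))) \<in> borel_measurable borel" "integrable gauss (\<lambda>u. \<psi> (T (G n) (M *v u)))" for n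
  proof -
    let ?c = "\<lambda>s. \<psi> (max (a n) (min (b n) s))"
    have ab: "a n \<le> b n" using niceD(4,5)[OF G(1)[of n]] order_trans by blast
    have "continuous_on UNIV ?c"
      by (rule continuous_on_compose2[OF Icc_cont(1)[OF G(2,3)[of n]]]) (use ab in \<open>auto intro!: continuous_intros\<close>)
    then have cm: "?c \<in> borel_measurable borel" by (rule borel_measurable_continuous_onI)
    have ce: "\<psi> (max (a n) (min (b n) (T (G n) (M *v u)))) = \<psi> (T (G n) (M *v u))" for u
      using Tmem[of n u] by (simp add: max_absorb2 min_absorb2)
    have "(\<lambda>u. T (G n) (M *v u)) \<in> borel_measurable borel"
      using borel_measurable_integrable[OF T_integral(1)[OF _ Gi[of n]]] by simp
    from measurable_compose[OF this cm] show m[measurable]: "(\<lambda>u. \<psi> (T (G n) (M *v u))) \<in> borel_measurable borel"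
      unfolding ce .
    have "compact (\<psi> ` {a n..b n})" using Icc_cont(1)[OF G(2,3)] by (rule compact_continuous_image) simp
    then obtain B where "\<forall>y\<in>\<psi> ` {a n..b n}. norm y \<le> B" using compact_imp_bounded bounded_iff by metis
    then have "\<bar>\<psi> (T (G n) (M *v u))\<bar> \<le> B" for u using Tmem[of n u] by auto
    then show "integrable gauss (\<lambda>u. \<psi> (T (G n) (M *v u)))"
      by (intro gauss.integrable_const_bound[of _ B]) auto
  qed
  have "(\<integral>\<^sup>+u. ennreal (\<psi> (T g (M *v u))) \<partial>gauss) \<le> (\<integral>\<^sup>+u. liminf (\<lambda>n. ?f n u) \<partial>gauss)"
  proof (rule nn_integral_mono_AE)
    show "AE u in gauss. ennreal (\<psi> (T g (M *v u))) \<le> liminf (\<lambda>n. ?f n u)"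
      using r(2)
    proof eventually_elim
      case (elim u)
      have "(\<lambda>n. T (G (r n)) (M *v u)) \<longlonglongrightarrow> T g (M *v u)" using elim by (rule LIM_zero_cancel)
      moreover have "T (G (r n)) (M *v u) \<in> closure I" for n using TI closure_subset by blast
      ultimately have "(\<lambda>n. \<psi> (T (G (r n)) (M *v u))) \<longlonglongrightarrow> \<psi> (T g (M *v u))"
        using psi_cont TgI unfolding continuous_on_sequentially comp_def by auto
      then have "(\<lambda>n. ?f n u) \<longlonglongrightarrow> ennreal (\<psi> (T g (M *v u)))" by (rule tendsto_ennrealI)
      then show ?case by (simp add: lim_imp_Liminf)
    qed
  qed
  also have "\<dots> \<le> liminf (\<lambda>n. \<integral>\<^sup>+u. ?f n u \<partial>gauss)"
    by (rule nn_integral_liminf) (use pm in auto)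
  also have "\<dots> \<le> liminf (\<lambda>n. ennreal (\<psi> (\<integral>u. G (r n) (M *v u) \<partial>gauss) + c / 2 * (S + ?e (r n))))"
  proof (rule Liminf_mono, rule always_eventually, rule allI)
    fix n
    have "(\<integral>\<^sup>+u. ?f n u \<partial>gauss) = ennreal (\<integral>u. \<psi> (T (G (r n)) (M *v u)) \<partial>gauss)"
    proof (rule nn_integral_eq_integral[OF pm(2)])
      have "T (G (r n)) (M *v u) \<in> closure I" for u using TI closure_subset by blast
      then show "AE u in gauss. 0 \<le> \<psi> (T (G (r n)) (M *v u))" by (intro AE_I2 psi_nonneg)
    qed
    also have "\<dots> \<le> ennreal (\<psi> (\<integral>u. G (r n) (M *v u) \<partial>gauss) + c / 2 * (S + ?e (r n)))"
      using transported_entropy_nice[OF tr c contr G(1,2,3), of "r n"] mult_left_mono[OF G(5)[of "r n"], of "c / 2"] c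
      by (intro ennreal_leI) auto
    finally show "(\<integral>\<^sup>+u. ?f n u \<partial>gauss) \<le> ennreal (\<psi> (\<integral>u. G (r n) (M *v u) \<partial>gauss) + c / 2 * (S + ?e (r n)))" .
  qed
  also have "\<dots> = ennreal (\<psi> 1 + c / 2 * (S + 0))"
  proof (rule lim_imp_Liminf)
    have rs: "filterlim r sequentially sequentially" using r(1) by (rule filterlim_subseq)
    have er: "(\<lambda>n. ?e (r n)) \<longlonglongrightarrow> 0" by (rule filterlim_compose[OF e0 rs])
    have "(\<lambda>n. \<integral>u. G n (M *v u) \<partial>gauss) \<longlonglongrightarrow> 1"
    proof (rule LIM_zero_cancel, rule Lim_null_comparison[OF _ e0], rule always_eventually, rule allI)
      fix n
      have "norm ((\<integral>u. G n (M *v u) \<partial>gauss) - 1) = norm (\<integral>u. G n (M *v u) - g (M *v u) \<partial>gauss)"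
        using Gi gi by (simp add: g1)
      also have "\<dots> \<le> (\<integral>u. norm (G n (M *v u) - g (M *v u)) \<partial>gauss)" by (rule integral_norm_bound)
      also have "\<dots> \<le> ?e n" using G(4)[of n] by simp
      finally show "norm ((\<integral>u. G n (M *v u) \<partial>gauss) - 1) \<le> ?e n" .
    qed
    from filterlim_compose[OF this rs] have m1: "(\<lambda>n. \<integral>u. G (r n) (M *v u) \<partial>gauss) \<longlonglongrightarrow> 1" .
    have "isCont \<psi> 1" using DERIV_isCont[OF d0[of 1]] I by auto
    from isCont_tendsto_compose[OF this m1]
    show "(\<lambda>n. ennreal (\<psi> (\<integral>u. G (r n) (M *v u) \<partial>gauss) + c / 2 * (S + ?e (r n)))) \<longlonglongrightarrow> ennreal (\<psi> 1 + c / 2 * (S + 0))"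
      by (intro tendsto_ennrealI tendsto_intros er)
  qed simp
  finally show ?thesis by (simp add: psi_1)
qed

end

section \<open>Mollification and weak gradients\<close>

text \<open>The type argument fixes the dimension, on which the normalising constant depends and
  which \<open>e\<close> does not reveal.\<close>

definition mol_mass :: "'a::euclidean_space itself \<Rightarrow> real \<Rightarrow> real" where
  "mol_mass T e = (\<integral>z. bump (1 / e\<^sup>2) (z::'a) ^ 2 \<partial>lborel)"

definition mol :: "real \<Rightarrow> 'a::euclidean_space \<Rightarrow> real" where
  "mol e z = bump (1 / e\<^sup>2) z ^ 2 / mol_mass TYPE('a) e"

definition gmol :: "real \<Rightarrow> 'a::euclidean_space \<Rightarrow> 'a" where
  "gmol e z = (- 4 / e\<^sup>2 * bump (1 / e\<^sup>2) z / mol_mass TYPE('a) e) *\<^sub>R z"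

lemma bump_zero_outside:
  assumes "0 < e" "e \<le> norm z" shows "bump (1 / e\<^sup>2) z = 0"
proof (rule ccontr)
  assume "bump (1 / e\<^sup>2) z \<noteq> 0"
  from bump_support[OF _ this] assms(1) have "(norm z)\<^sup>2 < e\<^sup>2" by (simp add: field_simps)
  then have "norm z < e" by (rule power2_less_imp_less) (use assms(1) in simp)
  then show False using assms(2) by simp
qed

lemma mol_mass_pos:
  assumes e: "0 < e" shows "0 < mol_mass TYPE('a::euclidean_space) e"
proof -
  have c: "continuous_on UNIV (\<lambda>z::'a. bump (1 / e\<^sup>2) z ^ 2)"
    by (intro continuous_intros bump_continuous)
  have i: "integrable lborel (\<lambda>z::'a. bump (1 / e\<^sup>2) z ^ 2)"
    by (rule integrable_continuous_compact_support[OF c, of e]) (simp add: bump_zero_outside[OF e])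
  have "measure lborel (cball (0::'a) (e / 2)) > 0"
    using content_cball_pos[of "e / 2" "0::'a"] e by simp
  \<comment> \<open>On the ball of half the radius the bump is at least \<open>1 - 1 / 4\<close>,
    and 9/16 is the square of this.\<close>
  then have "0 < 9 / 16 * measure lborel (cball (0::'a) (e / 2))" by simp
  also have "\<dots> = (\<integral>z. 9 / 16 * indicator (cball (0::'a) (e / 2)) z \<partial>lborel)" by simp
  also have "\<dots> \<le> mol_mass TYPE('a) e"
    unfolding mol_mass_def
  proof (rule integral_mono[OF _ i])
    show "integrable lborel (\<lambda>z. 9 / 16 * indicator (cball (0::'a) (e / 2)) z :: real)"
      by (intro integrable_mult_right integrable_indicator_cball)
    fix z :: 'a
    show "9 / 16 * indicator (cball 0 (e / 2)) z \<le> bump (1 / e\<^sup>2) z ^ 2"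
    proof (cases "norm z \<le> e / 2")
      case True
      then have "(norm z)\<^sup>2 \<le> (e / 2)\<^sup>2" by (intro power_mono) auto
      then have "z \<bullet> z \<le> (e / 2)\<^sup>2" by (simp only: power2_norm_eq_inner)
      then have "1 / e\<^sup>2 * (z \<bullet> z) \<le> 1 / 4"
        using e by (simp add: field_simps power2_eq_square)
      then have "3 / 4 \<le> 1 - 1 / e\<^sup>2 * (z \<bullet> z)" by linarith
      then have "3 / 4 \<le> bump (1 / e\<^sup>2) z"
        unfolding bump_def by (rule order_trans) simp
      then have "(3 / 4)\<^sup>2 \<le> bump (1 / e\<^sup>2) z ^ 2" by (intro power_mono) auto
      then show ?thesis using True by (simp add: power2_eq_square)
    qed simp
  qed
  finally show ?thesis .
qed

lemma mol_props:
  fixes z :: "'a::euclidean_space"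
  assumes e: "0 < e"
  shows "0 \<le> mol e z" "e \<le> norm z \<Longrightarrow> mol e z = 0" "e \<le> norm z \<Longrightarrow> gmol e z = 0"
    "continuous_on UNIV (mol e :: 'a \<Rightarrow> real)" "continuous_on UNIV (gmol e :: 'a \<Rightarrow> 'a)"
    "(mol e has_derivative (\<lambda>h. gmol e z \<bullet> h)) (at z)"
    "integrable lborel (mol e :: 'a \<Rightarrow> real)" "(\<integral>z. mol e (z::'a) \<partial>lborel) = 1"
    "(\<integral>\<^sup>+z. ennreal (mol e (z::'a)) \<partial>lborel) = 1"
proof -
  note m = mol_mass_pos[OF e, where 'a='a]
  show nn: "0 \<le> mol e z" for z :: 'a using m by (simp add: mol_def)
  show z0: "mol e z = 0" "gmol e z = 0" if "e \<le> norm z" for z :: 'a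
    using bump_zero_outside[OF e that] by (simp_all add: mol_def gmol_def)
  show c: "continuous_on UNIV (mol e :: 'a \<Rightarrow> real)"
    unfolding mol_def[abs_def] using m by (intro continuous_intros bump_continuous) auto
  show "continuous_on UNIV (gmol e :: 'a \<Rightarrow> 'a)"
    unfolding gmol_def[abs_def] using m by (intro continuous_intros bump_continuous) auto
  show "(mol e has_derivative (\<lambda>h. gmol e z \<bullet> h)) (at z)"
  proof -
    have "((\<lambda>z. bump (1 / e\<^sup>2) z ^ 2 * inverse (mol_mass TYPE('a) e)) has_derivative
       (\<lambda>h. (((- 2 * real 2 * (1 / e\<^sup>2) * bump (1 / e\<^sup>2) z ^ (2 - 1)) *\<^sub>R z) \<bullet> h) * inverse (mol_mass TYPE('a) e))) (at z)"
      by (intro has_derivative_mult_left bump_power_deriv) simp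
    then show ?thesis
      unfolding mol_def gmol_def divide_inverse by (rule has_derivative_eq_rhs) (auto simp: fun_eq_iff)
  qed
  show i: "integrable lborel (mol e :: 'a \<Rightarrow> real)"
    by (rule integrable_continuous_compact_support[OF c, of e]) (simp add: z0)
  show one: "(\<integral>z. mol e (z::'a) \<partial>lborel) = 1"
    using m by (simp add: mol_def mol_mass_def)
  show "(\<integral>\<^sup>+z. ennreal (mol e (z::'a)) \<partial>lborel) = 1"
    using nn_integral_eq_integral[OF i] nn one by simp
qed

lemma mol_measurable[measurable]: "mol e \<in> borel_measurable borel" "gmol e \<in> borel_measurable borel"
  unfolding mol_def[abs_def] gmol_def[abs_def] bump_def[abs_def] by measurable

lemma nn_integral_lborel_reflect:
  fixes F :: "'a::euclidean_space \<Rightarrow> ennreal"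
  assumes [measurable]: "F \<in> borel_measurable borel"
  shows "(\<integral>\<^sup>+y. F (x - y) \<partial>lborel) = (\<integral>\<^sup>+y. F y \<partial>lborel)" and "(\<integral>\<^sup>+y. F (y - x) \<partial>lborel) = (\<integral>\<^sup>+y. F y \<partial>lborel)"
proof -
  have "(\<integral>\<^sup>+y. F y \<partial>lborel) = (\<integral>\<^sup>+y. F (x + (-1) *\<^sub>R y) \<partial>lborel)"
    by (subst lborel_affine[of "-1" x]) (auto simp: nn_integral_density nn_integral_distr)
  then show "(\<integral>\<^sup>+y. F (x - y) \<partial>lborel) = (\<integral>\<^sup>+y. F y \<partial>lborel)" by simp
  have "(\<integral>\<^sup>+y. F y \<partial>lborel) = (\<integral>\<^sup>+y. F (- x + 1 *\<^sub>R y) \<partial>lborel)"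
    by (subst lborel_affine[of 1 "- x"]) (auto simp: nn_integral_density nn_integral_distr)
  then show "(\<integral>\<^sup>+y. F (y - x) \<partial>lborel) = (\<integral>\<^sup>+y. F y \<partial>lborel)" by simp
qed

lemma mol_mass_one:
  fixes x :: "'a::euclidean_space"
  assumes e: "0 < e"
  shows "(\<integral>\<^sup>+y. ennreal (mol e (x - y)) \<partial>lborel) = 1" "(\<integral>\<^sup>+y. ennreal (mol e (y - x)) \<partial>lborel) = 1"
    "integrable lborel (\<lambda>y. mol e (x - y))" "(\<integral>y. mol e (x - y) \<partial>lborel) = 1"
proof -
  show n: "(\<integral>\<^sup>+y. ennreal (mol e (x - y)) \<partial>lborel) = 1" "(\<integral>\<^sup>+y. ennreal (mol e (y - x)) \<partial>lborel) = 1"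
    using nn_integral_lborel_reflect[of "\<lambda>y. ennreal (mol e y)" x] mol_props(9)[OF e] by auto
  show i: "integrable lborel (\<lambda>y. mol e (x - y))"
    by (rule integrableI_bounded) (use n mol_props(1)[OF e, of "x - y" for y] in auto)
  have "ennreal (\<integral>y. mol e (x - y) \<partial>lborel) = 1"
    using nn_integral_eq_integral[OF i] n mol_props(1)[OF e, of "x - y" for y] by simp
  then show "(\<integral>y. mol e (x - y) \<partial>lborel) = 1" by simp
qed

section \<open>Mollification of locally integrable functions\<close>

definition molf :: "real \<Rightarrow> ('a::euclidean_space \<Rightarrow> 'b::{banach,second_countable_topology}) \<Rightarrow> 'a \<Rightarrow> 'b" where
  "molf e w x = (\<integral>y. mol e (x - y) *\<^sub>R w y \<partial>lborel)"

definition loc_integrable :: "('a::euclidean_space \<Rightarrow> 'b::{banach,second_countable_topology}) \<Rightarrow> bool" where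
  "loc_integrable w \<longleftrightarrow> w \<in> borel_measurable borel \<and> (\<forall>R. integrable lborel (\<lambda>x. indicator (cball 0 R) x *\<^sub>R w x))"

lemma loc_integrable_dominated:
  fixes v :: "'a::euclidean_space \<Rightarrow> 'c::{banach,second_countable_topology}"
  assumes w: "loc_integrable w" and v[measurable]: "v \<in> borel_measurable borel"
    and b: "\<And>y. norm (v y) \<le> B * norm (w y)" and z: "\<And>y. R < norm y \<Longrightarrow> v y = 0"
  shows "integrable lborel v"
proof (rule Bochner_Integration.integrable_bound)
  show "integrable lborel (\<lambda>y. B * norm (indicator (cball 0 R) y *\<^sub>R w y))"
    using w unfolding loc_integrable_def by (intro integrable_mult_right integrable_norm) auto
  show "AE y in lborel. norm (v y) \<le> norm (B * norm (indicator (cball 0 R) y *\<^sub>R w y))"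
    using b z by (intro AE_I2) (auto simp: indicator_def intro: order_trans[OF _ abs_ge_self])
qed simp

lemma mol_bounded:
  assumes e: "0 < e"
  obtains B where "0 \<le> B" "\<And>z::'a::euclidean_space. \<bar>mol e z\<bar> \<le> B" "\<And>z::'a. norm (gmol e z) \<le> B"
proof -
  have "compact ((mol e :: 'a \<Rightarrow> real) ` cball 0 e)" "compact ((gmol e :: 'a \<Rightarrow> 'a) ` cball 0 e)"
    using mol_props(4,5)[OF e, where 'a='a] continuous_on_subset by (auto intro!: compact_continuous_image)
  then have "bounded ((mol e :: 'a \<Rightarrow> real) ` cball 0 e)" "bounded ((gmol e :: 'a \<Rightarrow> 'a) ` cball 0 e)"
    using compact_imp_bounded by auto
  then obtain B1 B2 where B: "\<forall>y\<in>(mol e :: 'a \<Rightarrow> real) ` cball 0 e. norm y \<le> B1" "\<forall>y\<in>(gmol e :: 'a \<Rightarrow> 'a) ` cball 0 e. norm y \<le> B2"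
    unfolding bounded_iff by blast
  have "\<bar>mol e z\<bar> \<le> max 0 (max B1 B2)" "norm (gmol e z) \<le> max 0 (max B1 B2)" for z :: 'a
  proof -
    show "\<bar>mol e z\<bar> \<le> max 0 (max B1 B2)"
      using bspec[OF B(1) imageI[of z]] mol_props(2)[OF e, of z] by (cases "norm z \<le> e") auto
    show "norm (gmol e z) \<le> max 0 (max B1 B2)"
      using bspec[OF B(2) imageI[of z]] mol_props(3)[OF e, of z] by (cases "norm z \<le> e") auto
  qed
  then show thesis by (intro that[of "max 0 (max B1 B2)"]) auto
qed

lemma molf_integrand:
  fixes w :: "'a::euclidean_space \<Rightarrow> 'b::{banach,second_countable_topology}"
  assumes w: "loc_integrable w" and e: "0 < e"
  shows "integrable lborel (\<lambda>y. mol e (x - y) *\<^sub>R w y)"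
proof -
  obtain B where B: "0 \<le> B" "\<And>z::'a. \<bar>mol e z\<bar> \<le> B" using mol_bounded[OF e] by metis
  have [measurable]: "w \<in> borel_measurable borel" using w by (simp add: loc_integrable_def)
  show ?thesis
  proof (rule loc_integrable_dominated[OF w, where B=B and R="norm x + e"])
    show "mol e (x - y) *\<^sub>R w y = 0" if "norm x + e < norm y" for y
    proof -
      have "e \<le> norm (x - y)" using that norm_triangle_ineq2[of y x] by (simp add: norm_minus_commute)
      then show ?thesis using mol_props(2)[OF e, of "x - y"] by simp
    qed
  qed (use B in \<open>auto intro!: mult_right_mono\<close>)
qed

lemma molf_continuous:
  fixes w :: "'a::euclidean_space \<Rightarrow> 'b::{banach,second_countable_topology}"
  assumes w: "loc_integrable w" and e: "0 < e"
  shows "continuous_on UNIV (molf e w)"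
  unfolding continuous_on_sequentially comp_def
proof (intro allI ballI impI)
  fix X :: "nat \<Rightarrow> 'a" and x assume "(\<forall>n. X n \<in> UNIV) \<and> X \<longlonglongrightarrow> x"
  then have X: "X \<longlonglongrightarrow> x" by simp
  obtain B where B: "0 \<le> B" "\<And>z::'a. \<bar>mol e z\<bar> \<le> B" using mol_bounded[OF e] by metis
  have [measurable]: "w \<in> borel_measurable borel" using w by (simp add: loc_integrable_def)
  have "bounded (range X)" using X by (meson convergentI convergent_imp_bounded)
  then obtain R where R: "\<And>n. norm (X n) \<le> R" unfolding bounded_iff by auto
  show "(\<lambda>n. molf e w (X n)) \<longlonglongrightarrow> molf e w x"
    unfolding molf_def
  proof (rule integral_dominated_convergence[where w="\<lambda>y. B * norm (indicator (cball 0 (R + e)) y *\<^sub>R w y)"])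
    show "integrable lborel (\<lambda>y. B * norm (indicator (cball 0 (R + e)) y *\<^sub>R w y))"
      using w unfolding loc_integrable_def by (intro integrable_mult_right integrable_norm) auto
    show "AE y in lborel. norm (mol e (X n - y) *\<^sub>R w y) \<le> B * norm (indicator (cball 0 (R + e)) y *\<^sub>R w y)" for n
    proof (rule AE_I2)
      fix y
      show "norm (mol e (X n - y) *\<^sub>R w y) \<le> B * norm (indicator (cball 0 (R + e)) y *\<^sub>R w y)"
      proof (cases "norm y \<le> R + e")
        case False
        then have "e \<le> norm (X n - y)" using R[of n] norm_triangle_ineq2[of y "X n"] by (simp add: norm_minus_commute)
        then show ?thesis using mol_props(2)[OF e, of "X n - y"] B by simp
      qed (use B in \<open>auto intro!: mult_right_mono\<close>)
    qed
    show "AE y in lborel. (\<lambda>n. mol e (X n - y) *\<^sub>R w y) \<longlonglongrightarrow> mol e (x - y) *\<^sub>R w y"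
    proof (rule AE_I2)
      fix y
      have "isCont (mol e) (x - y)" using mol_props(4)[OF e, where 'a='a] by (simp add: continuous_on_eq_continuous_at)
      from isCont_tendsto_compose[OF this tendsto_diff[OF X tendsto_const[of y]]]
      show "(\<lambda>n. mol e (X n - y) *\<^sub>R w y) \<longlonglongrightarrow> mol e (x - y) *\<^sub>R w y"
        by (intro tendsto_intros)
    qed
  qed auto
qed

lemma molf_has_derivative:
  fixes w :: "'a::euclidean_space \<Rightarrow> real"
  assumes w: "loc_integrable w" and e: "0 < e"
  shows "(molf e w has_derivative (\<lambda>h. (\<integral>y. w y *\<^sub>R gmol e (x - y) \<partial>lborel) \<bullet> h)) (at x)"
    and "integrable lborel (\<lambda>y. w y *\<^sub>R gmol e (x - y))"
proof -
  obtain B where B: "0 \<le> B" "\<And>z::'a. norm (gmol e z) \<le> B" using mol_bounded[OF e] by metis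
  have [measurable]: "w \<in> borel_measurable borel" using w by (simp add: loc_integrable_def)
  let ?B = "\<lambda>y. B * norm (indicator (cball 0 (norm x + 1 + e)) y *\<^sub>R w y)"
  have Bi: "integrable lborel ?B"
    using w unfolding loc_integrable_def by (intro integrable_mult_right integrable_norm) auto
  have bd: "norm (w y *\<^sub>R gmol e (x' - y)) \<le> ?B y" if "x' \<in> ball x 1" for x' y
  proof (cases "norm y \<le> norm x + 1 + e")
    case True
    then show ?thesis using mult_left_mono[OF B(2), of "\<bar>w y\<bar>" "x' - y"] by (simp add: mult.commute)
  next
    case False
    have "norm x' \<le> norm x + 1" using that norm_triangle_ineq2[of x' x] by (simp add: dist_norm norm_minus_commute)
    then have "e \<le> norm (x' - y)" using False norm_triangle_ineq2[of y x'] by (simp add: norm_minus_commute)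
    then show ?thesis using mol_props(3)[OF e, of "x' - y"] B by simp
  qed
  have der: "((\<lambda>x. mol e (x - y) *\<^sub>R w y) has_derivative (\<lambda>h. (w y *\<^sub>R gmol e (x' - y)) \<bullet> h)) (at x')" for x' y
  proof -
    have "((\<lambda>x. x - y) has_derivative (\<lambda>h. h)) (at x')" by (auto intro!: derivative_eq_intros)
    from has_derivative_mult_left[OF has_derivative_compose[OF this mol_props(6)[OF e]], of "w y"]
    show ?thesis unfolding real_scaleR_def by (rule has_derivative_eq_rhs) (auto simp: fun_eq_iff)
  qed
  have int: "integrable lborel (\<lambda>y. mol e (x - y) *\<^sub>R w y)" by (rule molf_integrand[OF w e])
  have "((\<lambda>x. \<integral>y. mol e (x - y) *\<^sub>R w y \<partial>lborel) has_derivative (\<lambda>h. (\<integral>y. w y *\<^sub>R gmol e (x - y) \<partial>lborel) \<bullet> h)) (at x)"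
    by (rule has_derivative_integral_dominated(1)[where r=1 and B="?B" and D="\<lambda>x y. w y *\<^sub>R gmol e (x - y)"]) (use int der bd Bi in auto)
  then show "(molf e w has_derivative (\<lambda>h. (\<integral>y. w y *\<^sub>R gmol e (x - y) \<partial>lborel) \<bullet> h)) (at x)"
    by (simp add: molf_def[abs_def])
  show "integrable lborel (\<lambda>y. w y *\<^sub>R gmol e (x - y))"
    by (rule Bochner_Integration.integrable_bound[OF Bi _ AE_I2]) (use bd[of x] in \<open>auto intro: order_trans[OF _ abs_ge_self]\<close>)
qed

lemma weak_grad_loc_integrable:
  assumes "weak_grad w G"
  shows "loc_integrable w" "loc_integrable G"
  using assms unfolding weak_grad_def loc_integrable_def set_integrable_def by auto

text \<open>The shifted kernel \<open>\<lambda>y. mol e (x - y)\<close> is itself a test function,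
  with gradient \<open>- gmol e (x - y)\<close>. The defining identity of the weak gradient then
  moves the derivative from the kernel to \<open>w\<close>, and the two minus signs cancel.\<close>

lemma molf_weak_grad:
  fixes w :: "real^'n \<Rightarrow> real"
  assumes wg: "weak_grad w G" and e: "0 < e"
  shows "(molf e w has_derivative (\<lambda>h. molf e G x \<bullet> h)) (at x)"
proof -
  note lw = weak_grad_loc_integrable[OF wg]
  have "(\<integral>y. w y *\<^sub>R gmol e (x - y) \<partial>lborel) = molf e G x"
  proof (rule vec_eq_iff[THEN iffD2], rule allI)
    fix i
    have tf: "test_fun (\<lambda>y. mol e (x - y)) (\<lambda>y. - gmol e (x - y))"
      unfolding test_fun_def
    proof (intro conjI allI)
      show "((\<lambda>y. mol e (x - y)) has_derivative (\<lambda>h. - gmol e (x - y) \<bullet> h)) (at y)" for y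
      proof -
        have "((\<lambda>y. x - y) has_derivative (\<lambda>h. - h)) (at y)" by (auto intro!: derivative_eq_intros)
        from has_derivative_compose[OF this mol_props(6)[OF e]] show ?thesis
          by (rule has_derivative_eq_rhs) auto
      qed
      show "continuous_on UNIV (\<lambda>y. - gmol e (x - y))"
        by (intro continuous_intros continuous_on_compose2[OF mol_props(5)[OF e]]) auto
      have "{y. mol e (x - y) \<noteq> 0} \<subseteq> cball x e"
        using mol_props(2)[OF e, of "x - y" for y] by (auto simp: dist_norm) (meson linear)
      then show "bounded {y. mol e (x - y) \<noteq> 0}" using bounded_cball bounded_subset by blast
    qed
    have "(\<integral>y. w y * (- gmol e (x - y)) $ i \<partial>lborel) = - (\<integral>y. G y $ i * mol e (x - y) \<partial>lborel)"
      using wg tf unfolding weak_grad_def by blast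
    then have eq: "(\<integral>y. (w y *\<^sub>R gmol e (x - y)) $ i \<partial>lborel) = (\<integral>y. (mol e (x - y) *\<^sub>R G y) $ i \<partial>lborel)"
      by (simp add: mult.commute)
    show "(\<integral>y. w y *\<^sub>R gmol e (x - y) \<partial>lborel) $ i = molf e G x $ i"
      using eq integral_bounded_linear[OF bounded_linear_vec_nth[of i] molf_has_derivative(2)[OF lw(1) e, of x]]
        integral_bounded_linear[OF bounded_linear_vec_nth[of i] molf_integrand[OF lw(2) e, of x]]
      by (simp only: molf_def)
  qed
  then show ?thesis using molf_has_derivative(1)[OF lw(1) e, of x] by simp
qed

text \<open>Truncation at a high level \<open>m\<close> costs little in L1 on the ball. The
  truncated function is the almost everywhere limit of continuous functions truncated at the same
  level, so bounded convergence on the ball provides one that is close.\<close>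

lemma continuous_L1_approx:
  fixes w :: "'a::euclidean_space \<Rightarrow> real"
  assumes w: "loc_integrable w" and d: "0 < d"
  obtains \<phi> where "continuous_on UNIV \<phi>" "(\<integral>\<^sup>+x. ennreal \<bar>w x - \<phi> x\<bar> * indicator (cball 0 R) x \<partial>lborel) \<le> ennreal d"
proof -
  have wm[measurable]: "w \<in> borel_measurable borel" using w by (simp add: loc_integrable_def)
  have wi: "integrable lborel (\<lambda>x. indicator (cball 0 R) x * w x)"
    using w unfolding loc_integrable_def by auto
  let ?t = "\<lambda>m::nat. \<lambda>s::real. max (- real m) (min (real m) s)"
  have tb: "\<bar>?t m s\<bar> \<le> real m" for m s by auto
  have tm: "(\<lambda>s. ?t m s) \<in> borel_measurable borel" for m
    by (intro borel_measurable_continuous_onI continuous_intros)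
  have [measurable]: "(\<lambda>x. ?t m (w x)) \<in> borel_measurable borel" for m using measurable_compose[OF wm tm] .
  have [measurable]: "cball (0::'a) R \<in> sets borel" by simp
  have "(\<lambda>m. \<integral>x. indicator (cball 0 R) x * \<bar>w x - ?t m (w x)\<bar> \<partial>lborel) \<longlonglongrightarrow> (\<integral>x. 0 \<partial>(lborel :: 'a measure))"
  proof (rule integral_dominated_convergence[where w="\<lambda>x. 2 * \<bar>indicator (cball 0 R) x * w x\<bar>"])
    show "AE x in lborel. (\<lambda>m. indicator (cball 0 R) x * \<bar>w x - ?t m (w x)\<bar>) \<longlonglongrightarrow> 0"
    proof (rule AE_I2)
      fix x
      obtain m0 :: nat where m0: "\<bar>w x\<bar> \<le> real m0" using real_arch_simple by blast
      have "?t m (w x) = w x" if "m \<ge> m0" for m using m0 that by (auto simp: max_def min_def)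
      then have "\<forall>\<^sub>F m in sequentially. indicator (cball 0 R) x * \<bar>w x - ?t m (w x)\<bar> = 0"
        unfolding eventually_sequentially by (intro exI[of _ m0]) auto
      then show "(\<lambda>m. indicator (cball 0 R) x * \<bar>w x - ?t m (w x)\<bar>) \<longlonglongrightarrow> 0" by (rule tendsto_eventually)
    qed
    show "AE x in lborel. norm (indicator (cball 0 R) x * \<bar>w x - ?t m (w x)\<bar>) \<le> 2 * \<bar>indicator (cball 0 R) x * w x\<bar>" for m
      by (rule AE_I2) (auto simp: indicator_def max_def min_def)
    show "(\<lambda>x. indicator (cball 0 R) x * \<bar>w x - ?t m (w x)\<bar>) \<in> borel_measurable lborel" for m
      by measurable
  qed (use wi in auto)
  then have "\<forall>\<^sub>F m in sequentially. (\<integral>x. indicator (cball 0 R) x * \<bar>w x - ?t m (w x)\<bar> \<partial>lborel) < d / 2"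
    using d by (intro order_tendstoD(2)) auto
  then obtain m where m: "(\<integral>x. indicator (cball 0 R) x * \<bar>w x - ?t m (w x)\<bar> \<partial>lborel) < d / 2"
    by (auto simp: eventually_sequentially)
  have "w measurable_on UNIV"
    using wm by (intro lebesgue_measurable_imp_measurable_on measurable_completion) auto
  then obtain N g where N: "negligible N" and g: "\<And>n. continuous_on UNIV (g n)" and lim: "\<And>x. x \<notin> N \<Longrightarrow> (\<lambda>n. g n x) \<longlonglongrightarrow> w x"
    unfolding measurable_on_def by auto
  have gm[measurable]: "g n \<in> borel_measurable borel" for n using g by (rule borel_measurable_continuous_onI)
  have [measurable]: "(\<lambda>x. ?t m (g n x)) \<in> borel_measurable borel" for n using measurable_compose[OF gm tm] .
  have AEN: "AE x in lborel. x \<notin> N"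
  proof -
    have "N \<in> null_sets lebesgue" using N by (simp add: negligible_iff_null_sets)
    then obtain N' where "N \<subseteq> N'" "N' \<in> null_sets lborel" using null_sets_completion_iff2 by metis
    then show ?thesis using AE_not_in[of N' lborel] by auto
  qed
  have "(\<lambda>n. \<integral>x. indicator (cball 0 R) x * \<bar>?t m (w x) - ?t m (g n x)\<bar> \<partial>lborel) \<longlonglongrightarrow> (\<integral>x. 0 \<partial>(lborel :: 'a measure))"
  proof (rule integral_dominated_convergence[where w="\<lambda>x. 2 * real m * indicator (cball 0 R) x"])
    show "AE x in lborel. (\<lambda>n. indicator (cball 0 R) x * \<bar>?t m (w x) - ?t m (g n x)\<bar>) \<longlonglongrightarrow> 0"
      using AEN
    proof eventually_elim
      case (elim x)
      have "(\<lambda>n. indicator (cball 0 R) x * \<bar>?t m (w x) - ?t m (g n x)\<bar>) \<longlonglongrightarrow> indicator (cball 0 R) x * \<bar>?t m (w x) - ?t m (w x)\<bar>"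
        by (intro tendsto_intros lim elim)
      then show ?case by simp
    qed
    show "AE x in lborel. norm (indicator (cball 0 R) x * \<bar>?t m (w x) - ?t m (g n x)\<bar>) \<le> 2 * real m * indicator (cball 0 R) x" for n
    proof (rule AE_I2)
      fix x
      show "norm (indicator (cball 0 R) x * \<bar>?t m (w x) - ?t m (g n x)\<bar>) \<le> 2 * real m * indicator (cball 0 R) x"
        using tb[of m "w x"] tb[of m "g n x"] by (auto simp: indicator_def abs_le_iff)
    qed
  qed (auto intro!: integrable_indicator_cball)
  then have "\<forall>\<^sub>F n in sequentially. (\<integral>x. indicator (cball 0 R) x * \<bar>?t m (w x) - ?t m (g n x)\<bar> \<partial>lborel) < d / 2"
    using d by (intro order_tendstoD(2)) auto
  then obtain n where n: "(\<integral>x. indicator (cball 0 R) x * \<bar>?t m (w x) - ?t m (g n x)\<bar> \<partial>lborel) < d / 2"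
    by (auto simp: eventually_sequentially)
  let ?\<phi> = "\<lambda>x. ?t m (g n x)"
  have i1: "integrable lborel (\<lambda>x. indicator (cball 0 R) x * \<bar>w x - ?t m (w x)\<bar>)"
    by (rule Bochner_Integration.integrable_bound[of _ "\<lambda>x. 2 * \<bar>indicator (cball 0 R) x * w x\<bar>"])
       (use wi in \<open>auto intro!: AE_I2 simp: indicator_def max_def min_def\<close>)
  have i2: "integrable lborel (\<lambda>x. indicator (cball 0 R) x * \<bar>?t m (w x) - ?\<phi> x\<bar>)"
  proof (rule Bochner_Integration.integrable_bound[of _ "\<lambda>x. 2 * real m * indicator (cball 0 R) x"])
    show "integrable lborel (\<lambda>x::'a. 2 * real m * indicator (cball 0 R) x)" by (intro integrable_mult_right integrable_indicator_cball)
    show "AE x in lborel. norm (indicator (cball 0 R) x * \<bar>?t m (w x) - ?\<phi> x\<bar>) \<le> norm (2 * real m * indicator (cball 0 R) x)"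
    proof (rule AE_I2)
      fix x
      show "norm (indicator (cball 0 R) x * \<bar>?t m (w x) - ?\<phi> x\<bar>) \<le> norm (2 * real m * indicator (cball 0 R) x)"
        using tb[of m "w x"] tb[of m "g n x"] by (auto simp: indicator_def abs_le_iff)
    qed
  qed simp
  show thesis
  proof (rule that[of ?\<phi>])
    show "continuous_on UNIV ?\<phi>" using g by (intro continuous_intros)
    have tri: "\<bar>a - c\<bar> \<le> \<bar>a - b\<bar> + \<bar>b - c\<bar>" for a b c :: real by linarith
    have "(\<integral>\<^sup>+x. ennreal \<bar>w x - ?\<phi> x\<bar> * indicator (cball 0 R) x \<partial>lborel)
        \<le> (\<integral>\<^sup>+x. ennreal (indicator (cball 0 R) x * \<bar>w x - ?t m (w x)\<bar> + indicator (cball 0 R) x * \<bar>?t m (w x) - ?\<phi> x\<bar>) \<partial>lborel)"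
      by (rule nn_integral_mono) (auto simp: indicator_def simp del: ennreal_plus intro!: ennreal_leI tri)
    also have "\<dots> = ennreal (\<integral>x. indicator (cball 0 R) x * \<bar>w x - ?t m (w x)\<bar> + indicator (cball 0 R) x * \<bar>?t m (w x) - ?\<phi> x\<bar> \<partial>lborel)"
      using i1 i2 by (intro nn_integral_eq_integral Bochner_Integration.integrable_add AE_I2 add_nonneg_nonneg mult_nonneg_nonneg) auto
    also have "\<dots> \<le> ennreal d"
      using i1 i2 m n by (intro ennreal_leI) simp
    finally show "(\<integral>\<^sup>+x. ennreal \<bar>w x - ?\<phi> x\<bar> * indicator (cball 0 R) x \<partial>lborel) \<le> ennreal d" .
  qed
qed

text \<open>\<open>w\<close> is compared with a continuous \<phi>, for which uniform continuity
  handles the mollifier; averaging does not enlarge the error of this replacement, by Fubini and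
  unit mass of the kernel. The radius \<open>R + 1\<close> leaves room for kernels of radius below
  1.\<close>

lemma mollify_L1:
  fixes w :: "'a::euclidean_space \<Rightarrow> real"
  assumes w: "loc_integrable w" and d: "0 < d"
  obtains e0 where "0 < e0"
    "\<And>e. 0 < e \<Longrightarrow> e < e0 \<Longrightarrow> (\<integral>\<^sup>+x. ennreal \<bar>molf e w x - w x\<bar> * indicator (cball 0 R) x \<partial>lborel) \<le> ennreal d"
proof -
  have [measurable]: "w \<in> borel_measurable borel" using w by (simp add: loc_integrable_def)
  define V where "V = measure lborel (cball (0::'a) R)"
  have V: "emeasure lborel (cball (0::'a) R) = ennreal V" "0 \<le> V"
    using emeasure_bounded_finite[OF bounded_cball, of "0::'a" R] unfolding V_def by (auto simp: emeasure_eq_ennreal_measure less_top)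
  obtain \<phi> where \<phi>: "continuous_on UNIV \<phi>" and ap: "(\<integral>\<^sup>+x. ennreal \<bar>w x - \<phi> x\<bar> * indicator (cball 0 (R + 1)) x \<partial>lborel) \<le> ennreal (d / 4)"
    using continuous_L1_approx[OF w, of "d / 4" "R + 1"] d by auto
  have [measurable]: "\<phi> \<in> borel_measurable borel" using \<phi> by (rule borel_measurable_continuous_onI)
  have "uniformly_continuous_on (cball 0 (R + 1)) \<phi>"
    using continuous_on_subset[OF \<phi>] by (intro compact_uniformly_continuous) auto
  \<comment> \<open>The oscillation of \<phi> is integrated over a ball of volume \<open>V\<close>;
    \<open>V + 1\<close> keeps the denominator positive.\<close>
  moreover define d' where "d' = d / (4 * (V + 1))"
  moreover have "0 < d'" unfolding d'_def using d V by simp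
  ultimately obtain e1 where e1: "0 < e1" "\<And>x y. x \<in> cball 0 (R + 1) \<Longrightarrow> y \<in> cball 0 (R + 1) \<Longrightarrow> dist y x < e1 \<Longrightarrow> \<bar>\<phi> y - \<phi> x\<bar> < d'"
    unfolding uniformly_continuous_on_def dist_real_def by metis
  show thesis
  proof (rule that[of "min e1 1"])
    show "0 < min e1 1" using e1 by simp
    fix e assume e: "0 < e" "e < min e1 1"
    let ?I = "\<lambda>x. indicator (cball 0 R) x :: ennreal" and ?J = "\<lambda>x. indicator (cball 0 (R + 1)) x :: ennreal"
    have [measurable]: "cball (0::'a) R \<in> sets borel" "cball (0::'a) (R + 1) \<in> sets borel" by auto
    have far: "mol e (x - y) = 0" if "e \<le> norm (x - y)" for x y :: 'a by (rule mol_props(2)[OF e(1) that])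
    have mn: "0 \<le> mol e z" for z :: 'a by (rule mol_props(1)[OF e(1)])
    have pt: "ennreal \<bar>molf e w x - w x\<bar> * ?I x \<le> (\<integral>\<^sup>+y. ennreal (mol e (x - y)) * (ennreal \<bar>w y - \<phi> y\<bar> * ?J y) \<partial>lborel)
        + ennreal d' * ?I x + ennreal \<bar>w x - \<phi> x\<bar> * ?J x" for x
    proof (cases "x \<in> cball 0 R")
      case True
      have i: "integrable lborel (\<lambda>y. mol e (x - y) * w y)" using molf_integrand[OF w e(1), of x] by simp
      have i2: "integrable lborel (\<lambda>y. mol e (x - y))" by (rule mol_mass_one[OF e(1)])
      have "molf e w x - w x = (\<integral>y. mol e (x - y) * w y \<partial>lborel) - w x * (\<integral>y. mol e (x - y) \<partial>lborel)"
        using mol_mass_one(4)[OF e(1), of x] by (simp add: molf_def)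
      also have "\<dots> = (\<integral>y. mol e (x - y) * w y - w x * mol e (x - y) \<partial>lborel)"
        using i i2 by simp
      also have "(\<lambda>y. mol e (x - y) * w y - w x * mol e (x - y)) = (\<lambda>y. mol e (x - y) * (w y - w x))"
        by (simp add: fun_eq_iff algebra_simps)
      finally have eqn: "molf e w x - w x = (\<integral>y. mol e (x - y) * (w y - w x) \<partial>lborel)" .
      have "integrable lborel (\<lambda>y. mol e (x - y) * w y - w x * mol e (x - y))"
        using i i2 by (intro Bochner_Integration.integrable_diff integrable_mult_right)
      also have "(\<lambda>y. mol e (x - y) * w y - w x * mol e (x - y)) = (\<lambda>y. mol e (x - y) * (w y - w x))"
        by (simp add: fun_eq_iff algebra_simps)
      finally have i3: "integrable lborel (\<lambda>y. mol e (x - y) * (w y - w x))" .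
      have "ennreal \<bar>molf e w x - w x\<bar> \<le> (\<integral>\<^sup>+y. ennreal (norm (mol e (x - y) * (w y - w x))) \<partial>lborel)"
        using integral_norm_bound_ennreal[OF i3] unfolding eqn by simp
      also have "\<dots> \<le> (\<integral>\<^sup>+y. ennreal (mol e (x - y)) * (ennreal \<bar>w y - \<phi> y\<bar> * ?J y) + ennreal (mol e (x - y)) * (ennreal d' + ennreal \<bar>w x - \<phi> x\<bar>) \<partial>lborel)"
      proof (rule nn_integral_mono)
        fix y
        show "ennreal (norm (mol e (x - y) * (w y - w x))) \<le> ennreal (mol e (x - y)) * (ennreal \<bar>w y - \<phi> y\<bar> * ?J y) + ennreal (mol e (x - y)) * (ennreal d' + ennreal \<bar>w x - \<phi> x\<bar>)"
        proof (cases "norm (x - y) < e")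
          case near: True
          have y: "y \<in> cball 0 (R + 1)" using True near e norm_triangle_ineq2[of y x] by (simp add: norm_minus_commute)
          have x: "x \<in> cball 0 (R + 1)" using True by simp
          have "\<bar>\<phi> y - \<phi> x\<bar> < d'" using e1(2)[OF x y] near e by (simp add: dist_norm norm_minus_commute)
          then have "\<bar>w y - w x\<bar> \<le> \<bar>w y - \<phi> y\<bar> + (d' + \<bar>w x - \<phi> x\<bar>)" by linarith
          from mult_left_mono[OF this mn[of "x - y"]]
          have "norm (mol e (x - y) * (w y - w x)) \<le> mol e (x - y) * \<bar>w y - \<phi> y\<bar> + mol e (x - y) * (d' + \<bar>w x - \<phi> x\<bar>)"
            using mn[of "x - y"] by (simp add: abs_mult distrib_left)
          then have "ennreal (norm (mol e (x - y) * (w y - w x))) \<le> ennreal (mol e (x - y) * \<bar>w y - \<phi> y\<bar> + mol e (x - y) * (d' + \<bar>w x - \<phi> x\<bar>))"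
            by (rule ennreal_leI)
          also have "\<dots> = ennreal (mol e (x - y)) * (ennreal \<bar>w y - \<phi> y\<bar> * ?J y) + ennreal (mol e (x - y)) * (ennreal d' + ennreal \<bar>w x - \<phi> x\<bar>)"
            using mn[of "x - y"] \<open>0 < d'\<close> y by (simp add: ennreal_plus ennreal_mult)
          finally show ?thesis .
        qed (use far[of x y] in simp)
      qed
      also have "\<dots> = (\<integral>\<^sup>+y. ennreal (mol e (x - y)) * (ennreal \<bar>w y - \<phi> y\<bar> * ?J y) \<partial>lborel) + 1 * (ennreal d' + ennreal \<bar>w x - \<phi> x\<bar>)"
      proof (subst nn_integral_add)
        show "(\<lambda>y. ennreal (mol e (x - y)) * (ennreal \<bar>w y - \<phi> y\<bar> * ?J y)) \<in> borel_measurable lborel" by measurable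
      qed (auto simp: nn_integral_multc mol_mass_one(1)[OF e(1)])
      finally show ?thesis using True by (simp add: add.assoc)
    qed simp
    have "(\<integral>\<^sup>+x. ennreal \<bar>molf e w x - w x\<bar> * ?I x \<partial>lborel)
      \<le> (\<integral>\<^sup>+x. (\<integral>\<^sup>+y. ennreal (mol e (x - y)) * (ennreal \<bar>w y - \<phi> y\<bar> * ?J y) \<partial>lborel) + ennreal d' * ?I x + ennreal \<bar>w x - \<phi> x\<bar> * ?J x \<partial>lborel)"
      by (rule nn_integral_mono) (rule pt)
    also have "\<dots> = (\<integral>\<^sup>+x. (\<integral>\<^sup>+y. ennreal (mol e (x - y)) * (ennreal \<bar>w y - \<phi> y\<bar> * ?J y) \<partial>lborel) \<partial>lborel) + ennreal d' * ennreal V + (\<integral>\<^sup>+x. ennreal \<bar>w x - \<phi> x\<bar> * ?J x \<partial>lborel)"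
      by (subst nn_integral_add, measurable, subst nn_integral_add, measurable) (simp add: nn_integral_cmult V)
    also have "(\<integral>\<^sup>+x. (\<integral>\<^sup>+y. ennreal (mol e (x - y)) * (ennreal \<bar>w y - \<phi> y\<bar> * ?J y) \<partial>lborel) \<partial>lborel)
       = (\<integral>\<^sup>+y. (\<integral>\<^sup>+x. ennreal (mol e (x - y)) * (ennreal \<bar>w y - \<phi> y\<bar> * ?J y) \<partial>lborel) \<partial>lborel)"
      by (rule lborel_pair.Fubini') measurable
    also have "\<dots> = (\<integral>\<^sup>+y. ennreal \<bar>w y - \<phi> y\<bar> * ?J y \<partial>lborel)"
      by (simp add: nn_integral_multc mol_mass_one(2)[OF e(1)])
    finally have "(\<integral>\<^sup>+x. ennreal \<bar>molf e w x - w x\<bar> * ?I x \<partial>lborel) \<le> (\<integral>\<^sup>+y. ennreal \<bar>w y - \<phi> y\<bar> * ?J y \<partial>lborel) + ennreal d' * ennreal V + (\<integral>\<^sup>+x. ennreal \<bar>w x - \<phi> x\<bar> * ?J x \<partial>lborel)" .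
    also have "\<dots> \<le> ennreal (d / 4) + ennreal (d / 4) + ennreal (d / 4)"
    proof (intro add_mono ap)
      have "d' * V \<le> d / 4" unfolding d'_def using d V(2) by (simp add: field_simps)
      then show "ennreal d' * ennreal V \<le> ennreal (d / 4)" using \<open>0 < d'\<close> V(2) by (simp add: ennreal_mult[symmetric] ennreal_leI)
    qed
    also have "\<dots> \<le> ennreal d" using d by (simp add: ennreal_plus[symmetric] ennreal_leI del: ennreal_plus)
    finally show "(\<integral>\<^sup>+x. ennreal \<bar>molf e w x - w x\<bar> * ?I x \<partial>lborel) \<le> ennreal d" .
  qed
qed

text \<open>Both mollified gradients are the derivative of the same function
  \<open>molf e w\<close>, hence equal for every \<open>e\<close>; letting \<open>e\<close> tend to
  0 on balls identifies the gradients. \<open>S_psi\<close> picks a weak gradient by choice, and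
  this makes its value independent of the choice.\<close>

lemma weak_grad_unique:
  fixes w :: "real^'n \<Rightarrow> real"
  assumes "weak_grad w G" "weak_grad w H"
  shows "AE x in lborel. G x = H x"
proof -
  note lG = weak_grad_loc_integrable(2)[OF assms(1)] and lH = weak_grad_loc_integrable(2)[OF assms(2)]
  have [measurable]: "G \<in> borel_measurable borel" "H \<in> borel_measurable borel"
    using lG lH by (auto simp: loc_integrable_def)
  have comp: "loc_integrable (\<lambda>x. F x $ i)" if "loc_integrable F" for F :: "real^'n \<Rightarrow> real^'n" and i
    unfolding loc_integrable_def
  proof (intro conjI allI)
    have [measurable]: "F \<in> borel_measurable borel" using that by (simp add: loc_integrable_def)
    have "(\<lambda>v::real^'n. v $ i) \<in> borel_measurable borel"
      by (intro borel_measurable_continuous_onI continuous_intros)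
    from measurable_compose[OF \<open>F \<in> borel_measurable borel\<close> this]
    show "(\<lambda>x. F x $ i) \<in> borel_measurable borel" .
    fix R
    have "integrable lborel (\<lambda>x. (indicator (cball 0 R) x *\<^sub>R F x) $ i)"
      using that by (intro integrable_bounded_linear[OF bounded_linear_vec_nth]) (auto simp: loc_integrable_def)
    then show "integrable lborel (\<lambda>x. indicator (cball 0 R) x *\<^sub>R F x $ i)" by simp
  qed
  have same: "molf e (\<lambda>x. G x $ i) x = molf e (\<lambda>x. H x $ i) x" if e: "0 < e" for e x i
  proof -
    have "(\<lambda>h. molf e G x \<bullet> h) = (\<lambda>h. molf e H x \<bullet> h)"
      by (rule has_derivative_unique[OF molf_weak_grad[OF assms(1) e] molf_weak_grad[OF assms(2) e]])
    then have "molf e G x = molf e H x" by (metis vector_eq_rdot)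
    moreover have "molf e F x $ i = molf e (\<lambda>x. F x $ i) x" if "loc_integrable F" for F :: "real^'n \<Rightarrow> real^'n"
      using integral_bounded_linear[OF bounded_linear_vec_nth[of i] molf_integrand[OF that e, of x]] by (simp add: molf_def)
    ultimately show ?thesis using lG lH by metis
  qed
  have zero: "(\<integral>\<^sup>+x. ennreal \<bar>G x $ i - H x $ i\<bar> * indicator (cball 0 R) x \<partial>lborel) = 0" for i R
  proof (rule ccontr)
    assume nz: "(\<integral>\<^sup>+x. ennreal \<bar>G x $ i - H x $ i\<bar> * indicator (cball 0 R) x \<partial>lborel) \<noteq> 0"
    have le: "(\<integral>\<^sup>+x. ennreal \<bar>G x $ i - H x $ i\<bar> * indicator (cball 0 R) x \<partial>lborel) \<le> ennreal (2 * d)" if d: "0 < d" for d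
    proof -
      obtain e1 where e1: "0 < e1" "\<And>e. 0 < e \<Longrightarrow> e < e1 \<Longrightarrow> (\<integral>\<^sup>+x. ennreal \<bar>molf e (\<lambda>x. G x $ i) x - G x $ i\<bar> * indicator (cball 0 R) x \<partial>lborel) \<le> ennreal d"
        by (rule mollify_L1[OF comp[OF lG, of i] d, of R]) (rule that)
      obtain e2 where e2: "0 < e2" "\<And>e. 0 < e \<Longrightarrow> e < e2 \<Longrightarrow> (\<integral>\<^sup>+x. ennreal \<bar>molf e (\<lambda>x. H x $ i) x - H x $ i\<bar> * indicator (cball 0 R) x \<partial>lborel) \<le> ennreal d"
        by (rule mollify_L1[OF comp[OF lH, of i] d, of R]) (rule that)
      define e where "e = min e1 e2 / 2"
      have e: "0 < e" "e < e1" "e < e2" using e1 e2 by (auto simp: e_def min_def)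
      have [measurable]: "molf e (\<lambda>x. G x $ i) \<in> borel_measurable borel" "molf e (\<lambda>x. H x $ i) \<in> borel_measurable borel"
        using molf_continuous[OF comp[OF lG] e(1), of i] molf_continuous[OF comp[OF lH] e(1), of i] by (auto intro: borel_measurable_continuous_onI)
      have [measurable]: "(\<lambda>x. G x $ i) \<in> borel_measurable borel" "(\<lambda>x. H x $ i) \<in> borel_measurable borel" "cball (0::real^'n) R \<in> sets borel"
        using comp[OF lG] comp[OF lH] by (auto simp: loc_integrable_def)
      have "(\<integral>\<^sup>+x. ennreal \<bar>G x $ i - H x $ i\<bar> * indicator (cball 0 R) x \<partial>lborel)
         \<le> (\<integral>\<^sup>+x. ennreal \<bar>molf e (\<lambda>x. G x $ i) x - G x $ i\<bar> * indicator (cball 0 R) x + ennreal \<bar>molf e (\<lambda>x. H x $ i) x - H x $ i\<bar> * indicator (cball 0 R) x \<partial>lborel)"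
      proof (rule nn_integral_mono)
        fix x
        have "\<bar>G x $ i - H x $ i\<bar> \<le> \<bar>molf e (\<lambda>x. G x $ i) x - G x $ i\<bar> + \<bar>molf e (\<lambda>x. H x $ i) x - H x $ i\<bar>"
          unfolding same[OF e(1)] by linarith
        then have "ennreal \<bar>G x $ i - H x $ i\<bar> \<le> ennreal \<bar>molf e (\<lambda>x. G x $ i) x - G x $ i\<bar> + ennreal \<bar>molf e (\<lambda>x. H x $ i) x - H x $ i\<bar>"
          by (simp add: ennreal_plus[symmetric] ennreal_leI del: ennreal_plus)
        then show "ennreal \<bar>G x $ i - H x $ i\<bar> * indicator (cball 0 R) x \<le> ennreal \<bar>molf e (\<lambda>x. G x $ i) x - G x $ i\<bar> * indicator (cball 0 R) x + ennreal \<bar>molf e (\<lambda>x. H x $ i) x - H x $ i\<bar> * indicator (cball 0 R) x"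
          by (simp add: indicator_def)
      qed
      also have "\<dots> = (\<integral>\<^sup>+x. ennreal \<bar>molf e (\<lambda>x. G x $ i) x - G x $ i\<bar> * indicator (cball 0 R) x \<partial>lborel) + (\<integral>\<^sup>+x. ennreal \<bar>molf e (\<lambda>x. H x $ i) x - H x $ i\<bar> * indicator (cball 0 R) x \<partial>lborel)"
        by (rule nn_integral_add) measurable
      also have "\<dots> \<le> ennreal d + ennreal d" by (intro add_mono e1(2) e2(2) e)
      also have "\<dots> = ennreal (2 * d)" using d by (simp add: ennreal_plus[symmetric] del: ennreal_plus)
      finally show ?thesis .
    qed
    let ?z = "\<integral>\<^sup>+x. ennreal \<bar>G x $ i - H x $ i\<bar> * indicator (cball 0 R) x \<partial>lborel"
    have "?z \<noteq> top" using le[of 1] by (auto simp: top_unique)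
    then obtain r where r: "?z = ennreal r" "0 \<le> r" by (cases ?z) auto
    then have "0 < r" using nz by (cases "r = 0") auto
    then show False using le[of "r / 4"] r by simp
  qed
  have z: "AE x in lborel. ennreal \<bar>G x $ i - H x $ i\<bar> * indicator (cball 0 (real n)) x = 0" for n i
  proof -
    have [measurable]: "(\<lambda>x. G x $ i) \<in> borel_measurable borel" "(\<lambda>x. H x $ i) \<in> borel_measurable borel" "cball (0::real^'n) (real n) \<in> sets borel"
      using comp[OF lG] comp[OF lH] by (auto simp: loc_integrable_def)
    have m: "(\<lambda>x. ennreal \<bar>G x $ i - H x $ i\<bar> * indicator (cball 0 (real n)) x) \<in> borel_measurable lborel" by measurable
    show ?thesis using zero[of i "real n"] unfolding nn_integral_0_iff_AE[OF m] .
  qed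
  have "AE x in lborel. \<forall>n::nat. \<forall>i\<in>UNIV. ennreal \<bar>G x $ i - H x $ i\<bar> * indicator (cball 0 (real n)) x = 0"
    unfolding AE_all_countable by (intro allI AE_finite_allI z) simp
  then show ?thesis
  proof eventually_elim
    case (elim x)
    obtain n :: nat where "norm x \<le> real n" using real_arch_simple by blast
    have "G x $ i = H x $ i" for i
    proof -
      have "ennreal \<bar>G x $ i - H x $ i\<bar> * indicator (cball 0 (real n)) x = 0" using elim by blast
      then show ?thesis using \<open>norm x \<le> real n\<close> by simp
    qed
    then show ?case by (simp add: vec_eq_iff)
  qed
qed

text \<open>Jensen for the probability density \<open>mol e (x - y)\<close>, obtained by integrating
  the nonnegative \<open>(s - norm (v y))\<^sup>2\<close>, where \<open>s\<close> is the average of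
  the norm. If the right side is infinite there is nothing to show.\<close>

lemma molf_jensen:
  fixes v :: "'a::euclidean_space \<Rightarrow> 'b::euclidean_space"
  assumes v: "loc_integrable v" and e: "0 < e"
  shows "ennreal ((norm (molf e v x))\<^sup>2) \<le> (\<integral>\<^sup>+y. ennreal (mol e (x - y)) * ennreal ((norm (v y))\<^sup>2) \<partial>lborel)"
proof (cases "(\<integral>\<^sup>+y. ennreal (mol e (x - y)) * ennreal ((norm (v y))\<^sup>2) \<partial>lborel) < \<infinity>")
  case True
  have vm[measurable]: "v \<in> borel_measurable borel" using v by (simp add: loc_integrable_def)
  have mn: "0 \<le> mol e (x - y)" for y by (rule mol_props(1)[OF e])
  have eq: "ennreal (mol e (x - y)) * ennreal ((norm (v y))\<^sup>2) = ennreal (mol e (x - y) * (norm (v y))\<^sup>2)" for y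
    by (rule ennreal_mult[symmetric]) (use mn in auto)
  have i2: "integrable lborel (\<lambda>y. mol e (x - y) * (norm (v y))\<^sup>2)"
    by (rule integrableI_bounded) (use True mn in \<open>auto simp: eq\<close>)
  have i1: "integrable lborel (\<lambda>y. mol e (x - y) * norm (v y))"
    using integrable_norm[OF molf_integrand[OF v e, of x]] mn by simp
  have i0: "integrable lborel (\<lambda>y. mol e (x - y))" by (rule mol_mass_one(3)[OF e])
  define s where "s = (\<integral>y. mol e (x - y) * norm (v y) \<partial>lborel)"
  have "norm (molf e v x) \<le> (\<integral>y. norm (mol e (x - y) *\<^sub>R v y) \<partial>lborel)"
    unfolding molf_def by (rule integral_norm_bound)
  also have "\<dots> = s" using mn by (simp add: s_def)
  finally have "(norm (molf e v x))\<^sup>2 \<le> s\<^sup>2" by (rule power_mono) simp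
  also have "s\<^sup>2 = 2 * s * (\<integral>y. mol e (x - y) * norm (v y) \<partial>lborel) - s\<^sup>2 * (\<integral>y. mol e (x - y) \<partial>lborel)"
    unfolding mol_mass_one(4)[OF e] s_def[symmetric] by (simp add: power2_eq_square)
  also have "\<dots> = (\<integral>y. 2 * s * (mol e (x - y) * norm (v y)) - s\<^sup>2 * mol e (x - y) \<partial>lborel)"
    using i1 i0 by simp
  also have "\<dots> \<le> (\<integral>y. mol e (x - y) * (norm (v y))\<^sup>2 \<partial>lborel)"
  proof (rule integral_mono[OF _ i2])
    show "integrable lborel (\<lambda>y. 2 * s * (mol e (x - y) * norm (v y)) - s\<^sup>2 * mol e (x - y))"
      using i1 i0 by (intro Bochner_Integration.integrable_diff integrable_mult_right)
    fix y
    have "0 \<le> mol e (x - y) * (s - norm (v y))\<^sup>2" using mn by simp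
    then show "2 * s * (mol e (x - y) * norm (v y)) - s\<^sup>2 * mol e (x - y) \<le> mol e (x - y) * (norm (v y))\<^sup>2"
      by (simp add: power2_eq_square algebra_simps)
  qed
  finally have "ennreal ((norm (molf e v x))\<^sup>2) \<le> ennreal (\<integral>y. mol e (x - y) * (norm (v y))\<^sup>2 \<partial>lborel)"
    by (rule ennreal_leI)
  also have "\<dots> = (\<integral>\<^sup>+y. ennreal (mol e (x - y) * (norm (v y))\<^sup>2) \<partial>lborel)"
    by (rule nn_integral_eq_integral[OF i2, symmetric]) (use mn in auto)
  finally show ?thesis by (simp only: eq)
qed (simp add: less_top[symmetric])

text \<open>After Jensen and Fubini the kernel integrates to 1 and only the weight sits at the wrong
  point; moving it from \<open>x\<close> to \<open>y\<close> costs its modulus of continuity on a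
  slightly larger ball. The bound is one-sided, which is what lower semicontinuity of the entropy
  asks for.\<close>

lemma mollify_energy:
  fixes v :: "'a::euclidean_space \<Rightarrow> 'b::euclidean_space" and m :: "'a \<Rightarrow> real"
  assumes v: "loc_integrable v" and m: "continuous_on UNIV m" "\<And>x. 0 \<le> m x" "\<And>x. \<rho> < norm x \<Longrightarrow> m x = 0"
    and fin: "(\<integral>\<^sup>+y. ennreal ((norm (v y))\<^sup>2) * indicator (cball 0 (\<rho> + 1)) y \<partial>lborel) < \<infinity>" and d: "0 < d"
  obtains e0 where "0 < e0"
    "\<And>e. 0 < e \<Longrightarrow> e < e0 \<Longrightarrow> (\<integral>\<^sup>+x. ennreal (m x) * ennreal ((norm (molf e v x))\<^sup>2) \<partial>lborel)
        \<le> (\<integral>\<^sup>+x. ennreal (m x) * ennreal ((norm (v x))\<^sup>2) \<partial>lborel) + ennreal d"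
proof -
  have vm[measurable]: "v \<in> borel_measurable borel" using v by (simp add: loc_integrable_def)
  have mm[measurable]: "m \<in> borel_measurable borel" using m(1) by (rule borel_measurable_continuous_onI)
  have [measurable]: "cball (0::'a) (\<rho> + 1) \<in> sets borel" by auto
  let ?I = "\<lambda>y. indicator (cball 0 (\<rho> + 1)) y :: ennreal"
  obtain Z where Z: "(\<integral>\<^sup>+y. ennreal ((norm (v y))\<^sup>2) * ?I y \<partial>lborel) = ennreal Z" "0 \<le> Z"
    using fin by (cases "\<integral>\<^sup>+y. ennreal ((norm (v y))\<^sup>2) * ?I y \<partial>lborel") auto
  define d' where "d' = d / (Z + 1)"
  have d': "0 < d'" "Z * d' \<le> d" using d Z(2) by (auto simp: d'_def field_simps)
  have "uniformly_continuous_on (cball 0 (\<rho> + 2)) m"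
    using continuous_on_subset[OF m(1)] by (intro compact_uniformly_continuous) auto
  then obtain e1 where e1: "0 < e1" "\<And>x y. x \<in> cball 0 (\<rho> + 2) \<Longrightarrow> y \<in> cball 0 (\<rho> + 2) \<Longrightarrow> dist y x < e1 \<Longrightarrow> \<bar>m y - m x\<bar> < d'"
    using d'(1) unfolding uniformly_continuous_on_def dist_real_def by metis
  show thesis
  proof (rule that[of "min e1 1"])
    show "0 < min e1 1" using e1 by simp
    fix e assume e: "0 < e" "e < min e1 1"
    have mn: "0 \<le> mol e z" for z :: 'a by (rule mol_props(1)[OF e(1)])
    have [measurable]: "molf e v \<in> borel_measurable borel"
      using molf_continuous[OF v e(1)] by (rule borel_measurable_continuous_onI)
    have sh: "ennreal (m x) * ennreal (mol e (x - y)) \<le> (ennreal (m y) + ennreal d' * ?I y) * ennreal (mol e (x - y))" for x y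
    proof (cases "norm (x - y) < e")
      case True
      have xy: "norm x \<le> norm y + 1" "norm y \<le> norm x + 1"
        using True e norm_triangle_ineq2[of y x] norm_triangle_ineq2[of x y] by (auto simp: norm_minus_commute)
      have "ennreal (m x) \<le> ennreal (m y) + ennreal d' * ?I y"
      proof (cases "norm y \<le> \<rho> + 1")
        case y: True
        then have "\<bar>m y - m x\<bar> < d'" using xy True e by (intro e1(2)) (auto simp: dist_norm norm_minus_commute)
        then have "ennreal (m x) \<le> ennreal (m y + d')" by (intro ennreal_leI) linarith
        then show ?thesis using y m(2)[of y] d'(1) by (simp add: ennreal_plus)
      next
        case False
        then have "m x = 0" using xy by (intro m(3)) linarith
        then show ?thesis by simp
      qed
      then show ?thesis by (rule mult_right_mono) simp
    next
      case False
      then have "mol e (x - y) = 0" by (intro mol_props(2)[OF e(1)]) simp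
      then show ?thesis by simp
    qed
    have "(\<integral>\<^sup>+x. ennreal (m x) * ennreal ((norm (molf e v x))\<^sup>2) \<partial>lborel)
       \<le> (\<integral>\<^sup>+x. ennreal (m x) * (\<integral>\<^sup>+y. ennreal (mol e (x - y)) * ennreal ((norm (v y))\<^sup>2) \<partial>lborel) \<partial>lborel)"
      by (intro nn_integral_mono mult_left_mono molf_jensen[OF v e(1)]) simp
    also have "\<dots> = (\<integral>\<^sup>+x. (\<integral>\<^sup>+y. ennreal (m x) * (ennreal (mol e (x - y)) * ennreal ((norm (v y))\<^sup>2)) \<partial>lborel) \<partial>lborel)"
      by (intro nn_integral_cong nn_integral_cmult[symmetric]) measurable
    also have "\<dots> = (\<integral>\<^sup>+y. (\<integral>\<^sup>+x. ennreal (m x) * (ennreal (mol e (x - y)) * ennreal ((norm (v y))\<^sup>2)) \<partial>lborel) \<partial>lborel)"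
      by (rule lborel_pair.Fubini') measurable
    also have "\<dots> \<le> (\<integral>\<^sup>+y. (\<integral>\<^sup>+x. ((ennreal (m y) + ennreal d' * ?I y) * ennreal ((norm (v y))\<^sup>2)) * ennreal (mol e (x - y)) \<partial>lborel) \<partial>lborel)"
    proof (intro nn_integral_mono)
      fix x y
      show "ennreal (m x) * (ennreal (mol e (x - y)) * ennreal ((norm (v y))\<^sup>2)) \<le> ((ennreal (m y) + ennreal d' * ?I y) * ennreal ((norm (v y))\<^sup>2)) * ennreal (mol e (x - y))"
        using mult_right_mono[OF sh[of x y], of "ennreal ((norm (v y))\<^sup>2)"] by (simp only: mult_ac zero_le)
    qed
    also have "\<dots> = (\<integral>\<^sup>+y. (ennreal (m y) + ennreal d' * ?I y) * ennreal ((norm (v y))\<^sup>2) \<partial>lborel)"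
      by (intro nn_integral_cong) (simp add: nn_integral_cmult mol_mass_one(2)[OF e(1)])
    also have "\<dots> = (\<integral>\<^sup>+y. ennreal (m y) * ennreal ((norm (v y))\<^sup>2) + ennreal d' * (ennreal ((norm (v y))\<^sup>2) * ?I y) \<partial>lborel)"
      by (intro nn_integral_cong) (simp only: distrib_left distrib_right mult_ac)
    also have "\<dots> = (\<integral>\<^sup>+y. ennreal (m y) * ennreal ((norm (v y))\<^sup>2) \<partial>lborel) + (\<integral>\<^sup>+y. ennreal d' * (ennreal ((norm (v y))\<^sup>2) * ?I y) \<partial>lborel)"
      by (rule nn_integral_add) measurable
    also have "(\<integral>\<^sup>+y. ennreal d' * (ennreal ((norm (v y))\<^sup>2) * ?I y) \<partial>lborel) = ennreal d' * ennreal Z"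
      unfolding Z(1)[symmetric] by (rule nn_integral_cmult) measurable
    also have "ennreal d' * ennreal Z \<le> ennreal d"
      using d' Z(2) by (simp add: ennreal_mult[symmetric] mult.commute ennreal_leI)
    finally show "(\<integral>\<^sup>+x. ennreal (m x) * ennreal ((norm (molf e v x))\<^sup>2) \<partial>lborel)
        \<le> (\<integral>\<^sup>+x. ennreal (m x) * ennreal ((norm (v x))\<^sup>2) \<partial>lborel) + ennreal d" by (simp add: add_left_mono)
  qed
qed

section \<open>Approximation by smooth densities\<close>

text \<open>\<open>1 / r + 1\<close> exceeds the exact radius \<open>1 / sqrt r\<close> for small
  and large \<open>r\<close> alike and is free of roots.\<close>

lemma bump_zero_far:
  assumes r: "0 < r" and x: "1 / r + 1 < norm x" shows "bump r x = 0"
proof (rule ccontr)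
  assume "bump r x \<noteq> 0"
  then have "r * (norm x)\<^sup>2 < 1" by (rule bump_support[OF r])
  have i: "0 < 1 / r" using r by simp
  have "1 \<le> norm x" using x i by linarith
  then have "norm x * 1 \<le> norm x * norm x" by (intro mult_left_mono) auto
  then have "1 / r < (norm x)\<^sup>2" using x by (simp add: power2_eq_square)
  then show False using \<open>r * (norm x)\<^sup>2 < 1\<close> r by (simp add: field_simps)
qed

text \<open>With \<open>n\<close> instead of \<open>n - 1\<close> the values could reach the end point of the interval \<open>J\<close>
  below; here they stay in a compact part of it.\<close>

definition damp :: "real \<Rightarrow> real \<Rightarrow> real" where
  "damp n w = (n - 1) * arctan (w / n)"

text \<open>The slope lies between 0 and \<open>(n - 1) / n\<close>, so damping is nondecreasing,
  nonexpansive and fixes 0. The last inequality keeps negative values a fixed fraction away from the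
  lower end point of \<open>J\<close>.\<close>

lemma damp_props:
  assumes n: "1 < n"
  shows "(damp n has_real_derivative ((n - 1) / n) * inverse (1 + (w / n)\<^sup>2)) (at w)"
    and "0 \<le> ((n - 1) / n) * inverse (1 + (w / n)\<^sup>2)" "((n - 1) / n) * inverse (1 + (w / n)\<^sup>2) \<le> 1"
    and "\<bar>damp n w - damp n w'\<bar> \<le> \<bar>w - w'\<bar>"
    and "damp n 0 = 0" "\<bar>damp n w\<bar> \<le> (n - 1) * pi / 2" "damp n w \<le> max 0 w" "(n - 1) / n * min 0 w \<le> damp n w"
proof -
  show d: "(damp n has_real_derivative ((n - 1) / n) * inverse (1 + (w / n)\<^sup>2)) (at w)" for w
  proof -
    have "((\<lambda>w. w / n) has_real_derivative 1 / n) (at w)" using n by (auto intro!: derivative_eq_intros)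
    from DERIV_cmult[OF DERIV_chain2[OF DERIV_arctan this], of "n - 1"]
    show ?thesis unfolding damp_def[abs_def] by (simp add: mult.commute)
  qed
  show d0: "0 \<le> ((n - 1) / n) * inverse (1 + (w / n)\<^sup>2)" for w using n by simp
  have d1': "((n - 1) / n) * inverse (1 + (w / n)\<^sup>2) \<le> (n - 1) / n" for w
    using n by (intro mult_left_le) (auto simp: inverse_le_1_iff)
  have "(n - 1) / n \<le> 1" using n by simp
  then show d1: "((n - 1) / n) * inverse (1 + (w / n)\<^sup>2) \<le> 1" for w using d1'[of w] by linarith
  have mvt: "0 \<le> damp n b - damp n a \<and> damp n b - damp n a \<le> (n - 1) / n * (b - a)" if "a \<le> b" for a b
  proof (cases "a < b")
    case True
    obtain z where z: "damp n b - damp n a = (b - a) * (((n - 1) / n) * inverse (1 + (z / n)\<^sup>2))"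
      using MVT2[OF True, of "damp n" "\<lambda>w. ((n - 1) / n) * inverse (1 + (w / n)\<^sup>2)"] d by blast
    then show ?thesis using True mult_left_mono[OF d1'[of z], of "b - a"] mult_nonneg_nonneg[OF _ d0[of z], of "b - a"]
      by (auto simp: mult.commute)
  qed (use that in auto)
  show z: "damp n 0 = 0" by (simp add: damp_def)
  have q1: "(n - 1) / n * c \<le> c" if "0 \<le> c" for c using that n by (simp add: field_simps)
  show "\<bar>damp n w - damp n w'\<bar> \<le> \<bar>w - w'\<bar>"
    using mvt[of w w'] mvt[of w' w] q1[of "w - w'"] q1[of "w' - w"] by (cases "w \<le> w'") auto
  show "\<bar>damp n w\<bar> \<le> (n - 1) * pi / 2"
  proof -
    have "\<bar>arctan (w / n)\<bar> \<le> pi / 2" using arctan_bounded[of "w / n"] by auto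
    from mult_left_mono[OF this, of "n - 1"] n show ?thesis by (simp add: damp_def abs_mult)
  qed
  show "damp n w \<le> max 0 w"
    using mvt[of 0 w] mvt[of w 0] q1[of w] z by (cases "0 \<le> w") auto
  show "(n - 1) / n * min 0 w \<le> damp n w"
    using mvt[of 0 w] mvt[of w 0] z by (cases "0 \<le> w") auto
qed

lemma damp_tendsto: "(\<lambda>n. damp (real (Suc (Suc n))) w) \<longlonglongrightarrow> w"
proof (cases "w = 0")
  case True
  then show ?thesis by (simp add: damp_def)
next
  case False
  let ?a = "\<lambda>n::nat. w / real (Suc (Suc n))"
  have inv: "(\<lambda>n. inverse (real (Suc (Suc n)))) \<longlonglongrightarrow> 0"
    using LIMSEQ_Suc[OF LIMSEQ_inverse_real_of_nat] .
  have "(\<lambda>n. 1 - inverse (real (Suc (Suc n)))) \<longlonglongrightarrow> 1 - 0" by (intro tendsto_intros inv)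
  then have "(\<lambda>n. 1 - inverse (real (Suc (Suc n)))) \<longlonglongrightarrow> 1" by (simp only: diff_zero)
  then have q: "(\<lambda>n. real (Suc n) / real (Suc (Suc n))) \<longlonglongrightarrow> 1"
    by (rule Lim_transform_eventually) (auto simp: field_simps)
  have a: "?a \<longlonglongrightarrow> 0" using tendsto_mult[OF tendsto_const[of w] inv] by (simp only: divide_inverse mult_zero_right)
  have "((\<lambda>x. arctan x / x) \<longlongrightarrow> 1) (at (0::real))"
    using DERIV_arctan[of 0] by (simp add: has_field_derivative_iff)
  moreover have "filterlim ?a (at 0) sequentially" unfolding filterlim_at using a False by auto
  ultimately have "(\<lambda>n. arctan (?a n) / ?a n) \<longlonglongrightarrow> 1" by (rule filterlim_compose)
  from tendsto_mult[OF tendsto_const[of w] tendsto_mult[OF q this]]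
  have "(\<lambda>n. w * (real (Suc n) / real (Suc (Suc n)) * (arctan (?a n) / ?a n))) \<longlonglongrightarrow> w" by (simp only: mult_1_right)
  moreover have "w * (real (Suc n) / real (Suc (Suc n)) * (arctan (?a n) / ?a n)) = damp (real (Suc (Suc n))) w" for n
  proof -
    have "w * (x / y * (t / (w / y))) = x * t" if "y \<noteq> 0" for x y t :: real using that False by simp
    from this[of "real (Suc (Suc n))" "real (Suc n)"] show ?thesis by (simp add: damp_def)
  qed
  ultimately show ?thesis by simp
qed

section \<open>Damping, cut-off and composition with the inverse root\<close>

context entropy_root
begin

lemma one_I: "1 \<in> I" using I by auto
lemma zero_J: "0 \<in> J" using W_in[OF one_I] W_1 by simp
lemma V_0: "V 0 = 1" using V_W[OF one_I] W_1 by simp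
lemma J_Icc: "a \<in> J \<Longrightarrow> b \<in> J \<Longrightarrow> {a..b} \<subseteq> J" using J by auto

lemma V_mono:
  assumes "u \<in> J" "u' \<in> J" "u \<le> u'" shows "V u \<le> V u'"
proof (rule DERIV_nonneg_imp_nondecreasing[OF assms(3)])
  fix z assume "u \<le> z" "z \<le> u'"
  then have z: "z \<in> J" using J_Icc[OF assms(1,2)] by auto
  show "\<exists>y. (V has_real_derivative y) (at z) \<and> 0 \<le> y"
    using V_deriv[OF z] hpos[OF V_in[OF z]] by (intro exI[of _ "1 / sqrt (h (V z))"]) auto
qed

lemma V_continuous:
  assumes "lo \<in> J" "hi \<in> J"
  shows "continuous_on {lo..hi} V" "continuous_on {lo..hi} (\<lambda>u. 1 / sqrt (h (V u)))"
proof -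
  have z: "isCont V u" "isCont (\<lambda>u. 1 / sqrt (h (V u))) u" if "u \<in> {lo..hi}" for u
  proof -
    have u: "u \<in> J" using J_Icc[OF assms] that by auto
    show c: "isCont V u" using V_deriv[OF u] DERIV_isCont by blast
    have "isCont h (V u)" using d2[OF V_in[OF u]] DERIV_isCont by blast
    with c have "isCont (\<lambda>u. h (V u)) u" by (rule isCont_o2)
    then show "isCont (\<lambda>u. 1 / sqrt (h (V u))) u"
      using hpos[OF V_in[OF u]] by (intro continuous_intros) auto
  qed
  then show "continuous_on {lo..hi} V" "continuous_on {lo..hi} (\<lambda>u. 1 / sqrt (h (V u)))"
    by (auto intro: continuous_at_imp_continuous_on)
qed

lemma V_lipschitz:
  assumes lh: "lo \<in> J" "hi \<in> J"
  obtains L where "0 \<le> L" "\<And>u. u \<in> {lo..hi} \<Longrightarrow> 1 / sqrt (h (V u)) \<le> L"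
    "\<And>u u'. u \<in> {lo..hi} \<Longrightarrow> u' \<in> {lo..hi} \<Longrightarrow> \<bar>V u - V u'\<bar> \<le> L * \<bar>u - u'\<bar>"
proof -
  have "compact ((\<lambda>u. 1 / sqrt (h (V u))) ` {lo..hi})"
    by (rule compact_continuous_image[OF V_continuous(2)[OF lh]]) simp
  then obtain L0 where L0: "\<forall>y\<in>(\<lambda>u. 1 / sqrt (h (V u))) ` {lo..hi}. norm y \<le> L0"
    using compact_imp_bounded bounded_iff by metis
  define L where "L = max 0 L0"
  have L: "norm (1 / sqrt (h (V u))) \<le> L" if "u \<in> {lo..hi}" for u
  proof -
    have "norm (1 / sqrt (h (V u))) \<le> L0" using L0 that by blast
    then show ?thesis unfolding L_def by linarith
  qed
  show thesis
  proof (rule that[of L])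
    show "0 \<le> L" by (simp add: L_def)
    show "1 / sqrt (h (V u)) \<le> L" if "u \<in> {lo..hi}" for u using L[OF that] abs_ge_self[of "1 / sqrt (h (V u))"] unfolding real_norm_def by linarith
    show "\<bar>V u - V u'\<bar> \<le> L * \<bar>u - u'\<bar>" if "u \<in> {lo..hi}" "u' \<in> {lo..hi}" for u u'
    proof -
      have "norm (V u - V u') \<le> L * norm (u - u')"
      proof (rule field_differentiable_bound[of "{lo..hi}" V "\<lambda>u. 1 / sqrt (h (V u))"])
        show "(V has_field_derivative 1 / sqrt (h (V z))) (at z within {lo..hi})" if "z \<in> {lo..hi}" for z
          by (rule has_field_derivative_at_within[OF V_deriv]) (rule subsetD[OF J_Icc[OF lh] that])
      qed (use L that in auto)
      then show ?thesis by simp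
    qed
  qed
qed

lemma damp_range:
  assumes n: "1 < n"
  obtains lo hi where "lo \<in> J" "hi \<in> J" "lo \<le> 0" "0 \<le> hi" "\<And>w. w \<in> closure J \<Longrightarrow> damp n w \<in> {lo..hi}"
proof -
  let ?B = "(n - 1) * pi / 2"
  have B: "0 \<le> ?B" "damp n w \<le> ?B" "- ?B \<le> damp n w" for w
    using n damp_props(6)[OF n, of w] by auto
  from J show thesis
  proof
    assume "\<exists>\<alpha><0. J = {\<alpha><..}"
    then obtain \<alpha> where \<alpha>: "\<alpha> < 0" "J = {\<alpha><..}" by blast
    \<comment> \<open>Shrinking the negative end point by the factor \<open>(n - 1) / n\<close>
      moves it strictly into \<open>J\<close>.\<close>
    have lo: "\<alpha> < (n - 1) / n * \<alpha>" "(n - 1) / n * \<alpha> \<le> 0" using \<alpha> n by (auto simp: field_simps mult_le_0_iff)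
    show thesis
    proof (rule that[of "(n - 1) / n * \<alpha>" ?B])
      fix w assume "w \<in> closure J"
      then have "\<alpha> \<le> min 0 w" using \<alpha> by simp
      from mult_left_mono[OF this, of "(n - 1) / n"] n damp_props(8)[OF n, of w]
      have "(n - 1) / n * \<alpha> \<le> damp n w" by simp
      then show "damp n w \<in> {(n - 1) / n * \<alpha>..?B}" using B(2)[of w] by simp
    qed (use lo B \<alpha> in auto)
  next
    assume "J = UNIV"
    then show thesis using B by (intro that[of "- ?B" ?B]) auto
  qed
qed

text \<open>Damping shrinks \<open>W s\<close> towards 0 and \<open>V\<close> is nondecreasing with
  \<open>V 0 = 1\<close>, so the damped value lies between 1 and \<open>s\<close>. The resulting
  bound \<open>1 + \<bar>s\<bar>\<close> is a dominating function as integrable as the density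
  itself. When \<open>W s\<close> falls outside \<open>J\<close>, necessarily \<open>s = 0\<close>,
  and the value lies between 0 and 1.\<close>

lemma V_damp_W:
  assumes s: "s \<in> closure I"
  shows "(\<lambda>n. V (damp (real (Suc (Suc n))) (W s))) \<longlonglongrightarrow> s"
    and "\<bar>V (damp (real (Suc (Suc n))) (W s)) - s\<bar> \<le> 1 + \<bar>s\<bar>"
proof -
  let ?d = "\<lambda>n. damp (real (Suc (Suc n)))"
  have d_in: "?d n (W s) \<in> J" for n
  proof -
    obtain lo hi where "lo \<in> J" "hi \<in> J" "?d n (W s) \<in> {lo..hi}"
      using damp_range[of "real (Suc (Suc n))"] W_closure[OF s] by (metis of_nat_1 of_nat_less_iff Suc_less_eq zero_less_Suc One_nat_def)
    then show ?thesis using J_Icc by blast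
  qed
  show "(\<lambda>n. V (?d n (W s))) \<longlonglongrightarrow> s"
    using d_in by (intro V_boundary[OF s] damp_tendsto) auto
  have n: "1 < real (Suc (Suc n))" by simp
  note k = damp_props(4)[OF n, of "W s" 0] damp_props(7,8)[OF n, of "W s"] damp_props(5)[OF n]
  have up: "W s \<le> ?d n (W s)" if "W s \<le> 0"
    using k that by auto
  show "\<bar>V (?d n (W s)) - s\<bar> \<le> 1 + \<bar>s\<bar>"
  proof (cases "W s \<in> J")
    case True
    have Vs: "V (W s) = s"
      using LIMSEQ_unique[OF V_boundary[OF s, of "\<lambda>_. W s"] tendsto_const] True by auto
    show ?thesis
    proof (cases "0 \<le> W s")
      case pos: True
      have "0 \<le> ?d n (W s)" "?d n (W s) \<le> W s"
        using k pos by (auto simp: damp_def intro!: mult_nonneg_nonneg)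
      then have "1 \<le> V (?d n (W s))" "V (?d n (W s)) \<le> s"
        using V_mono[OF zero_J d_in[of n]] V_mono[OF d_in[of n] True] Vs V_0 by auto
      then show ?thesis by linarith
    next
      case False
      have "?d n (W s) \<le> 0" "W s \<le> ?d n (W s)" using k up False by auto
      then have "V (?d n (W s)) \<le> 1" "s \<le> V (?d n (W s))"
        using V_mono[OF d_in[of n] zero_J] V_mono[OF True d_in[of n]] Vs V_0 by auto
      then show ?thesis by linarith
    qed
  next
    case False
    have neg: "W s \<le> 0" using False W_closure[OF s] J by auto
    then have "?d n (W s) \<le> 0" using k by auto
    then have "V (?d n (W s)) \<le> 1" using V_mono[OF d_in[of n] zero_J] V_0 by simp
    moreover have "s \<notin> I" using False W_in by blast
    then have "I = {0<..}" "s = 0" using I s by auto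
    moreover have "V (?d n (W s)) \<in> I" by (rule V_in[OF d_in])
    ultimately show ?thesis by auto
  qed
qed

text \<open>The derivative of \<open>V\<close> is \<open>1 / sqrt (h (V u))\<close>, so the left
  side of the energy bound is the squared norm of \<open>transpose R\<close> applied to the gradient
  of \<open>bump r x ^ 2 * damp n (p x)\<close>. The product rule and Young's inequality with
  parameter \<open>d\<close> separate the gradient of \<open>p\<close> from that of the bump;
  damping bounds the coefficient of the latter, whose square is of order \<open>r\<close>. Where the
  bump vanishes the relative density has the equilibrium value 1.\<close>

lemma cutoff_nice:
  fixes p :: "real^'n \<Rightarrow> real" and R :: "real^'n^'n"
  assumes n: "1 < n" and lh: "lo \<in> J" "hi \<in> J" "lo \<le> 0" "0 \<le> hi"
    and range: "\<And>w. w \<in> closure J \<Longrightarrow> damp n w \<in> {lo..hi}"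
    and p: "\<And>x. (p has_derivative (\<lambda>v. dp x \<bullet> v)) (at x)" "continuous_on UNIV dp" "\<And>x. p x \<in> closure J"
    and r: "0 < r" and d: "0 < d" and CR: "0 \<le> CR" "\<And>x. norm (transpose R *v x) \<le> CR * norm x"
  obtains L dg where "nice (V lo) (V hi) L (\<lambda>x. V (bump r x ^ 2 * damp n (p x))) dg"
    "\<And>x. h (V (bump r x ^ 2 * damp n (p x))) * (norm (transpose R *v dg x))\<^sup>2
      \<le> (1 + d) * ((bump r x ^ 2)\<^sup>2 * (norm (transpose R *v dp x))\<^sup>2) + (1 + 1 / d) * ((n - 1) * pi / 2 * CR * 4)\<^sup>2 * r"
proof -
  define u where "u x = bump r x ^ 2 * damp n (p x)" for x
  define k where "k w = ((n - 1) / n) * inverse (1 + (w / n)\<^sup>2)" for w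
  define gx where "gx x = (- 2 * real 2 * r * bump r x ^ (2 - 1)) *\<^sub>R x" for x :: "real^'n"
  define du where "du x = (bump r x ^ 2 * k (p x)) *\<^sub>R dp x + damp n (p x) *\<^sub>R gx x" for x
  define dg where "dg x = (1 / sqrt (h (V (u x)))) *\<^sub>R du x" for x
  have b: "0 \<le> bump r x ^ 2" "bump r x ^ 2 \<le> 1" "0 \<le> bump r x" "bump r x \<le> 1" for x :: "real^'n"
    using bump_bounds(1)[of r x] bump_bounds(2)[of r x] r by (auto simp: power_le_one)
  have u_in: "u x \<in> {lo..hi}" for x
  proof -
    have t: "lo \<le> damp n (p x)" "damp n (p x) \<le> hi" using range[OF p(3)[of x]] by auto
    have "lo \<le> bump r x ^ 2 * lo" using mult_right_mono_neg[OF b(2)[of x] lh(3)] by simp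
    also have "\<dots> \<le> u x" unfolding u_def by (rule mult_left_mono[OF t(1) b(1)])
    finally have "lo \<le> u x" .
    moreover have "u x \<le> bump r x ^ 2 * hi" unfolding u_def by (rule mult_left_mono[OF t(2) b(1)])
    moreover have "bump r x ^ 2 * hi \<le> hi" using mult_right_mono[OF b(2)[of x] lh(4)] by simp
    ultimately show ?thesis by simp
  qed
  have u_J: "u x \<in> J" for x using u_in J_Icc[OF lh(1,2)] by blast
  have pc: "continuous_on UNIV p" using p(1) by (intro has_derivative_continuous_on) (auto intro: has_derivative_at_withinI)
  have ud: "(u has_derivative (\<lambda>v. du x \<bullet> v)) (at x)" for x
  proof -
    have "((\<lambda>x. damp n (p x)) has_derivative (\<lambda>v. k (p x) * (dp x \<bullet> v))) (at x)"
      using has_derivative_compose[OF p(1) damp_props(1)[OF n, unfolded has_field_derivative_def], of x] by (simp add: k_def)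
    from has_derivative_mult[OF bump_power_deriv[of 2 r x] this] show ?thesis
      unfolding u_def[abs_def]
      by (rule has_derivative_eq_rhs) (auto simp: fun_eq_iff du_def gx_def inner_add_left algebra_simps)
  qed
  have uc: "continuous_on UNIV u" using ud by (intro has_derivative_continuous_on) (auto intro: has_derivative_at_withinI)
  have gd: "((\<lambda>x. V (u x)) has_derivative (\<lambda>v. dg x \<bullet> v)) (at x)" for x
    using has_derivative_compose[OF ud V_deriv[OF u_J, unfolded has_field_derivative_def], of x]
    by (simp add: dg_def)
  have kc: "continuous_on UNIV (\<lambda>x. k (p x))"
    unfolding k_def by (intro continuous_intros pc) (auto simp: add_nonneg_eq_0_iff n less_imp_neq[symmetric] order_less_trans[OF zero_less_one n])
  have dc: "continuous_on UNIV (\<lambda>x. damp n (p x))"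
    unfolding damp_def using n by (intro continuous_intros pc) auto
  have duc: "continuous_on UNIV du"
    unfolding du_def gx_def by (intro continuous_intros kc dc p(2) bump_continuous)
  have du0: "du x = 0" if "1 / r + 1 < norm x" for x
  proof -
    have "bump r x = 0" by (rule bump_zero_far[OF r that])
    then show ?thesis by (simp add: du_def gx_def)
  qed
  obtain L0 where L0: "\<And>x. norm (du x) \<le> L0"
  proof -
    have "compact (du ` cball 0 (1 / r + 1))"
      using continuous_on_subset[OF duc] by (intro compact_continuous_image) auto
    then obtain B where "\<forall>y\<in>du ` cball 0 (1 / r + 1). norm y \<le> B" using compact_imp_bounded bounded_iff by metis
    then have B: "norm (du x) \<le> B" if "norm x \<le> 1 / r + 1" for x using that by auto
    have "norm (du x) \<le> max B 0" for x
    proof (cases "norm x \<le> 1 / r + 1")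
      case True
      then show ?thesis using B[of x] by linarith
    qed (use du0[of x] in simp)
    then show thesis by (rule that)
  qed
  obtain LV where LV: "0 \<le> LV" "\<And>u. u \<in> {lo..hi} \<Longrightarrow> 1 / sqrt (h (V u)) \<le> LV"
    using V_lipschitz[OF lh(1,2)] by metis
  have hV: "0 < h (V (u x))" for x by (rule hpos[OF V_in[OF u_J]])
  have nice: "nice (V lo) (V hi) (LV * L0) (\<lambda>x. V (u x)) dg"
    unfolding nice_def
  proof (intro conjI allI)
    show "((\<lambda>x. V (u x)) has_derivative (\<lambda>v. dg x \<bullet> v)) (at x)" for x by (rule gd)
    show "continuous_on UNIV dg"
      unfolding dg_def using u_in
      by (intro continuous_on_scaleR duc continuous_on_compose2[OF V_continuous(2)[OF lh(1,2)] uc]) auto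
    show "norm (dg x) \<le> LV * L0" for x
      unfolding dg_def norm_scaleR using LV(2)[OF u_in[of x]] LV(1) L0[of x] hV[of x]
      by (intro mult_mono) auto
    show "V (u x) \<in> {V lo..V hi}" for x
      using V_mono[OF lh(1) u_J] V_mono[OF u_J lh(2)] u_in[of x] by auto
  qed
  have en: "h (V (u x)) * (norm (transpose R *v dg x))\<^sup>2
      \<le> (1 + d) * ((bump r x ^ 2)\<^sup>2 * (norm (transpose R *v dp x))\<^sup>2) + (1 + 1 / d) * ((n - 1) * pi / 2 * CR * 4)\<^sup>2 * r" for x
  proof -
    have "transpose R *v dg x = (1 / sqrt (h (V (u x)))) *\<^sub>R (transpose R *v du x)"
      unfolding dg_def by (rule matrix_vector_mult_scaleR)
    then have "(norm (transpose R *v dg x))\<^sup>2 = (1 / sqrt (h (V (u x))))\<^sup>2 * (norm (transpose R *v du x))\<^sup>2"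
      by (simp only: norm_scaleR power_mult_distrib real_norm_def power2_abs)
    then have e1: "h (V (u x)) * (norm (transpose R *v dg x))\<^sup>2 = (norm (transpose R *v du x))\<^sup>2"
      using hV[of x] by (simp add: power_divide)
    let ?a = "bump r x ^ 2 * norm (transpose R *v dp x)" and ?b = "((n - 1) * pi / 2) * (CR * (4 * (r * bump r x * norm x)))"
    have "transpose R *v du x = (bump r x ^ 2 * k (p x)) *\<^sub>R (transpose R *v dp x) + damp n (p x) *\<^sub>R (transpose R *v gx x)"
      by (simp add: du_def matrix_vector_right_distrib matrix_vector_mult_scaleR)
    then have "norm (transpose R *v du x) \<le> norm ((bump r x ^ 2 * k (p x)) *\<^sub>R (transpose R *v dp x)) + norm (damp n (p x) *\<^sub>R (transpose R *v gx x))"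
      by (simp only: norm_triangle_ineq)
    also have "\<dots> \<le> ?a + ?b"
    proof (rule add_mono)
      have k: "0 \<le> k (p x)" "k (p x) \<le> 1" unfolding k_def by (rule damp_props(2,3)[OF n])+
      have "bump r x ^ 2 * k (p x) \<le> bump r x ^ 2 * 1" by (rule mult_left_mono[OF k(2) b(1)])
      then show "norm ((bump r x ^ 2 * k (p x)) *\<^sub>R (transpose R *v dp x)) \<le> ?a"
        using k b(1)[of x] unfolding norm_scaleR by (intro mult_right_mono) auto
      have "norm (gx x) = 4 * (r * bump r x * norm x)" using r b(3)[of x] by (simp add: gx_def abs_mult)
      then have "norm (transpose R *v gx x) \<le> CR * (4 * (r * bump r x * norm x))" using CR(2)[of "gx x"] by simp
      then show "norm (damp n (p x) *\<^sub>R (transpose R *v gx x)) \<le> ?b"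
        using damp_props(6)[OF n, of "p x"] n unfolding norm_scaleR real_norm_def by (intro mult_mono) auto
    qed
    finally have "(norm (transpose R *v du x))\<^sup>2 \<le> (?a + ?b)\<^sup>2" by (rule power_mono) simp
    also have "(?a + ?b)\<^sup>2 \<le> (1 + d) * ?a\<^sup>2 + (1 + 1 / d) * ?b\<^sup>2"
    proof -
      have "0 \<le> (d * ?a - ?b)\<^sup>2 / d" using d by simp
      also have "\<dots> = d * ?a\<^sup>2 - 2 * ?a * ?b + 1 / d * ?b\<^sup>2" using d by (simp add: power2_diff field_simps power2_eq_square)
      finally show ?thesis by (simp add: power2_sum distrib_right)
    qed
    also have "\<dots> \<le> (1 + d) * ?a\<^sup>2 + (1 + 1 / d) * (((n - 1) * pi / 2 * CR * 4)\<^sup>2 * r)"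
    proof (intro add_left_mono mult_left_mono)
      have "(r * bump r x * norm x)\<^sup>2 \<le> r"
      proof (cases "bump r x = 0")
        case False
        have "(r * bump r x * norm x)\<^sup>2 = r * ((bump r x)\<^sup>2 * (r * (norm x)\<^sup>2))" by (simp add: power2_eq_square)
        also have "\<dots> \<le> r * (1 * 1)"
          using bump_support[OF r False] b[of x] r by (intro mult_left_mono mult_mono) auto
        finally show ?thesis by simp
      qed (use r in simp)
      note mult_left_mono[OF this zero_le_power2[of "(n - 1) * pi / 2 * CR * 4"]]
      moreover have "?b = ((n - 1) * pi / 2 * CR * 4) * (r * bump r x * norm x)" by simp
      ultimately show "?b\<^sup>2 \<le> ((n - 1) * pi / 2 * CR * 4)\<^sup>2 * r" by (simp only: power_mult_distrib)
    qed (use d in auto)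
    finally show ?thesis unfolding e1 by (simp only: power_mult_distrib mult.assoc)
  qed
  show thesis by (rule that[of "LV * L0" dg, folded u_def, OF nice en])
qed

lemma molf_in_closure_J:
  fixes w :: "'a::euclidean_space \<Rightarrow> real"
  assumes w: "loc_integrable w" and e: "0 < e" and J': "\<And>y. w y \<in> closure J"
  shows "molf e w x \<in> closure J"
  using J
proof
  assume "\<exists>\<alpha><0. J = {\<alpha><..}"
  then obtain \<alpha> where \<alpha>: "J = {\<alpha><..}" by blast
  have mn: "0 \<le> mol e z" for z :: 'a by (rule mol_props(1)[OF e])
  have "\<alpha> = (\<integral>y. mol e (x - y) * \<alpha> \<partial>lborel)" using mol_mass_one(4)[OF e, of x] by simp
  also have "\<dots> \<le> (\<integral>y. mol e (x - y) * w y \<partial>lborel)"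
    using molf_integrand[OF w e, of x] mol_mass_one(3)[OF e, of x] J' mn \<alpha>
    by (intro integral_mono mult_left_mono integrable_mult_left) auto
  finally show ?thesis using \<alpha> by (simp add: molf_def)
qed simp

end

context entropy_root
begin

text \<open>Mollification acts on \<open>w\<close> first; damping, cut-off and \<open>V\<close> act
  on the resulting smooth function, so only the classical chain rule enters. The parameters are
  chosen in the order \<open>n\<close>, \<open>r\<close>, \<epsilon>, each for an L1 error of
  \<open>e / 3\<close>; \<epsilon> comes last because its tolerance involves the Lipschitz constant
  of \<open>V\<close> on the damped range and the maximum of the Gaussian on the support of the
  cut-off.\<close>

lemma smooth_approximation:
  fixes K M R :: "real^'n^'n" and g :: "real^'n \<Rightarrow> real"
  assumes K: "sym_mat K" "pos_def K" and M: "K = M ** transpose M"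
    and g[measurable]: "g \<in> borel_measurable borel" and gI: "\<And>x. g x \<in> closure I"
    and gi: "integrable gauss (\<lambda>u. g (M *v u))"
    and wg: "weak_grad (\<lambda>x. W (g x)) G" and G2: "integrable lborel (\<lambda>x. (norm (G x))\<^sup>2 * finf K x)"
    and e: "0 < e"
  shows "\<exists>a b L g' dg'. nice a b L g' dg' \<and> a \<in> I \<and> b \<in> I
        \<and> (\<integral>u. \<bar>g' (M *v u) - g (M *v u)\<bar> \<partial>gauss) \<le> e
        \<and> (\<integral>u. h (g' (M *v u)) * (norm (transpose R *v dg' (M *v u)))\<^sup>2 \<partial>gauss)
           \<le> (\<integral>x. finf K x * (norm (transpose R *v G x))\<^sup>2 \<partial>lborel) + e"
proof -
  note fK = finf_integral[OF K M]
  define \<gamma> where "\<gamma> = finf K"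
  have \<gamma>: "0 < \<gamma> x" "continuous_on UNIV \<gamma>" for x
    unfolding \<gamma>_def using fK(4,6)[of "\<lambda>_. 0"] by auto
  have \<gamma>m[measurable]: "\<gamma> \<in> borel_measurable borel" using \<gamma>(2) by (rule borel_measurable_continuous_onI)
  define w where "w x = W (g x)" for x
  define v where "v x = transpose R *v G x" for x
  note lw = weak_grad_loc_integrable[OF wg, folded w_def]
  have wJ: "w x \<in> closure J" for x unfolding w_def by (rule W_closure[OF gI])
  have Gm[measurable]: "G \<in> borel_measurable borel" and wm[measurable]: "w \<in> borel_measurable borel"
    using lw by (auto simp: loc_integrable_def)
  have vm[measurable]: "v \<in> borel_measurable borel"
    unfolding v_def[abs_def] using measurable_compose[OF Gm matrix_borel_measurable] by simp
  have bl: "bounded_linear ((*v) (transpose R))" by (rule matrix_vector_mul_bounded_linear)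
  obtain CR where CR: "0 < CR" "\<And>x. norm (transpose R *v x) \<le> CR * norm x"
    using bounded_linear.pos_bounded[OF bl] by (auto simp: mult.commute)
  have v2: "(norm (v x))\<^sup>2 \<le> CR\<^sup>2 * (norm (G x))\<^sup>2" for x
    unfolding v_def power_mult_distrib[symmetric] by (rule power_mono[OF CR(2)]) simp
  have vi: "integrable lborel (\<lambda>x. \<gamma> x * (norm (v x))\<^sup>2)"
  proof (rule Bochner_Integration.integrable_bound[OF integrable_mult_right[OF G2, of "CR\<^sup>2"]])
    show "AE x in lborel. norm (\<gamma> x * (norm (v x))\<^sup>2) \<le> norm (CR\<^sup>2 * ((norm (G x))\<^sup>2 * finf K x))"
      using v2 \<gamma>(1) by (intro AE_I2) (auto simp: \<gamma>_def[symmetric] abs_mult abs_of_pos mult_ac intro!: mult_left_mono)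
  qed measurable
  have lv: "loc_integrable v"
    unfolding loc_integrable_def
  proof (intro conjI allI)
    fix r show "integrable lborel (\<lambda>x. indicator (cball 0 r) x *\<^sub>R v x)"
      using integrable_bounded_linear[OF bl, of lborel "\<lambda>x. indicator (cball 0 r) x *\<^sub>R G x"] lw(2)
      by (simp add: loc_integrable_def v_def matrix_vector_mult_scaleR)
  qed measurable
  define S where "S = (\<integral>x. \<gamma> x * (norm (v x))\<^sup>2 \<partial>lborel)"
  have S: "0 \<le> S" unfolding S_def using \<gamma>(1) by (intro integral_nonneg_AE AE_I2 mult_nonneg_nonneg) (auto intro: less_imp_le)
  have clip: "(\<lambda>x. V (max lo (min hi (q x)))) \<in> borel_measurable borel"
    if "lo \<in> J" "hi \<in> J" "lo \<le> hi" "q \<in> borel_measurable borel" for lo hi and q :: "real^'n \<Rightarrow> real"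
  proof -
    have "continuous_on UNIV (\<lambda>t. V (max lo (min hi t)))"
      by (rule continuous_on_compose2[OF V_continuous(1)[OF that(1,2)]]) (use that in \<open>auto intro!: continuous_intros\<close>)
    from measurable_compose[OF that(4) borel_measurable_continuous_onI[OF this]] show ?thesis .
  qed
  have Vm: "(\<lambda>x. V (q x)) \<in> borel_measurable borel"
    if "lo \<in> J" "hi \<in> J" "\<And>x. q x \<in> {lo..hi}" "q \<in> borel_measurable borel" for lo hi and q :: "real^'n \<Rightarrow> real"
  proof -
    have "lo \<le> hi" using that(3)[of 0] by auto
    moreover have "max lo (min hi (q x)) = q x" for x using that(3)[of x] by auto
    ultimately show ?thesis using clip[OF that(1,2) _ that(4)] by simp
  qed
  have dampm[measurable]: "damp n \<in> borel_measurable borel" for n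
  proof -
    have [measurable]: "arctan \<in> borel_measurable borel" by (intro borel_measurable_continuous_onI continuous_intros continuous_on_id)
    show ?thesis unfolding damp_def[abs_def] by measurable
  qed
  let ?N = "\<lambda>j. real (Suc (Suc j))"
  define q where "q j x = V (damp (?N j) (w x))" for j x
  have N1: "1 < ?N j" for j by simp
  have qm[measurable]: "q j \<in> borel_measurable borel" for j
  proof -
    obtain lo hi where *: "lo \<in> J" "hi \<in> J" "\<And>w. w \<in> closure J \<Longrightarrow> damp (?N j) w \<in> {lo..hi}"
      using damp_range[OF N1] by metis
    have "damp (?N j) (w x) \<in> {lo..hi}" for x by (rule *(3)[OF wJ])
    from Vm[OF *(1,2) this] show ?thesis unfolding q_def by simp
  qed
  have "(\<lambda>j. \<integral>u. \<bar>q j (M *v u) - g (M *v u)\<bar> \<partial>gauss) \<longlonglongrightarrow> (\<integral>u. 0 \<partial>(gauss :: (real^'n) measure))"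
  proof (rule integral_dominated_convergence[where w="\<lambda>u. 1 + \<bar>g (M *v u)\<bar>"])
    show "integrable gauss (\<lambda>u. 1 + \<bar>g (M *v u)\<bar>)" using gi by auto
    show "AE u in gauss. (\<lambda>j. \<bar>q j (M *v u) - g (M *v u)\<bar>) \<longlonglongrightarrow> 0"
    proof (rule AE_I2)
      fix u
      show "(\<lambda>j. \<bar>q j (M *v u) - g (M *v u)\<bar>) \<longlonglongrightarrow> 0"
        using V_damp_W(1)[OF gI[of "M *v u"]] unfolding q_def w_def by (intro tendsto_rabs_zero LIM_zero)
    qed
    show "AE u in gauss. norm \<bar>q j (M *v u) - g (M *v u)\<bar> \<le> 1 + \<bar>g (M *v u)\<bar>" for j
      using V_damp_W(2)[OF gI] unfolding q_def w_def by simp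
  qed measurable
  then have "\<forall>\<^sub>F j in sequentially. (\<integral>u. \<bar>q j (M *v u) - g (M *v u)\<bar> \<partial>gauss) < e / 3"
    using e by (intro order_tendstoD(2)) auto
  then obtain j where j: "(\<integral>u. \<bar>q j (M *v u) - g (M *v u)\<bar> \<partial>gauss) < e / 3"
    by (auto simp: eventually_sequentially)
  define n where "n = ?N j"
  have n: "1 < n" using N1 by (simp add: n_def)
  obtain lo hi where lh: "lo \<in> J" "hi \<in> J" "lo \<le> 0" "0 \<le> hi" and range: "\<And>w. w \<in> closure J \<Longrightarrow> damp n w \<in> {lo..hi}"
    by (rule damp_range[OF n]) (rule that)
  have cut_in: "c * damp n t \<in> {lo..hi}" if "0 \<le> c" "c \<le> 1" "t \<in> closure J" for c t
  proof -
    have t: "lo \<le> damp n t" "damp n t \<le> hi" using range[OF that(3)] by auto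
    have "lo \<le> c * lo" using mult_right_mono_neg[OF that(2) lh(3)] by simp
    moreover have "c * lo \<le> c * damp n t" "c * damp n t \<le> c * hi" using t that(1) by (auto intro: mult_left_mono)
    moreover have "c * hi \<le> hi" using mult_right_mono[OF that(2) lh(4)] by simp
    ultimately show ?thesis by simp
  qed
  obtain LV where LV: "0 \<le> LV" "\<And>u u'. u \<in> {lo..hi} \<Longrightarrow> u' \<in> {lo..hi} \<Longrightarrow> \<bar>V u - V u'\<bar> \<le> LV * \<bar>u - u'\<bar>"
    using V_lipschitz[OF lh(1,2)] by metis
  \<comment> \<open>The parameter of Young's inequality: it inflates the energy \<open>S\<close> by
    at most \<open>e / 3\<close>, and \<open>S + 1\<close> keeps the denominator positive.\<close>
  define d where "d = min 1 (e / (3 * (S + 1)))"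
  have d: "0 < d" "d \<le> 1" "d * S \<le> e / 3"
  proof -
    show "0 < d" "d \<le> 1" using e S by (auto simp: d_def)
    have "d * S \<le> e / (3 * (S + 1)) * S" using S by (intro mult_right_mono) (auto simp: d_def)
    also have "\<dots> \<le> e / 3" using e S by (simp add: field_simps)
    finally show "d * S \<le> e / 3" .
  qed
  define A where "A = (1 + 1 / d) * ((n - 1) * pi / 2 * CR * 4)\<^sup>2"
  let ?r = "\<lambda>i. inverse (real (Suc i))"
  have r0: "?r \<longlonglongrightarrow> 0" by (rule LIMSEQ_inverse_real_of_nat)
  define p where "p r x = V (bump r x ^ 2 * damp n (w x))" for r x
  have b: "0 \<le> bump r x ^ 2" "bump r x ^ 2 \<le> 1" if "0 < r" for r and x :: "real^'n"
    using bump_bounds(1)[of r x] bump_bounds(2)[of r x] that by (auto simp: power_le_one)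
  have bm[measurable]: "bump r \<in> borel_measurable borel" for r
    by (rule borel_measurable_continuous_onI[OF bump_continuous])
  have pm[measurable]: "p r \<in> borel_measurable borel" if "0 < r" for r
    unfolding p_def by (rule Vm[OF lh(1,2)]) (use cut_in[OF b[OF that] wJ] in auto)
  have qn: "q j x = V (damp n (w x))" for x by (simp add: q_def n_def)
  have "(\<lambda>i. \<integral>u. \<bar>p (?r i) (M *v u) - q j (M *v u)\<bar> \<partial>gauss) \<longlonglongrightarrow> (\<integral>u. 0 \<partial>(gauss :: (real^'n) measure))"
  proof (rule integral_dominated_convergence[where w="\<lambda>_. LV * (hi - lo)"])
    have *: "\<bar>p (?r i) x - q j x\<bar> \<le> LV * \<bar>bump (?r i) x ^ 2 * damp n (w x) - 1 * damp n (w x)\<bar>" for i x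
    proof -
      have "\<bar>V (bump (?r i) x ^ 2 * damp n (w x)) - V (1 * damp n (w x))\<bar> \<le> LV * \<bar>bump (?r i) x ^ 2 * damp n (w x) - 1 * damp n (w x)\<bar>"
        by (intro LV(2) cut_in b wJ) (auto simp del: of_nat_Suc)
      then show ?thesis unfolding p_def qn by (simp only: mult_1_left)
    qed
    show "AE u in gauss. (\<lambda>i. \<bar>p (?r i) (M *v u) - q j (M *v u)\<bar>) \<longlonglongrightarrow> 0"
    proof (rule AE_I2)
      fix u
      have "(\<lambda>i. LV * \<bar>bump (?r i) (M *v u) ^ 2 * damp n (w (M *v u)) - 1 * damp n (w (M *v u))\<bar>) \<longlonglongrightarrow> LV * \<bar>1 ^ 2 * damp n (w (M *v u)) - 1 * damp n (w (M *v u))\<bar>"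
        by (intro tendsto_intros bump_tendsto_1[OF r0])
      then have l: "(\<lambda>i. LV * \<bar>bump (?r i) (M *v u) ^ 2 * damp n (w (M *v u)) - 1 * damp n (w (M *v u))\<bar>) \<longlonglongrightarrow> 0"
        by (simp only: power_one diff_self abs_zero mult_zero_right)
      show "(\<lambda>i. \<bar>p (?r i) (M *v u) - q j (M *v u)\<bar>) \<longlonglongrightarrow> 0"
        by (rule Lim_null_comparison[OF always_eventually l]) (use * in simp)
    qed
    show "AE u in gauss. norm \<bar>p (?r i) (M *v u) - q j (M *v u)\<bar> \<le> LV * (hi - lo)" for i
    proof (rule AE_I2)
      fix u
      have "\<bar>bump (?r i) (M *v u) ^ 2 * damp n (w (M *v u)) - 1 * damp n (w (M *v u))\<bar> \<le> hi - lo"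
        using cut_in[OF b[of "?r i" "M *v u"] wJ[of "M *v u"]] cut_in[OF _ _ wJ[of "M *v u"], of 1] by (auto simp: abs_le_iff)
      from mult_left_mono[OF this LV(1)] *[of i "M *v u"]
      show "norm \<bar>p (?r i) (M *v u) - q j (M *v u)\<bar> \<le> LV * (hi - lo)" by simp
    qed
  qed (auto simp del: of_nat_Suc intro!: borel_measurable_abs borel_measurable_diff measurable_compose[OF _ pm] measurable_compose[OF _ qm])
  then have "\<forall>\<^sub>F i in sequentially. (\<integral>u. \<bar>p (?r i) (M *v u) - q j (M *v u)\<bar> \<partial>gauss) < e / 3"
    using e by (intro order_tendstoD(2)) auto
  moreover have "(\<lambda>i. A * ?r i) \<longlonglongrightarrow> A * 0" by (intro tendsto_intros r0)
  then have "\<forall>\<^sub>F i in sequentially. A * ?r i < e / 3" using e by (intro order_tendstoD(2)) auto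
  ultimately have "\<forall>\<^sub>F i in sequentially. (\<integral>u. \<bar>p (?r i) (M *v u) - q j (M *v u)\<bar> \<partial>gauss) < e / 3 \<and> A * ?r i < e / 3"
    by (rule eventually_conj)
  then obtain i where i: "(\<integral>u. \<bar>p (?r i) (M *v u) - q j (M *v u)\<bar> \<partial>gauss) < e / 3" "A * ?r i < e / 3"
    by (auto simp: eventually_sequentially)
  define r where "r = ?r i"
  have r: "0 < r" "(\<integral>u. \<bar>p r (M *v u) - q j (M *v u)\<bar> \<partial>gauss) < e / 3" "A * r < e / 3"
    using i by (auto simp: r_def)
  let ?\<rho> = "1 / r + 1"
  define m where "m x = (bump r x ^ 2)\<^sup>2 * \<gamma> x" for x
  have m: "continuous_on UNIV m" "\<And>x. 0 \<le> m x" "\<And>x. ?\<rho> < norm x \<Longrightarrow> m x = 0" "\<And>x. m x \<le> \<gamma> x"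
  proof -
    show "continuous_on UNIV m" unfolding m_def by (intro continuous_intros bump_continuous \<gamma>)
    show "0 \<le> m x" for x unfolding m_def using \<gamma>(1)[of x] by (intro mult_nonneg_nonneg) auto
    show "m x = 0" if "?\<rho> < norm x" for x using bump_zero_far[OF r(1) that] by (simp add: m_def)
    have "(bump r x ^ 2)\<^sup>2 \<le> 1" for x :: "real^'n" by (rule power_le_one[OF b[OF r(1), of x]])
    then show "m x \<le> \<gamma> x" for x unfolding m_def using \<gamma>(1)[of x] mult_right_mono[of "(bump r x ^ 2)\<^sup>2" 1 "\<gamma> x"] by simp
  qed
  have [measurable]: "m \<in> borel_measurable borel" using m(1) by (rule borel_measurable_continuous_onI)
  \<comment> \<open>The Gaussian weight has a positive minimum on the ball, so weighted square
    integrability of \<open>v\<close> gives local square integrability.\<close>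
  have fin: "(\<integral>\<^sup>+y. ennreal ((norm (v y))\<^sup>2) * indicator (cball 0 (?\<rho> + 1)) y \<partial>lborel) < \<infinity>"
  proof -
    have cb: "compact (cball (0::real^'n) (?\<rho> + 1))" "cball (0::real^'n) (?\<rho> + 1) \<noteq> {}" using r(1) by (auto simp: not_less)
    obtain x0 where x0: "\<And>x. x \<in> cball 0 (?\<rho> + 1) \<Longrightarrow> \<gamma> x0 \<le> \<gamma> x"
      using continuous_attains_inf[OF cb continuous_on_subset[OF \<gamma>(2) subset_UNIV]] by blast
    have "(\<integral>\<^sup>+y. ennreal ((norm (v y))\<^sup>2) * indicator (cball 0 (?\<rho> + 1)) y \<partial>lborel) \<le> (\<integral>\<^sup>+y. ennreal (1 / \<gamma> x0 * (\<gamma> y * (norm (v y))\<^sup>2)) \<partial>lborel)"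
    proof (rule nn_integral_mono)
      fix y
      show "ennreal ((norm (v y))\<^sup>2) * indicator (cball 0 (?\<rho> + 1)) y \<le> ennreal (1 / \<gamma> x0 * (\<gamma> y * (norm (v y))\<^sup>2))"
      proof (cases "y \<in> cball 0 (?\<rho> + 1)")
        case True
        have "\<gamma> x0 * (norm (v y))\<^sup>2 \<le> \<gamma> y * (norm (v y))\<^sup>2" using x0[OF True] by (rule mult_right_mono) simp
        then have "(norm (v y))\<^sup>2 \<le> 1 / \<gamma> x0 * (\<gamma> y * (norm (v y))\<^sup>2)" using \<gamma>(1)[of x0] by (simp add: field_simps)
        then show ?thesis using True by (simp add: ennreal_leI)
      qed simp
    qed
    also have "\<dots> = ennreal (\<integral>y. 1 / \<gamma> x0 * (\<gamma> y * (norm (v y))\<^sup>2) \<partial>lborel)"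
      using vi \<gamma>(1) by (intro nn_integral_eq_integral integrable_mult_right AE_I2 mult_nonneg_nonneg) (auto intro: less_imp_le)
    also have "\<dots> < \<infinity>" by simp
    finally show ?thesis .
  qed
  obtain e1 where e1: "0 < e1" "\<And>\<epsilon>. 0 < \<epsilon> \<Longrightarrow> \<epsilon> < e1 \<Longrightarrow> (\<integral>\<^sup>+x. ennreal (m x) * ennreal ((norm (molf \<epsilon> v x))\<^sup>2) \<partial>lborel)
        \<le> (\<integral>\<^sup>+x. ennreal (m x) * ennreal ((norm (v x))\<^sup>2) \<partial>lborel) + ennreal (e / 6)"
    by (rule mollify_energy[OF lv m(1-3) fin, of "e / 6"]) (use e that in auto)
  obtain \<Gamma> where \<Gamma>: "0 < \<Gamma>" "\<And>x. x \<in> cball 0 ?\<rho> \<Longrightarrow> \<gamma> x \<le> \<Gamma>"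
  proof -
    have cb: "compact (cball (0::real^'n) ?\<rho>)" "cball (0::real^'n) ?\<rho> \<noteq> {}" using r(1) by (auto simp: not_less)
    obtain x0 where "\<And>x. x \<in> cball 0 ?\<rho> \<Longrightarrow> \<gamma> x \<le> \<gamma> x0"
      using continuous_attains_sup[OF cb continuous_on_subset[OF \<gamma>(2) subset_UNIV]] by blast
    then show thesis using \<gamma>(1) by (intro that[of "\<gamma> x0"]) auto
  qed
  \<comment> \<open>The mollification error in \<open>w\<close> is amplified by the Lipschitz
    constant \<open>LV\<close> of \<open>V\<close> and the bound \<Gamma> of the weight, both fixed
    by now.\<close>
  define d1 where "d1 = e / (3 * (LV * \<Gamma> + 1))"
  have LG: "0 \<le> LV * \<Gamma>" using LV(1) \<Gamma>(1) by simp
  have d1: "0 < d1" "LV * \<Gamma> * d1 \<le> e / 3" unfolding d1_def using e LG by (auto simp: field_simps add_pos_nonneg)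
  obtain e2 where e2: "0 < e2" "\<And>\<epsilon>. 0 < \<epsilon> \<Longrightarrow> \<epsilon> < e2 \<Longrightarrow> (\<integral>\<^sup>+x. ennreal \<bar>molf \<epsilon> w x - w x\<bar> * indicator (cball 0 ?\<rho>) x \<partial>lborel) \<le> ennreal d1"
    by (rule mollify_L1[OF lw(1) d1(1), of ?\<rho>]) (rule that)
  define \<epsilon> where "\<epsilon> = min e1 e2 / 2"
  have \<epsilon>: "0 < \<epsilon>" "\<epsilon> < e1" "\<epsilon> < e2" using e1(1) e2(1) by (auto simp: \<epsilon>_def min_def)
  have mw: "molf \<epsilon> w x \<in> closure J" for x by (rule molf_in_closure_J[OF lw(1) \<epsilon>(1) wJ])
  have mG: "transpose R *v molf \<epsilon> G x = molf \<epsilon> v x" for x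
    using integral_bounded_linear[OF bl molf_integrand[OF lw(2) \<epsilon>(1), of x]]
    by (simp add: molf_def v_def matrix_vector_mult_scaleR)
  have [measurable]: "molf \<epsilon> w \<in> borel_measurable borel" "molf \<epsilon> v \<in> borel_measurable borel"
    using molf_continuous[OF lw(1) \<epsilon>(1)] molf_continuous[OF lv \<epsilon>(1)] by (auto intro: borel_measurable_continuous_onI)
  define g' where "g' x = V (bump r x ^ 2 * damp n (molf \<epsilon> w x))" for x
  obtain L dg where c1: "nice (V lo) (V hi) L (\<lambda>x. V (bump r x ^ 2 * damp n (molf \<epsilon> w x))) dg"
    and c2: "\<And>x. h (V (bump r x ^ 2 * damp n (molf \<epsilon> w x))) * (norm (transpose R *v dg x))\<^sup>2
      \<le> (1 + d) * ((bump r x ^ 2)\<^sup>2 * (norm (transpose R *v molf \<epsilon> G x))\<^sup>2) + (1 + 1 / d) * ((n - 1) * pi / 2 * CR * 4)\<^sup>2 * r"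
    by (rule cutoff_nice[OF n lh range molf_weak_grad[OF wg[folded w_def] \<epsilon>(1)] molf_continuous[OF lw(2) \<epsilon>(1)] mw r(1) d(1) less_imp_le[OF CR(1)] CR(2)])
      (assumption, rule that)
  have nice: "nice (V lo) (V hi) L g' dg" using c1 unfolding g'_def[abs_def] .
  have en: "h (g' x) * (norm (transpose R *v dg x))\<^sup>2
      \<le> (1 + d) * ((bump r x ^ 2)\<^sup>2 * (norm (molf \<epsilon> v x))\<^sup>2) + A * r" for x
    using c2[of x] unfolding mG A_def g'_def .
  note [measurable] = niceD(8,9)[OF nice]
  have gi': "integrable gauss (\<lambda>u. g' (M *v u))"
    by (rule gauss.integrable_const_bound[of _ "max \<bar>V lo\<bar> \<bar>V hi\<bar>"]) (use niceD(6)[OF nice] in auto)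
  have "(\<integral>u. \<bar>g' (M *v u) - g (M *v u)\<bar> \<partial>gauss) \<le> e"
  proof -
    have pr[measurable]: "p r \<in> borel_measurable borel" by (rule pm[OF r(1)])
    have bd: "\<bar>p r x\<bar> \<le> max \<bar>V lo\<bar> \<bar>V hi\<bar>" "\<bar>q j x\<bar> \<le> max \<bar>V lo\<bar> \<bar>V hi\<bar>" for x
    proof -
      have "V t \<in> {V lo..V hi}" if "t \<in> {lo..hi}" for t
        using V_mono[OF lh(1), of t] V_mono[OF _ lh(2), of t] J_Icc[OF lh(1,2)] that by auto
      from this[OF cut_in[OF b[OF r(1), of x] wJ[of x]]] this[OF cut_in[OF _ _ wJ[of x], of 1]]
      show "\<bar>p r x\<bar> \<le> max \<bar>V lo\<bar> \<bar>V hi\<bar>" "\<bar>q j x\<bar> \<le> max \<bar>V lo\<bar> \<bar>V hi\<bar>"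
        unfolding p_def qn by auto
    qed
    have pi: "integrable gauss (\<lambda>u. p r (M *v u))" "integrable gauss (\<lambda>u. q j (M *v u))"
      by (rule gauss.integrable_const_bound[of _ "max \<bar>V lo\<bar> \<bar>V hi\<bar>"]; use bd in auto)+
    have gp: "(\<integral>u. \<bar>g' (M *v u) - p r (M *v u)\<bar> \<partial>gauss) \<le> e / 3"
    proof -
      have pt: "\<gamma> x * \<bar>g' x - p r x\<bar> \<le> LV * \<Gamma> * (\<bar>molf \<epsilon> w x - w x\<bar> * indicator (cball 0 ?\<rho>) x)" for x
      proof (cases "x \<in> cball 0 ?\<rho>")
        case True
        have "\<bar>g' x - p r x\<bar> \<le> LV * \<bar>bump r x ^ 2 * damp n (molf \<epsilon> w x) - bump r x ^ 2 * damp n (w x)\<bar>"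
          unfolding g'_def p_def by (intro LV(2) cut_in b r(1) mw wJ)
        also have "\<dots> = LV * (bump r x ^ 2 * \<bar>damp n (molf \<epsilon> w x) - damp n (w x)\<bar>)"
          using b(1)[OF r(1), of x] by (simp add: abs_mult right_diff_distrib[symmetric])
        also have "\<dots> \<le> LV * (1 * \<bar>molf \<epsilon> w x - w x\<bar>)"
          using LV(1) b[OF r(1), of x] damp_props(4)[OF n] by (intro mult_left_mono mult_mono) auto
        finally have "\<gamma> x * \<bar>g' x - p r x\<bar> \<le> \<Gamma> * (LV * (1 * \<bar>molf \<epsilon> w x - w x\<bar>))"
          using \<Gamma> True \<gamma>(1)[of x] by (intro mult_mono) auto
        then show ?thesis using True by (simp add: mult_ac)
      next
        case False
        then have "g' x = p r x" using bump_zero_far[OF r(1), of x] by (simp add: g'_def p_def)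
        then show ?thesis using LG by simp
      qed
      have "(\<integral>u. \<bar>g' (M *v u) - p r (M *v u)\<bar> \<partial>gauss) = (\<integral>x. \<gamma> x * \<bar>g' x - p r x\<bar> \<partial>lborel)"
        unfolding \<gamma>_def by (rule fK(1)[symmetric]) measurable
      also have "ennreal \<dots> \<le> (\<integral>\<^sup>+x. ennreal (norm (\<gamma> x * \<bar>g' x - p r x\<bar>)) \<partial>lborel)"
      proof -
        have "integrable gauss (\<lambda>u. \<bar>g' (M *v u) - p r (M *v u)\<bar>)" using gi' pi(1) by auto
        then have "integrable lborel (\<lambda>x. \<gamma> x * \<bar>g' x - p r x\<bar>)"
          unfolding \<gamma>_def by (subst fK(2)) measurable
        from integral_norm_bound_ennreal[OF this] show ?thesis
          by (rule order_trans[rotated]) (simp add: ennreal_leI)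
      qed
      also have "\<dots> \<le> (\<integral>\<^sup>+x. ennreal (LV * \<Gamma>) * (ennreal \<bar>molf \<epsilon> w x - w x\<bar> * indicator (cball 0 ?\<rho>) x) \<partial>lborel)"
      proof (rule nn_integral_mono)
        fix x
        have "ennreal (norm (\<gamma> x * \<bar>g' x - p r x\<bar>)) \<le> ennreal (LV * \<Gamma> * (\<bar>molf \<epsilon> w x - w x\<bar> * indicator (cball 0 ?\<rho>) x))"
          using pt[of x] \<gamma>(1)[of x] by (intro ennreal_leI) (simp add: abs_mult abs_of_pos)
        also have "\<dots> = ennreal (LV * \<Gamma>) * (ennreal \<bar>molf \<epsilon> w x - w x\<bar> * indicator (cball 0 ?\<rho>) x)"
          using LG by (subst ennreal_mult) (auto simp: indicator_def)
        finally show "ennreal (norm (\<gamma> x * \<bar>g' x - p r x\<bar>)) \<le> ennreal (LV * \<Gamma>) * (ennreal \<bar>molf \<epsilon> w x - w x\<bar> * indicator (cball 0 ?\<rho>) x)" .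
      qed
      also have "\<dots> = ennreal (LV * \<Gamma>) * (\<integral>\<^sup>+x. ennreal \<bar>molf \<epsilon> w x - w x\<bar> * indicator (cball 0 ?\<rho>) x \<partial>lborel)"
      proof (rule nn_integral_cmult)
        have [measurable]: "cball (0::real^'n) ?\<rho> \<in> sets borel" by auto
        show "(\<lambda>x. ennreal \<bar>molf \<epsilon> w x - w x\<bar> * indicator (cball 0 ?\<rho>) x) \<in> borel_measurable lborel" by measurable
      qed
      also have "\<dots> \<le> ennreal (LV * \<Gamma>) * ennreal d1" by (intro mult_left_mono e2(2) \<epsilon>) simp
      also have "\<dots> = ennreal (LV * \<Gamma> * d1)" using LG d1 by (intro ennreal_mult[symmetric]) auto
      finally have "(\<integral>u. \<bar>g' (M *v u) - p r (M *v u)\<bar> \<partial>gauss) \<le> LV * \<Gamma> * d1"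
        using LG d1 by (subst (asm) ennreal_le_iff) auto
      then show ?thesis using d1(2) by linarith
    qed
    have "(\<integral>u. \<bar>g' (M *v u) - g (M *v u)\<bar> \<partial>gauss) \<le> (\<integral>u. \<bar>g' (M *v u) - p r (M *v u)\<bar> + \<bar>p r (M *v u) - q j (M *v u)\<bar> + \<bar>q j (M *v u) - g (M *v u)\<bar> \<partial>gauss)"
      by (rule integral_mono) (use gi gi' pi in auto)
    also have "\<dots> = (\<integral>u. \<bar>g' (M *v u) - p r (M *v u)\<bar> \<partial>gauss) + (\<integral>u. \<bar>p r (M *v u) - q j (M *v u)\<bar> \<partial>gauss) + (\<integral>u. \<bar>q j (M *v u) - g (M *v u)\<bar> \<partial>gauss)"
      using gi gi' pi by simp
    also have "\<dots> \<le> e" using gp r(2) j by linarith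
    finally show ?thesis .
  qed
  moreover have "(\<integral>u. h (g' (M *v u)) * (norm (transpose R *v dg (M *v u)))\<^sup>2 \<partial>gauss) \<le> S + e"
  proof -
    let ?E = "\<lambda>x. (bump r x ^ 2)\<^sup>2 * (norm (molf \<epsilon> v x))\<^sup>2"
    have "(\<integral>\<^sup>+x. ennreal (m x) * ennreal ((norm (molf \<epsilon> v x))\<^sup>2) \<partial>lborel) \<le> (\<integral>\<^sup>+x. ennreal (\<gamma> x * (norm (v x))\<^sup>2) \<partial>lborel) + ennreal (e / 6)"
    proof (rule order_trans[OF e1(2)[OF \<epsilon>(1,2)]], rule add_right_mono, rule nn_integral_mono)
      fix x
      show "ennreal (m x) * ennreal ((norm (v x))\<^sup>2) \<le> ennreal (\<gamma> x * (norm (v x))\<^sup>2)"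
        using m(2,4)[of x] by (simp add: ennreal_mult[symmetric] ennreal_leI mult_right_mono)
    qed
    also have "(\<integral>\<^sup>+x. ennreal (\<gamma> x * (norm (v x))\<^sup>2) \<partial>lborel) = ennreal S"
      unfolding S_def using vi \<gamma>(1) by (intro nn_integral_eq_integral AE_I2 mult_nonneg_nonneg) (auto intro: less_imp_le)
    also have "ennreal S + ennreal (e / 6) = ennreal (S + e / 6)" using S e by (simp add: ennreal_plus)
    also have "(\<integral>\<^sup>+x. ennreal (m x) * ennreal ((norm (molf \<epsilon> v x))\<^sup>2) \<partial>lborel) = (\<integral>\<^sup>+x. ennreal (m x * (norm (molf \<epsilon> v x))\<^sup>2) \<partial>lborel)"
      using m(2) by (simp add: ennreal_mult)
    finally have nE: "(\<integral>\<^sup>+x. ennreal (m x * (norm (molf \<epsilon> v x))\<^sup>2) \<partial>lborel) \<le> ennreal (S + e / 6)" .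
    have iE: "integrable lborel (\<lambda>x. m x * (norm (molf \<epsilon> v x))\<^sup>2)"
      by (rule integrableI_bounded) (use nE m(2) in \<open>auto intro: le_less_trans\<close>)
    have "ennreal (\<integral>x. m x * (norm (molf \<epsilon> v x))\<^sup>2 \<partial>lborel) \<le> ennreal (S + e / 6)"
      using nE nn_integral_eq_integral[OF iE] m(2) by simp
    then have E1: "(\<integral>x. m x * (norm (molf \<epsilon> v x))\<^sup>2 \<partial>lborel) \<le> S + e / 6"
      using S e by (subst (asm) ennreal_le_iff) auto
    have mE: "m x * (norm (molf \<epsilon> v x))\<^sup>2 = finf K x * ?E x" for x by (simp add: m_def \<gamma>_def)
    have Em: "?E \<in> borel_measurable borel" by measurable
    have E2: "(\<integral>u. ?E (M *v u) \<partial>gauss) \<le> S + e / 6" and iE2: "integrable gauss (\<lambda>u. ?E (M *v u))"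
      using E1 fK(1)[OF Em] iE fK(2)[OF Em] unfolding mE by auto
    have "(\<integral>u. h (g' (M *v u)) * (norm (transpose R *v dg (M *v u)))\<^sup>2 \<partial>gauss) \<le> (\<integral>u. (1 + d) * ?E (M *v u) + A * r \<partial>gauss)"
    proof (rule integral_mono')
      show "integrable gauss (\<lambda>u. (1 + d) * ?E (M *v u) + A * r)" using iE2 by auto
      show "h (g' (M *v u)) * (norm (transpose R *v dg (M *v u)))\<^sup>2 \<le> (1 + d) * ?E (M *v u) + A * r" for u by (rule en)
      show "0 \<le> (1 + d) * ?E (M *v u) + A * r" for u
        using d(1) r(1) unfolding A_def by (intro add_nonneg_nonneg mult_nonneg_nonneg) auto
    qed
    also have "\<dots> = (1 + d) * (\<integral>u. ?E (M *v u) \<partial>gauss) + A * r" using iE2 by (simp add: gauss.prob_space)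
    also have "\<dots> \<le> (1 + d) * (S + e / 6) + e / 3" using E2 d(1) r(3) by (intro add_mono mult_left_mono) auto
    \<comment> \<open>The budget: \<open>e / 6\<close> from mollifying, \<open>e / 3\<close> from
      \<open>d * S\<close>, at most \<open>e / 6\<close> from \<open>d * e / 6\<close>, and
      \<open>e / 3\<close> from the cut-off.\<close>
    also have "\<dots> = S + e / 6 + d * S + d * e / 6 + e / 3" by (simp add: field_simps)
    also have "\<dots> \<le> S + e" using d(3) mult_right_mono[OF d(2) less_imp_le[OF e]] e by linarith
    finally show ?thesis .
  qed
  ultimately show ?thesis
    using nice V_in[OF lh(1)] V_in[OF lh(2)] unfolding S_def \<gamma>_def v_def by blast
qed

end

section \<open>The Fokker-Planck equation\<close>

lemma uminus_matrix_vector: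
  fixes A :: "real^'n^'m"
  shows "(- A) *v x = - (A *v x)" "A *v (- x) = - (A *v x)"
  by (simp_all add: matrix_vector_mult_def vec_eq_iff sum_negf)

lemma diag_first_ones_psd: "psd (diag_first_ones k :: real^('n::{finite,linorder})^('n::{finite,linorder}))"
proof -
  have "x \<bullet> (diag_first_ones k *v x) = (\<Sum>i\<in>UNIV. if card {l. l < i} < k then (x $ i)\<^sup>2 else 0)" for x :: "real^('n::{finite,linorder})"
  proof -
    have "(diag_first_ones k *v x) $ i = (if card {l. l < i} < k then x $ i else 0)" for i
    proof -
      have "(diag_first_ones k *v x) $ i = (\<Sum>j\<in>UNIV. (if i = j \<and> card {l. l < i} < k then 1 else 0) * x $ j)"
        by (simp add: matrix_vector_mult_def diag_first_ones_def)
      also have "\<dots> = (\<Sum>j\<in>UNIV. if i = j then (if card {l. l < i} < k then x $ j else 0) else 0)"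
        by (rule sum.cong) auto
      finally show ?thesis by simp
    qed
    then show ?thesis by (auto simp: inner_vec_def power2_eq_square intro!: sum.cong)
  qed
  then have "0 \<le> x \<bullet> (diag_first_ones k *v x)" for x :: "real^('n::{finite,linorder})" by (auto intro!: sum_nonneg)
  moreover have "sym_mat (diag_first_ones k :: real^('n::{finite,linorder})^('n::{finite,linorder}))"
    unfolding sym_mat_def diag_first_ones_def transpose_def by (auto simp: vec_eq_iff)
  ultimately show ?thesis by (simp add: psd_def)
qed

text \<open>\<open>A = K E\<^sup>T K\<^sup>-\<^sup>1\<close> with \<open>E = exp (- t C)\<close> is the drift of the time-reversed
  Ornstein-Uhlenbeck process, so its transpose is \<open>exp (- t Q\<^sup>T)\<close>.\<close>

lemma reversed_transport:
  fixes C D K P M :: "real^'n^'n" and E :: "real \<Rightarrow> real^'n^'n"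
  assumes K: "sym_mat K" "pos_def K" and D: "psd D" and lyap: "2 *\<^sub>R D = C ** K + K ** transpose C"
    and P: "sym_mat P" and Q: "loewner_le ((2 * \<nu>) *\<^sub>R P) (Qmat K C ** P + P ** transpose (Qmat K C))"
    and M: "K = M ** transpose M" and t: "0 \<le> t"
    and E0: "E 0 = mat 1"
    and E1: "\<And>t v. ((\<lambda>t. E t *v v) has_vector_derivative - C *v (E t *v v)) (at t)"
    and E2: "\<And>t v. ((\<lambda>t. transpose (E t) *v v) has_vector_derivative transpose (- C) *v (transpose (E t) *v v)) (at t)"
  obtains A N N' :: "real^'n^'n" where "gauss_transport K M A N" "K = E t ** K ** transpose (E t) + N' ** transpose N'"
    "K ** transpose A = E t ** K"
    "\<And>v. (transpose A *v v) \<bullet> (P *v (transpose A *v v)) \<le> exp (- 2 * \<nu> * t) * (v \<bullet> (P *v v))"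
proof -
  note iK = matrix_inv_pos_def[OF K] and mK = matrix_inv_mult[OF pos_def_invertible[OF K(2)]]
  have tK: "transpose K = K" "transpose (matrix_inv K) = matrix_inv K" using K iK by (auto simp: sym_mat_def)
  have Dx: "x \<bullet> (C *v (K *v x)) = x \<bullet> (D *v x)" "x \<bullet> (K *v (transpose C *v x)) = x \<bullet> (D *v x)" for x
  proof -
    have "x \<bullet> (K *v (transpose C *v x)) = (K *v x) \<bullet> (transpose C *v x)" by (rule sym_mat_inner[OF K(1)])
    also have "\<dots> = (C *v (K *v x)) \<bullet> x" by (rule inner_matrix_transpose[symmetric])
    finally have eq: "x \<bullet> (K *v (transpose C *v x)) = x \<bullet> (C *v (K *v x))" by (simp only: inner_commute)
    have "2 * (x \<bullet> (D *v x)) = x \<bullet> ((2 *\<^sub>R D) *v x)" by (simp add: scaleR_matrix_vector_assoc[symmetric])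
    also have "\<dots> = x \<bullet> (C *v (K *v x)) + x \<bullet> (K *v (transpose C *v x))"
      unfolding lyap by (simp add: matrix_vector_mult_add_rdistrib inner_add_right matrix_vector_mul_assoc)
    finally show "x \<bullet> (C *v (K *v x)) = x \<bullet> (D *v x)" "x \<bullet> (K *v (transpose C *v x)) = x \<bullet> (D *v x)"
      using eq by auto
  qed
  have Dn: "0 \<le> x \<bullet> (D *v x)" for x using D by (simp add: psd_def)
  define A where "A = K ** transpose (E t) ** matrix_inv K"
  have At: "transpose A = matrix_inv K ** E t ** K"
    by (simp add: A_def matrix_transpose_mul tK matrix_mul_assoc)
  have rev: "K ** transpose A = E t ** K" unfolding At by (simp add: matrix_mul_assoc mK)
  \<comment> \<open>The generator of the flow of \<open>transpose A\<close>: up to sign it is the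
    transpose of \<open>Qmat K C\<close>, so the hypothesis on \<open>P\<close> is its decay
    condition for the form of \<open>P\<close>.\<close>
  define B where "B = - (matrix_inv K ** C ** K)"
  define y where "y v t = matrix_inv K *v (E t *v (K *v v))" for v t
  have Bv: "B *v x = - (matrix_inv K *v (C *v (K *v x)))" for x
    unfolding B_def by (simp add: uminus_matrix_vector(1) matrix_vector_mul_assoc matrix_mul_assoc)
  have mv: "(- C) *v x = - (C *v x)" for x by (rule uminus_matrix_vector(1))
  have yd: "(y v has_vector_derivative B *v y v t) (at t)" for v t
  proof -
    have "(y v has_vector_derivative matrix_inv K *v (- C *v (E t *v (K *v v)))) (at t)"
      unfolding y_def[abs_def] by (rule bounded_linear.has_vector_derivative[OF matrix_vector_mul_bounded_linear E1])
    moreover have "matrix_inv K *v (- C *v (E t *v (K *v v))) = B *v y v t"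
      unfolding Bv y_def mK mv by (simp add: uminus_matrix_vector(2))
    ultimately show ?thesis by simp
  qed
  have yt: "y v t = transpose A *v v" for v by (simp add: y_def At matrix_vector_mul_assoc matrix_mul_assoc)
  have y0: "y v 0 = v" for v by (simp add: y_def E0 mK)
  have Pc: "(transpose A *v v) \<bullet> (P *v (transpose A *v v)) \<le> exp (- 2 * \<nu> * t) * (v \<bullet> (P *v v))" for v
  proof -
    have "x \<bullet> (P *v (B *v x)) \<le> - \<nu> * (x \<bullet> (P *v x))" for x
    proof -
      let ?q = "transpose (Qmat K C)"
      have q: "?q = matrix_inv K ** C ** K" by (simp add: Qmat_def matrix_transpose_mul tK matrix_mul_assoc)
      have "x \<bullet> (Qmat K C *v (P *v x)) = (P *v x) \<bullet> (?q *v x)"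
        using inner_matrix_transpose[of "Qmat K C" "P *v x" x] by (simp only: inner_commute)
      also have "\<dots> = x \<bullet> (P *v (?q *v x))" by (rule sym_mat_inner[OF P, symmetric])
      finally have "x \<bullet> ((Qmat K C ** P + P ** ?q) *v x) = 2 * (x \<bullet> (P *v (?q *v x)))"
        by (simp add: matrix_vector_mult_add_rdistrib inner_add_right matrix_vector_mul_assoc[symmetric])
      then have "2 * \<nu> * (x \<bullet> (P *v x)) \<le> 2 * (x \<bullet> (P *v (?q *v x)))"
        using Q[unfolded loewner_le_def, rule_format, of x]
        by (simp add: matrix_vector_mult_diff_rdistrib inner_diff_right scaleR_matrix_vector_assoc[symmetric])
      moreover have "P *v (B *v x) = - (P *v (?q *v x))"
        unfolding q B_def by (simp add: uminus_matrix_vector(1) uminus_matrix_vector(2))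
      ultimately show ?thesis by simp
    qed
    from quadratic_form_decay[OF P yd this t, of v] show ?thesis by (simp add: yt y0)
  qed
  \<comment> \<open>The form of \<open>K\<close> does not grow along this flow, its derivative being
    minus twice the form of \<open>D\<close>. Hence \<open>K - A ** K ** transpose A\<close> is
    positive semidefinite and factors through a noise matrix \<open>N\<close>; the same argument for
    \<open>E t\<close> gives \<open>N'\<close>.\<close>
  have Kc: "(transpose A *v v) \<bullet> (K *v (transpose A *v v)) \<le> v \<bullet> (K *v v)" for v
  proof -
    have "x \<bullet> (K *v (B *v x)) \<le> - 0 * (x \<bullet> (K *v x))" for x
      using Dx(1)[of x] Dn[of x] by (simp add: Bv uminus_matrix_vector(2) mK)
    from quadratic_form_decay[OF K(1) yd this t, of v] show ?thesis by (simp add: yt y0)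
  qed
  have Ec: "(transpose (E t) *v v) \<bullet> (K *v (transpose (E t) *v v)) \<le> v \<bullet> (K *v v)" for v
  proof -
    have tm: "transpose (- C) *v x = - (transpose C *v x)" for x
    proof -
      have "transpose (- C) = - transpose C" by (simp add: transpose_def vec_eq_iff)
      then show ?thesis by (simp only: uminus_matrix_vector(1))
    qed
    have "x \<bullet> (K *v (transpose (- C) *v x)) \<le> - 0 * (x \<bullet> (K *v x))" for x
      using Dx(2)[of x] Dn[of x] by (simp add: tm uminus_matrix_vector(2))
    from quadratic_form_decay[OF K(1) E2 this t, of v] show ?thesis by (simp add: E0 transpose_mat)
  qed
  have diff_psd: "psd (K - F ** K ** transpose F)"
    if "\<And>v. (transpose F *v v) \<bullet> (K *v (transpose F *v v)) \<le> v \<bullet> (K *v v)" for F :: "real^'n^'n"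
    unfolding psd_def
  proof (intro conjI allI)
    have "transpose (F ** K ** transpose F) = F ** K ** transpose F"
      by (simp add: matrix_transpose_mul tK matrix_mul_assoc)
    then show "sym_mat (K - F ** K ** transpose F)"
      using tK(1) unfolding sym_mat_def transpose_def by (simp add: vec_eq_iff)
    fix v
    have "v \<bullet> ((F ** K ** transpose F) *v v) = v \<bullet> (F *v (K *v (transpose F *v v)))"
      by (simp only: matrix_vector_mul_assoc matrix_mul_assoc)
    also have "\<dots> = (transpose F *v v) \<bullet> (K *v (transpose F *v v))"
      using inner_matrix_transpose[of F "K *v (transpose F *v v)" v] by (simp only: inner_commute)
    finally show "0 \<le> v \<bullet> ((K - F ** K ** transpose F) *v v)"
      using that[of v] by (simp add: matrix_vector_mult_diff_rdistrib inner_diff_right)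
  qed
  obtain N :: "real^'n^'n" where N: "K - A ** K ** transpose A = N ** transpose N" by (rule psd_factor[OF diff_psd[OF Kc]]) (rule that)
  obtain N' :: "real^'n^'n" where N': "K - E t ** K ** transpose (E t) = N' ** transpose N'" by (rule psd_factor[OF diff_psd[OF Ec]]) (rule that)
  show thesis
  proof (rule that[OF _ _ rev Pc])
    show "gauss_transport K M A N" by unfold_locales (use M N in \<open>auto simp: algebra_simps\<close>)
    show "K = E t ** K ** transpose (E t) + N' ** transpose N'" using N' by (simp add: algebra_simps)
  qed
qed

lemma (in gauss_transport) T_measurable:
  assumes [measurable]: "q \<in> borel_measurable borel" shows "T q \<in> borel_measurable borel"
proof -
  have "case_prod (\<lambda>x z. q (A *v x + N *v z)) \<in> borel_measurable (borel \<Otimes>\<^sub>M gauss)"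
    by measurable
  then show ?thesis unfolding T_def[abs_def]
    by (rule sigma_finite_measure.borel_measurable_lebesgue_integral[rotated]) (rule prob_space_imp_sigma_finite[OF prob_space_gauss])
qed

text \<open>Both sides have the same cosine transform: since \<open>K\<close> splits into the
  transported covariance and the noise, the exponent of \<open>solution_fourier\<close> is minus
  half the variance of the noise \<open>N'\<close> in \<open>T_cos_transform\<close>. The transform
  determines an integrable function up to null sets, hence the almost everywhere statement.\<close>

lemma solution_representation:
  fixes D C K M A N N' :: "real^'n^'n" and E :: "real \<Rightarrow> real^'n^'n"
  assumes sol: "is_solution D C f0 f" and D: "sym_mat D" and K: "sym_mat K" "pos_def K" and M: "K = M ** transpose M"
    and lyap: "2 *\<^sub>R D = C ** K + K ** transpose C" and f0: "integrable lborel f0"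
    and E0: "E 0 = mat 1"
    and E2: "\<And>t v. ((\<lambda>t. transpose (E t) *v v) has_vector_derivative transpose (- C) *v (transpose (E t) *v v)) (at t)"
    and t: "0 \<le> t" and tr: "gauss_transport K M A N"
    and N': "K = E t ** K ** transpose (E t) + N' ** transpose N'" and rev: "K ** transpose A = E t ** K"
  shows "AE x in lborel. f t x = finf K x * gauss_transport.T A N (\<lambda>x. f0 x / finf K x) x"
proof -
  interpret gauss_transport K M A N by (fact tr)
  note fK = finf_integral[OF K M]
  have pos: "0 < finf K x" and [measurable]: "finf K \<in> borel_measurable borel" for x
    using fK(4,5)[of "\<lambda>_. 0"] by auto
  define q where "q x = f0 x / finf K x" for x
  have fq: "finf K x * q x = f0 x" for x using pos[of x] by (simp add: q_def)
  have [measurable]: "f0 \<in> borel_measurable borel" using f0 by simp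
  have qm[measurable]: "q \<in> borel_measurable borel" unfolding q_def[abs_def] by measurable
  have qi: "integrable gauss (\<lambda>u. q (M *v u))" using fK(2)[OF qm] f0 by (simp add: fq)
  note Tm[measurable] = T_measurable[OF qm]
  have Ti: "integrable lborel (\<lambda>x. finf K x * T q x)" using fK(2)[OF Tm] T_integral(1)[OF qm qi] by simp
  have fi: "integrable lborel (f t)" and f0': "f 0 = f0" using sol t by (auto simp: is_solution_def)
  have ft: "(\<integral>x. f t x * cos (\<xi> \<bullet> x + p) \<partial>lborel)
      = exp (((transpose (E t) *v \<xi>) \<bullet> (K *v (transpose (E t) *v \<xi>)) - \<xi> \<bullet> (K *v \<xi>)) / 2)
        * (\<integral>x. f0 x * cos ((transpose (E t) *v \<xi>) \<bullet> x + p) \<partial>lborel)" for \<xi> p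
  proof (cases "t = 0")
    case True
    then show ?thesis by (simp add: f0' E0 transpose_mat)
  next
    case False
    then show ?thesis using t by (intro solution_fourier[OF sol D K(1) lyap E0 E2]) auto
  qed
  have "(\<integral>x. f t x * cos (\<xi> \<bullet> x + p) \<partial>lborel) = (\<integral>x. (finf K x * T q x) * cos (\<xi> \<bullet> x + p) \<partial>lborel)" for \<xi> p
  proof -
    let ?\<eta> = "transpose (E t) *v \<xi>"
    have "(\<integral>x. (finf K x * T q x) * cos (\<xi> \<bullet> x + p) \<partial>lborel) = (\<integral>u. T q (M *v u) * cos (\<xi> \<bullet> (M *v u) + p) \<partial>gauss)"
      unfolding mult.assoc by (rule fK(1)) measurable
    also have "\<dots> = exp (- (norm (transpose N' *v \<xi>))\<^sup>2 / 2) * (\<integral>u. q (M *v u) * cos (?\<eta> \<bullet> (M *v u) + p) \<partial>gauss)"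
      by (rule T_cos_transform[OF N' rev qm qi])
    also have "(\<integral>u. q (M *v u) * cos (?\<eta> \<bullet> (M *v u) + p) \<partial>gauss) = (\<integral>x. finf K x * (q x * cos (?\<eta> \<bullet> x + p)) \<partial>lborel)"
      by (rule fK(1)[symmetric]) measurable
    also have "\<dots> = (\<integral>x. f0 x * cos (?\<eta> \<bullet> x + p) \<partial>lborel)" unfolding mult.assoc[symmetric] fq ..
    also have "- (norm (transpose N' *v \<xi>))\<^sup>2 = ?\<eta> \<bullet> (K *v ?\<eta>) - \<xi> \<bullet> (K *v \<xi>)"
    proof -
      have aux: "\<xi> \<bullet> (X *v y) = (transpose X *v \<xi>) \<bullet> y" for X :: "real^'n^'n" and y
        using inner_matrix_transpose[of X y \<xi>] by (simp only: inner_commute)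
      have "\<xi> \<bullet> (K *v \<xi>) = \<xi> \<bullet> (E t *v (K *v ?\<eta>)) + \<xi> \<bullet> (N' *v (transpose N' *v \<xi>))"
        by (subst N') (simp only: matrix_vector_mult_add_rdistrib inner_add_right matrix_vector_mul_assoc[symmetric])
      then show ?thesis unfolding aux by (simp add: power2_norm_eq_inner)
    qed
    finally show ?thesis unfolding ft by simp
  qed
  from cos_transform_unique[OF fi Ti this] show ?thesis by (simp add: q_def[abs_def])
qed

text \<open>The rate \<nu> and the interval \<open>I\<close> are left open, so one estimate covers
  both parts of the theorem and both sign conditions. The constant arises as \<open>c / 2\<close>
  with \<open>c = exp (- 2 * \<nu> * t) / lambdaP K P\<close>: the exponential is the contraction of
  the form of \<open>P\<close>, and the quotient passes from that form to the form of
  \<open>K\<close>, in which the Sobolev inequality is written.\<close>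

lemma (in entropy_root) entropy_decay:
  fixes D C K P :: "real^'n^'n"
  assumes W: "\<And>s. W s = (LBINT x=1..s. sqrt ((deriv ^^ 2) \<psi> x))"
    and D: "psd D" and K: "sym_mat K" "pos_def K" and lyap: "2 *\<^sub>R D = C ** K + K ** transpose C"
    and f0: "integrable lborel f0" "(\<integral>x. f0 x \<partial>lborel) = 1" and f0I: "\<And>x. f0 x / finf K x \<in> closure I"
    and compat: "psi_compatible \<psi> K f0" and sol: "is_solution D C f0 f"
    and P: "sym_mat P" "pos_def P" and Q: "loewner_le ((2 * \<nu>) *\<^sub>R P) (Qmat K C ** P + P ** transpose (Qmat K C))"
    and t: "0 \<le> t"
  shows "e_psi \<psi> K (f t) \<le> ennreal (1 / (2 * lambdaP K P) * S_psi \<psi> K P f0 * exp (- 2 * \<nu> * t))"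
proof -
  obtain M :: "real^'n^'n" where M: "K = M ** transpose M" by (rule psd_factor[OF pos_def_psd[OF K]]) (rule that)
  obtain R :: "real^'n^'n" where R: "P = R ** transpose R" by (rule psd_factor[OF pos_def_psd[OF P]]) (rule that)
  obtain E :: "real \<Rightarrow> real^'n^'n" where E: "E 0 = mat 1" "\<And>t v. ((\<lambda>t. E t *v v) has_vector_derivative - C *v (E t *v v)) (at t)"
    "\<And>t v. ((\<lambda>t. transpose (E t) *v v) has_vector_derivative transpose (- C) *v (transpose (E t) *v v)) (at t)"
    by (rule matrix_exponential[of "- C"]) (rule that)
  obtain A N N' :: "real^'n^'n" where tr: "gauss_transport K M A N" and N': "K = E t ** K ** transpose (E t) + N' ** transpose N'"
    and rev: "K ** transpose A = E t ** K"
    and Pc: "\<And>v. (transpose A *v v) \<bullet> (P *v (transpose A *v v)) \<le> exp (- 2 * \<nu> * t) * (v \<bullet> (P *v v))"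
    by (rule reversed_transport[OF K D lyap P(1) Q M t E]) (rule that)
  interpret gauss_transport K M A N by (fact tr)
  note fK = finf_integral[OF K M]
  have pos: "0 < finf K x" and [measurable]: "finf K \<in> borel_measurable borel" for x
    using fK(4,5)[of "\<lambda>_. 0"] by auto
  define g where "g x = f0 x / finf K x" for x
  have fq: "finf K x * g x = f0 x" for x using pos[of x] by (simp add: g_def)
  have [measurable]: "f0 \<in> borel_measurable borel" using f0 by simp
  have gm[measurable]: "g \<in> borel_measurable borel" unfolding g_def[abs_def] by measurable
  have gI: "g x \<in> closure I" for x using f0I by (simp add: g_def)
  have gi: "integrable gauss (\<lambda>u. g (M *v u))" and g1: "(\<integral>u. g (M *v u) \<partial>gauss) = 1"
    using fK(1,2)[OF gm] f0 by (auto simp: fq)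
  note Tm[measurable] = T_measurable[OF gm]
  have rep: "AE x in lborel. f t x = finf K x * T g x"
    using solution_representation[OF sol _ K M lyap f0(1) E(1,3) t tr N' rev] D unfolding psd_def g_def[abs_def] by blast
  have TI: "T g x \<in> closure I" for x
  proof (cases "I = UNIV")
    case False
    then have "I = {0<..}" using I by auto
    then have "0 \<le> g x" for x using gI[of x] by simp
    then show ?thesis using \<open>I = {0<..}\<close> by (simp add: T_def)
  qed simp
  have \<psi>m: "(\<lambda>x. \<psi> (T g x)) \<in> borel_measurable borel"
  proof (cases "I = UNIV")
    case True
    then show ?thesis using psi_cont by (intro measurable_compose[OF Tm] borel_measurable_continuous_onI) simp
  next
    case False
    then have I0: "I = {0<..}" using I by auto
    have "continuous_on UNIV (\<lambda>s. \<psi> (max 0 s))"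
      by (rule continuous_on_compose2[OF psi_cont]) (auto simp: I0 intro!: continuous_intros)
    from measurable_compose[OF Tm borel_measurable_continuous_onI[OF this]]
    have "(\<lambda>x. \<psi> (max 0 (T g x))) \<in> borel_measurable borel" .
    moreover have "max 0 (T g x) = T g x" for x using TI[of x] by (simp add: I0)
    ultimately show ?thesis by simp
  qed
  have "e_psi \<psi> K (f t) = (\<integral>\<^sup>+x. ennreal (finf K x) * ennreal (\<psi> (T g x)) \<partial>lborel)"
    unfolding e_psi_def
  proof (rule nn_integral_cong_AE)
    show "AE x in lborel. ennreal (\<psi> (f t x / finf K x) * finf K x) = ennreal (finf K x) * ennreal (\<psi> (T g x))"
      using rep
    proof eventually_elim
      case (elim x)
      then have "f t x / finf K x = T g x" using pos[of x] by simp
      then show ?case using psi_nonneg[OF TI[of x]] pos[of x] by (simp add: ennreal_mult mult.commute)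
    qed
  qed
  also have "\<dots> = (\<integral>\<^sup>+u. ennreal (\<psi> (T g (M *v u))) \<partial>gauss)" by (rule fK(3)[OF \<psi>m])
  finally have e_eq: "e_psi \<psi> K (f t) = (\<integral>\<^sup>+u. ennreal (\<psi> (T g (M *v u))) \<partial>gauss)" .
  have wW: "w_fun \<psi> K f0 = (\<lambda>x. W (g x))" by (simp add: fun_eq_iff w_fun_def W g_def)
  obtain G where G: "weak_grad (\<lambda>x. W (g x)) G" "integrable lborel (\<lambda>x. (norm (G x))\<^sup>2 * finf K x)"
    using compat unfolding psi_compatible_def wW by blast
  \<comment> \<open>\<open>S_psi\<close> takes a weak gradient obtained by choice, while
    compatibility provides one with finite energy; almost everywhere uniqueness lets
    \<open>G\<close> replace the chosen one.\<close>
  define G' where "G' = (SOME G. weak_grad (\<lambda>x. W (g x)) G)"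
  have G': "weak_grad (\<lambda>x. W (g x)) G'" unfolding G'_def by (rule someI[of "weak_grad _", OF G(1)])
  have [measurable]: "G \<in> borel_measurable borel" "G' \<in> borel_measurable borel"
    using weak_grad_loc_integrable(2)[OF G(1)] weak_grad_loc_integrable(2)[OF G'] by (auto simp: loc_integrable_def)
  have PR: "(norm (transpose R *v v))\<^sup>2 = v \<bullet> (P *v v)" for v
    unfolding power2_norm_eq_inner R matrix_vector_mul_assoc[symmetric]
    using inner_matrix_transpose[of R "transpose R *v v" v] by (simp add: inner_commute)
  define S where "S = (\<integral>x. finf K x * (norm (transpose R *v G x))\<^sup>2 \<partial>lborel)"
  have S: "S_psi \<psi> K P f0 = S"
    unfolding S_psi_def wW G'_def[symmetric] Let_def S_def PR
  proof (rule integral_cong_AE)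
    have [measurable]: "(\<lambda>x. P *v G x) \<in> borel_measurable borel" "(\<lambda>x. P *v G' x) \<in> borel_measurable borel"
      by (rule measurable_compose[OF _ matrix_borel_measurable], measurable)+
    show "(\<lambda>x. G' x \<bullet> (P *v G' x) * finf K x) \<in> borel_measurable lborel"
      "(\<lambda>x. finf K x * (G x \<bullet> (P *v G x))) \<in> borel_measurable lborel" by measurable
    show "AE x in lborel. G' x \<bullet> (P *v G' x) * finf K x = finf K x * (G x \<bullet> (P *v G x))"
      using weak_grad_unique[OF G' G(1)] by eventually_elim (simp add: mult.commute)
  qed
  note lam = lambdaP_props[OF K P]
  define c where "c = exp (- 2 * \<nu> * t) / lambdaP K P"
  have c: "0 \<le> c" using lam(1) by (simp add: c_def)
  have contr: "(norm (transpose M *v (transpose A *v v)))\<^sup>2 \<le> c * (norm (transpose R *v v))\<^sup>2" for v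
  proof -
    have "lambdaP K P * (norm (transpose M *v (transpose A *v v)))\<^sup>2 \<le> exp (- 2 * \<nu> * t) * (norm (transpose R *v v))\<^sup>2"
      using order_trans[OF lam(2)[of "transpose A *v v"] Pc[of v]] unfolding PR by (simp only: K_inner power2_norm_eq_inner)
    then show ?thesis using lam(1) by (simp add: c_def field_simps)
  qed
  have "(\<integral>\<^sup>+u. ennreal (\<psi> (T g (M *v u))) \<partial>gauss) \<le> ennreal (c / 2 * S)"
    using transported_entropy[OF tr c contr gm gI gi g1 smooth_approximation[OF K M gm gI gi G, of _ R, folded S_def]] .
  then show ?thesis unfolding e_eq S c_def by (simp add: field_simps)
qed

lemma admissible_imp_derivs:
  assumes "admissible \<psi>"
  shows "admissible_derivs \<psi> (deriv \<psi>) ((deriv ^^ 2) \<psi>) ((deriv ^^ 3) \<psi>) ((deriv ^^ 4) \<psi>)"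
proof -
  have d: "((deriv ^^ k) \<psi> has_real_derivative (deriv ^^ Suc k) \<psi> s) (at s)" if "k < 4" "0 < s" for k s
    using assms that unfolding admissible_def by (auto simp: DERIV_deriv_iff_real_differentiable)
  have Suc_eq: "Suc 1 = 2" "Suc 2 = 3" "Suc 3 = 4" by simp_all
  have d0: "(\<psi> has_real_derivative deriv \<psi> s) (at s)" if "0 < s" for s using d[of 0 s] that by simp
  have d1: "(deriv \<psi> has_real_derivative (deriv ^^ 2) \<psi> s) (at s)" if "0 < s" for s
    using d[of 1 s, unfolded Suc_eq] that by simp
  have d2: "((deriv ^^ 2) \<psi> has_real_derivative (deriv ^^ 3) \<psi> s) (at s)" if "0 < s" for s
    by (rule d[of 2 s, unfolded Suc_eq]) (use that in auto)
  have d3: "((deriv ^^ 3) \<psi> has_real_derivative (deriv ^^ 4) \<psi> s) (at s)" if "0 < s" for s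
    by (rule d[of 3 s, unfolded Suc_eq]) (use that in auto)
  note a = assms[unfolded admissible_def]
  show ?thesis
    by (rule admissible_derivs.intro) (use a d0 d1 d2 d3 in blast)+
qed

theorem theorem4p6:
  fixes D C K :: "real^('n::{finite,linorder})^('n::{finite,linorder})"
    and k :: nat
    and \<psi> :: "real \<Rightarrow> real"
    and f0 :: "real^('n::{finite,linorder}) \<Rightarrow> real"
    and f :: "real \<Rightarrow> real^('n::{finite,linorder}) \<Rightarrow> real"
  assumes dim: "CARD('n) \<ge> 2"
    and k: "1 \<le> k" "k < CARD('n)"
    and D: "D = diag_first_ones k"
    and A: "condition_A D C"
    and K: "sym_mat K" "pos_def K" "2 *\<^sub>R D = C ** K + K ** transpose C"
    and psi: "admissible \<psi>"
    and f0_int: "integrable lborel f0" "(\<integral>x. f0 x \<partial>lborel) = 1"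
    and f0_sign: "(\<forall>x. f0 x \<ge> 0) \<or> \<psi> = (\<lambda>s. (s - 1)\<^sup>2)"
    and compat: "psi_compatible \<psi> K f0"
    and sol: "is_solution D C f0 f"
  shows
    "((\<forall>lam\<in>spec C. Re lam = mu_min C \<longrightarrow> \<not> defective C lam) \<longrightarrow>
       (\<forall>P. sym_mat P \<and> pos_def P \<and>
            loewner_le ((2 * mu_min C) *\<^sub>R P) (Qmat K C ** P + P ** transpose (Qmat K C)) \<longrightarrow>
            (\<forall>t\<ge>0. e_psi \<psi> K (f t)
               \<le> ennreal (1 / (2 * lambdaP K P) * S_psi \<psi> K P f0 * exp (- 2 * mu_min C * t)))))
     \<and>
     ((\<exists>lam\<in>spec C. Re lam = mu_min C \<and> defective C lam) \<longrightarrow>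
       (\<forall>\<epsilon> P. 0 < \<epsilon> \<and> \<epsilon> < mu_min C \<and> sym_mat P \<and> pos_def P \<and>
            loewner_le ((2 * (mu_min C - \<epsilon>)) *\<^sub>R P) (Qmat K C ** P + P ** transpose (Qmat K C)) \<longrightarrow>
            (\<forall>t\<ge>0. e_psi \<psi> K (f t)
               \<le> ennreal (1 / (2 * lambdaP K P) * S_psi \<psi> K P f0 * exp (- 2 * (mu_min C - \<epsilon>) * t)))))"
proof -
  have psdD: "psd D" unfolding D by (rule diag_first_ones_psd)
  \<comment> \<open>Both conclusions are instances: \<nu> is \<open>mu_min C\<close> in the first
    and \<open>mu_min C - \<epsilon>\<close> in the second. Nonnegative data take the open half line
    as \<open>I\<close>, the quadratic generator takes the whole line.\<close>
  have decay: "e_psi \<psi> K (f t) \<le> ennreal (1 / (2 * lambdaP K P) * S_psi \<psi> K P f0 * exp (- 2 * \<nu> * t))"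
    if P: "sym_mat P" "pos_def P" and Q: "loewner_le ((2 * \<nu>) *\<^sub>R P) (Qmat K C ** P + P ** transpose (Qmat K C))"
      and t: "0 \<le> t" for P \<nu> t
    using f0_sign
  proof
    assume nonneg: "\<forall>x. f0 x \<ge> 0"
    obtain J V where er: "entropy_root {0<..} \<psi> (deriv \<psi>) ((deriv ^^ 2) \<psi>) ((deriv ^^ 3) \<psi>) J (\<lambda>s. LBINT x=1..s. sqrt ((deriv ^^ 2) \<psi> x)) V"
      by (rule admissible_derivs.root[OF admissible_imp_derivs[OF psi]]) (rule refl, rule that)
    obtain M :: "real^('n::{finite,linorder})^('n::{finite,linorder})" where M: "K = M ** transpose M" by (rule psd_factor[OF pos_def_psd[OF K(1,2)]]) (rule that)
    have "0 < finf K x" for x by (rule finf_integral(4)[OF K(1,2) M, of "\<lambda>_. 0"]) simp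
    then have "f0 x / finf K x \<in> closure {0<..}" for x using nonneg by (simp add: less_imp_le)
    then show ?thesis by (intro entropy_root.entropy_decay[OF er _ psdD K f0_int _ compat sol P Q t]) auto
  next
    assume \<psi>: "\<psi> = (\<lambda>s. (s - 1)\<^sup>2)"
    have "deriv \<psi> = (\<lambda>s. 2 * (s - 1))"
      unfolding \<psi> by (rule ext, rule DERIV_imp_deriv) (auto intro!: derivative_eq_intros)
    then have "(deriv ^^ 2) \<psi> = deriv (\<lambda>s. 2 * (s - 1))" by (simp add: numeral_2_eq_2)
    also have "\<dots> = (\<lambda>_. 2)" by (rule ext, rule DERIV_imp_deriv) (auto intro!: derivative_eq_intros)
    finally have \<psi>2: "(deriv ^^ 2) \<psi> = (\<lambda>_. 2)" .
    have er: "entropy_root UNIV \<psi> (\<lambda>s. 2 * (s - 1)) (\<lambda>_. 2) (\<lambda>_. 0) UNIV (\<lambda>s. LBINT x=1..s. sqrt ((deriv ^^ 2) \<psi> x)) (\<lambda>u. 1 + u / sqrt 2)"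
      unfolding \<psi>2 unfolding \<psi> by (rule quadratic_root) (rule refl)
    show ?thesis by (intro entropy_root.entropy_decay[OF er _ psdD K f0_int _ compat sol P Q t]) auto
  qed
  show ?thesis using decay by blast
qed

end
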